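(* Let $m\in\mathbb{N}$ and let $Q:\mathbb{R}\to\mathbb{C}^{m\times m}$ satisfy $Q(x)=Q(x)^*$ for all $x\in\mathbb{R}$ and $Q\in \mathrm{AC}_{\mathrm{loc}}(\mathbb{R})^{m\times m}$. Suppose that $-I_m\frac{d^2}{dx^2}+Q$ is in the limit point case at $+\infty$ and at $-\infty$, and let $H$ be the associated self-adjoint operator in $L^2(\mathbb{R})^m$. Suppose that $Q$ is reflectionless and that $\sigma(H)=[E_0,\infty)$ for some $E_0\in\mathbb{R}$. Then $$Q(x)=E_0I_m\quad\text{for all }x\in\mathbb{R}.$$
   Context: Notation: $I_m$ is the identity matrix in $\mathbb{C}^m$, $M^*$ is the conjugate transpose of $M$, $\mathbb{C}_+=\{z:\mathrm{Im}\,z>0\}$, and for a square matrix $\mathrm{Im}(M)=(M-M^* )/(2i)$. $\mathrm{AC}_{\mathrm{loc}}(\mathbb{R})$ denotes the locally absolutely continuous functions on $\mathbb{R}$; $\sigma(\cdot)$ and $\sigma_{\mathrm{ess}}(\cdot)$ denote spectrum and essential spectrum. Limit point case: the expression $-I_m\frac{d^2}{dx^2}+Q$ is in the limit point case at $\pm\infty$ if for all $z\in\mathbb{C}\setminus\mathbb{R}$ the space of $\mathbb{C}^m$-valued solutions $u$ (with $u,u'$ locally absolutely continuous) of $-u''+Qu=zu$ that are square integrable near $\pm\infty$ has dimension exactly $m$ (for each of the two ends). In this case the operator $$H=-I_m\frac{d^2}{dx^2}+Q,\quad \mathrm{dom}(H)=\{g\in L^2(\mathbb{R})^m : g,g'\in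 \mathrm{AC}_{\mathrm{loc}}(\mathbb{R})^m,\ -g''+Qg\in L^2(\mathbb{R})^m\}$$ is self-adjoint in $L^2(\mathbb{R})^m$. Weyl–Titchmarsh matrices: for $x_0\in\mathbb{R}$, $z\in\mathbb{C}$, let $\theta_1(z,\cdot,x_0),\phi_1(z,\cdot,x_0)$ be the $m\times m$ matrix solutions of $-\psi''+Q\psi=z\psi$ with $\theta_1(z,x_0,x_0)=I_m$, $\theta_1'(z,x_0,x_0)=0$, $\phi_1(z,x_0,x_0)=0$, $\phi_1'(z,x_0,x_0)=I_m$. For $z\in\mathbb{C}\setminus\mathbb{R}$, $$M_\pm(z,x_0)=\lim_{R\to\pm\infty}\bigl(-\phi_1(z,R,x_0)^{-1}\theta_1(z,R,x_0)\bigr);$$ the columns of $\theta_1+\phi_1M_\pm$ form a basis of the solutions square integrable near $\pm\infty$. Green's matrix on the diagonal: $G(z,x,x)=(M_-(z,x)-M_+(z,x))^{-1}$, $z\in\mathbb{C}\setminus\mathbb{R}$; this is the integral kernel of $(H-z)^{-1}$ on the diagonal. As a function of $z\in\mathbb{C}_+$ it is an $m\times m$ matrix-valued Herglotz function with $\mathrm{Im}(G(z,x,x))>0$, so $\ln(G(z,x,x))$ is defined by the holomorphic functional calculus with the principal branch of the logarithm. For each $x\in\mathbb{R}$, $$\Xi(\lambda,x)=\lim_{\varepsilon\downarrow0}\frac1\pi\mathrm{Im}\bigl(\ln(G(\lambda+i\varepsilon,x,x))\bigr)\quad\text{for a.e. }\lambda\in\mathbb{R}.$$ Reflectionless: $Q$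 is called reflectionless if for all $x\in\mathbb{R}$, $\Xi(\lambda,x)=\frac12I_m$ for a.e. $\lambda\in\sigma_{\mathrm{ess}}(H)$. *)

theory Defs
  imports "HOL-Complex_Analysis.Complex_Analysis" "HOL-Library.Function_Algebras"
begin

section \<open>Local absolute continuity and second derivatives\<close>

text \<open>A finite set \<open>I\<close> of pairs \<open>(s, t)\<close> encodes finitely many pairwise non-overlapping
  subintervals of \<open>[a, b]\<close>. For matrix-valued functions (finite-dimensional range) this is the
  same as absolute continuity of every entry.\<close>

definition AC_on :: "real \<Rightarrow> real \<Rightarrow> (real \<Rightarrow> 'a::real_normed_vector) \<Rightarrow> bool" where
  "AC_on a b f \<longleftrightarrow>
     (\<forall>\<epsilon>>0. \<exists>\<delta>>0. \<forall>I. finite I \<longrightarrow> (\<forall>(s, t)\<in>I. a \<le> s \<and> s < t \<and> t \<le> b) \<longrightarrow>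
        disjoint_family_on (\<lambda>(s, t). {s<..<t}) I \<longrightarrow>
        (\<Sum>(s, t)\<in>I. t - s) < \<delta> \<longrightarrow> (\<Sum>(s, t)\<in>I. norm (f t - f s)) < \<epsilon>)"

definition AC_loc :: "(real \<Rightarrow> 'a::real_normed_vector) \<Rightarrow> bool" where
  "AC_loc f \<longleftrightarrow> (\<forall>a b. a < b \<longrightarrow> AC_on a b f)"

text \<open>\<open>u\<close> and \<open>u'\<close> are locally absolutely continuous, \<open>u'\<close> is the derivative of \<open>u\<close>, and
  \<open>u''\<close> is a version of the almost everywhere defined second derivative.\<close>

definition AC2 :: "(real \<Rightarrow> 'a::real_normed_vector) \<Rightarrow> (real \<Rightarrow> 'a) \<Rightarrow> (real \<Rightarrow> 'a) \<Rightarrow> bool" where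
  "AC2 u u' u'' \<longleftrightarrow>
     AC_loc u \<and> (\<forall>x. (u has_vector_derivative u' x) (at x)) \<and>
     AC_loc u' \<and> (AE x in lebesgue. (u' has_vector_derivative u'' x) (at x))"


section \<open>Solutions and the limit point case\<close>

definition vec_solution ::
  "(real \<Rightarrow> complex^'m^'m) \<Rightarrow> complex \<Rightarrow> (real \<Rightarrow> complex^'m) \<Rightarrow> bool" where
  "vec_solution Q z u \<longleftrightarrow>
     (\<exists>u' u''. AC2 u u' u'' \<and> (AE x in lebesgue. - u'' x + Q x *v u x = z *s u x))"

definition mat_solution ::
  "(real \<Rightarrow> complex^'m^'m) \<Rightarrow> complex \<Rightarrow> (real \<Rightarrow> complex^'m^'m) \<Rightarrow> bool" where
  "mat_solution Q z \<psi> \<longleftrightarrow>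
     (\<exists>\<psi>' \<psi>''. AC2 \<psi> \<psi>' \<psi>'' \<and> (AE x in lebesgue. - \<psi>'' x + Q x ** \<psi> x = mat z ** \<psi> x))"

text \<open>The complex vector space of all functions from the reals to \<open>\<complex>\<^sup>m\<close>.\<close>

interpretation cfun: vector_space
  "\<lambda>(c::complex) (u::real \<Rightarrow> complex^'m) x. c *s u x"
  by unfold_locales (auto simp: fun_eq_iff vec_eq_iff algebra_simps)

text \<open>Since \<open>cfun.dim\<close> of an infinite-dimensional space is \<open>0\<close> and \<open>CARD('m) \<ge> 1\<close>, the
  equations below do express that the dimension is finite and equal to \<open>m\<close>.\<close>

definition limit_point_at_top :: "(real \<Rightarrow> complex^'m^'m) \<Rightarrow> bool" where
  "limit_point_at_top Q \<longleftrightarrow>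
     (\<forall>z. Im z \<noteq> 0 \<longrightarrow>
        cfun.dim {u. vec_solution Q z u \<and>
                     (\<exists>a. set_integrable lebesgue {a..} (\<lambda>x. (norm (u x))\<^sup>2))} = CARD('m))"

definition limit_point_at_bot :: "(real \<Rightarrow> complex^'m^'m) \<Rightarrow> bool" where
  "limit_point_at_bot Q \<longleftrightarrow>
     (\<forall>z. Im z \<noteq> 0 \<longrightarrow>
        cfun.dim {u. vec_solution Q z u \<and>
                     (\<exists>a. set_integrable lebesgue {..a} (\<lambda>x. (norm (u x))\<^sup>2))} = CARD('m))"


section \<open>The operator and its spectra\<close>

definition in_L2 :: "(real \<Rightarrow> complex^'m) \<Rightarrow> bool" where
  "in_L2 f \<longleftrightarrow> f \<in> borel_measurable lebesgue \<and> integrable lebesgue (\<lambda>x. (norm (f x))\<^sup>2)"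

definition L2_norm :: "(real \<Rightarrow> complex^'m) \<Rightarrow> real" where
  "L2_norm f = sqrt (LINT x|lebesgue. (norm (f x))\<^sup>2)"

text \<open>The graph of \<open>H\<close>. Elements of the domain are continuous, so each \<open>L\<^sup>2\<close> class in the domain
  has exactly one representative \<open>g\<close> here, whereas for given \<open>g\<close> all representatives \<open>h\<close> of
  the class of \<open>H g\<close> occur.\<close>

definition schroedinger_graph ::
  "(real \<Rightarrow> complex^'m^'m) \<Rightarrow> ((real \<Rightarrow> complex^'m) \<times> (real \<Rightarrow> complex^'m)) set" where
  "schroedinger_graph Q =
     {(g, h). in_L2 g \<and> in_L2 h \<and>
        (\<exists>g' g''. AC2 g g' g'' \<and> (AE x in lebesgue. h x = - g'' x + Q x *v g x))}"

text \<open>\<open>H - z\<close> is a bijection from the domain onto \<open>L\<^sup>2\<close> with bounded inverse; \<open>(H - z) g = f\<close> is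
  written as \<open>H g = f + z g\<close>.\<close>

definition resolvent_set :: "(real \<Rightarrow> complex^'m^'m) \<Rightarrow> complex set" where
  "resolvent_set Q =
     {z. (\<forall>f. in_L2 f \<longrightarrow> (\<exists>!g. (g, \<lambda>x. f x + z *s g x) \<in> schroedinger_graph Q)) \<and>
         (\<exists>C. \<forall>(g, h)\<in>schroedinger_graph Q. L2_norm g \<le> C * L2_norm (\<lambda>x. h x - z *s g x))}"

definition spectrum :: "(real \<Rightarrow> complex^'m^'m) \<Rightarrow> complex set" where
  "spectrum Q = - resolvent_set Q"

definition eigenspace :: "(real \<Rightarrow> complex^'m^'m) \<Rightarrow> complex \<Rightarrow> (real \<Rightarrow> complex^'m) set" where
  "eigenspace Q z = {g. (g, \<lambda>x. z *s g x) \<in> schroedinger_graph Q}"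

text \<open>For self-adjoint operators: the discrete spectrum consists of the isolated points of the
  spectrum that are eigenvalues of finite multiplicity, and the essential spectrum is the rest.\<close>

definition discrete_spectrum :: "(real \<Rightarrow> complex^'m^'m) \<Rightarrow> complex set" where
  "discrete_spectrum Q =
     {z. z isolated_in spectrum Q \<and> eigenspace Q z \<noteq> {\<lambda>x. 0} \<and>
         (\<exists>B. finite B \<and> eigenspace Q z \<subseteq> cfun.span B)}"

definition ess_spectrum :: "(real \<Rightarrow> complex^'m^'m) \<Rightarrow> complex set" where
  "ess_spectrum Q = spectrum Q - discrete_spectrum Q"


section \<open>Weyl--Titchmarsh and Green's matrices\<close>

text \<open>Argument order as in \<open>\<theta>\<^sub>1(z, x, x\<^sub>0)\<close> and \<open>\<phi>\<^sub>1(z, x, x\<^sub>0)\<close>.\<close>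

definition theta1 :: "(real \<Rightarrow> complex^'m^'m) \<Rightarrow> complex \<Rightarrow> real \<Rightarrow> real \<Rightarrow> complex^'m^'m" where
  "theta1 Q z x x0 =
     (THE \<psi>. mat_solution Q z \<psi> \<and> \<psi> x0 = mat 1 \<and> (\<psi> has_vector_derivative 0) (at x0)) x"

definition phi1 :: "(real \<Rightarrow> complex^'m^'m) \<Rightarrow> complex \<Rightarrow> real \<Rightarrow> real \<Rightarrow> complex^'m^'m" where
  "phi1 Q z x x0 =
     (THE \<psi>. mat_solution Q z \<psi> \<and> \<psi> x0 = 0 \<and> (\<psi> has_vector_derivative mat 1) (at x0)) x"

definition M_plus :: "(real \<Rightarrow> complex^'m^'m) \<Rightarrow> complex \<Rightarrow> real \<Rightarrow> complex^'m^'m" where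
  "M_plus Q z x0 = Lim at_top (\<lambda>R. - (matrix_inv (phi1 Q z R x0) ** theta1 Q z R x0))"

definition M_minus :: "(real \<Rightarrow> complex^'m^'m) \<Rightarrow> complex \<Rightarrow> real \<Rightarrow> complex^'m^'m" where
  "M_minus Q z x0 = Lim at_bot (\<lambda>R. - (matrix_inv (phi1 Q z R x0) ** theta1 Q z R x0))"

definition green_diag :: "(real \<Rightarrow> complex^'m^'m) \<Rightarrow> complex \<Rightarrow> real \<Rightarrow> complex^'m^'m" where
  "green_diag Q z x = matrix_inv (M_minus Q z x - M_plus Q z x)"


section \<open>Matrix logarithm\<close>

definition conj_transpose :: "complex^'m^'m \<Rightarrow> complex^'m^'m" where
  "conj_transpose A = (\<chi> i j. cnj (A $ j $ i))"

definition matrix_Im :: "complex^'m^'m \<Rightarrow> complex^'m^'m" where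
  "matrix_Im A = (\<chi> i j. (A $ i $ j - conj_transpose A $ i $ j) / (2 * \<i>))"

definition mat_spectrum :: "complex^'m^'m \<Rightarrow> complex set" where
  "mat_spectrum A = {\<zeta>. \<not> invertible (mat \<zeta> - A)}"

text \<open>A closed contour in the open set \<open>S\<close> that winds once around each point of \<open>K\<close> and is
  null-homologous in \<open>S\<close>.\<close>

definition riesz_contour :: "complex set \<Rightarrow> complex set \<Rightarrow> (real \<Rightarrow> complex) \<Rightarrow> bool" where
  "riesz_contour S K \<gamma> \<longleftrightarrow>
     valid_path \<gamma> \<and> pathfinish \<gamma> = pathstart \<gamma> \<and> path_image \<gamma> \<subseteq> S - K \<and>
     (\<forall>w\<in>K. winding_number \<gamma> w = 1) \<and> (\<forall>w. w \<notin> S \<longrightarrow> winding_number \<gamma> w = 0)"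

text \<open>The Riesz--Dunford integral \<open>f(A) = (2\<pi>i)\<^sup>-\<^sup>1 \<integral>\<^sub>\<gamma> f(\<zeta>) (\<zeta> - A)\<^sup>-\<^sup>1 d\<zeta>\<close> for \<open>f\<close> holomorphic on \<open>S\<close>; by
  Cauchy's theorem it does not depend on the choice of \<open>\<gamma>\<close>.\<close>

definition holo_calculus ::
  "complex set \<Rightarrow> (complex \<Rightarrow> complex) \<Rightarrow> complex^'m^'m \<Rightarrow> complex^'m^'m" where
  "holo_calculus S f A =
     (let \<gamma> = (SOME \<gamma>. riesz_contour S (mat_spectrum A) \<gamma>)
      in \<chi> i j. contour_integral \<gamma> (\<lambda>\<zeta>. f \<zeta> * matrix_inv (mat \<zeta> - A) $ i $ j) / (2 * of_real pi * \<i>))"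

definition matrix_Ln :: "complex^'m^'m \<Rightarrow> complex^'m^'m" where
  "matrix_Ln A = holo_calculus (- \<real>\<^sub>\<le>\<^sub>0) Ln A"


section \<open>Reflectionless potentials\<close>

text \<open>\<open>\<Xi>(l, x)\<close> is only defined where the limit exists, hence the relational form:
  \<open>has_Xi Q l x X\<close> says that \<open>\<Xi>(l, x)\<close> exists and equals \<open>X\<close>.\<close>

definition has_Xi ::
  "(real \<Rightarrow> complex^'m^'m) \<Rightarrow> real \<Rightarrow> real \<Rightarrow> complex^'m^'m \<Rightarrow> bool" where
  "has_Xi Q l x X \<longleftrightarrow>
     ((\<lambda>\<epsilon>. (1 / pi) *\<^sub>R matrix_Im (matrix_Ln (green_diag Q (Complex l \<epsilon>) x))) \<longlongrightarrow> X) (at_right 0)"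

definition reflectionless :: "(real \<Rightarrow> complex^'m^'m) \<Rightarrow> bool" where
  "reflectionless Q \<longleftrightarrow>
     (\<forall>x. AE l in lebesgue. complex_of_real l \<in> ess_spectrum Q \<longrightarrow> has_Xi Q l x (mat (1/2)))"

end

theory Submission
  imports Defs "HOL-Real_Asymp.Real_Asymp"
begin

text \<open>Put \<open>N = M\<^sub>- - M\<^sub>+\<close> and \<open>G = N\<^sup>-\<^sup>1\<close>. Cutting off Weyl solutions and using that \<open>H \<ge> E\<^sub>0\<close>, one finds
  \<open>w\<^sup>* N(z,x) w = t - (z - E\<^sub>0) \<nu>\<close> with \<open>t \<ge> 0\<close> and \<open>\<nu> > 0\<close>. Hence the numerical range of \<open>G\<close> lies in the upper
  half-plane, and near the half-line below \<open>E\<^sub>0\<close> it lies in arbitrarily thin sectors around the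
  positive axis. So \<open>ln G(z,x) + \<onehalf> ln (E\<^sub>0 - z)\<close> has bounded imaginary part, whose boundary
  values vanish almost everywhere: below \<open>E\<^sub>0\<close> by the sector bound, above \<open>E\<^sub>0\<close> by the reflectionless
  condition. It is therefore constant in \<open>z\<close>, that is \<open>N(z,x) = (E\<^sub>0 - z)\<^sup>1\<^sup>/\<^sup>2 T(x)\<close> where the real part of
  \<open>T\<close> is positive definite. The Riccati equations \<open>M\<^sub>\<plusminus>' = Q - z - M\<^sub>\<plusminus>\<^sup>2\<close> yield \<open>T' = -\<onehalf> (\<Sigma> T + T \<Sigma>)\<close> for
  \<open>\<Sigma> = M\<^sub>- + M\<^sub>+\<close>, so \<open>\<Sigma>\<close> does not depend on \<open>z\<close> (Sylvester), and comparing the equations for \<open>\<Sigma>'\<close>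
  at two values of \<open>z\<close> gives \<open>T\<^sup>2 = 4\<close>, then \<open>T = 2\<close>, \<open>\<Sigma> = 0\<close> and \<open>Q = E\<^sub>0\<close>.\<close>

subsection \<open>Locally absolutely continuous functions\<close>

text \<open>The spectrum is given only through bounded solvability of (H - z) g = f, so symmetry of
  H and H \<ge> E0 are derived: the former from vanishing boundary terms at both ends, the latter
  from a differential inequality for the resolvent below E0. The form of N comes from gluing the
  left and right Weyl solutions with value w at x. The glued function has the jump N w in its
  derivative (left minus right); smoothing this kink on a short interval gives an element g of the
  domain with (H - z) g = F supported there. Then <g, F> tends to <w, N w>, while <g, F> = <g, H g>
  - z |g|^2. So t is a limit of <g, (H - E0) g> and \<nu> is the squared norm of the glued function.
  The logarithm is handled through the forms <v, ln G v>: sector bounds on the numerical range carry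
  over to them, the scalar uniqueness theorem applies to them, and polarization returns to matrices.
  In the last step \<Sigma>' contains -2 z - (E0 - z) T^2 / 2 with T independent of z, and only T^2
  = 4 makes this constant in z.\<close>

lemma AC_on_imp_continuous_on:
  assumes "AC_on a b f"
  shows "continuous_on {a..b} f"
  unfolding continuous_on_iff
proof (intro ballI allI impI)
  fix x \<epsilon> :: real assume x: "x \<in> {a..b}" and "\<epsilon> > 0"
  then obtain \<delta> where "\<delta> > 0" and \<delta>: "\<And>I. finite I \<Longrightarrow> (\<forall>(s, t)\<in>I. a \<le> s \<and> s < t \<and> t \<le> b) \<Longrightarrow>
      disjoint_family_on (\<lambda>(s, t). {s<..<t}) I \<Longrightarrow> (\<Sum>(s, t)\<in>I. t - s) < \<delta> \<Longrightarrow>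
      (\<Sum>(s, t)\<in>I. norm (f t - f s)) < \<epsilon>"
    using assms unfolding AC_on_def by blast
  have "dist (f y) (f x) < \<epsilon>" if y: "y \<in> {a..b}" "dist y x < \<delta>" for y
  proof (cases x y rule: linorder_cases)
    case less
    then show ?thesis
      using \<delta>[of "{(x, y)}"] x y by (auto simp: disjoint_family_on_def dist_norm)
  next
    case greater
    then show ?thesis
      using \<delta>[of "{(y, x)}"] x y
      by (auto simp: disjoint_family_on_def dist_norm norm_minus_commute)
  qed (use \<open>\<epsilon> > 0\<close> in auto)
  with \<open>\<delta> > 0\<close> show "\<exists>d>0. \<forall>x'\<in>{a..b}. dist x' x < d \<longrightarrow> dist (f x') (f x) < \<epsilon>"
    by blast
qed

lemma AC_loc_imp_isCont:
  assumes "AC_loc f"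
  shows "isCont f x"
proof -
  have "continuous_on {x - 1..x + 1} f"
    using assms by (auto simp: AC_loc_def intro: AC_on_imp_continuous_on)
  then show ?thesis
    by (rule continuous_on_interior) auto
qed

lemma AC_loc_imp_continuous_on: "AC_loc f \<Longrightarrow> continuous_on S f"
  by (simp add: AC_loc_imp_isCont continuous_at_imp_continuous_on)

lemma lipschitz_imp_AC_on:
  assumes "\<And>s t. a \<le> s \<Longrightarrow> s < t \<Longrightarrow> t \<le> b \<Longrightarrow> norm (f t - f s) \<le> L * (t - s)"
  shows "AC_on a b f"
  unfolding AC_on_def
proof (intro allI impI)
  fix \<epsilon> :: real assume "\<epsilon> > 0"
  define \<delta> where "\<delta> = \<epsilon> / (\<bar>L\<bar> + 1)"
  have "\<delta> > 0" using \<open>\<epsilon> > 0\<close> by (simp add: \<delta>_def)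
  have "(\<Sum>(s, t)\<in>I. norm (f t - f s)) < \<epsilon>"
    if I: "finite I" "\<forall>(s, t)\<in>I. a \<le> s \<and> s < t \<and> t \<le> b" "(\<Sum>(s, t)\<in>I. t - s) < \<delta>"
    for I :: "(real \<times> real) set"
  proof -
    have "(\<Sum>(s, t)\<in>I. norm (f t - f s)) \<le> (\<Sum>(s, t)\<in>I. (\<bar>L\<bar> + 1) * (t - s))"
    proof (rule sum_mono, clarify)
      fix s t assume "(s, t) \<in> I"
      then have st: "a \<le> s" "s < t" "t \<le> b" using I by auto
      have "norm (f t - f s) \<le> L * (t - s)" by (rule assms[OF st])
      also have "\<dots> \<le> (\<bar>L\<bar> + 1) * (t - s)" using st by (intro mult_right_mono) auto
      finally show "norm (f t - f s) \<le> (\<bar>L\<bar> + 1) * (t - s)" .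
    qed
    also have "\<dots> = (\<bar>L\<bar> + 1) * (\<Sum>(s, t)\<in>I. t - s)"
      by (simp add: sum_distrib_left case_prod_unfold)
    also have "\<dots> < (\<bar>L\<bar> + 1) * \<delta>" using I by (intro mult_strict_left_mono) auto
    also have "\<dots> = \<epsilon>" by (simp add: \<delta>_def)
    finally show ?thesis .
  qed
  with \<open>\<delta> > 0\<close> show "\<exists>\<delta>>0. \<forall>I. finite I \<longrightarrow> (\<forall>(s, t)\<in>I. a \<le> s \<and> s < t \<and> t \<le> b) \<longrightarrow>
      disjoint_family_on (\<lambda>(s, t). {s<..<t}) I \<longrightarrow>
      (\<Sum>(s, t)\<in>I. t - s) < \<delta> \<longrightarrow> (\<Sum>(s, t)\<in>I. norm (f t - f s)) < \<epsilon>"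
    by blast
qed

text \<open>Kept general in the product because it is applied to the sesquilinear
  \<open>cip\<close>, for the Wronskian of two elements of the domain. Both factors are bounded on
  [a, b], so each increment of the product is controlled by the increments of the factors.\<close>

lemma AC_on_prod:
  assumes bb: "bounded_bilinear pr" and f: "AC_on a b f" and g: "AC_on a b g"
  shows "AC_on a b (\<lambda>x. pr (f x) (g x))"
proof -
  obtain K where "K > 0" and K: "\<And>u v. norm (pr u v) \<le> norm u * norm v * K"
    using bounded_bilinear.pos_bounded[OF bb] by blast
  have "bounded (f ` {a..b})" "bounded (g ` {a..b})"
    using f g by (auto intro!: compact_imp_bounded compact_continuous_image AC_on_imp_continuous_on)
  then obtain B1 B2 where B1: "\<And>x. x \<in> {a..b} \<Longrightarrow> norm (f x) \<le> B1"
      and B2: "\<And>x. x \<in> {a..b} \<Longrightarrow> norm (g x) \<le> B2"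
    by (metis bounded_iff imageI)
  define B where "B = \<bar>B1\<bar> + \<bar>B2\<bar> + 1"
  have "B > 0" by (simp add: B_def)
  have Bf: "norm (f x) \<le> B" and Bg: "norm (g x) \<le> B" if "x \<in> {a..b}" for x
    using B1[OF that] B2[OF that] by (auto simp: B_def)
  show ?thesis
    unfolding AC_on_def
  proof (intro allI impI)
    fix \<epsilon> :: real assume "\<epsilon> > 0"
    define \<eta> where "\<eta> = \<epsilon> / (2 * B * K)"
    have "\<eta> > 0" using \<open>\<epsilon> > 0\<close> \<open>B > 0\<close> \<open>K > 0\<close> by (simp add: \<eta>_def)
    obtain \<delta>1 where "\<delta>1 > 0" and \<delta>1: "\<And>I. finite I \<Longrightarrow> (\<forall>(s, t)\<in>I. a \<le> s \<and> s < t \<and> t \<le> b) \<Longrightarrow>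
        disjoint_family_on (\<lambda>(s, t). {s<..<t}) I \<Longrightarrow> (\<Sum>(s, t)\<in>I. t - s) < \<delta>1 \<Longrightarrow>
        (\<Sum>(s, t)\<in>I. norm (f t - f s)) < \<eta>"
      using f \<open>\<eta> > 0\<close> unfolding AC_on_def by blast
    obtain \<delta>2 where "\<delta>2 > 0" and \<delta>2: "\<And>I. finite I \<Longrightarrow> (\<forall>(s, t)\<in>I. a \<le> s \<and> s < t \<and> t \<le> b) \<Longrightarrow>
        disjoint_family_on (\<lambda>(s, t). {s<..<t}) I \<Longrightarrow> (\<Sum>(s, t)\<in>I. t - s) < \<delta>2 \<Longrightarrow>
        (\<Sum>(s, t)\<in>I. norm (g t - g s)) < \<eta>"
      using g \<open>\<eta> > 0\<close> unfolding AC_on_def by blast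
    have "(\<Sum>(s, t)\<in>I. norm (pr (f t) (g t) - pr (f s) (g s))) < \<epsilon>"
      if I: "finite I" "\<forall>(s, t)\<in>I. a \<le> s \<and> s < t \<and> t \<le> b"
        "disjoint_family_on (\<lambda>(s, t). {s<..<t}) I" "(\<Sum>(s, t)\<in>I. t - s) < min \<delta>1 \<delta>2"
      for I :: "(real \<times> real) set"
    proof -
      have "(\<Sum>(s, t)\<in>I. norm (pr (f t) (g t) - pr (f s) (g s)))
          \<le> (\<Sum>(s, t)\<in>I. B * K * (norm (f t - f s) + norm (g t - g s)))"
      proof (rule sum_mono, clarify)
        fix s t assume "(s, t) \<in> I"
        then have st: "s \<in> {a..b}" "t \<in> {a..b}" using I by force+
        have "pr (f t) (g t) - pr (f s) (g s) = pr (f t - f s) (g t) + pr (f s) (g t - g s)"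
          by (simp add: bounded_bilinear.diff_left[OF bb] bounded_bilinear.diff_right[OF bb])
        also have "norm \<dots> \<le> norm (f t - f s) * norm (g t) * K + norm (f s) * norm (g t - g s) * K"
          by (intro order_trans[OF norm_triangle_ineq] add_mono K)
        also have "\<dots> \<le> norm (f t - f s) * B * K + B * norm (g t - g s) * K"
          using Bf[OF st(1)] Bg[OF st(2)] \<open>K > 0\<close>
          by (intro add_mono mult_right_mono mult_left_mono) auto
        finally show "norm (pr (f t) (g t) - pr (f s) (g s)) \<le> B * K * (norm (f t - f s) + norm (g t - g s))"
          by (simp add: algebra_simps)
      qed
      also have "\<dots> = B * K * ((\<Sum>(s, t)\<in>I. norm (f t - f s)) + (\<Sum>(s, t)\<in>I. norm (g t - g s)))"
        by (simp add: sum_distrib_left case_prod_unfold sum.distrib distrib_left)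
      also have "\<dots> < B * K * (\<eta> + \<eta>)"
        using \<delta>1[OF I(1-3)] \<delta>2[OF I(1-3)] I(4) \<open>B > 0\<close> \<open>K > 0\<close>
        by (intro mult_strict_left_mono add_strict_mono) auto
      also have "\<dots> = \<epsilon>" using \<open>B > 0\<close> \<open>K > 0\<close> by (simp add: \<eta>_def)
      finally show ?thesis .
    qed
    then show "\<exists>\<delta>>0. \<forall>I. finite I \<longrightarrow> (\<forall>(s, t)\<in>I. a \<le> s \<and> s < t \<and> t \<le> b) \<longrightarrow>
        disjoint_family_on (\<lambda>(s, t). {s<..<t}) I \<longrightarrow>
        (\<Sum>(s, t)\<in>I. t - s) < \<delta> \<longrightarrow> (\<Sum>(s, t)\<in>I. norm (pr (f t) (g t) - pr (f s) (g s))) < \<epsilon>"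
      using \<open>\<delta>1 > 0\<close> \<open>\<delta>2 > 0\<close> by (intro exI[of _ "min \<delta>1 \<delta>2"]) simp
  qed
qed

lemma AC_on_diff:
  assumes f: "AC_on a b f" and g: "AC_on a b g"
  shows "AC_on a b (\<lambda>x. f x - g x)"
  unfolding AC_on_def
proof (intro allI impI)
  fix \<epsilon> :: real assume "\<epsilon> > 0"
  then have "\<epsilon> / 2 > 0" by simp
  obtain \<delta>1 where "\<delta>1 > 0" and \<delta>1: "\<And>I. finite I \<Longrightarrow> (\<forall>(s, t)\<in>I. a \<le> s \<and> s < t \<and> t \<le> b) \<Longrightarrow>
      disjoint_family_on (\<lambda>(s, t). {s<..<t}) I \<Longrightarrow> (\<Sum>(s, t)\<in>I. t - s) < \<delta>1 \<Longrightarrow>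
      (\<Sum>(s, t)\<in>I. norm (f t - f s)) < \<epsilon> / 2"
    using f \<open>\<epsilon> / 2 > 0\<close> unfolding AC_on_def by blast
  obtain \<delta>2 where "\<delta>2 > 0" and \<delta>2: "\<And>I. finite I \<Longrightarrow> (\<forall>(s, t)\<in>I. a \<le> s \<and> s < t \<and> t \<le> b) \<Longrightarrow>
      disjoint_family_on (\<lambda>(s, t). {s<..<t}) I \<Longrightarrow> (\<Sum>(s, t)\<in>I. t - s) < \<delta>2 \<Longrightarrow>
      (\<Sum>(s, t)\<in>I. norm (g t - g s)) < \<epsilon> / 2"
    using g \<open>\<epsilon> / 2 > 0\<close> unfolding AC_on_def by blast
  have "(\<Sum>(s, t)\<in>I. norm (f t - g t - (f s - g s))) < \<epsilon>"
    if I: "finite I" "\<forall>(s, t)\<in>I. a \<le> s \<and> s < t \<and> t \<le> b"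
      "disjoint_family_on (\<lambda>(s, t). {s<..<t}) I" "(\<Sum>(s, t)\<in>I. t - s) < min \<delta>1 \<delta>2"
    for I :: "(real \<times> real) set"
  proof -
    have *: "norm (f t - g t - (f s - g s)) \<le> norm (f t - f s) + norm (g t - g s)" for s t
      by norm
    have "(\<Sum>(s, t)\<in>I. norm (f t - g t - (f s - g s)))
        \<le> (\<Sum>(s, t)\<in>I. norm (f t - f s)) + (\<Sum>(s, t)\<in>I. norm (g t - g s))"
      unfolding sum.distrib[symmetric] case_prod_unfold by (intro sum_mono *)
    then show ?thesis
      using \<delta>1[OF I(1-3)] \<delta>2[OF I(1-3)] I(4) by simp
  qed
  then show "\<exists>\<delta>>0. \<forall>I. finite I \<longrightarrow> (\<forall>(s, t)\<in>I. a \<le> s \<and> s < t \<and> t \<le> b) \<longrightarrow>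
      disjoint_family_on (\<lambda>(s, t). {s<..<t}) I \<longrightarrow>
      (\<Sum>(s, t)\<in>I. t - s) < \<delta> \<longrightarrow> (\<Sum>(s, t)\<in>I. norm (f t - g t - (f s - g s))) < \<epsilon>"
    using \<open>\<delta>1 > 0\<close> \<open>\<delta>2 > 0\<close> by (intro exI[of _ "min \<delta>1 \<delta>2"]) simp
qed

text \<open>The Henstock--Kurzweil integral makes this direct: on the exceptional null set the gauge
  keeps the intervals inside an open set of small measure, where absolute continuity applies.\<close>

theorem AC_fundamental_theorem_of_calculus:
  fixes f :: "real \<Rightarrow> 'a::euclidean_space"
  assumes "a \<le> b" and AC: "AC_on a b f" and N: "negligible N"
    and der: "\<And>x. x \<in> {a..b} - N \<Longrightarrow> (f has_vector_derivative g x) (at x within {a..b})"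
  shows "(g has_integral f b - f a) {a..b}"
proof -
  \<comment> \<open>The values of \<open>g\<close> on the null set are arbitrary. With
    \<open>h = 0\<close> there, a cell tagged in \<open>N\<close> contributes exactly an increment
    of \<open>f\<close>; the final spike argument returns to \<open>g\<close>.\<close>
  define h where "h x = (if x \<in> N then 0 else g x)" for x
  have "(h has_integral f b - f a) {a..b}"
    unfolding has_integral_real
  proof (intro allI impI)
    fix \<epsilon> :: real assume "\<epsilon> > 0"
    then have "\<epsilon> / 2 > 0" by simp
    obtain \<delta> where "\<delta> > 0" and \<delta>: "\<And>I. finite I \<Longrightarrow> (\<forall>(s, t)\<in>I. a \<le> s \<and> s < t \<and> t \<le> b) \<Longrightarrow>
        disjoint_family_on (\<lambda>(s, t). {s<..<t}) I \<Longrightarrow> (\<Sum>(s, t)\<in>I. t - s) < \<delta> \<Longrightarrow>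
        (\<Sum>(s, t)\<in>I. norm (f t - f s)) < \<epsilon> / 2"
      using AC \<open>\<epsilon> / 2 > 0\<close> unfolding AC_on_def by blast
    have Nnull: "N \<in> null_sets lebesgue" using N by (simp add: negligible_iff_null_sets)
    then obtain T where T: "open T" "N \<subseteq> T" "T - N \<in> lmeasurable"
        "emeasure lebesgue (T - N) < ennreal \<delta>"
      using sets_lebesgue_outer_open[of N \<delta>] \<open>\<delta> > 0\<close> by auto
    have TN: "T = (T - N) \<union> N" using T(2) by blast
    have Tm: "T \<in> lmeasurable"
      by (subst TN, intro fmeasurable.Un T(3)) (use N negligible_iff_measure in blast)
    have "emeasure lebesgue T = emeasure lebesgue (T - N)"
      using emeasure_Diff_null_set[OF Nnull] Tm by (simp add: fmeasurableD)
    then have "ennreal (measure lebesgue T) < ennreal \<delta>"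
      using T(4) Tm by (metis emeasure_eq_measure2)
    then have measT: "measure lebesgue T < \<delta>"
      by (simp add: ennreal_less_iff)
    \<comment> \<open>The \<open>+ 1\<close> keeps the denominator positive when a = b. The cells
      tagged outside \<open>N\<close> then cost at most \<epsilon>/4.\<close>
    define \<eta> where "\<eta> = \<epsilon> / (4 * (b - a + 1))"
    have "\<eta> > 0" using \<open>\<epsilon> > 0\<close> \<open>a \<le> b\<close> by (simp add: \<eta>_def)
    have "\<forall>x. \<exists>d>0. x \<in> {a..b} - N \<longrightarrow>
         (\<forall>y\<in>{a..b}. norm (y-x) < d \<longrightarrow> norm (f y - f x - (y-x) *\<^sub>R g x) \<le> \<eta> * norm (y-x))"
      using der[unfolded has_vector_derivative_def has_derivative_within_alt] \<open>\<eta> > 0\<close>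
      by (metis zero_less_one)
    then obtain d where d: "\<And>x. 0 < d x"
        "\<And>x y. \<lbrakk>x \<in> {a..b} - N; y \<in> {a..b}; norm (y-x) < d x\<rbrakk>
          \<Longrightarrow> norm (f y - f x - (y-x) *\<^sub>R g x) \<le> \<eta> * norm (y-x)"
      by metis
    define \<gamma> where "\<gamma> x = (if x \<in> N then T else ball x (d x))" for x
    have "gauge \<gamma>"
      using T d(1) by (auto simp: gauge_def \<gamma>_def)
    have "norm ((\<Sum>(x, K)\<in>p. measure lborel K *\<^sub>R h x) - (f b - f a)) < \<epsilon>"
      if p: "p tagged_division_of {a..b}" and fine: "\<gamma> fine p" for p
    proof -
      have finp: "finite p" using p by auto
      have ba: "b - a = (\<Sum>(x,K)\<in>p. Sup K - Inf K)" "f b - f a = (\<Sum>(x,K)\<in>p. f(Sup K) - f(Inf K))"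
        using additive_tagged_division_1[where f= "\<lambda>x. x"] additive_tagged_division_1[where f= f]
          \<open>a \<le> b\<close> p by auto
      have cell: "\<exists>u v. K = {u..v} \<and> u \<le> v \<and> x \<in> {u..v} \<and> a \<le> u \<and> v \<le> b"
        if xK: "(x, K) \<in> p" for x K
      proof -
        obtain u v where "K = cbox u v" using tagged_division_ofD(4)[OF p xK] by blast
        moreover have "x \<in> K" "K \<subseteq> {a..b}" using tagged_division_ofD(2,3)[OF p xK] by auto
        ultimately show ?thesis by (metis atLeastatMost_subset_iff atLeastAtMost_iff box_real(2) order_trans)
      qed
      define p1 where "p1 = {(x, K) \<in> p. x \<notin> N}"
      define p2 where "p2 = {(x, K) \<in> p. x \<in> N}"
      have pU: "p = p1 \<union> p2" "p1 \<inter> p2 = {}" by (auto simp: p1_def p2_def)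
      have fin12: "finite p1" "finite p2" using finp pU by auto
      let ?E = "\<lambda>(x, K). norm (measure lborel K *\<^sub>R h x - (f (Sup K) - f (Inf K)))"
      have "norm ((\<Sum>(x, K)\<in>p. measure lborel K *\<^sub>R h x) - (f b - f a)) \<le> sum ?E p"
        unfolding ba(2) sum_subtractf[symmetric] case_prod_unfold by (rule norm_sum)
      also have "\<dots> = sum ?E p1 + sum ?E p2"
        unfolding pU(1) by (rule sum.union_disjoint) (use fin12 pU in auto)
      also have "sum ?E p1 \<le> (\<Sum>(x, K)\<in>p1. \<eta> * (Sup K - Inf K))"
      proof (rule sum_mono, clarify)
        fix x K assume "(x, K) \<in> p1"
        then have xK: "(x, K) \<in> p" and xN: "x \<notin> N" by (auto simp: p1_def)
        obtain u v where K: "K = {u..v}" and uv: "u \<le> v" "x \<in> {u..v}" "a \<le> u" "v \<le> b"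
          using cell[OF xK] by blast
        have "K \<subseteq> ball x (d x)" using fine xK xN by (fastforce simp: fine_def \<gamma>_def)
        moreover have "u \<in> K" "v \<in> K" using K uv by auto
        ultimately have "u \<in> ball x (d x)" "v \<in> ball x (d x)" by blast+
        then have du: "norm (u - x) < d x" and dv: "norm (v - x) < d x"
          by (auto simp: dist_real_def)
        have "norm ((v - u) *\<^sub>R g x - (f v - f u))
            \<le> norm (f u - f x - (u - x) *\<^sub>R g x) + norm (f v - f x - (v - x) *\<^sub>R g x)"
          by (rule order_trans[OF _ norm_triangle_ineq4]) (auto simp: algebra_simps)
        also have "\<dots> \<le> \<eta> * norm (u - x) + \<eta> * norm (v - x)"
          using d(2)[of x u] d(2)[of x v] du dv xN uv by (intro add_mono) auto
        also have "\<dots> = \<eta> * (v - u)" using uv by (simp add: algebra_simps)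
        finally show "norm (measure lborel K *\<^sub>R h x - (f (Sup K) - f (Inf K))) \<le> \<eta> * (Sup K - Inf K)"
          using uv xN by (simp add: K h_def)
      qed
      also have "\<dots> \<le> (\<Sum>(x, K)\<in>p. \<eta> * (Sup K - Inf K))"
        using cell \<open>\<eta> > 0\<close> finp pU(1) by (intro sum_mono2) force+
      also have "\<dots> = \<eta> * (b - a)" unfolding ba(1) by (simp add: sum_distrib_left case_prod_unfold)
      also have "\<dots> < \<epsilon> / 2"
      proof -
        have "\<eta> * (b - a) = \<epsilon> / 4 * ((b - a) / (b - a + 1))" by (simp add: \<eta>_def)
        also have "\<dots> \<le> \<epsilon> / 4 * 1" using \<open>\<epsilon> > 0\<close> \<open>a \<le> b\<close> by (intro mult_left_mono) auto
        finally show ?thesis using \<open>\<epsilon> > 0\<close> by simp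
      qed
      also have "sum ?E p2 < \<epsilon> / 2"
      proof -
        \<comment> \<open>Degenerate cells contribute 0 and are discarded: absolute continuity
          speaks of intervals with s < t, and only a cell with nonempty interior determines its tag,
          which makes \<open>?h\<close> injective.\<close>
        define q where "q = {(x, K) \<in> p. x \<in> N \<and> Inf K < Sup K}"
        have qp: "q \<subseteq> p" "q \<subseteq> p2" by (auto simp: q_def p2_def)
        have finq: "finite q" using finp qp(1) finite_subset by blast
        have int_ne: "interior K \<noteq> {}" if "(x, K) \<in> q" for x K
        proof -
          have xK: "(x, K) \<in> p" "Inf K < Sup K" using that by (auto simp: q_def)
          then obtain u v where "K = {u..v}" "u \<le> v" using cell by blast
          with xK show ?thesis by auto
        qed
        have disj: "interior K \<inter> interior K' = {}" if "(x, K) \<in> q" "(x', K') \<in> q" "(x, K) \<noteq> (x', K')"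
          for x K x' K'
          using tagged_division_ofD(5)[OF p] that qp by blast
        let ?h = "\<lambda>(x, K). (Inf K :: real, Sup K)"
        have qcell: "K = {Inf K..Sup K} \<and> Inf K < Sup K \<and> a \<le> Inf K \<and> Sup K \<le> b \<and> K \<subseteq> T"
          if "(x, K) \<in> q" for x K
        proof -
          have xK: "(x, K) \<in> p" "Inf K < Sup K" "x \<in> N" using that by (auto simp: q_def)
          then obtain u v where "K = {u..v}" "u \<le> v" "a \<le> u" "v \<le> b" using cell by blast
          moreover have "K \<subseteq> T" using fine xK by (fastforce simp: fine_def \<gamma>_def)
          ultimately show ?thesis using xK by simp
        qed
        have qT: "K \<subseteq> T" if "(x, K) \<in> q" for x K
          using qcell[OF that] by blast
        have snd_inj: "inj_on snd q"
          using disj int_ne by (fastforce simp: inj_on_def)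
        have inj: "inj_on ?h q"
        proof (rule inj_onI, clarify)
          fix x K x' K' assume A: "(x, K) \<in> q" "(x', K') \<in> q" and "Inf K = Inf K'" "Sup K = Sup K'"
          then have "K = K'" using qcell by metis
          then show "x = x' \<and> K = K'" using snd_inj A unfolding inj_on_def by (metis prod.inject snd_conv)
        qed
        have "sum ?E p2 = sum ?E q"
        proof (rule sum.mono_neutral_right)
          show "\<forall>i\<in>p2 - q. ?E i = 0"
          proof clarify
            fix x K assume A: "(x, K) \<in> p2" "(x, K) \<notin> q"
            then have xK: "(x, K) \<in> p" "\<not> Inf K < Sup K" "x \<in> N" by (auto simp: q_def p2_def)
            then obtain u v where "K = {u..v}" "u \<le> v" using cell by blast
            with xK show "norm (measure lborel K *\<^sub>R h x - (f (Sup K) - f (Inf K))) = 0"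
              by (simp add: h_def)
          qed
        qed (use fin12 qp in auto)
        also have "\<dots> = (\<Sum>(x, K)\<in>q. norm (f (Sup K) - f (Inf K)))"
          by (intro sum.cong) (auto simp: q_def h_def norm_minus_commute)
        also have "\<dots> = (\<Sum>(s, t)\<in>?h ` q. norm (f t - f s))"
          by (subst sum.reindex[OF inj]) (simp add: case_prod_unfold)
        also have "\<dots> < \<epsilon> / 2"
        proof (rule \<delta>)
          show "finite (?h ` q)" using finq by simp
          show "\<forall>(s, t)\<in>?h ` q. a \<le> s \<and> s < t \<and> t \<le> b" using qcell by auto
          show "disjoint_family_on (\<lambda>(s, t). {s<..<t}) (?h ` q)"
          proof (unfold disjoint_family_on_def, intro ballI impI)
            fix m n assume "m \<in> ?h ` q" "n \<in> ?h ` q" and "m \<noteq> n"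
            then obtain x K x' K' where A: "(x, K) \<in> q" "(x', K') \<in> q"
              and mn: "m = (Inf K, Sup K)" "n = (Inf K', Sup K')" and ne: "(x, K) \<noteq> (x', K')"
              by auto
            have "interior K \<inter> interior K' = {}" using disj[OF A ne] .
            moreover have "interior K = {Inf K<..<Sup K}" "interior K' = {Inf K'<..<Sup K'}"
              using qcell A by (metis interior_atLeastAtMost_real)+
            ultimately show "(case m of (s, t) \<Rightarrow> {s<..<t}) \<inter> (case n of (s, t) \<Rightarrow> {s<..<t}) = {}"
              by (simp add: mn)
          qed
          \<comment> \<open>The cells form a division, so their total length is the measure of their
            union, and that union lies in \<open>T\<close>.\<close>
          have div: "(snd ` q) division_of \<Union>(snd ` q)"
            using p qp(1) by (meson partial_division_of_tagged_division tagged_division_of_def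
                tagged_partial_division_subset)
          have "(\<Sum>(s, t)\<in>?h ` q. t - s) = (\<Sum>(x, K)\<in>q. Sup K - Inf K)"
            by (subst sum.reindex[OF inj]) (simp add: case_prod_unfold)
          also have "\<dots> = (\<Sum>(x, K)\<in>q. measure lebesgue K)"
          proof (rule sum.cong, simp, clarify)
            fix x K assume "(x, K) \<in> q"
            then have "K = {Inf K..Sup K}" "Inf K < Sup K" using qcell by auto
            then have "measure lebesgue K = measure lebesgue {Inf K..Sup K}"
              by (intro arg_cong[where f = "measure lebesgue"])
            also have "\<dots> = Sup K - Inf K" using \<open>Inf K < Sup K\<close> by simp
            finally show "Sup K - Inf K = measure lebesgue K" ..
          qed
          also have "\<dots> = sum (measure lebesgue) (snd ` q)"
            by (subst sum.reindex[OF snd_inj]) (simp add: case_prod_unfold)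
          also have "\<dots> = measure lebesgue (\<Union>(snd ` q))" by (rule content_division[OF div])
          also have "\<dots> \<le> measure lebesgue T"
          proof (rule measure_mono_fmeasurable)
            show "\<Union>(snd ` q) \<subseteq> T" using qT by force
          qed (use lmeasurable_division[OF div] Tm in \<open>auto simp: fmeasurableD\<close>)
          finally show "(\<Sum>(s, t)\<in>?h ` q. t - s) < \<delta>" using measT by simp
        qed
        finally show ?thesis .
      qed
      finally show ?thesis by simp
    qed
    with \<open>gauge \<gamma>\<close> show "\<exists>\<gamma>. gauge \<gamma> \<and> (\<forall>\<D>. \<D> tagged_division_of {a..b} \<and> \<gamma> fine \<D> \<longrightarrow>
        norm ((\<Sum>(x, K)\<in>\<D>. measure lborel K *\<^sub>R h x) - (f b - f a)) < \<epsilon>)"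
      by (intro exI[of _ \<gamma>]) simp
  qed
  then show ?thesis
    by (rule has_integral_spike[OF N, rotated]) (simp add: h_def)
qed

subsection \<open>Complex matrices\<close>

abbreviation adj :: "complex^'m^'m \<Rightarrow> complex^'m^'m" where "adj \<equiv> conj_transpose"

definition cip :: "complex^'m \<Rightarrow> complex^'m \<Rightarrow> complex" where
  "cip u v = (\<Sum>i\<in>UNIV. cnj (u $ i) * v $ i)"

lemma bounded_bilinear_matrix_matrix_mult:
  "bounded_bilinear ((**) :: complex^'n^'m \<Rightarrow> complex^'k^'n \<Rightarrow> complex^'k^'m)"
  unfolding bilinear_conv_bounded_bilinear[symmetric] bilinear_def
  by (auto intro!: linearI simp: vec_eq_iff matrix_matrix_mult_def algebra_simps sum.distrib
      scaleR_sum_right sum_distrib_left)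

lemma bounded_bilinear_matrix_vector_mult:
  "bounded_bilinear ((*v) :: complex^'n^'m \<Rightarrow> complex^'n \<Rightarrow> complex^'m)"
  unfolding bilinear_conv_bounded_bilinear[symmetric] bilinear_def
  by (auto intro!: linearI simp: vec_eq_iff matrix_vector_mult_def algebra_simps sum.distrib
      scaleR_sum_right sum_distrib_left)

text \<open>\<open>cip\<close> is conjugate-linear in its first argument, but
  \<open>bounded_bilinear\<close> is a notion over the reals, so the product rules for continuity
  and derivatives become available.\<close>

lemma bounded_bilinear_cip: "bounded_bilinear (cip :: complex^'m \<Rightarrow> complex^'m \<Rightarrow> complex)"
  unfolding bilinear_conv_bounded_bilinear[symmetric] bilinear_def
  by (auto intro!: linearI simp: cip_def algebra_simps sum.distrib scaleR_sum_right sum_distrib_left)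

lemma bounded_bilinear_scale: "bounded_bilinear ((*s) :: complex \<Rightarrow> complex^'m \<Rightarrow> complex^'m)"
  unfolding bilinear_conv_bounded_bilinear[symmetric] bilinear_def
  by (auto intro!: linearI simp: vec_eq_iff algebra_simps)

interpretation mm: bounded_bilinear "(**) :: complex^'m^'m \<Rightarrow> complex^'m^'m \<Rightarrow> complex^'m^'m"
  by (rule bounded_bilinear_matrix_matrix_mult)

interpretation mv: bounded_bilinear "(*v) :: complex^'m^'m \<Rightarrow> complex^'m \<Rightarrow> complex^'m"
  by (rule bounded_bilinear_matrix_vector_mult)

interpretation cip_bl: bounded_bilinear "cip :: complex^'m \<Rightarrow> complex^'m \<Rightarrow> complex"
  by (rule bounded_bilinear_cip)

interpretation cs_bl: bounded_bilinear "(*s) :: complex \<Rightarrow> complex^'m \<Rightarrow> complex^'m"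
  by (rule bounded_bilinear_scale)

lemma bounded_linear_adj: "bounded_linear (adj :: complex^'m^'m \<Rightarrow> complex^'m^'m)"
  unfolding linear_conv_bounded_linear[symmetric]
  by (auto intro!: linearI simp: vec_eq_iff conj_transpose_def)

lemma bounded_linear_mat: "bounded_linear (mat :: complex \<Rightarrow> complex^'m^'m)"
  unfolding linear_conv_bounded_linear[symmetric]
  by (auto intro!: linearI simp: vec_eq_iff mat_def)

lemmas mat_diff = linear_diff[OF bounded_linear.linear[OF bounded_linear_mat]]

lemma cip_scale_left: "cip (c *s u) v = cnj c * cip u v"
  by (simp add: cip_def sum_distrib_left mult_ac)

lemma cip_scale_right: "cip u (c *s v) = c * cip u v"
  by (simp add: cip_def sum_distrib_left mult_ac)

lemma cnj_cip: "cnj (cip u v) = cip v u"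
  by (simp add: cip_def mult_ac)

lemma cip_self: "cip u u = of_real ((norm u)\<^sup>2)"
proof -
  have "(norm u)\<^sup>2 = (\<Sum>i\<in>UNIV. (norm (u $ i))\<^sup>2)"
    by (simp add: norm_vec_def L2_set_def sum_nonneg)
  then show ?thesis
    by (simp add: cip_def complex_norm_square mult.commute del: of_real_power)
qed

lemma norm_cip_le: "norm (cip u v) \<le> norm u * norm v"
proof -
  have "norm (cip u v) \<le> (\<Sum>i\<in>UNIV. norm (u $ i) * norm (v $ i))"
    unfolding cip_def by (rule order_trans[OF norm_sum]) (simp add: norm_mult)
  also have "\<dots> \<le> norm u * norm v"
    unfolding norm_vec_def using L2_set_mult_ineq[of "\<lambda>i. norm (u $ i)" "\<lambda>i. norm (v $ i)" UNIV] by simp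
  finally show ?thesis .
qed

lemma cip_adj: fixes A :: "complex^'m^'m" shows "cip u (A *v v) = cip (adj A *v u) v"
proof -
  have "cip u (A *v v) = (\<Sum>i\<in>UNIV. \<Sum>j\<in>UNIV. cnj (u $ i) * (A $ i $ j * v $ j))"
    by (simp add: cip_def matrix_vector_mult_def sum_distrib_left)
  also have "\<dots> = (\<Sum>j\<in>UNIV. \<Sum>i\<in>UNIV. cnj (u $ i) * (A $ i $ j * v $ j))"
    by (rule sum.swap)
  also have "\<dots> = cip (adj A *v u) v"
    by (simp add: cip_def matrix_vector_mult_def conj_transpose_def sum_distrib_left sum_distrib_right
        mult_ac)
  finally show ?thesis .
qed

lemma adj_adj [simp]: "adj (adj A) = A"
  by (simp add: conj_transpose_def vec_eq_iff)

lemma cip_adj': "cip (A *v u) v = cip u (adj A *v v)"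
  by (simp add: cip_adj)

lemma mat_mult_comm: "mat c ** A = A ** (mat c :: complex^'m^'m)"
proof -
  have "(mat c ** A) $ i $ j = c * A $ i $ j" for i j
    by (simp add: matrix_matrix_mult_def mat_def if_distrib if_distribR sum.delta sum.delta' cong: if_cong)
  moreover have "(A ** mat c) $ i $ j = A $ i $ j * c" for i j
    by (simp add: matrix_matrix_mult_def mat_def if_distrib if_distribR sum.delta sum.delta' cong: if_cong)
  ultimately show ?thesis by (simp add: vec_eq_iff mult.commute[of c])
qed

lemma mat_mult_entry: "(mat c ** A) $ i $ j = c * (A :: complex^'m^'m) $ i $ j"
  by (simp add: matrix_matrix_mult_def mat_def if_distrib if_distribR sum.delta sum.delta' cong: if_cong)

lemma mat_mult_mat: "mat c ** mat d = (mat (c * d) :: complex^'m^'m)"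
  by (simp add: vec_eq_iff mat_mult_entry) (simp add: mat_def)

lemma mat_mult_vec: "mat c *v v = c *s (v :: complex^'m)"
  by (simp add: matrix_vector_mult_def mat_def vec_eq_iff if_distrib if_distribR sum.delta sum.delta'
      cong: if_cong)

lemma mv_scale: "A *v (c *s v) = c *s ((A :: complex^'m^'m) *v v)"
  by (simp add: matrix_vector_mult_def vec_eq_iff sum_distrib_left mult_ac)

lemma cip_nondegenerate:
  fixes A B :: "complex^'m^'m"
  assumes "\<And>u v. cip u (A *v v) = cip u (B *v v)"
  shows "A = B"
proof -
  have *: "A $ i $ j = cip (axis i 1) (A *v axis j 1)" for A :: "complex^'m^'m" and i j
    by (simp add: cip_def matrix_vector_mult_def axis_def if_distrib if_distribR sum.delta sum.delta'
        cong: if_cong)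
  have "A $ i $ j = B $ i $ j" for i j
    unfolding *[of A i j] *[of B i j] by (rule assms)
  then show ?thesis by (simp add: vec_eq_iff)
qed

lemma cip_polarization:
  fixes A :: "complex^'m^'m"
  shows
  "4 * cip u (A *v v) = cip (u + v) (A *v (u + v)) - cip (u - v) (A *v (u - v))
      - \<i> * cip (u + \<i> *s v) (A *v (u + \<i> *s v)) + \<i> * cip (u - \<i> *s v) (A *v (u - \<i> *s v))"
  by (simp add: cip_bl.add_left cip_bl.add_right cip_bl.diff_left cip_bl.diff_right mv.add_right mv.diff_right
      mv_scale cip_scale_left cip_scale_right algebra_simps)

text \<open>Over the complex numbers polarization recovers all entries from the quadratic form, so
  scalar statements about <v, A v> give matrix identities for arbitrary, also non-Hermitian,
  matrices.\<close>

lemma quadratic_form_eqI: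
  fixes A B :: "complex^'m^'m"
  assumes "\<And>v. cip v (A *v v) = cip v (B *v v)"
  shows "A = B"
proof (rule cip_nondegenerate)
  fix u v
  have "4 * cip u (A *v v) = 4 * cip u (B *v v)"
    unfolding cip_polarization assms ..
  then show "cip u (A *v v) = cip u (B *v v)" by simp
qed

lemma invertibleI_ker:
  fixes A :: "complex^'m^'m"
  assumes "\<And>v. A *v v = 0 \<Longrightarrow> v = 0"
  shows "invertible A"
  using assms by (simp add: invertible_left_inverse matrix_left_invertible_ker)

lemma invertible_matrix_inv:
  fixes A :: "complex^'m^'m"
  assumes "invertible A"
  shows "A ** matrix_inv A = mat 1" and "matrix_inv A ** A = mat 1"
  using someI_ex[OF assms[unfolded invertible_def]] by (simp_all add: matrix_inv_def)

lemma matrix_inv_unique: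
  fixes A :: "complex^'m^'m"
  assumes "A ** B = mat 1"
  shows "invertible A" and "matrix_inv A = B"
proof -
  show inv: "invertible A" using assms by (metis invertible_def matrix_left_right_inverse)
  have "matrix_inv A = matrix_inv A ** (A ** B)" by (simp add: assms)
  also have "\<dots> = B" by (simp add: matrix_mul_assoc invertible_matrix_inv[OF inv])
  finally show "matrix_inv A = B" .
qed

text \<open>Cramer's rule: the entries of the inverse are polynomials in the entries divided by the
  determinant. Holomorphy and continuity of inversion are read off from this.\<close>

lemma matrix_inv_entry:
  fixes A :: "complex^'m^'m"
  assumes "invertible A"
  shows "matrix_inv A $ i $ j = det (\<chi> r c. if c = i then (if r = j then 1 else 0) else A $ r $ c) / det A"
proof -
  have "A *v (matrix_inv A *v axis j 1) = axis j 1"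
    by (simp add: matrix_vector_mul_assoc invertible_matrix_inv[OF assms])
  then have *: "matrix_inv A *v axis j 1
      = (\<chi> k. det (\<chi> r c. if c = k then axis j 1 $ r else A $ r $ c) / det A)"
    using cramer[of A] assms by (simp add: invertible_det_nz)
  have "matrix_inv A $ i $ j = (matrix_inv A *v axis j 1) $ i"
    by (simp add: matrix_vector_mult_def axis_def if_distrib sum.delta' cong: if_cong)
  also have "\<dots> = det (\<chi> r c. if c = i then axis j 1 $ r else A $ r $ c) / det A"
    unfolding * by simp
  also have "(\<chi> r c. if c = i then axis j 1 $ r else A $ r $ c)
      = (\<chi> r c. if c = i then (if r = j then 1 else 0) else A $ r $ c)"
    by (simp add: vec_eq_iff axis_def)
  finally show ?thesis .
qed

lemma holomorphic_on_det:
  fixes B :: "complex \<Rightarrow> complex^'m^'m"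
  assumes "\<And>i j. (\<lambda>z. B z $ i $ j) holomorphic_on S"
  shows "(\<lambda>z. det (B z)) holomorphic_on S"
  unfolding det_def by (intro holomorphic_intros assms)

lemma holomorphic_on_matrix_inv:
  fixes B :: "complex \<Rightarrow> complex^'m^'m"
  assumes "\<And>i j. (\<lambda>z. B z $ i $ j) holomorphic_on S" and "\<And>z. z \<in> S \<Longrightarrow> invertible (B z)"
  shows "(\<lambda>z. matrix_inv (B z) $ i $ j) holomorphic_on S"
proof -
  have "(\<lambda>z. det (\<chi> r c. if c = i then (if r = j then 1 else 0) else B z $ r $ c) / det (B z)) holomorphic_on S"
  proof (intro holomorphic_on_divide holomorphic_on_det)
    show "(\<lambda>z. (\<chi> r c. if c = i then if r = j then 1 else 0 else B z $ r $ c) $ r $ c) holomorphic_on S" for r c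
      using assms(1) by (cases "c = i") auto
  qed (use assms invertible_det_nz in auto)
  then show ?thesis
    by (rule holomorphic_transform) (simp add: assms matrix_inv_entry)
qed

lemma continuous_on_vec_nth2:
  fixes B :: "'a::topological_space \<Rightarrow> complex^'m^'m"
  shows "continuous_on S B \<Longrightarrow> continuous_on S (\<lambda>x. B x $ i $ j)"
  by (intro continuous_intros)

lemma continuous_on_vecI2:
  fixes B :: "'a::topological_space \<Rightarrow> complex^'m^'m"
  assumes "\<And>i j. continuous_on S (\<lambda>x. B x $ i $ j)"
  shows "continuous_on S B"
proof -
  have "continuous_on S (\<lambda>x. \<chi> i. \<chi> j. B x $ i $ j)"
    by (intro continuous_on_vec_lambda assms)
  then show ?thesis by simp
qed

lemma continuous_on_det:
  fixes B :: "'a::topological_space \<Rightarrow> complex^'m^'m"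
  assumes "\<And>i j. continuous_on S (\<lambda>x. B x $ i $ j)"
  shows "continuous_on S (\<lambda>x. det (B x))"
  unfolding det_def by (intro continuous_intros assms)

lemma continuous_on_matrix_inv:
  fixes B :: "'a::topological_space \<Rightarrow> complex^'m^'m"
  assumes cont: "continuous_on S B" and inv: "\<And>x. x \<in> S \<Longrightarrow> invertible (B x)"
  shows "continuous_on S (\<lambda>x. matrix_inv (B x))"
proof (rule continuous_on_vecI2)
  fix i j
  have "continuous_on S (\<lambda>x. det (\<chi> r c. if c = i then (if r = j then 1 else 0) else B x $ r $ c) / det (B x))"
  proof (intro continuous_on_divide continuous_on_det)
    show "continuous_on S (\<lambda>x. (\<chi> r c. if c = i then if r = j then 1 else 0 else B x $ r $ c) $ r $ c)" for r c
      using continuous_on_vec_nth2[OF cont] by (cases "c = i") auto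
  qed (use inv invertible_det_nz continuous_on_vec_nth2[OF cont] in auto)
  then show "continuous_on S (\<lambda>x. matrix_inv (B x) $ i $ j)"
    by (rule continuous_on_eq) (simp add: inv matrix_inv_entry)
qed

lemma matrix_Im_form: "cip v (matrix_Im A *v v) = of_real (Im (cip v (A *v v)))"
proof -
  have "matrix_Im A = mat (1 / (2 * \<i>)) ** (A - adj A)"
    by (simp add: vec_eq_iff matrix_Im_def mat_mult_entry)
  then have "cip v (matrix_Im A *v v) = (cip v (A *v v) - cip v (adj A *v v)) / (2 * \<i>)"
    by (simp add: matrix_vector_mul_assoc[symmetric] mat_mult_vec cip_scale_right mv.diff_left cip_bl.diff_right
        diff_divide_distrib algebra_simps)
  also have "cip v (adj A *v v) = cnj (cip v (A *v v))"
    by (simp add: cnj_cip cip_adj')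
  also have "(w - cnj w) / (2 * \<i>) = of_real (Im w)" for w
    by (simp add: complex_eq_iff Re_divide Im_divide power2_eq_square)
  finally show ?thesis .
qed

subsection \<open>Linear second-order equations\<close>

text \<open>The integral is oriented, so this is a primitive on both sides of the base
  point.\<close>

definition prim :: "real \<Rightarrow> (real \<Rightarrow> 'a::euclidean_space) \<Rightarrow> real \<Rightarrow> 'a" where
  "prim x0 f x = (LBINT y=ereal x0..ereal x. f y)"

lemma prim_start [simp]: "prim x0 f x0 = 0"
  by (simp add: prim_def)

lemma prim_derivative:
  assumes "continuous_on UNIV f"
  shows "(prim x0 f has_vector_derivative f x) (at x)"
proof -
  let ?a = "min x x0 - 1" and ?b = "max x x0 + 1"
  have "((\<lambda>u. LBINT y=x0..u. f y) has_vector_derivative f x) (at x within {?a..?b})"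
    by (rule interval_integral_FTC2) (auto intro: continuous_on_subset[OF assms])
  moreover have "at x within {?a..?b} = at x"
    by (rule at_within_interior) auto
  ultimately show ?thesis by (simp add: prim_def[abs_def])
qed

lemma vector_derivative_zero_imp_eq:
  fixes F :: "real \<Rightarrow> 'a::real_normed_vector"
  assumes "\<And>x. (F has_vector_derivative 0) (at x)"
  shows "F x = F y"
  using has_derivative_zero_constant[of UNIV F] assms
  by (auto simp: has_vector_derivative_def)

lemma prim_unique:
  assumes "continuous_on UNIV f" "\<And>x. (F has_vector_derivative f x) (at x)" "F x0 = 0"
  shows "F = prim x0 f"
proof
  fix x
  have "((\<lambda>x. F x - prim x0 f x) has_vector_derivative 0) (at x)" for x
    using has_vector_derivative_diff[OF assms(2) prim_derivative[OF assms(1)]] by simp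
  from vector_derivative_zero_imp_eq[OF this, of x x0] show "F x = prim x0 f x"
    using assms(3) by simp
qed

lemma prim_continuous:
  assumes "continuous_on UNIV f"
  shows "continuous_on S (prim x0 f)"
  by (intro continuous_at_imp_continuous_on ballI has_vector_derivative_continuous[OF prim_derivative[OF assms]])

text \<open>In the weighted norm with weight exp(L |x - x0|) one integration gains the factor 1/L.
  Two integrations beat any bounded coefficient once L is large, so no restriction to short
  intervals is needed.\<close>

lemma exp_weight_bound:
  fixes F :: "real \<Rightarrow> 'a::banach"
  assumes der: "\<And>x. (F has_vector_derivative f x) (at x)" and "F x0 = 0" and "L > 0"
    and bd: "\<And>y. \<bar>y - x0\<bar> \<le> T \<Longrightarrow> norm (f y) \<le> c * exp (L * \<bar>y - x0\<bar>)"
    and x: "\<bar>x - x0\<bar> \<le> T"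
  shows "norm (F x) \<le> c / L * exp (L * \<bar>x - x0\<bar>)"
proof -
  \<comment> \<open>Orientation of the interval from \<open>x0\<close> to \<open>x\<close>; the
    substitution x0 + \<sigma> t treats both sides at once.\<close>
  define \<sigma> :: real where "\<sigma> = (if x \<ge> x0 then 1 else -1)"
  define d where "d = \<bar>x - x0\<bar>"
  have x_eq: "x = x0 + \<sigma> * d" and s1: "\<bar>\<sigma>\<bar> = 1" by (auto simp: \<sigma>_def d_def)
  have c0: "c \<ge> 0" using order_trans[OF norm_ge_zero bd[of x0]] x by (simp add: d_def)
  show ?thesis
  proof (cases "d = 0")
    case True
    then show ?thesis using assms(2) c0 \<open>L > 0\<close> by (simp add: d_def)
  next
    case False
    then have "d > 0" by (simp add: d_def)
    have "norm (F (x0 + \<sigma> * d) - F (x0 + \<sigma> * 0)) \<le> c / L * exp (L * d) - c / L * exp (L * 0)"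
    proof (rule differentiable_bound_general[OF \<open>d > 0\<close>])
      have cF: "continuous_on UNIV F"
        by (intro continuous_at_imp_continuous_on ballI has_vector_derivative_continuous[OF der])
      show "continuous_on {0..d} (\<lambda>t. F (x0 + \<sigma> * t))"
        by (rule continuous_on_compose2[OF cF]) (auto intro!: continuous_intros)
      show "continuous_on {0..d} (\<lambda>t. c / L * exp (L * t))" by (intro continuous_intros)
      fix t assume t: "0 < t" "t < d"
      have "((\<lambda>t. x0 + \<sigma> * t) has_vector_derivative \<sigma>) (at t)"
        by (auto intro!: derivative_eq_intros simp: has_real_derivative_iff_has_vector_derivative[symmetric])
      from vector_diff_chain_at[OF this der]
      show "((\<lambda>t. F (x0 + \<sigma> * t)) has_vector_derivative \<sigma> *\<^sub>R f (x0 + \<sigma> * t)) (at t)"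
        by (simp add: o_def)
      show "((\<lambda>t. c / L * exp (L * t)) has_vector_derivative c * exp (L * t)) (at t)"
        using \<open>L > 0\<close> by (auto intro!: derivative_eq_intros
            simp: has_real_derivative_iff_has_vector_derivative[symmetric])
      have "\<bar>x0 + \<sigma> * t - x0\<bar> = t" using t s1 by (simp add: abs_mult)
      then show "norm (\<sigma> *\<^sub>R f (x0 + \<sigma> * t)) \<le> c * exp (L * t)"
        using bd[of "x0 + \<sigma> * t"] t x s1 by (simp add: d_def)
    qed
    then have "norm (F x) \<le> c / L * exp (L * d) - c / L" using assms(2) by (simp add: x_eq)
    also have "\<dots> \<le> c / L * exp (L * d)" using c0 \<open>L > 0\<close> by simp
    finally show ?thesis by (simp add: d_def)
  qed
qed

text \<open>Each round of the estimate passes from u to u'' and integrates twice. With L^2 = 2 K the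
  constant is halved every time, so u is bounded by arbitrarily small multiples of a fixed
  function.\<close>

lemma second_order_unique:
  fixes u :: "real \<Rightarrow> 'a::banach"
  assumes u: "\<And>x. (u has_vector_derivative u' x) (at x)"
    and u': "\<And>x. (u' has_vector_derivative u'' x) (at x)"
    and bd: "\<And>T. \<exists>K. \<forall>x. \<bar>x - x0\<bar> \<le> T \<longrightarrow> norm (u'' x) \<le> K * norm (u x)"
    and init: "u x0 = 0" "u' x0 = 0"
  shows "u x = 0"
proof -
  define T where "T = \<bar>x - x0\<bar>"
  obtain K0 where K0: "\<And>y. \<bar>y - x0\<bar> \<le> T \<Longrightarrow> norm (u'' y) \<le> K0 * norm (u y)" using bd by blast
  define K where "K = \<bar>K0\<bar> + 1"
  have K: "K > 0" "\<And>y. \<bar>y - x0\<bar> \<le> T \<Longrightarrow> norm (u'' y) \<le> K * norm (u y)"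
  proof -
    fix y assume "\<bar>y - x0\<bar> \<le> T"
    then have "norm (u'' y) \<le> K0 * norm (u y)" by (rule K0)
    also have "\<dots> \<le> K * norm (u y)" by (intro mult_right_mono) (auto simp: K_def)
    finally show "norm (u'' y) \<le> K * norm (u y)" .
  qed (simp add: K_def)
  define L where "L = sqrt (2 * K)"
  have L: "L > 0" "L * L = 2 * K" using K by (auto simp: L_def)
  have "continuous_on {x0 - T..x0 + T} u"
    by (intro continuous_at_imp_continuous_on ballI has_vector_derivative_continuous[OF u])
  then have "bounded (u ` {x0 - T..x0 + T})"
    by (intro compact_imp_bounded compact_continuous_image) auto
  then obtain C where C: "C > 0" "\<And>y. y \<in> {x0 - T..x0 + T} \<Longrightarrow> norm (u y) \<le> C"
    by (auto simp: bounded_pos)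
  have it: "norm (u y) \<le> C * (1/2) ^ n * exp (L * \<bar>y - x0\<bar>)" if "\<bar>y - x0\<bar> \<le> T" for n y
    using that
  proof (induction n arbitrary: y)
    case 0
    have "norm (u y) \<le> C * 1" using C(2)[of y] 0 by (simp add: abs_le_iff)
    also have "\<dots> \<le> C * exp (L * \<bar>y - x0\<bar>)" using C L by (intro mult_left_mono) auto
    finally show ?case by simp
  next
    case (Suc n)
    let ?c = "K * (C * (1/2) ^ n)"
    have 1: "norm (u'' y) \<le> ?c * exp (L * \<bar>y - x0\<bar>)" if "\<bar>y - x0\<bar> \<le> T" for y
    proof -
      have "norm (u'' y) \<le> K * norm (u y)"
        by (rule K(2)[OF that])
      also have "\<dots> \<le> K * (C * (1/2) ^ n * exp (L * \<bar>y - x0\<bar>))"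
        by (intro mult_left_mono Suc.IH that) (use K in auto)
      finally show ?thesis by (simp add: mult_ac)
    qed
    have 2: "norm (u' y) \<le> ?c / L * exp (L * \<bar>y - x0\<bar>)" if "\<bar>y - x0\<bar> \<le> T" for y
      by (rule exp_weight_bound[OF u' init(2) L(1) 1 that])
    have "norm (u y) \<le> ?c / L / L * exp (L * \<bar>y - x0\<bar>)"
      by (rule exp_weight_bound[OF u init(1) L(1) 2 Suc.prems])
    also have "?c / L / L = C * (1/2) ^ Suc n"
    proof -
      have "?c / L / L = ?c / (L * L)" by simp
      also have "\<dots> = C * (1/2) ^ Suc n" unfolding L(2) using K(1) by (simp add: field_simps)
      finally show ?thesis .
    qed
    finally show ?case .
  qed
  have "(\<lambda>n. C * (1/2) ^ n * exp (L * \<bar>x - x0\<bar>)) \<longlonglongrightarrow> C * 0 * exp (L * \<bar>x - x0\<bar>)"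
    by (intro tendsto_intros LIMSEQ_realpow_zero) auto
  then have "norm (u x) \<le> 0"
    using it[of x] by (intro LIMSEQ_le_const[of "\<lambda>n. C * (1/2) ^ n * exp (L * \<bar>x - x0\<bar>)"]) (auto simp: T_def)
  then show ?thesis by simp
qed

section \<open>Picard iteration with entire dependence on the spectral parameter\<close>

inductive zpoly :: "(complex \<Rightarrow> real \<Rightarrow> complex^'m^'m) \<Rightarrow> bool" where
  mono: "continuous_on UNIV p \<Longrightarrow> zpoly (\<lambda>z x. mat (z ^ n) ** p x)"
| add: "zpoly f \<Longrightarrow> zpoly g \<Longrightarrow> zpoly (\<lambda>z x. f z x + g z x)"

lemma zpoly_continuous: "zpoly f \<Longrightarrow> continuous_on UNIV (f z)"
  by (induction rule: zpoly.induct) (auto intro!: continuous_intros mm.continuous_on)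

lemma zpoly_holomorphic: "zpoly f \<Longrightarrow> (\<lambda>z. f z x $ i $ j) holomorphic_on S"
  by (induction rule: zpoly.induct) (auto intro!: holomorphic_intros simp: mat_mult_entry)

lemma zpoly_const: "continuous_on UNIV p \<Longrightarrow> zpoly (\<lambda>z. p)"
  using zpoly.mono[of p 0] by simp

lemma zpoly_potential:
  assumes "zpoly f" and Q: "continuous_on UNIV Q"
  shows "zpoly (\<lambda>z x. Q x ** f z x - mat z ** f z x)"
  using assms(1)
proof (induction rule: zpoly.induct)
  case (mono p n)
  have "zpoly (\<lambda>z x. mat (z ^ n) ** (Q x ** p x) + mat (z ^ Suc n) ** (- p x))"
    by (intro zpoly.intros mm.continuous_on continuous_intros mono Q)
  moreover have "mat (z ^ n) ** (Q x ** p x) + mat (z ^ Suc n) ** (- p x)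
      = Q x ** (mat (z ^ n) ** p x) - mat z ** (mat (z ^ n) ** p x)" for z x
    by (simp add: mm.minus_right matrix_mul_assoc mat_mult_mat mat_mult_comm[of _ "Q x"])
  ultimately show ?case by simp
next
  case (add f g)
  from zpoly.add[OF add.IH] show ?case by (simp add: mm.add_right algebra_simps)
qed

lemma zpoly_prim:
  assumes "zpoly f"
  shows "zpoly (\<lambda>z. prim x0 (f z))"
  using assms
proof (induction rule: zpoly.induct)
  case (mono p n)
  have "(\<lambda>x. mat (z ^ n) ** prim x0 p x) = prim x0 (\<lambda>x. mat (z ^ n) ** p x)" for z
    by (rule prim_unique)
      (auto intro!: mm.continuous_on continuous_intros mono
        bounded_linear.has_vector_derivative[OF mm.bounded_linear_right] prim_derivative)
  with zpoly.mono[OF prim_continuous[OF mono, of UNIV x0], of n] show ?case by simp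
next
  case (add f g)
  have c: "continuous_on UNIV (f z)" "continuous_on UNIV (g z)" for z
    using add.hyps by (simp_all add: zpoly_continuous)
  have "(\<lambda>x. prim x0 (f z) x + prim x0 (g z) x) = prim x0 (\<lambda>x. f z x + g z x)" for z
    by (rule prim_unique) (auto intro!: continuous_on_add c has_vector_derivative_add prim_derivative)
  with zpoly.add[OF add.IH] show ?case by simp
qed

text \<open>The second-order equation integrated twice. Every iterate is a polynomial in z with
  coefficients continuous in x (\<open>zpoly\<close>); this is how holomorphy in z enters, and it
  survives locally uniform limits.\<close>

fun picard where
  "picard Q x0 a b 0 z x = a + (x - x0) *\<^sub>R b"
| "picard Q x0 a b (Suc n) z x = a + (x - x0) *\<^sub>R b +
     prim x0 (prim x0 (\<lambda>x. Q x ** picard Q x0 a b n z x - mat z ** picard Q x0 a b n z x)) x"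

lemma picard_zpoly:
  fixes a b :: "complex^'m^'m"
  assumes Q: "continuous_on UNIV Q"
  shows "zpoly (picard Q x0 a b n)"
proof (induction n)
  case 0
  have "zpoly (\<lambda>z x. a + (x - x0) *\<^sub>R b)" by (intro zpoly_const continuous_intros)
  moreover have "picard Q x0 a b 0 = (\<lambda>z x. a + (x - x0) *\<^sub>R b)" by (simp add: fun_eq_iff)
  ultimately show ?case by simp
next
  case (Suc n)
  have "zpoly (\<lambda>z x. a + (x - x0) *\<^sub>R b)" by (intro zpoly_const continuous_intros)
  from zpoly.add[OF this zpoly_prim[OF zpoly_prim[OF zpoly_potential[OF Suc Q]]]]
  have "zpoly (\<lambda>z x. a + (x - x0) *\<^sub>R b +
     prim x0 (prim x0 (\<lambda>x. Q x ** picard Q x0 a b n z x - mat z ** picard Q x0 a b n z x)) x)" .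
  moreover have "picard Q x0 a b (Suc n) = (\<lambda>z x. a + (x - x0) *\<^sub>R b +
     prim x0 (prim x0 (\<lambda>x. Q x ** picard Q x0 a b n z x - mat z ** picard Q x0 a b n z x)) x)"
    by (simp add: fun_eq_iff)
  ultimately show ?case by simp
qed

text \<open>One constant serves all x in a compact interval and all z in a disc simultaneously; this
  makes the Picard estimates uniform in both variables.\<close>

lemma potential_bound:
  fixes Q :: "real \<Rightarrow> complex^'m^'m"
  assumes Q: "continuous_on UNIV Q"
  obtains K where "K > 0"
    and "\<And>x z (w :: complex^'m^'m). \<bar>x - x0\<bar> \<le> T \<Longrightarrow> norm z \<le> Z \<Longrightarrow> norm (Q x ** w - mat z ** w) \<le> K * norm w"
proof -
  obtain M where M: "M > 0" "\<And>(A :: complex^'m^'m) (B :: complex^'m^'m). norm (A ** B) \<le> norm A * norm B * M"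
    using mm.pos_bounded by blast
  obtain N where N: "N > 0" "\<And>z. norm (mat z :: complex^'m^'m) \<le> norm z * N"
    using bounded_linear.pos_bounded[OF bounded_linear_mat] by blast
  have "bounded (Q ` {x0 - T..x0 + T})"
    by (intro compact_imp_bounded compact_continuous_image continuous_on_subset[OF Q]) auto
  then obtain C where C: "C > 0" "\<And>y. y \<in> {x0 - T..x0 + T} \<Longrightarrow> norm (Q y) \<le> C"
    by (auto simp: bounded_pos)
  show ?thesis
  proof (rule that[of "(C + \<bar>Z\<bar> * N) * M"])
    show "(C + \<bar>Z\<bar> * N) * M > 0" using C M N by (simp add: add_pos_nonneg)
    fix x and z :: complex and w :: "complex^'m^'m" assume xz: "\<bar>x - x0\<bar> \<le> T" "norm z \<le> Z"
    have "norm (Q x - mat z) \<le> C + \<bar>Z\<bar> * N"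
    proof -
      have "norm (Q x) \<le> C" using C(2)[of x] xz by (simp add: abs_le_iff)
      moreover have "norm (mat z :: complex^'m^'m) \<le> \<bar>Z\<bar> * N"
        by (rule order_trans[OF N(2)]) (use xz N in \<open>auto intro!: mult_right_mono\<close>)
      ultimately show ?thesis using norm_triangle_ineq4[of "Q x" "mat z"] by simp
    qed
    have "norm (Q x ** w - mat z ** w) = norm ((Q x - mat z) ** w)" by (simp add: mm.diff_left)
    also have "\<dots> \<le> norm (Q x - mat z) * norm w * M" by (rule M)
    also have "\<dots> \<le> (C + \<bar>Z\<bar> * N) * norm w * M"
      using \<open>norm (Q x - mat z) \<le> _\<close> M by (intro mult_right_mono) auto
    finally show "norm (Q x ** w - mat z ** w) \<le> (C + \<bar>Z\<bar> * N) * M * norm w" by (simp add: mult_ac)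
  qed
qed

definition matrix_sol ::
  "(real \<Rightarrow> complex^'m^'m) \<Rightarrow> complex \<Rightarrow> (real \<Rightarrow> complex^'m^'m) \<Rightarrow> (real \<Rightarrow> complex^'m^'m) \<Rightarrow> bool" where
  "matrix_sol Q z u u' \<longleftrightarrow> (\<forall>x. (u has_vector_derivative u' x) (at x)) \<and>
     (\<forall>x. (u' has_vector_derivative (Q x ** u x - mat z ** u x)) (at x))"

text \<open>Convergence is uniform for |z| \<le> Z and |x - x0| \<le> T together. The same uniform
  limit then gives continuity in x, the integral equation, and holomorphy in z for fixed x.\<close>

theorem matrix_sol_exists:
  fixes Q :: "real \<Rightarrow> complex^'m^'m" and a b :: "complex^'m^'m"
  assumes Q: "continuous_on UNIV Q"
  obtains U U' :: "complex \<Rightarrow> real \<Rightarrow> complex^'m^'m" where "\<And>z. matrix_sol Q z (U z) (U' z)" "\<And>z. U z x0 = a" "\<And>z. U' z x0 = b"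
    "\<And>x i j. (\<lambda>z. U z x $ i $ j) holomorphic_on UNIV"
proof -
  let ?p = "picard Q x0 a b"
  let ?A = "\<lambda>z (w :: real \<Rightarrow> complex^'m^'m) x. Q x ** w x - mat z ** w x"
  have pc: "continuous_on UNIV (?p n z)" for n z
    by (rule zpoly_continuous[OF picard_zpoly[OF Q]])
  have Ac: "continuous_on UNIV (?A z w)" if "continuous_on UNIV w" for z and w :: "real \<Rightarrow> complex^'m^'m"
    by (intro continuous_intros mm.continuous_on Q that)
  define U where "U z x = lim (\<lambda>n. ?p n z x)" for z x
  have unif: "uniform_limit {(z, x). norm z \<le> Z \<and> \<bar>x - x0\<bar> \<le> T} (\<lambda>n (z, x). ?p n z x) (\<lambda>(z, x). U z x) sequentially"
    if T: "T \<ge> 0" for Z T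
  proof -
    let ?X = "{(z, x). norm z \<le> Z \<and> \<bar>x - x0\<bar> \<le> T}"
    obtain K where "K > 0" and K: "\<And>x z (w :: complex^'m^'m). \<bar>x - x0\<bar> \<le> T \<Longrightarrow> norm z \<le> Z \<Longrightarrow>
        norm (Q x ** w - mat z ** w) \<le> K * norm w"
      using potential_bound[OF Q] by blast
    \<comment> \<open>With L^2 = 2 K, two weighted integrations multiply the bound on a difference
      of iterates by K / L^2 = 1/2.\<close>
    define L where "L = sqrt (2 * K)"
    have L: "L > 0" "L * L = 2 * K" using \<open>K > 0\<close> by (auto simp: L_def)
    define C where "C = norm a + T * norm b"
    have C0: "C \<ge> 0" using T by (simp add: C_def)
    define d where "d n z x = ?p (Suc n) z x - ?p n z x" for n z x
    \<comment> \<open>\<open>e\<close> is the derivative of the n-th difference. Both vanish at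
      \<open>x0\<close>, and the second derivative is the potential applied to the previous
      difference, which is the input for \<open>exp_weight_bound\<close>.\<close>
    have dd: "\<exists>e. (\<forall>x. (d n z has_vector_derivative e x) (at x)) \<and> e x0 = 0 \<and>
        (\<forall>x. (e has_vector_derivative (if n = 0 then ?A z (?p 0 z) x else ?A z (d (n - 1) z) x)) (at x))" for n z
    proof (cases n)
      case 0
      have "d 0 z = prim x0 (prim x0 (?A z (?p 0 z)))" by (simp add: d_def fun_eq_iff)
      then show ?thesis using 0
        by (intro exI[of _ "prim x0 (?A z (?p 0 z))"])
          (auto intro!: prim_derivative prim_continuous Ac pc continuous_intros)
    next
      case (Suc k)
      have "d n z = (\<lambda>x. prim x0 (prim x0 (?A z (?p n z))) x - prim x0 (prim x0 (?A z (?p k z))) x)"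
        using Suc by (simp add: d_def fun_eq_iff)
      moreover have A: "?A z (?p n z) x - ?A z (?p k z) x = ?A z (d k z) x" for x
        unfolding d_def Suc mm.diff_right by (simp del: picard.simps)
      let ?e = "\<lambda>x. prim x0 (?A z (?p n z)) x - prim x0 (?A z (?p k z)) x"
      have e: "(?e has_vector_derivative ?A z (d k z) x) (at x)" for x
        unfolding A[symmetric] by (intro has_vector_derivative_diff prim_derivative Ac pc)
      have "((\<lambda>x. prim x0 (prim x0 (?A z (?p n z))) x - prim x0 (prim x0 (?A z (?p k z))) x)
          has_vector_derivative ?e x) (at x)" for x
        by (intro has_vector_derivative_diff prim_derivative prim_continuous Ac pc)
      ultimately show ?thesis using e Suc by (intro exI[of _ ?e]) (simp del: picard.simps)
    qed
    have d0: "d n z x0 = 0" for n z by (cases n) (simp_all add: d_def)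
    have dbd: "norm (d n z x) \<le> C * (1/2) ^ Suc n * exp (L * \<bar>x - x0\<bar>)"
      if z: "norm z \<le> Z" and x: "\<bar>x - x0\<bar> \<le> T" for n z x
      using x
    proof (induction n arbitrary: x)
      case (0 x)
      obtain e where e: "\<And>x. (d 0 z has_vector_derivative e x) (at x)" "e x0 = 0"
          "\<And>x. (e has_vector_derivative ?A z (?p 0 z) x) (at x)"
        using dd[of 0 z] by auto
      have p0: "norm (?p 0 z y) \<le> C" if "\<bar>y - x0\<bar> \<le> T" for y
      proof -
        have "norm (a + (y - x0) *\<^sub>R b) \<le> norm a + \<bar>y - x0\<bar> * norm b"
          by (rule order_trans[OF norm_triangle_ineq]) simp
        also have "\<dots> \<le> C" unfolding C_def using that by (intro add_mono mult_right_mono) auto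
        finally show ?thesis by simp
      qed
      have 1: "norm (?A z (?p 0 z) y) \<le> K * C * exp (L * \<bar>y - x0\<bar>)" if "\<bar>y - x0\<bar> \<le> T" for y
      proof -
        have "norm (?A z (?p 0 z) y) \<le> K * C * 1"
          using order_trans[OF K[OF that z] mult_left_mono[OF p0[OF that]]] \<open>K > 0\<close> by simp
        also have "\<dots> \<le> K * C * exp (L * \<bar>y - x0\<bar>)"
          using \<open>K > 0\<close> C0 L by (intro mult_left_mono) auto
        finally show ?thesis .
      qed
      have 2: "norm (e y) \<le> K * C / L * exp (L * \<bar>y - x0\<bar>)" if "\<bar>y - x0\<bar> \<le> T" for y
        by (rule exp_weight_bound[OF e(3) e(2) L(1) 1 that])
      have "norm (d 0 z x) \<le> K * C / L / L * exp (L * \<bar>x - x0\<bar>)"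
        by (rule exp_weight_bound[OF e(1) d0 L(1) 2 0])
      also have "K * C / L / L = K * C / (L * L)" by simp
      also have "\<dots> = C * (1/2) ^ Suc 0" unfolding L(2) using \<open>K > 0\<close> by (simp add: field_simps)
      finally show ?case .
    next
      case (Suc n x)
      obtain e where e: "\<And>x. (d (Suc n) z has_vector_derivative e x) (at x)" "e x0 = 0"
          "\<And>x. (e has_vector_derivative ?A z (d n z) x) (at x)"
        using dd[of "Suc n" z] by auto
      let ?c = "K * (C * (1/2) ^ Suc n)"
      have 1: "norm (?A z (d n z) y) \<le> ?c * exp (L * \<bar>y - x0\<bar>)" if "\<bar>y - x0\<bar> \<le> T" for y
        using order_trans[OF K[OF that z] mult_left_mono[OF Suc.IH[OF that]]] \<open>K > 0\<close> by (simp add: mult_ac)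
      have 2: "norm (e y) \<le> ?c / L * exp (L * \<bar>y - x0\<bar>)" if "\<bar>y - x0\<bar> \<le> T" for y
        by (rule exp_weight_bound[OF e(3) e(2) L(1) 1 that])
      have "norm (d (Suc n) z x) \<le> ?c / L / L * exp (L * \<bar>x - x0\<bar>)"
        by (rule exp_weight_bound[OF e(1) d0 L(1) 2 Suc.prems])
      also have "?c / L / L = ?c / (L * L)" by simp
      also have "\<dots> = C * (1/2) ^ Suc (Suc n)" unfolding L(2) using \<open>K > 0\<close> by (simp add: field_simps)
      finally show ?case .
    qed
    have uc: "uniformly_convergent_on ?X (\<lambda>n p. \<Sum>i<n. d i (fst p) (snd p))"
    proof (rule Weierstrass_m_test')
      show "norm (d n (fst p) (snd p)) \<le> C * (1/2) ^ Suc n * exp (L * T)" if "p \<in> ?X" for n p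
      proof -
        have "norm (d n (fst p) (snd p)) \<le> C * (1/2) ^ Suc n * exp (L * \<bar>snd p - x0\<bar>)"
          using that by (intro dbd) auto
        also have "\<dots> \<le> C * (1/2) ^ Suc n * exp (L * T)"
          using that L C0 by (intro mult_left_mono) auto
        finally show ?thesis .
      qed
      show "summable (\<lambda>n. C * (1/2) ^ Suc n * exp (L * T))"
        by (intro summable_mult summable_mult2) (simp add: summable_geometric)
    qed
    have tele: "?p n z x = ?p 0 z x + (\<Sum>i<n. d i z x)" for n z x
      by (induction n) (simp_all add: d_def del: picard.simps)
    obtain l where l: "uniform_limit ?X (\<lambda>n p. \<Sum>i<n. d i (fst p) (snd p)) l sequentially"
      using uc unfolding uniformly_convergent_on_def by blast
    have ul: "uniform_limit ?X (\<lambda>n p. ?p n (fst p) (snd p)) (\<lambda>p. ?p 0 (fst p) (snd p) + l p) sequentially"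
      by (subst tele) (intro uniform_limit_add uniform_limit_const l)
    have "U (fst p) (snd p) = ?p 0 (fst p) (snd p) + l p" if "p \<in> ?X" for p
      unfolding U_def by (rule limI[OF tendsto_uniform_limitI[OF ul that]])
    then have "uniform_limit ?X (\<lambda>n p. ?p n (fst p) (snd p)) (\<lambda>p. U (fst p) (snd p)) sequentially"
      by (intro uniform_limit_cong'[THEN iffD1, OF _ _ ul]) auto
    then show ?thesis by (simp add: case_prod_unfold del: picard.simps)
  qed
  have unifx: "uniform_limit {x0 - T..x0 + T} (\<lambda>n. ?p n z) (U z) sequentially" if "T \<ge> 0" for z T
  proof -
    have "uniform_limit {x0 - T..x0 + T} (\<lambda>n x. (\<lambda>(z, x). ?p n z x) (z, x)) (\<lambda>x. (\<lambda>(z, x). U z x) (z, x)) sequentially"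
      by (rule uniform_limit_compose'[OF unif[OF that, of "norm z"]]) (auto simp: abs_le_iff)
    then show ?thesis by simp
  qed
  have lim: "(\<lambda>n. ?p n z x) \<longlonglongrightarrow> U z x" for z x
  proof -
    have "x \<in> {x0 - \<bar>x - x0\<bar>..x0 + \<bar>x - x0\<bar>}" by (auto simp: abs_real_def)
    from tendsto_uniform_limitI[OF unifx[OF abs_ge_zero] this] show ?thesis .
  qed
  have Uc: "continuous_on UNIV (U z)" for z
  proof (rule continuous_at_imp_continuous_on, rule ballI)
    fix x
    let ?T = "\<bar>x - x0\<bar> + 1"
    have "continuous_on {x0 - ?T..x0 + ?T} (U z)"
      by (rule uniform_limit_theorem[OF _ unifx]) (auto intro!: always_eventually continuous_on_subset[OF pc])
    then show "isCont (U z) x"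
      by (rule continuous_on_interior) (auto simp: abs_real_def)
  qed
  define v where "v z x = a + (x - x0) *\<^sub>R b + prim x0 (prim x0 (?A z (U z))) x" for z x
  \<comment> \<open>Both sides are limits of the shifted iterates. Thus \<open>U\<close> satisfies
    the integral equation, and its differentiability comes from \<open>v\<close>.\<close>
  have "U z x = v z x" for z x
  proof (rule LIMSEQ_unique[OF LIMSEQ_Suc[OF lim]])
    let ?T = "\<bar>x - x0\<bar>"
    obtain K where "K > 0" and K0: "\<And>y \<zeta> (w :: complex^'m^'m). \<bar>y - x0\<bar> \<le> ?T \<Longrightarrow> norm \<zeta> \<le> norm z \<Longrightarrow>
        norm (Q y ** w - mat \<zeta> ** w) \<le> K * norm w"
      by (rule potential_bound[OF Q, where T = ?T and Z = "norm z" and ?x0.0 = x0]) blast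
    note K = K0[OF _ order_refl]
    show "(\<lambda>n. ?p (Suc n) z x) \<longlonglongrightarrow> v z x"
    proof (rule LIMSEQ_I)
      fix r :: real assume "r > 0"
      \<comment> \<open>No contraction is wanted here, so the weight exponent is 1: two integrations
        lose at most the factor exp(T), which the denominator anticipates; the 2 makes the bound
        strict.\<close>
      define \<epsilon> where "\<epsilon> = r / (2 * K * exp ?T)"
      have "\<epsilon> > 0" using \<open>r > 0\<close> \<open>K > 0\<close> by (simp add: \<epsilon>_def)
      have ul: "uniform_limit {x0 - ?T..x0 + ?T} (\<lambda>n. ?p n z) (U z) sequentially" by (rule unifx) simp
      obtain N where N: "\<And>n y. n \<ge> N \<Longrightarrow> y \<in> {x0 - ?T..x0 + ?T} \<Longrightarrow> dist (?p n z y) (U z y) < \<epsilon>"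
        using uniform_limitD[OF ul \<open>\<epsilon> > 0\<close>] unfolding eventually_sequentially by blast
      have "norm (?p (Suc n) z x - v z x) < r" if "n \<ge> N" for n
      proof -
        let ?f = "\<lambda>y. ?A z (?p n z) y - ?A z (U z) y"
        let ?F = "\<lambda>y. prim x0 (?A z (?p n z)) y - prim x0 (?A z (U z)) y"
        let ?G = "\<lambda>y. prim x0 (prim x0 (?A z (?p n z))) y - prim x0 (prim x0 (?A z (U z))) y"
        have 1: "norm (?f y) \<le> K * \<epsilon> * exp (1 * \<bar>y - x0\<bar>)" if y: "\<bar>y - x0\<bar> \<le> ?T" for y
        proof -
          have "?f y = ?A z (\<lambda>y. ?p n z y - U z y) y" by (simp add: mm.diff_right algebra_simps)
          also have "norm \<dots> \<le> K * norm (?p n z y - U z y)" by (rule K[OF y])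
          also have "\<dots> \<le> K * \<epsilon>"
            using N[OF \<open>n \<ge> N\<close>, of y] y \<open>K > 0\<close> by (intro mult_left_mono) (auto simp: dist_norm abs_le_iff)
          also have "\<dots> \<le> K * \<epsilon> * exp (1 * \<bar>y - x0\<bar>)"
            using mult_left_mono[of 1 "exp (1 * \<bar>y - x0\<bar>)" "K * \<epsilon>"] \<open>K > 0\<close> \<open>\<epsilon> > 0\<close> by simp
          finally show ?thesis .
        qed
        have 2: "norm (?F y) \<le> K * \<epsilon> / 1 * exp (1 * \<bar>y - x0\<bar>)" if y: "\<bar>y - x0\<bar> \<le> ?T" for y
          by (rule exp_weight_bound[OF _ _ _ 1 y])
            (auto intro!: has_vector_derivative_diff prim_derivative Ac pc Uc)
        have "norm (?G x) \<le> K * \<epsilon> / 1 / 1 * exp (1 * \<bar>x - x0\<bar>)"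
          by (rule exp_weight_bound[OF _ _ _ 2 order_refl])
            (auto intro!: has_vector_derivative_diff prim_derivative prim_continuous Ac pc Uc)
        also have "\<dots> = r / 2" using \<open>K > 0\<close> by (simp add: \<epsilon>_def)
        also have "\<dots> < r" using \<open>r > 0\<close> by simp
        finally show ?thesis by (simp add: v_def)
      qed
      then show "\<exists>no. \<forall>n\<ge>no. norm (?p (Suc n) z x - v z x) < r" by blast
    qed
  qed
  then have Uv: "U z = v z" for z by (simp add: fun_eq_iff)
  define U' where "U' z x = b + prim x0 (?A z (U z)) x" for z x
  have aff: "((\<lambda>x. a + (x - x0) *\<^sub>R b) has_vector_derivative b) (at x)" for x
  proof -
    have "((\<lambda>x. x - x0) has_vector_derivative 1) (at x)" by (auto intro!: derivative_eq_intros)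
    from has_vector_derivative_add[OF has_vector_derivative_const[of a]
        bounded_linear.has_vector_derivative[OF bounded_linear_scaleR_left this, of b]]
    show ?thesis by simp
  qed
  have "(v z has_vector_derivative U' z x) (at x)" for z x
    unfolding v_def[abs_def] U'_def
    by (intro has_vector_derivative_add aff prim_derivative prim_continuous Ac Uc)
  then have dU: "(U z has_vector_derivative U' z x) (at x)" for z x by (simp only: Uv)
  have dU': "(U' z has_vector_derivative ?A z (U z) x) (at x)" for z x
    unfolding U'_def[abs_def]
    by (rule has_vector_derivative_eq_rhs[OF has_vector_derivative_add[OF has_vector_derivative_const
        prim_derivative[OF Ac[OF Uc]]]]) simp
  have hol: "(\<lambda>z. U z x $ i $ j) holomorphic_on UNIV" for x i j
  proof (rule holomorphic_uniform_sequence[of UNIV "\<lambda>n z. ?p n z x $ i $ j"])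
    show "(\<lambda>z. ?p n z x $ i $ j) holomorphic_on UNIV" for n
      by (rule zpoly_holomorphic[OF picard_zpoly[OF Q]])
    have bl: "bounded_linear (\<lambda>A :: complex^'m^'m. A $ i $ j)"
      by (rule bounded_linear_compose[OF bounded_linear_vec_nth[of j] bounded_linear_vec_nth[of i]])
    fix z0 :: complex
    have "uniform_limit (cball z0 1) (\<lambda>n z. (\<lambda>(z, x). ?p n z x) (z, x)) (\<lambda>z. (\<lambda>(z, x). U z x) (z, x)) sequentially"
    proof (rule uniform_limit_compose'[OF unif[of "\<bar>x - x0\<bar>" "norm z0 + 1"]])
      have "norm z \<le> norm z0 + 1" if "z \<in> cball z0 1" for z
        using that norm_triangle_ineq2[of z z0] by (auto simp: dist_norm norm_minus_commute)
      then show "(\<lambda>z. (z, x)) \<in> cball z0 1 \<rightarrow> {(z, y). norm z \<le> norm z0 + 1 \<and> \<bar>y - x0\<bar> \<le> \<bar>x - x0\<bar>}"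
        by auto
    qed simp
    then have ul: "uniform_limit (cball z0 1) (\<lambda>n z. ?p n z x) (\<lambda>z. U z x) sequentially"
      by (simp only: prod.case)
    have "uniform_limit (cball z0 1) (\<lambda>n z. ?p n z x $ i $ j) (\<lambda>z. U z x $ i $ j) sequentially"
      by (rule bounded_linear.uniform_limit[OF bl ul])
    then show "\<exists>d>0. cball z0 d \<subseteq> UNIV \<and> uniform_limit (cball z0 d) (\<lambda>n z. ?p n z x $ i $ j) (\<lambda>z. U z x $ i $ j) sequentially"
      by (intro exI[of _ 1] conjI zero_less_one subset_UNIV)
  qed (rule open_UNIV)
  show ?thesis
  proof (rule that)
    show "matrix_sol Q z (U z) (U' z)" for z using dU dU' by (simp add: matrix_sol_def)
    show "U z x0 = a" for z by (subst Uv, simp add: v_def)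
    show "U' z x0 = b" for z by (simp add: U'_def)
  qed (rule hol)
qed

subsection \<open>Bounded holomorphic functions on the upper half-plane\<close>

text \<open>In the domain the kernel 1/(1 + w^2) has only the pole i, and 2 \<pi> i h(i) / (2 i) =
  \<pi> h(i). On the arc the integrand is O(1/R^2) against the length \<pi> R. The bound \<epsilon>
  < 1 keeps the other pole -i outside. The winding number is carried along as a factor.\<close>

lemma half_disc_cauchy:
  assumes hol: "h holomorphic_on {z. Im z > - \<epsilon>}" and "\<epsilon> > 0" "\<epsilon> < 1" and "R > 1"
    and B: "\<And>z. Im z \<ge> 0 \<Longrightarrow> norm (h z) \<le> B"
  defines "\<gamma> \<equiv> linepath (- of_real R) (of_real R) +++ part_circlepath 0 R 0 pi"
  obtains A where "of_real pi * winding_number \<gamma> \<i> * h \<i>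
      = integral {-R..R} (\<lambda>t. h (of_real t) / (1 + (of_real t)\<^sup>2)) + A"
    and "norm A \<le> B * pi * R / (R\<^sup>2 - 1)"
proof -
  let ?S = "{z. Im z > - \<epsilon>}"
  let ?g = "\<lambda>w. h w / (1 + w\<^sup>2)"
  let ?l = "linepath (- of_real R) (of_real R) :: real \<Rightarrow> complex"
  let ?a = "part_circlepath 0 R 0 pi"
  have R2: "R\<^sup>2 > 1" using \<open>R > 1\<close> by (simp add: one_less_power)
  have B0: "B \<ge> 0" by (rule order_trans[OF norm_ge_zero B[of 0]]) simp
  have pa: "path_image ?a \<subseteq> {z. norm z = R \<and> Im z \<ge> 0}"
  proof -
    have "path_image ?a = {exp (\<i> * of_real x) * R |x. 0 \<le> x \<and> x \<le> pi}"
      using \<open>R > 1\<close> by (auto simp: path_image_part_circlepath mult.commute)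
    moreover have "Im (exp (\<i> * of_real x) * of_real R) \<ge> 0" if "0 \<le> x" "x \<le> pi" for x
      using that \<open>R > 1\<close> by (simp add: Im_exp sin_ge_zero)
    moreover have "norm (exp (\<i> * of_real x) * complex_of_real R) = R" for x
      using \<open>R > 1\<close> by (simp add: norm_mult)
    ultimately show ?thesis by auto
  qed
  have pl: "path_image ?l \<subseteq> {z. Im z = 0}"
    by (auto simp: linepath_def path_image_def)
  have fin: "pathstart ?a = of_real R" "pathfinish ?a = - of_real R"
    by (simp_all add: pathstart_part_circlepath pathfinish_part_circlepath)
  have vp: "valid_path \<gamma>" unfolding \<gamma>_def using fin by (intro valid_path_join) auto
  have loop: "pathfinish \<gamma> = pathstart \<gamma>" unfolding \<gamma>_def using fin by simp
  have ni: "\<i> \<notin> path_image ?a" "\<i> \<notin> path_image ?l"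
    using pa pl \<open>R > 1\<close> by auto
  have pim: "path_image \<gamma> \<subseteq> ?S - {\<i>}"
  proof -
    have "path_image \<gamma> = path_image ?l \<union> path_image ?a"
      unfolding \<gamma>_def using fin by (intro path_image_join) auto
    then show ?thesis using pa pl ni \<open>\<epsilon> > 0\<close> by force
  qed
  have conv: "convex ?S" by (rule convex_halfspace_Im_gt)
  have op: "open ?S" by (rule open_halfspace_Im_gt)
  have "((\<lambda>w. (h w / (w + \<i>)) / (w - \<i>)) has_contour_integral
      (2 * pi * \<i> * winding_number \<gamma> \<i> * (h \<i> / (\<i> + \<i>)))) \<gamma>"
  proof (rule Cauchy_integral_formula_convex_simple[OF conv])
    have "w + \<i> \<noteq> 0" if "w \<in> ?S" for w
    proof
      assume "w + \<i> = 0"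
      then have "w = - \<i>" by (simp add: eq_neg_iff_add_eq_0)
      then show False using that \<open>\<epsilon> < 1\<close> by simp
    qed
    then show "(\<lambda>w. h w / (w + \<i>)) holomorphic_on ?S"
      by (intro holomorphic_intros hol) auto
  qed (use op vp loop pim \<open>\<epsilon> > 0\<close> in \<open>auto simp: interior_open\<close>)
  moreover have "(\<lambda>w. (h w / (w + \<i>)) / (w - \<i>)) = ?g"
    by (simp add: fun_eq_iff power2_eq_square algebra_simps)
  moreover have "2 * pi * \<i> * winding_number \<gamma> \<i> * (h \<i> / (\<i> + \<i>)) = pi * winding_number \<gamma> \<i> * h \<i>"
    by (simp add: field_simps)
  ultimately have tot: "(?g has_contour_integral (pi * winding_number \<gamma> \<i> * h \<i>)) \<gamma>" by simp
  have ne: "1 + w\<^sup>2 \<noteq> 0" if "w \<in> ?S" "w \<noteq> \<i>" for w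
  proof
    assume "1 + w\<^sup>2 = 0"
    then have "(w + \<i>) * (w - \<i>) = 0" by (simp add: algebra_simps power2_eq_square)
    then have "w = - \<i> \<or> w = \<i>" by (auto simp: eq_neg_iff_add_eq_0)
    then show False using that \<open>\<epsilon> < 1\<close> by auto
  qed
  have contg: "continuous_on (?S - {\<i>}) ?g"
    using ne by (intro continuous_intros holomorphic_on_imp_continuous_on holomorphic_on_subset[OF hol]) auto
  have int_l: "?g contour_integrable_on ?l"
    by (rule contour_integrable_continuous_linepath[OF continuous_on_subset[OF contg]])
      (use pl ni \<open>\<epsilon> > 0\<close> in \<open>force simp: path_image_linepath\<close>)
  have int_a: "?g contour_integrable_on ?a"
    by (rule contour_integrable_continuous_part_circlepath[OF continuous_on_subset[OF contg]])
      (use pa ni \<open>\<epsilon> > 0\<close> in force)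
  have sum: "pi * winding_number \<gamma> \<i> * h \<i> = contour_integral ?l ?g + contour_integral ?a ?g"
    using contour_integral_unique[OF tot] int_l int_a fin unfolding \<gamma>_def
    by (simp add: contour_integral_join)
  have L: "contour_integral ?l ?g = integral {-R..R} (\<lambda>t. h (of_real t) / (1 + (of_real t)\<^sup>2))"
  proof -
    have "contour_integral (linepath (of_real (-R)) (of_real R)) ?g
        = integral {Re (of_real (-R))..Re (of_real R)} (\<lambda>t. ?g (of_real t))"
      by (rule contour_integral_linepath_Reals_eq) (use \<open>R > 1\<close> in auto)
    then show ?thesis by simp
  qed
  have A: "norm (contour_integral ?a ?g) \<le> B / (R\<^sup>2 - 1) * R * \<bar>pi - 0\<bar>"
  proof (rule contour_integral_bound_part_circlepath[OF int_a])
    fix w assume "w \<in> path_image ?a"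
    then have w: "norm w = R" "Im w \<ge> 0" using pa by auto
    have "R\<^sup>2 - 1 \<le> norm (1 + w\<^sup>2)"
      using norm_triangle_ineq2[of "w\<^sup>2" "-1"] w by (simp add: norm_power add.commute)
    then show "norm (?g w) \<le> B / (R\<^sup>2 - 1)"
      unfolding norm_divide using B[OF w(2)] R2 B0 by (intro frac_le) auto
  qed (use B0 R2 \<open>R > 1\<close> in auto)
  show ?thesis
    by (rule that[of "contour_integral ?a ?g"]) (use sum L A in \<open>simp_all add: mult_ac\<close>)
qed

lemma has_integral_inverse_1_plus_square:
  "((\<lambda>t::real. 1 / (1 + t\<^sup>2)) has_integral (2 * arctan R)) {-R..R}" if "R > 0"
proof -
  have "((\<lambda>t::real. 1 / (1 + t\<^sup>2)) has_integral (arctan R - arctan (- R))) {-R..R}"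
    using that by (intro fundamental_theorem_of_calculus)
      (auto intro!: derivative_eq_intros simp: has_real_derivative_iff_has_vector_derivative[symmetric]
        divide_inverse)
  then show ?thesis by (simp add: arctan_minus)
qed

text \<open>Poisson estimate at i: |h(i)| is at most the mean of |h| over the boundary with weight 1
  / (\<pi> (1 + t^2)). Boundary values exist only as vertical limits, so the contour identity is
  applied to the shifts h(z + i e) and e is sent to 0 by dominated convergence. Boundedness is
  essential: exp(-i z) has modulus 1 on the real line.\<close>

lemma upper_half_plane_le_1_at_i:
  assumes hol: "h holomorphic_on {z. Im z > 0}" and B: "\<And>z. Im z > 0 \<Longrightarrow> norm (h z) \<le> B"
    and bd: "AE t in lebesgue. ((\<lambda>\<epsilon>. norm (h (Complex t \<epsilon>))) \<longlongrightarrow> 1) (at_right 0)"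
  shows "norm (h \<i>) \<le> 1"
proof -
  obtain N where N: "negligible N"
      "\<And>t. t \<notin> N \<Longrightarrow> ((\<lambda>\<epsilon>. norm (h (Complex t \<epsilon>))) \<longlongrightarrow> 1) (at_right 0)"
    using AE_E3[OF bd] by (auto simp: negligible_iff_null_sets)
  have B0: "B \<ge> 0" by (rule order_trans[OF norm_ge_zero B[of \<i>]]) simp
  let ?W = "\<lambda>R. winding_number (linepath (- of_real R) (of_real R) +++ part_circlepath 0 R 0 pi) \<i>"
  have key: "pi * norm (?W R) * norm (h \<i>) \<le> 2 * arctan R + B * pi * R / (R\<^sup>2 - 1)" if "R > 1" for R
  proof -
    \<comment> \<open>The offset 2 gives e < 1 already for n = 0, as the contour lemma
      demands.\<close>
    define e where "e n = 1 / (real n + 2)" for n :: nat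
    have e: "0 < e n" "e n < 1" for n by (auto simp: e_def)
    have e0: "e \<longlonglongrightarrow> 0" unfolding e_def by real_asymp
    have er: "filterlim e (at_right 0) sequentially"
      using e0 e(1) by (simp add: filterlim_at less_imp_neq[symmetric])
    have *: "pi * norm (?W R) * norm (h (\<i> + \<i> * e n))
        \<le> integral {-R..R} (\<lambda>t. norm (h (Complex t (e n))) / (1 + t\<^sup>2)) + B * pi * R / (R\<^sup>2 - 1)" for n
    proof -
      have hol': "(\<lambda>z. h (z + \<i> * e n)) holomorphic_on {z. Im z > - e n}"
        by (rule holomorphic_on_compose_gen[OF _ hol, unfolded o_def]) (auto intro!: holomorphic_intros)
      have b: "norm (h (z + \<i> * e n)) \<le> B" if "Im z \<ge> 0" for z
        by (rule B) (use that e[of n] in simp)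
      obtain A where A: "of_real pi * ?W R * h (\<i> + \<i> * e n)
          = integral {-R..R} (\<lambda>t. h (of_real t + \<i> * e n) / (1 + (of_real t)\<^sup>2)) + A"
          "norm A \<le> B * pi * R / (R\<^sup>2 - 1)"
        by (rule half_disc_cauchy[OF hol' e \<open>R > 1\<close> b]) auto
      have cont: "continuous_on {-R..R} (\<lambda>t. h (of_real t + \<i> * e n))"
        by (rule continuous_on_compose2[OF holomorphic_on_imp_continuous_on[OF hol']])
          (use e in \<open>auto intro!: continuous_intros\<close>)
      have ne: "1 + (complex_of_real t)\<^sup>2 \<noteq> 0" for t
      proof -
        have "Re (1 + (complex_of_real t)\<^sup>2) > 0" by (simp add: add_pos_nonneg)
        then show ?thesis by fastforce
      qed
      have ne': "1 + t\<^sup>2 \<noteq> 0" for t :: real by (simp add: add_pos_nonneg pos_add_strict less_imp_neq[symmetric])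
      have "norm (integral {-R..R} (\<lambda>t. h (of_real t + \<i> * e n) / (1 + (of_real t)\<^sup>2)))
          \<le> integral {-R..R} (\<lambda>t. norm (h (of_real t + \<i> * e n)) / (1 + t\<^sup>2))"
      proof (rule integral_norm_bound_integral)
        show "(\<lambda>t. h (of_real t + \<i> * e n) / (1 + (of_real t)\<^sup>2)) integrable_on {-R..R}"
          using ne by (intro integrable_continuous_real continuous_intros cont) auto
        show "(\<lambda>t. norm (h (of_real t + \<i> * e n)) / (1 + t\<^sup>2)) integrable_on {-R..R}"
          using ne' by (intro integrable_continuous_real continuous_intros cont) auto
        fix t
        have "1 + (complex_of_real t)\<^sup>2 = of_real (1 + t\<^sup>2)" by simp
        then have "norm (1 + (complex_of_real t)\<^sup>2) = 1 + t\<^sup>2" by (metis abs_of_nonneg add_nonneg_nonneg norm_of_real zero_le_one zero_le_power2)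
        then show "norm (h (of_real t + \<i> * e n) / (1 + (of_real t)\<^sup>2)) \<le> norm (h (of_real t + \<i> * e n)) / (1 + t\<^sup>2)"
          by (simp add: norm_divide)
      qed
      moreover have "pi * norm (?W R) * norm (h (\<i> + \<i> * e n)) = norm (of_real pi * ?W R * h (\<i> + \<i> * e n))"
        by (simp add: norm_mult)
      moreover have "of_real t + \<i> * e n = Complex t (e n)" for t by (simp add: complex_eq_iff)
      ultimately show ?thesis using A norm_triangle_ineq[of "integral {-R..R} (\<lambda>t. h (of_real t + \<i> * e n) / (1 + (of_real t)\<^sup>2))" A]
        by simp
    qed
    have lim: "(\<lambda>n. integral {-R..R} (\<lambda>t. norm (h (Complex t (e n))) / (1 + t\<^sup>2))) \<longlonglongrightarrow> 2 * arctan R"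
    proof -
      \<comment> \<open>Both integrands are set to 0 on the exceptional null set, so that
        convergence holds at every point; the integrals do not change.\<close>
      let ?f = "\<lambda>n t. if t \<in> N then 0 else norm (h (Complex t (e n))) / (1 + t\<^sup>2)"
      let ?g = "\<lambda>t::real. if t \<in> N then 0 else 1 / (1 + t\<^sup>2)"
      have int: "(\<lambda>t. norm (h (Complex t (e n))) / (1 + t\<^sup>2)) integrable_on {-R..R}" for n
      proof -
        have ne': "1 + t\<^sup>2 \<noteq> 0" for t :: real by (simp add: add_pos_nonneg pos_add_strict less_imp_neq[symmetric])
        have "continuous_on {-R..R} (\<lambda>t. h (Complex t (e n)))"
          by (rule continuous_on_compose2[OF holomorphic_on_imp_continuous_on[OF hol]])
            (use e in \<open>auto intro!: continuous_intros simp: Complex_eq\<close>)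
        then show ?thesis using ne' by (intro integrable_continuous_real continuous_intros) auto
      qed
      have "(\<lambda>n. integral {-R..R} (?f n)) \<longlonglongrightarrow> integral {-R..R} ?g"
      proof (rule dominated_convergence(2)[where h = "\<lambda>t. B / (1 + t\<^sup>2)"])
        show "?f n integrable_on {-R..R}" for n
          by (rule integrable_spike[OF int[of n] N(1)]) auto
        have "(\<lambda>t. B * (1 / (1 + t\<^sup>2))) integrable_on {-R..R}"
          using has_integral_inverse_1_plus_square[of R] \<open>R > 1\<close> by (intro integrable_on_mult_right) (auto simp: integrable_on_def)
        then show "(\<lambda>t. B / (1 + t\<^sup>2)) integrable_on {-R..R}" by simp
        show "norm (?f n t) \<le> B / (1 + t\<^sup>2)" for n t
          using B[of "Complex t (e n)"] e[of n] B0 by (auto intro!: divide_right_mono)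
        show "(\<lambda>n. ?f n t) \<longlonglongrightarrow> ?g t" for t
        proof (cases "t \<in> N")
          case False
          have "(\<lambda>n. norm (h (Complex t (e n)))) \<longlonglongrightarrow> 1"
            by (rule filterlim_compose[OF N(2)[OF False] er])
          then have "(\<lambda>n. norm (h (Complex t (e n))) / (1 + t\<^sup>2)) \<longlonglongrightarrow> 1 / (1 + t\<^sup>2)"
            by (intro tendsto_intros) (auto simp: add_pos_nonneg pos_add_strict less_imp_neq[symmetric])
          then show ?thesis using False by simp
        qed auto
      qed
      moreover have "integral {-R..R} (?f n) = integral {-R..R} (\<lambda>t. norm (h (Complex t (e n))) / (1 + t\<^sup>2))" for n
        by (rule integral_spike[OF N(1)]) auto
      moreover have "integral {-R..R} ?g = integral {-R..R} (\<lambda>t. 1 / (1 + t\<^sup>2))"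
        by (rule integral_spike[OF N(1)]) auto
      moreover have "integral {-R..R} (\<lambda>t. 1 / (1 + t\<^sup>2)) = 2 * arctan R"
        by (rule integral_unique[OF has_integral_inverse_1_plus_square]) (use \<open>R > 1\<close> in auto)
      ultimately show ?thesis by simp
    qed
    have "(\<lambda>n. h (\<i> + \<i> * e n)) \<longlonglongrightarrow> h \<i>"
    proof -
      have "isCont h \<i>"
        using hol by (intro continuous_on_interior[OF holomorphic_on_imp_continuous_on[OF hol]])
          (auto simp: interior_open open_halfspace_Im_gt)
      moreover have "(\<lambda>n. \<i> + \<i> * e n) \<longlonglongrightarrow> \<i> + \<i> * of_real 0"
        by (intro tendsto_intros e0)
      ultimately show ?thesis using isCont_tendsto_compose by fastforce
    qed
    then have "(\<lambda>n. pi * norm (?W R) * norm (h (\<i> + \<i> * e n))) \<longlonglongrightarrow> pi * norm (?W R) * norm (h \<i>)"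
      by (intro tendsto_intros)
    moreover have "(\<lambda>n. integral {-R..R} (\<lambda>t. norm (h (Complex t (e n))) / (1 + t\<^sup>2)) + B * pi * R / (R\<^sup>2 - 1))
        \<longlonglongrightarrow> 2 * arctan R + B * pi * R / (R\<^sup>2 - 1)"
      by (intro tendsto_intros lim)
    ultimately show ?thesis using * by (intro LIMSEQ_le) auto
  qed
  text \<open>Applying the Cauchy formula to the constant \<open>1\<close> shows that the winding number tends to \<open>1\<close>.\<close>
  have W: "pi * norm (?W R) \<ge> 2 * arctan R - pi * R / (R\<^sup>2 - 1)" if "R > 1" for R
  proof -
    obtain A where A: "of_real pi * ?W R * 1 = integral {-R..R} (\<lambda>t. 1 / (1 + (of_real t)\<^sup>2)) + A"
        "norm A \<le> 1 * pi * R / (R\<^sup>2 - 1)"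
      using half_disc_cauchy[of "\<lambda>_. 1" "1/2" R 1] \<open>R > 1\<close> by auto
    have "((\<lambda>t. complex_of_real (1 / (1 + t\<^sup>2))) has_integral of_real (2 * arctan R)) {-R..R}"
      using \<open>R > 1\<close> by (intro has_integral_of_real has_integral_inverse_1_plus_square) auto
    then have I: "integral {-R..R} (\<lambda>t. 1 / (1 + (complex_of_real t)\<^sup>2)) = of_real (2 * arctan R)"
      by (intro integral_unique) simp
    have "2 * arctan R \<le> norm (of_real (2 * arctan R) :: complex)" by (simp del: of_real_mult)
    also have "of_real (2 * arctan R) = of_real pi * ?W R - A" using A(1) I by simp
    also have "norm \<dots> \<le> pi * norm (?W R) + norm A"
      by (rule order_trans[OF norm_triangle_ineq4]) (simp add: norm_mult)
    finally show ?thesis using A(2) by simp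
  qed
  have "(2 * arctan R - pi * R / (R\<^sup>2 - 1)) * norm (h \<i>) \<le> 2 * arctan R + B * pi * R / (R\<^sup>2 - 1)" if "R > 1" for R
    using key[OF that] mult_right_mono[OF W[OF that], of "norm (h \<i>)"] by simp
  then have ev: "\<forall>\<^sub>F R in at_top. (2 * arctan R - pi * R / (R\<^sup>2 - 1)) * norm (h \<i>) \<le> 2 * arctan R + B * pi * R / (R\<^sup>2 - 1)"
    using eventually_gt_at_top by (rule eventually_mono[rotated]) auto
  have l1: "((\<lambda>R::real. 2 * arctan R - pi * R / (R\<^sup>2 - 1)) \<longlongrightarrow> pi) at_top" by real_asymp
  have l2: "((\<lambda>R::real. 2 * arctan R + B * pi * R / (R\<^sup>2 - 1)) \<longlongrightarrow> pi) at_top" by real_asymp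
  have "pi * norm (h \<i>) \<le> pi"
    by (rule tendsto_le[OF _ l2 tendsto_mult[OF l1 tendsto_const] ev]) simp
  then show ?thesis by simp
qed

text \<open>The exceptional set is the image of a null set under the inverse affine map. This serves
  the rescaling of the boundary as well as the reflection x \<mapsto> -x of almost everywhere
  equations.\<close>

lemma AE_lebesgue_affine:
  fixes y :: real
  assumes "AE t in lebesgue. P t" and "y \<noteq> 0"
  shows "AE t in lebesgue. P (x + y * t)"
proof -
  obtain N where N: "negligible N" "\<And>t. t \<notin> N \<Longrightarrow> P t"
    using AE_E3[OF assms(1)] by (auto simp: negligible_iff_null_sets)
  let ?N = "(\<lambda>s. (s - x) / y) ` N"
  have "negligible ?N"
    by (rule negligible_differentiable_image_negligible)
      (use N \<open>y \<noteq> 0\<close> in \<open>auto intro!: derivative_intros simp: differentiable_on_def\<close>)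
  moreover have "P (x + y * t)" if "t \<notin> ?N" for t
  proof (rule N(2), rule notI)
    assume "x + y * t \<in> N"
    then have "(x + y * t - x) / y \<in> ?N" by (rule imageI)
    then show False using that \<open>y \<noteq> 0\<close> by simp
  qed
  ultimately show ?thesis
    by (intro AE_I'[of ?N]) (auto simp: negligible_iff_null_sets)
qed

text \<open>The map w \<mapsto> Re z + w Im z preserves the half-plane, sends i to z, and takes
  vertical approach to vertical approach.\<close>

lemma upper_half_plane_le_1:
  assumes hol: "h holomorphic_on {z. Im z > 0}" and B: "\<And>z. Im z > 0 \<Longrightarrow> norm (h z) \<le> B"
    and bd: "AE t in lebesgue. ((\<lambda>\<epsilon>. norm (h (Complex t \<epsilon>))) \<longlongrightarrow> 1) (at_right 0)"
    and z: "Im z > 0"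
  shows "norm (h z) \<le> 1"
proof -
  define k where "k w = h (of_real (Re z) + of_real (Im z) * w)" for w
  have "norm (k \<i>) \<le> 1"
  proof (rule upper_half_plane_le_1_at_i)
    show "k holomorphic_on {z. Im z > 0}"
      unfolding k_def by (rule holomorphic_on_compose_gen[OF _ hol, unfolded o_def])
        (use z in \<open>auto intro!: holomorphic_intros\<close>)
    show "norm (k w) \<le> B" if "Im w > 0" for w
      unfolding k_def using B z that by simp
    have "AE t in lebesgue. ((\<lambda>\<epsilon>. norm (h (Complex (Re z + Im z * t) \<epsilon>))) \<longlongrightarrow> 1) (at_right 0)"
      using AE_lebesgue_affine[OF bd, of "Im z" "Re z"] z by simp
    then show "AE t in lebesgue. ((\<lambda>\<epsilon>. norm (k (Complex t \<epsilon>))) \<longlongrightarrow> 1) (at_right 0)"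
    proof (rule AE_mp, intro AE_I2 impI)
      fix t assume *: "((\<lambda>\<epsilon>. norm (h (Complex (Re z + Im z * t) \<epsilon>))) \<longlongrightarrow> 1) (at_right 0)"
      have "filterlim (\<lambda>\<epsilon>. Im z * \<epsilon>) (at_right 0) (at_right 0)"
        using z by real_asymp
      from filterlim_compose[OF * this]
      show "((\<lambda>\<epsilon>. norm (k (Complex t \<epsilon>))) \<longlongrightarrow> 1) (at_right 0)"
        unfolding k_def by (simp add: complex_eq_iff Complex_eq algebra_simps)
    qed
  qed
  moreover have "of_real (Re z) + of_real (Im z) * \<i> = z" by (simp add: complex_eq_iff)
  ultimately show ?thesis by (simp add: k_def)
qed

text \<open>Both exp(i f) and exp(-i f) are bounded with boundary modulus 1, so both have modulus at
  most 1, which forces Im f = 0. A real-valued holomorphic function is constant by the open mapping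
  theorem.\<close>

theorem upper_half_plane_constant:
  assumes hol: "f holomorphic_on {z. Im z > 0}" and B: "\<And>z. Im z > 0 \<Longrightarrow> \<bar>Im (f z)\<bar> \<le> B"
    and bd: "AE t in lebesgue. ((\<lambda>\<epsilon>. Im (f (Complex t \<epsilon>))) \<longlongrightarrow> 0) (at_right 0)"
    and z: "Im z > 0" and w: "Im w > 0"
  shows "f z = f w"
proof -
  have "norm (exp (c * \<i> * f z)) \<le> 1" if "Im z > 0" "c = 1 \<or> c = -1" for z c
  proof (rule upper_half_plane_le_1[OF _ _ _ that(1)])
    show "(\<lambda>z. exp (c * \<i> * f z)) holomorphic_on {z. Im z > 0}" by (intro holomorphic_intros hol)
    show "norm (exp (c * \<i> * f z)) \<le> exp B" if "Im z > 0" for z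
      using B[OF that] \<open>c = 1 \<or> c = -1\<close> by (auto simp: norm_exp_eq_Re)
    show "AE t in lebesgue. ((\<lambda>\<epsilon>. norm (exp (c * \<i> * f (Complex t \<epsilon>)))) \<longlongrightarrow> 1) (at_right 0)"
      using bd
    proof (rule AE_mp, intro AE_I2 impI)
      fix t assume "((\<lambda>\<epsilon>. Im (f (Complex t \<epsilon>))) \<longlongrightarrow> 0) (at_right 0)"
      then have "((\<lambda>\<epsilon>. exp (- Re c * Im (f (Complex t \<epsilon>)))) \<longlongrightarrow> exp (- Re c * 0)) (at_right 0)"
        by (intro tendsto_intros)
      then show "((\<lambda>\<epsilon>. norm (exp (c * \<i> * f (Complex t \<epsilon>)))) \<longlongrightarrow> 1) (at_right 0)"
        using that(2) by (auto simp: norm_exp_eq_Re)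
    qed
  qed
  from this[where c = 1] this[where c = "-1"] have Im0: "Im (f z) = 0" if "Im z > 0" for z
    using that by (force simp: norm_exp_eq_Re)
  have "f constant_on {z. Im z > 0}"
  proof (rule ccontr)
    assume "\<not> f constant_on {z. Im z > 0}"
    then have "open (f ` {z. Im z > 0})"
      using hol by (intro open_mapping_thm[where S = "{z. Im z > 0}"])
        (auto simp: open_halfspace_Im_gt convex_connected convex_halfspace_Im_gt)
    moreover have "f z \<in> f ` {z. Im z > 0}" using z by simp
    ultimately obtain e where "e > 0" "ball (f z) e \<subseteq> f ` {z. Im z > 0}"
      by (meson open_contains_ball)
    moreover have "f z + \<i> * of_real (e / 2) \<in> ball (f z) e"
      using \<open>e > 0\<close> by (simp add: dist_norm norm_mult)
    ultimately obtain w where "Im w > 0" "f w = f z + \<i> * of_real (e / 2)" by auto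
    then have "Im (f w) = e / 2" using Im0 z by simp
    then show False using Im0[OF \<open>Im w > 0\<close>] \<open>e > 0\<close> by simp
  qed
  then show ?thesis using z w by (auto simp: constant_on_def)
qed

subsection \<open>Classical solutions\<close>

definition vector_sol ::
  "(real \<Rightarrow> complex^'m^'m) \<Rightarrow> complex \<Rightarrow> (real \<Rightarrow> complex^'m) \<Rightarrow> (real \<Rightarrow> complex^'m) \<Rightarrow> bool" where
  "vector_sol Q z u u' \<longleftrightarrow> (\<forall>x. (u has_vector_derivative u' x) (at x)) \<and>
     (\<forall>x. (u' has_vector_derivative (Q x *v u x - z *s u x)) (at x))"

lemma vector_solD:
  assumes "vector_sol Q z u u'"
  shows "(u has_vector_derivative u' x) (at x)" "(u' has_vector_derivative (Q x *v u x - z *s u x)) (at x)"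
    "continuous_on S u" "continuous_on S u'"
  using assms by (auto simp: vector_sol_def
      intro!: continuous_at_imp_continuous_on intro: has_vector_derivative_continuous)

lemma matrix_solD:
  assumes "matrix_sol Q z u u'"
  shows "(u has_vector_derivative u' x) (at x)"
    "(u' has_vector_derivative (Q x ** u x - mat z ** u x)) (at x)"
    "continuous_on S u" "continuous_on S u'"
  using assms by (auto simp: matrix_sol_def
      intro!: continuous_at_imp_continuous_on intro: has_vector_derivative_continuous)

lemma matrix_sol_column:
  assumes "matrix_sol Q z u u'"
  shows "vector_sol Q z (\<lambda>x. u x *v c) (\<lambda>x. u' x *v c)"
proof -
  have "((\<lambda>x. u' x *v c) has_vector_derivative (Q x ** u x - mat z ** u x) *v c) (at x)" for x
    by (rule bounded_linear.has_vector_derivative[OF mv.bounded_linear_left matrix_solD(2)[OF assms]])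
  moreover have "(Q x ** u x - mat z ** u x) *v c = Q x *v (u x *v c) - z *s (u x *v c)" for x
    by (simp add: mv.diff_left matrix_vector_mul_assoc[symmetric] mat_mult_vec)
  ultimately show ?thesis unfolding vector_sol_def
    using bounded_linear.has_vector_derivative[OF mv.bounded_linear_left matrix_solD(1)[OF assms]] by simp
qed

lemma matrix_sol_mult:
  assumes "matrix_sol Q z u u'"
  shows "matrix_sol Q z (\<lambda>x. u x ** C) (\<lambda>x. u' x ** C)"
proof -
  have "((\<lambda>x. u' x ** C) has_vector_derivative (Q x ** u x - mat z ** u x) ** C) (at x)" for x
    by (rule bounded_linear.has_vector_derivative[OF mm.bounded_linear_left matrix_solD(2)[OF assms]])
  moreover have "(Q x ** u x - mat z ** u x) ** C = Q x ** (u x ** C) - mat z ** (u x ** C)" for x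
    by (simp add: mm.diff_left matrix_mul_assoc)
  ultimately show ?thesis unfolding matrix_sol_def
    using bounded_linear.has_vector_derivative[OF mm.bounded_linear_left matrix_solD(1)[OF assms]] by simp
qed

lemma matrix_sol_add:
  assumes "matrix_sol Q z u u'" "matrix_sol Q z v v'"
  shows "matrix_sol Q z (\<lambda>x. u x + v x) (\<lambda>x. u' x + v' x)"
proof -
  have "Q x ** (u x + v x) - mat z ** (u x + v x)
      = (Q x ** u x - mat z ** u x) + (Q x ** v x - mat z ** v x)" for x
    by (simp add: mm.add_right)
  then show ?thesis using assms by (auto simp: matrix_sol_def intro!: has_vector_derivative_add)
qed

lemma vector_sol_diff:
  assumes "vector_sol Q z u u'" "vector_sol Q z v v'"
  shows "vector_sol Q z (\<lambda>x. u x - v x) (\<lambda>x. u' x - v' x)"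
proof -
  have *: "Q x *v (u x - v x) - z *s (u x - v x) = (Q x *v u x - z *s u x) - (Q x *v v x - z *s v x)" for x
    by (simp add: mv.diff_right cs_bl.diff_right)
  show ?thesis
    unfolding vector_sol_def * by (intro conjI allI has_vector_derivative_diff vector_solD[OF assms(1)] vector_solD[OF assms(2)])
qed

lemma vector_sol_zero:
  fixes u :: "real \<Rightarrow> complex^'m"
  assumes Q: "continuous_on UNIV Q" and u: "vector_sol Q z u u'" and init: "u x0 = 0" "u' x0 = 0"
  shows "u x = 0" "u' x = 0"
proof -
  have 0: "u x = 0" for x
  proof (rule second_order_unique[where u' = u' and u'' = "\<lambda>x. Q x *v u x - z *s u x" and ?x0.0 = x0])
    fix T
    obtain M where M: "M > 0" "\<And>(A :: complex^'m^'m) w. norm (A *v w) \<le> norm A * norm w * M"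
      using mv.pos_bounded by blast
    have "bounded ((\<lambda>x. Q x - mat z) ` {x0 - T..x0 + T})"
      by (intro compact_imp_bounded compact_continuous_image continuous_on_subset[OF Q] continuous_intros) auto
    then obtain C where C: "C > 0" "\<And>y. y \<in> {x0 - T..x0 + T} \<Longrightarrow> norm (Q y - mat z) \<le> C"
      by (auto simp: bounded_pos)
    have "norm (Q x *v u x - z *s u x) \<le> C * M * norm (u x)" if "\<bar>x - x0\<bar> \<le> T" for x
    proof -
      have "norm (Q x *v u x - z *s u x) = norm ((Q x - mat z) *v u x)"
        by (simp add: mv.diff_left mat_mult_vec)
      also have "\<dots> \<le> norm (Q x - mat z) * norm (u x) * M" by (rule M)
      also have "\<dots> \<le> C * norm (u x) * M"
        using C(2)[of x] that M by (intro mult_right_mono) (auto simp: abs_le_iff)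
      finally show ?thesis by (simp add: mult_ac)
    qed
    then show "\<exists>K. \<forall>x. \<bar>x - x0\<bar> \<le> T \<longrightarrow> norm (Q x *v u x - z *s u x) \<le> K * norm (u x)" by blast
  qed (use vector_solD[OF u] init in auto)
  then show "u x = 0" .
  have "((\<lambda>x. 0 :: complex^'m) has_vector_derivative u' x) (at x)"
    using vector_solD(1)[OF u, of x] 0 by (metis (no_types, lifting) has_vector_derivative_transform_within_open UNIV_I open_UNIV)
  then show "u' x = 0" by (metis has_vector_derivative_const vector_derivative_unique_at)
qed

lemma vector_sol_unique:
  assumes Q: "continuous_on UNIV Q" and u: "vector_sol Q z u u'" and v: "vector_sol Q z v v'"
    and init: "u x0 = v x0" "u' x0 = v' x0"
  shows "u = v" "u' = v'"
  using vector_sol_zero[OF Q vector_sol_diff[OF u v], of x0] init by (auto simp: fun_eq_iff)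

lemma matrix_sol_unique:
  fixes u :: "real \<Rightarrow> complex^'m^'m"
  assumes Q: "continuous_on UNIV Q" and u: "matrix_sol Q z u u'" and v: "matrix_sol Q z v v'"
    and init: "u x0 = v x0" "u' x0 = v' x0"
  shows "u = v" "u' = v'"
proof -
  have *: "(\<lambda>x. u x *v c) = (\<lambda>x. v x *v c)" "(\<lambda>x. u' x *v c) = (\<lambda>x. v' x *v c)" for c
    using vector_sol_unique[OF Q matrix_sol_column[OF u, of c] matrix_sol_column[OF v, of c], of x0] init by auto
  show "u = v" using *(1) by (intro ext) (metis matrix_eq)
  show "u' = v'" using *(2) by (intro ext) (metis matrix_eq)
qed

lemma C1_imp_AC_loc:
  fixes f :: "real \<Rightarrow> 'a::real_normed_vector"
  assumes der: "\<And>x. (f has_vector_derivative f' x) (at x)" and cont: "continuous_on UNIV f'"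
  shows "AC_loc f"
  unfolding AC_loc_def
proof (intro allI impI)
  fix a b :: real assume "a < b"
  have "bounded (f' ` {a..b})"
    by (intro compact_imp_bounded compact_continuous_image continuous_on_subset[OF cont]) auto
  then obtain L where L: "L > 0" "\<And>y. y \<in> {a..b} \<Longrightarrow> norm (f' y) \<le> L" by (auto simp: bounded_pos)
  show "AC_on a b f"
  proof (rule lipschitz_imp_AC_on)
    fix s t assume st: "a \<le> s" "s < t" "t \<le> b"
    have "norm (f t - f s) \<le> L * t - L * s"
    proof (rule differentiable_bound_general[OF st(2)])
      show "continuous_on {s..t} f"
        by (intro continuous_at_imp_continuous_on ballI has_vector_derivative_continuous[OF der])
      show "((\<lambda>x. L * x) has_vector_derivative L) (at x)" for x
        by (auto intro!: derivative_eq_intros simp: has_real_derivative_iff_has_vector_derivative[symmetric])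
      show "norm (f' x) \<le> L" if "s < x" "x < t" for x using L st that by auto
    qed (auto intro!: continuous_intros der)
    then show "norm (f t - f s) \<le> L * (t - s)" by (simp add: algebra_simps)
  qed
qed

lemma AE_lebesgueE:
  assumes "AE x in lebesgue. P x"
  obtains N where "negligible (N :: real set)" "\<And>x. x \<notin> N \<Longrightarrow> P x"
  using AE_E3[OF assms] by (auto simp: negligible_iff_null_sets)

text \<open>An absolutely continuous u' is the integral of its almost everywhere derivative, which
  coincides almost everywhere with the continuous \<open>w\<close>. So u' is a primitive of
  \<open>w\<close> and the equation holds at every point. This removes the exceptional sets from
  solutions, since \<open>Q\<close> is continuous.\<close>

lemma AC2_classical:
  fixes u :: "real \<Rightarrow> 'a::euclidean_space"
  assumes AC: "AC2 u u' u''" and eq: "AE x in lebesgue. u'' x = w x" and w: "continuous_on UNIV w"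
  shows "(u' has_vector_derivative w x) (at x)"
proof -
  have "AE x in lebesgue. (u' has_vector_derivative u'' x) (at x)"
    using AC by (simp add: AC2_def)
  with eq have "AE x in lebesgue. (u' has_vector_derivative w x) (at x)"
    by eventually_elim simp
  then obtain N where N: "negligible N" "\<And>x. x \<notin> N \<Longrightarrow> (u' has_vector_derivative w x) (at x)"
    by (rule AE_lebesgueE) blast
  have *: "u' b - u' a = prim 0 w b - prim 0 w a" if "a < b" for a b
  proof -
    have "(w has_integral u' b - u' a) {a..b}"
      by (rule AC_fundamental_theorem_of_calculus[OF _ _ N(1)])
        (use AC that N(2) in \<open>auto simp: AC2_def AC_loc_def intro: has_vector_derivative_at_within\<close>)
    moreover have "(w has_integral prim 0 w b - prim 0 w a) {a..b}"
      by (rule fundamental_theorem_of_calculus)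
        (use that in \<open>auto intro: has_vector_derivative_at_within prim_derivative[OF w]\<close>)
    ultimately show ?thesis by (rule has_integral_unique)
  qed
  have "u' x = u' 0 + prim 0 w x" for x
  proof (cases x "0::real" rule: linorder_cases)
    case less
    from *[OF this] show ?thesis by (simp add: eq_diff_eq) (metis add.commute add_diff_cancel diff_add_cancel uminus_add_conv_diff)
  next
    case greater
    from *[OF this] show ?thesis by (simp add: diff_eq_eq add.commute)
  qed simp
  then have eq': "u' = (\<lambda>x. u' 0 + prim 0 w x)" by (rule ext)
  have "((\<lambda>x. u' 0 + prim 0 w x) has_vector_derivative 0 + w x) (at x)"
    by (intro has_vector_derivative_add has_vector_derivative_const prim_derivative w)
  then show ?thesis by (subst eq') simp
qed

lemma vec_solution_iff:
  assumes Q: "continuous_on UNIV Q"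
  shows "vec_solution Q z u \<longleftrightarrow> (\<exists>u'. vector_sol Q z u u')"
proof
  assume "vec_solution Q z u"
  then obtain u' u'' where AC: "AC2 u u' u''" and eq: "AE x in lebesgue. - u'' x + Q x *v u x = z *s u x"
    by (auto simp: vec_solution_def)
  have eq': "AE x in lebesgue. u'' x = Q x *v u x - z *s u x"
    using eq by (rule AE_mp) (auto simp: algebra_simps intro!: AE_I2)
  have "continuous_on UNIV u" using AC by (auto simp: AC2_def intro: AC_loc_imp_continuous_on)
  then have w: "continuous_on UNIV (\<lambda>x. Q x *v u x - z *s u x)"
    by (intro continuous_intros mv.continuous_on Q bounded_linear.continuous_on[OF cs_bl.bounded_linear_right])
  show "\<exists>u'. vector_sol Q z u u'"
    using AC2_classical[OF AC eq' w] AC by (auto simp: vector_sol_def AC2_def)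
next
  assume "\<exists>u'. vector_sol Q z u u'"
  then obtain u' where u: "vector_sol Q z u u'" by blast
  have w: "continuous_on UNIV (\<lambda>x. Q x *v u x - z *s u x)"
    by (intro continuous_intros mv.continuous_on Q vector_solD[OF u] bounded_linear.continuous_on[OF cs_bl.bounded_linear_right])
  have "AC2 u u' (\<lambda>x. Q x *v u x - z *s u x)"
    unfolding AC2_def
    by (auto intro!: vector_solD[OF u] C1_imp_AC_loc[OF vector_solD(1)[OF u]] C1_imp_AC_loc[OF vector_solD(2)[OF u]] w)
  then show "vec_solution Q z u" by (force simp: vec_solution_def)
qed

lemma mat_solution_iff:
  assumes Q: "continuous_on UNIV Q"
  shows "mat_solution Q z u \<longleftrightarrow> (\<exists>u'. matrix_sol Q z u u')"
proof
  assume "mat_solution Q z u"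
  then obtain u' u'' where AC: "AC2 u u' u''" and eq: "AE x in lebesgue. - u'' x + Q x ** u x = mat z ** u x"
    by (auto simp: mat_solution_def)
  have eq': "AE x in lebesgue. u'' x = Q x ** u x - mat z ** u x"
    using eq by (rule AE_mp) (auto simp: algebra_simps intro!: AE_I2)
  have "continuous_on UNIV u" using AC by (auto simp: AC2_def intro: AC_loc_imp_continuous_on)
  then have w: "continuous_on UNIV (\<lambda>x. Q x ** u x - mat z ** u x)"
    by (intro continuous_intros mm.continuous_on Q)
  show "\<exists>u'. matrix_sol Q z u u'"
    using AC2_classical[OF AC eq' w] AC by (auto simp: matrix_sol_def AC2_def)
next
  assume "\<exists>u'. matrix_sol Q z u u'"
  then obtain u' where u: "matrix_sol Q z u u'" by blast
  have w: "continuous_on UNIV (\<lambda>x. Q x ** u x - mat z ** u x)"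
    by (intro continuous_intros mm.continuous_on Q matrix_solD[OF u])
  have "AC2 u u' (\<lambda>x. Q x ** u x - mat z ** u x)"
    unfolding AC2_def
    by (auto intro!: matrix_solD[OF u] C1_imp_AC_loc[OF matrix_solD(1)[OF u]] C1_imp_AC_loc[OF matrix_solD(2)[OF u]] w)
  then show "mat_solution Q z u" by (force simp: mat_solution_def)
qed

text \<open>The description prescribes only the derivative at the single point \<open>x0\<close>;
  uniqueness of derivatives turns this into an initial condition, and the initial value problem has
  one solution.\<close>

lemma mat_solution_the:
  assumes Q: "continuous_on UNIV Q" and u: "matrix_sol Q z u u'" "u x0 = a" "u' x0 = b"
  shows "(THE \<psi>. mat_solution Q z \<psi> \<and> \<psi> x0 = a \<and> (\<psi> has_vector_derivative b) (at x0)) = u"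
proof (rule the_equality)
  show "mat_solution Q z u \<and> u x0 = a \<and> (u has_vector_derivative b) (at x0)"
    using u matrix_solD(1)[OF u(1), of x0] by (auto simp: mat_solution_iff[OF Q])
  fix \<psi> assume A: "mat_solution Q z \<psi> \<and> \<psi> x0 = a \<and> (\<psi> has_vector_derivative b) (at x0)"
  then obtain \<psi>' where \<psi>: "matrix_sol Q z \<psi> \<psi>'" by (auto simp: mat_solution_iff[OF Q])
  have "\<psi>' x0 = b" using A matrix_solD(1)[OF \<psi>, of x0] vector_derivative_unique_at by blast
  then show "\<psi> = u" using A u matrix_sol_unique(1)[OF Q \<psi> u(1), of x0] by simp
qed

lemma fundamental_system:
  fixes Q :: "real \<Rightarrow> complex^'m^'m"
  assumes Q: "continuous_on UNIV Q"
  obtains \<theta> \<theta>' \<phi> \<phi>' :: "complex \<Rightarrow> real \<Rightarrow> complex^'m^'m" where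
    "\<And>z. matrix_sol Q z (\<theta> z) (\<theta>' z)" "\<And>z. matrix_sol Q z (\<phi> z) (\<phi>' z)"
    "\<And>z. \<theta> z x0 = mat 1" "\<And>z. \<theta>' z x0 = 0" "\<And>z. \<phi> z x0 = 0" "\<And>z. \<phi>' z x0 = mat 1"
    "\<And>z x. theta1 Q z x x0 = \<theta> z x" "\<And>z x. phi1 Q z x x0 = \<phi> z x"
    "\<And>x i j. (\<lambda>z. \<theta> z x $ i $ j) holomorphic_on UNIV" "\<And>x i j. (\<lambda>z. \<phi> z x $ i $ j) holomorphic_on UNIV"
proof -
  obtain \<theta> \<theta>' :: "complex \<Rightarrow> real \<Rightarrow> complex^'m^'m" where t: "\<And>z. matrix_sol Q z (\<theta> z) (\<theta>' z)" "\<And>z. \<theta> z x0 = mat 1" "\<And>z. \<theta>' z x0 = 0"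
    "\<And>x i j. (\<lambda>z. \<theta> z x $ i $ j) holomorphic_on UNIV"
    by (rule matrix_sol_exists[OF Q, of x0 "mat 1" 0]) blast
  obtain \<phi> \<phi>' :: "complex \<Rightarrow> real \<Rightarrow> complex^'m^'m" where p: "\<And>z. matrix_sol Q z (\<phi> z) (\<phi>' z)" "\<And>z. \<phi> z x0 = 0" "\<And>z. \<phi>' z x0 = mat 1"
    "\<And>x i j. (\<lambda>z. \<phi> z x $ i $ j) holomorphic_on UNIV"
    by (rule matrix_sol_exists[OF Q, of x0 0 "mat 1"]) blast
  show ?thesis
  proof (rule that[OF t(1) p(1) t(2,3) p(2,3) _ _ t(4) p(4)])
    show "theta1 Q z x x0 = \<theta> z x" for z x
      unfolding theta1_def using mat_solution_the[OF Q t(1-3)] by simp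
    show "phi1 Q z x x0 = \<phi> z x" for z x
      unfolding phi1_def using mat_solution_the[OF Q p(1-3)] by simp
  qed
qed


subsection \<open>Square integrability at infinity\<close>

text \<open>Square integrability near plus infinity for continuous functions, expressed by bounded
  partial integrals. The start at 0 is a convention, see \<open>L2p_from\<close>. The other end is
  treated by composing with x \<mapsto> -x.\<close>

definition L2p :: "(real \<Rightarrow> complex^'m) \<Rightarrow> bool" where
  "L2p u \<longleftrightarrow> (\<exists>B. \<forall>R\<ge>0. integral {0..R} (\<lambda>x. (norm (u x))\<^sup>2) \<le> B)"

text \<open>Monotone convergence along an exhaustion by compact intervals; used for both half-lines
  and for the whole line.\<close>

lemma nested_integrable:
  fixes f :: "real \<Rightarrow> real"
  assumes f: "continuous_on UNIV f" "\<And>x. f x \<ge> 0"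
    and J: "\<And>n. a n \<ge> a (Suc n)" "\<And>n. b n \<le> b (Suc n)" "\<And>n. {a n..b n} \<subseteq> S"
      "\<And>x. x \<in> S \<Longrightarrow> \<exists>n. x \<in> {a n..b n}"
    and bd: "\<And>n :: nat. integral {a n..b n} f \<le> B"
  shows "f absolutely_integrable_on S"
proof -
  let ?f = "\<lambda>n x. if x \<in> {a n..b n} then f x else 0"
  have int: "f integrable_on {s..t}" for s t
    by (intro integrable_continuous_real continuous_on_subset[OF f(1)]) auto
  have mono: "{a m..b m} \<subseteq> {a n..b n}" if "m \<le> n" for m n
    using that
  proof (induction n rule: dec_induct)
    case (step n)
    then show ?case using J(1)[of n] J(2)[of n] by auto
  qed auto
  have "f integrable_on S"
  proof (rule conjunct1[OF monotone_convergence_increasing[of ?f]])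
    show "?f n integrable_on S" for n
      using integrable_restrict_Int[of "{a n..b n}" f S] int J(3)[of n] by (simp add: Int_absorb2)
    show "?f n x \<le> ?f (Suc n) x" for n x using J(1,2)[of n] f(2) by auto
    show "(\<lambda>n. ?f n x) \<longlonglongrightarrow> f x" if xS: "x \<in> S" for x
    proof (rule tendsto_eventually)
      obtain m where "x \<in> {a m..b m}" using J(4)[OF xS] by blast
      then have "x \<in> {a n..b n}" if "n \<ge> m" for n using mono[OF that] by blast
      then show "\<forall>\<^sub>F n in sequentially. ?f n x = f x" unfolding eventually_sequentially by auto
    qed
    have "integral S (?f n) = integral {a n..b n} f" for n
      using integral_restrict_Int[of S "{a n..b n}" f] J(3)[of n] by (simp add: Int_absorb1 Int_commute)
    moreover have "integral {a n..b n} f \<ge> 0" for n by (intro integral_nonneg int) (simp add: f)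
    ultimately show "bounded (range (\<lambda>n. integral S (?f n)))"
      using bd by (auto intro!: boundedI[of _ B])
  qed
  then show ?thesis by (rule nonnegative_absolutely_integrable_1) (use f in auto)
qed

lemma L2p_iff_top:
  fixes u :: "real \<Rightarrow> complex^'m"
  assumes u: "continuous_on UNIV u"
  shows "L2p u \<longleftrightarrow> (\<exists>a. set_integrable lebesgue {a..} (\<lambda>x. (norm (u x))\<^sup>2))"
proof
  let ?f = "\<lambda>x. (norm (u x))\<^sup>2"
  have f: "continuous_on UNIV ?f" by (intro continuous_intros u)
  assume "L2p u"
  then obtain B where B: "\<And>R. R \<ge> 0 \<Longrightarrow> integral {0..R} ?f \<le> B" by (auto simp: L2p_def)
  have "?f absolutely_integrable_on {0..}"
    by (rule nested_integrable[OF f, of "\<lambda>_. 0" real _ B]) (use B real_arch_simple in auto)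
  then show "\<exists>a. set_integrable lebesgue {a..} ?f" by blast
next
  let ?f = "\<lambda>x. (norm (u x))\<^sup>2"
  have f: "continuous_on UNIV ?f" by (intro continuous_intros u)
  have int: "?f integrable_on {s..t}" for s t
    by (intro integrable_continuous_real continuous_on_subset[OF f]) auto
  assume "\<exists>a. set_integrable lebesgue {a..} ?f"
  then obtain a where "?f absolutely_integrable_on {a..}" by blast
  then have a: "?f integrable_on {a..}" by (rule set_lebesgue_integral_eq_integral(1))
  have "integral {0..R} ?f \<le> integral {0..\<bar>a\<bar>} ?f + integral {a..} ?f" if "R \<ge> 0" for R
  proof -
    have "integral {0..R} ?f \<le> integral {0..max \<bar>a\<bar> R} ?f" by (intro integral_subset_le int) auto
    also have "\<dots> = integral {0..\<bar>a\<bar>} ?f + integral {\<bar>a\<bar>..max \<bar>a\<bar> R} ?f"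
      by (rule Henstock_Kurzweil_Integration.integral_combine[symmetric]) (auto intro: int)
    also have "integral {\<bar>a\<bar>..max \<bar>a\<bar> R} ?f \<le> integral {a..} ?f" by (intro integral_subset_le int a) auto
    finally show ?thesis by simp
  qed
  then show "L2p u" unfolding L2p_def by blast
qed

lemma L2p_iff_bot:
  fixes u :: "real \<Rightarrow> complex^'m"
  assumes u: "continuous_on UNIV u"
  shows "L2p (\<lambda>x. u (- x)) \<longleftrightarrow> (\<exists>a. set_integrable lebesgue {..a} (\<lambda>x. (norm (u x))\<^sup>2))"
proof
  let ?f = "\<lambda>x. (norm (u x))\<^sup>2"
  have f: "continuous_on UNIV ?f" by (intro continuous_intros u)
  have r: "integral {0..R} (\<lambda>x. ?f (- x)) = integral {-R..0} ?f" for R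
    using Henstock_Kurzweil_Integration.integral_reflect_real[of 0 "-R" ?f] by simp
  {
    assume "L2p (\<lambda>x. u (- x))"
    then obtain B where B: "\<And>R. R \<ge> 0 \<Longrightarrow> integral {-R..0} ?f \<le> B" by (auto simp: L2p_def r)
    have "?f absolutely_integrable_on {..0}"
    proof (rule nested_integrable[OF f, of "\<lambda>n. - real n" "\<lambda>_. 0" _ B])
      show "\<exists>n. x \<in> {- real n..0}" if "x \<in> {..0}" for x using that real_arch_simple[of "- x"] by (auto simp: minus_le_iff)
    qed (use B in auto)
    then show "\<exists>a. set_integrable lebesgue {..a} ?f" by blast
  next
    have int: "?f integrable_on {s..t}" for s t
      by (intro integrable_continuous_real continuous_on_subset[OF f]) auto
    assume "\<exists>a. set_integrable lebesgue {..a} ?f"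
    then obtain a where "?f absolutely_integrable_on {..a}" by blast
    then have a: "?f integrable_on {..a}" by (rule set_lebesgue_integral_eq_integral(1))
    have "integral {-R..0} ?f \<le> integral {..a} ?f + integral {-\<bar>a\<bar>..0} ?f" if "R \<ge> 0" for R
    proof -
      have "integral {-R..0} ?f \<le> integral {- max \<bar>a\<bar> R..0} ?f" by (intro integral_subset_le int) auto
      also have "\<dots> = integral {- max \<bar>a\<bar> R..-\<bar>a\<bar>} ?f + integral {-\<bar>a\<bar>..0} ?f"
        by (rule Henstock_Kurzweil_Integration.integral_combine[symmetric]) (auto intro: int)
      also have "integral {- max \<bar>a\<bar> R..-\<bar>a\<bar>} ?f \<le> integral {..a} ?f" by (intro integral_subset_le int a) auto
      finally show ?thesis by simp
    qed
    then show "L2p (\<lambda>x. u (- x))" unfolding L2p_def r by blast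
  }
qed

text \<open>The limit point case in the form in which it is used: square integrable columns of a
  matrix solution normalized at one point exhaust all square integrable solutions.\<close>

definition limit_point_plus :: "(real \<Rightarrow> complex^'m^'m) \<Rightarrow> bool" where
  "limit_point_plus Q \<longleftrightarrow> (\<forall>z x0 \<psi> \<psi>' u u'. Im z \<noteq> 0 \<longrightarrow> matrix_sol Q z \<psi> \<psi>' \<longrightarrow> \<psi> x0 = mat 1 \<longrightarrow>
     (\<forall>c. L2p (\<lambda>x. \<psi> x *v c)) \<longrightarrow> vector_sol Q z u u' \<longrightarrow> L2p u \<longrightarrow> (\<exists>c. u = (\<lambda>x. \<psi> x *v c)))"

text \<open>The columns of \<psi> are linearly independent because they are the unit vectors at
  \<open>x0\<close>; being m in number in a space of dimension m, they span it.\<close>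

lemma dim_eq_CARD_imp_span:
  fixes \<psi> :: "real \<Rightarrow> complex^'m^'m" and S :: "(real \<Rightarrow> complex^'m) set"
  assumes dim: "cfun.dim S = CARD('m)" and \<psi>: "\<And>c. (\<lambda>x. \<psi> x *v c) \<in> S" and "\<psi> x0 = mat 1" and "u \<in> S"
  shows "\<exists>c. u = (\<lambda>x. \<psi> x *v c)"
proof -
  obtain B where B: "B \<subseteq> S" "cfun.independent B" "S \<subseteq> cfun.span B" "card B = cfun.dim S"
    by (rule cfun.basis_exists)
  \<comment> \<open>An infinite basis would have \<open>card\<close> equal to 0, while
    \<open>CARD('m)\<close> is positive.\<close>
  have finB: "finite B" using B(4) dim by (metis card.infinite zero_less_card_finite less_irrefl)
  let ?e = "\<lambda>i :: 'm. \<lambda>x. \<psi> x *v axis i 1"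
  let ?C = "range ?e"
  have ev: "?e i x0 = axis i 1" for i by (simp add: \<open>\<psi> x0 = mat 1\<close>)
  have inj: "inj ?e"
  proof (rule injI)
    fix i j assume "?e i = ?e j"
    then have "?e i x0 = ?e j x0" by metis
    then have "(axis i 1 :: complex^'m) = axis j 1" unfolding ev .
    then show "i = j" by (metis axis_eq_axis zero_neq_one)
  qed
  have fs: "(\<Sum>a\<in>X. g a) x = (\<Sum>a\<in>X. g a x)" if "finite X" for g :: "'m \<Rightarrow> real \<Rightarrow> complex^'m" and X x
    using that by (induction X rule: finite_induct) auto
  have "cfun.independent ?C"
  proof (rule cfun.independent_if_scalars_zero)
    fix f v assume 0: "(\<Sum>x\<in>?C. (\<lambda>y. f x *s x y)) = 0" and "v \<in> ?C"
    then obtain i where i: "v = ?e i" by blast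
    have "0 = (\<Sum>x\<in>?C. (\<lambda>y. f x *s x y)) x0" using 0 by simp
    also have "\<dots> = (\<Sum>j\<in>UNIV. f (?e j) *s axis j 1)"
      by (subst sum.reindex[OF inj]) (simp add: fs ev)
    finally have "0 = (\<Sum>j\<in>UNIV. f (?e j) *s axis j 1) $ i" by (metis zero_index)
    also have "\<dots> = f (?e i)" by (simp add: axis_def if_distrib sum.delta' cong: if_cong)
    finally show "f v = 0" using i by simp
  qed simp
  have "u \<in> cfun.span ?C"
  proof (rule ccontr)
    assume nu: "u \<notin> cfun.span ?C"
    then have "cfun.independent (insert u ?C)"
      using \<open>cfun.independent ?C\<close> by (rule cfun.independent_insertI)
    moreover have "insert u ?C \<subseteq> cfun.span B" using \<psi> \<open>u \<in> S\<close> B(3) by auto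
    ultimately have "card (insert u ?C) \<le> card B" using cfun.independent_span_bound[OF finB] by blast
    moreover have "u \<notin> ?C"
    proof
      assume "u \<in> ?C"
      then have "u \<in> cfun.span ?C" by (rule cfun.span_base)
      with nu show False by simp
    qed
    then have "card (insert u ?C) = Suc CARD('m)" using inj by (simp add: card_image)
    ultimately show False using B(4) dim by simp
  qed
  moreover have "cfun.span ?C \<subseteq> {v. \<exists>c. v = (\<lambda>x. \<psi> x *v c)}"
  proof (rule cfun.span_minimal)
    show "cfun.subspace {v. \<exists>c. v = (\<lambda>x. \<psi> x *v c)}"
    proof (rule cfun.subspaceI)
      show "0 \<in> {v. \<exists>c. v = (\<lambda>x. \<psi> x *v c)}" by (auto intro!: exI[of _ 0])
      show "v + w \<in> {v. \<exists>c. v = (\<lambda>x. \<psi> x *v c)}"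
        if "v \<in> {v. \<exists>c. v = (\<lambda>x. \<psi> x *v c)}" "w \<in> {v. \<exists>c. v = (\<lambda>x. \<psi> x *v c)}" for v w
      proof -
        from that obtain c d where "v = (\<lambda>x. \<psi> x *v c)" "w = (\<lambda>x. \<psi> x *v d)" by blast
        then show ?thesis by (auto intro!: exI[of _ "c + d"] simp: fun_eq_iff mv.add_right)
      qed
      show "(\<lambda>x. a *s v x) \<in> {v. \<exists>c. v = (\<lambda>x. \<psi> x *v c)}" if "v \<in> {v. \<exists>c. v = (\<lambda>x. \<psi> x *v c)}" for a v
      proof -
        from that obtain c where "v = (\<lambda>x. \<psi> x *v c)" by blast
        then show ?thesis by (auto intro!: exI[of _ "a *s c"] simp: fun_eq_iff mv_scale)
      qed
    qed
  qed auto
  ultimately show ?thesis by blast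
qed

lemma limit_point_at_top_imp:
  assumes Q: "continuous_on UNIV Q" and "limit_point_at_top Q"
  shows "limit_point_plus Q"
  unfolding limit_point_plus_def
proof (intro allI impI)
  fix z x0 \<psi> \<psi>' u u'
  assume A: "Im z \<noteq> 0" "matrix_sol Q z \<psi> \<psi>'" "\<psi> x0 = mat 1" "\<forall>c. L2p (\<lambda>x. \<psi> x *v c)" "vector_sol Q z u u'" "L2p u"
  let ?S = "{u. vec_solution Q z u \<and> (\<exists>a. set_integrable lebesgue {a..} (\<lambda>x. (norm (u x))\<^sup>2))}"
  have *: "v \<in> ?S" if "vector_sol Q z v v'" "L2p v" for v v'
    using that L2p_iff_top[OF vector_solD(3)[OF that(1)]] by (auto simp: vec_solution_iff[OF Q])
  show "\<exists>c. u = (\<lambda>x. \<psi> x *v c)"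
  proof (rule dim_eq_CARD_imp_span[of ?S])
    show "cfun.dim ?S = CARD('a)" using assms(2) A(1) by (auto simp: limit_point_at_top_def)
    show "(\<lambda>x. \<psi> x *v c) \<in> ?S" for c using * matrix_sol_column[OF A(2)] A(4) by blast
  qed (use A * in auto)
qed

lemma reflect_has_vector_derivative:
  assumes "\<And>x. (f has_vector_derivative f' x) (at x)"
  shows "((\<lambda>x. f (- x)) has_vector_derivative - f' (- x)) (at x)"
proof -
  have "((\<lambda>x::real. - x) has_vector_derivative -1) (at x)"
    by (auto intro!: derivative_eq_intros simp: has_real_derivative_iff_has_vector_derivative[symmetric])
  from vector_diff_chain_at[OF this assms] show ?thesis by (simp add: o_def)
qed

lemma reflect_vector_sol:
  assumes "vector_sol Q z u u'"
  shows "vector_sol (\<lambda>x. Q (- x)) z (\<lambda>x. u (- x)) (\<lambda>x. - u' (- x))"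
  unfolding vector_sol_def
  using reflect_has_vector_derivative[OF vector_solD(1)[OF assms]]
    has_vector_derivative_minus[OF reflect_has_vector_derivative[OF vector_solD(2)[OF assms]]] by simp

lemma reflect_matrix_sol:
  assumes "matrix_sol Q z u u'"
  shows "matrix_sol (\<lambda>x. Q (- x)) z (\<lambda>x. u (- x)) (\<lambda>x. - u' (- x))"
  unfolding matrix_sol_def
  using reflect_has_vector_derivative[OF matrix_solD(1)[OF assms]]
    has_vector_derivative_minus[OF reflect_has_vector_derivative[OF matrix_solD(2)[OF assms]]] by simp

text \<open>Reflection carries minus infinity to plus infinity, so Weyl theory is developed at one
  end only and applied to Q(x) and to Q(-x).\<close>

lemma limit_point_at_bot_imp:
  assumes Q: "continuous_on UNIV Q" and "limit_point_at_bot Q"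
  shows "limit_point_plus (\<lambda>x. Q (- x))"
  unfolding limit_point_plus_def
proof (intro allI impI)
  fix z x0 \<psi> \<psi>' u u'
  assume A: "Im z \<noteq> 0" "matrix_sol (\<lambda>x. Q (- x)) z \<psi> \<psi>'" "\<psi> x0 = mat 1" "\<forall>c. L2p (\<lambda>x. \<psi> x *v c)"
    "vector_sol (\<lambda>x. Q (- x)) z u u'" "L2p u"
  let ?S = "{u. vec_solution Q z u \<and> (\<exists>a. set_integrable lebesgue {..a} (\<lambda>x. (norm (u x))\<^sup>2))}"
  have *: "(\<lambda>x. v (- x)) \<in> ?S" if v: "vector_sol (\<lambda>x. Q (- x)) z v v'" and "L2p v" for v v'
  proof -
    have r: "vector_sol Q z (\<lambda>x. v (- x)) (\<lambda>x. - v' (- x))" using reflect_vector_sol[OF v] by simp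
    then show ?thesis using \<open>L2p v\<close> L2p_iff_bot[OF vector_solD(3)[OF r]] by (auto simp: vec_solution_iff[OF Q])
  qed
  have "\<exists>c. (\<lambda>x. u (- x)) = (\<lambda>x. \<psi> (- x) *v c)"
  proof (rule dim_eq_CARD_imp_span[of ?S _ "- x0"])
    show "cfun.dim ?S = CARD('a)" using assms(2) A(1) by (auto simp: limit_point_at_bot_def)
    show "(\<lambda>x. \<psi> (- x) *v c) \<in> ?S" for c using *[OF matrix_sol_column[OF A(2)]] A(4) by simp
  qed (use A * in auto)
  then show "\<exists>c. u = (\<lambda>x. \<psi> x *v c)" by (metis (no_types) minus_minus ext)
qed

subsection \<open>Weyl--Titchmarsh theory at plus infinity\<close>

text \<open>Lagrange's identity; the potential cancels because it is Hermitian. The conjugate of w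
  appears since \<open>v\<close> occupies the conjugate-linear slot, so the Wronskian is constant
  when v solves the equation at the conjugate of z.\<close>

lemma wronskian_derivative:
  fixes Q :: "real \<Rightarrow> complex^'m^'m"
  assumes herm: "\<And>x. adj (Q x) = Q x" and u: "vector_sol Q z u u'" and v: "vector_sol Q w v v'"
  shows "((\<lambda>x. cip (v x) (u' x) - cip (v' x) (u x)) has_vector_derivative (cnj w - z) * cip (v x) (u x)) (at x)"
proof -
  have "((\<lambda>x. cip (v x) (u' x) - cip (v' x) (u x)) has_vector_derivative
      (cip (v x) (Q x *v u x - z *s u x) + cip (v' x) (u' x)) -
      (cip (v' x) (u' x) + cip (Q x *v v x - w *s v x) (u x))) (at x)"
    by (intro has_vector_derivative_diff cip_bl.has_vector_derivative vector_solD[OF u] vector_solD[OF v])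
  moreover have "cip (Q x *v v x) (u x) = cip (v x) (Q x *v u x)" by (simp add: cip_adj' herm)
  then have "(cip (v x) (Q x *v u x - z *s u x) + cip (v' x) (u' x)) -
      (cip (v' x) (u' x) + cip (Q x *v v x - w *s v x) (u x)) = (cnj w - z) * cip (v x) (u x)"
    by (simp add: cip_bl.diff_right cip_bl.diff_left cip_scale_left cip_scale_right algebra_simps)
  ultimately show ?thesis by simp
qed

lemma wronskian_constant:
  fixes Q :: "real \<Rightarrow> complex^'m^'m"
  assumes herm: "\<And>x. adj (Q x) = Q x" and u: "vector_sol Q z u u'" and v: "vector_sol Q (cnj z) v v'"
  shows "cip (v x) (u' x) - cip (v' x) (u x) = cip (v y) (u' y) - cip (v' y) (u y)"
  by (rule vector_derivative_zero_imp_eq) (use wronskian_derivative[OF herm u v] in simp)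

text \<open>Lagrange's identity for v = u, divided by 2 i. For nonreal z it converts boundary values
  into an L2 norm, which is the source of all positivity in Weyl theory.\<close>

lemma energy_identity:
  fixes Q :: "real \<Rightarrow> complex^'m^'m"
  assumes herm: "\<And>x. adj (Q x) = Q x" and u: "vector_sol Q z u u'" and "a \<le> b"
  shows "Im (cip (u b) (u' b)) - Im (cip (u a) (u' a)) = - Im z * integral {a..b} (\<lambda>x. (norm (u x))\<^sup>2)"
proof -
  have der: "((\<lambda>x. Im (cip (u x) (u' x))) has_vector_derivative - Im z * (norm (u x))\<^sup>2) (at x)" for x
  proof -
    have "((\<lambda>x. Im (cip (u x) (u' x))) has_vector_derivative
        Im (cip (u x) (Q x *v u x - z *s u x) + cip (u' x) (u' x))) (at x)"
      by (intro bounded_linear.has_vector_derivative[OF bounded_linear_Im] cip_bl.has_vector_derivative vector_solD[OF u])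
    moreover have "Im (cip (u x) (Q x *v u x)) = 0"
    proof -
      have "cnj (cip (u x) (Q x *v u x)) = cip (u x) (Q x *v u x)" by (simp add: cnj_cip cip_adj' herm)
      then show ?thesis by (simp add: complex_eq_iff)
    qed
    ultimately show ?thesis
      by (simp add: cip_bl.diff_right cip_scale_right cip_self del: of_real_power)
  qed
  have "((\<lambda>x. - Im z * (norm (u x))\<^sup>2) has_integral
      Im (cip (u b) (u' b)) - Im (cip (u a) (u' a))) {a..b}"
    by (rule fundamental_theorem_of_calculus[OF \<open>a \<le> b\<close>]) (rule has_vector_derivative_at_within[OF der])
  then have "integral {a..b} (\<lambda>x. - Im z * (norm (u x))\<^sup>2) = Im (cip (u b) (u' b)) - Im (cip (u a) (u' a))"
    by (rule integral_unique)
  then show ?thesis by (metis integral_mult_right)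
qed

lemma vector_sol_interval_zero:
  fixes Q :: "real \<Rightarrow> complex^'m^'m"
  assumes Q: "continuous_on UNIV Q" and u: "vector_sol Q z u u'" and "a < b"
    and 0: "integral {a..b} (\<lambda>x. (norm (u x))\<^sup>2) = 0"
  shows "u x = 0" "u' x = 0"
proof -
  have "\<forall>x\<in>{a..b}. (norm (u x))\<^sup>2 = 0"
    using 0 \<open>a < b\<close> by (subst (asm) integral_eq_0_iff) (auto intro!: continuous_intros vector_solD[OF u])
  then have z: "u x = 0" if "x \<in> {a<..<b}" for x using that by auto
  let ?c = "(a + b) / 2"
  have c: "?c \<in> {a<..<b}" using \<open>a < b\<close> by auto
  have "((\<lambda>x. 0) has_vector_derivative u' ?c) (at ?c)"
    by (rule has_vector_derivative_transform_within_open[OF vector_solD(1)[OF u] _ c]) (auto simp: z)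
  then have "u' ?c = 0" by (metis has_vector_derivative_const vector_derivative_unique_at)
  show "u x = 0" "u' x = 0" by (rule vector_sol_zero[OF Q u z[OF c] \<open>u' ?c = 0\<close>])+
qed

text \<open>A function that stays in a compact set and has only one cluster point converges. This
  produces the Weyl limit without monotonicity or nesting of discs.\<close>

lemma tendsto_at_top_cluster:
  fixes f :: "real \<Rightarrow> 'a::heine_borel"
  assumes bd: "bounded (f ` {R0..})"
    and uniq: "\<And>r l. filterlim r at_top sequentially \<Longrightarrow> (\<lambda>n. f (r n)) \<longlonglongrightarrow> l \<Longrightarrow> l = M"
  shows "(f \<longlongrightarrow> M) at_top"
proof (rule ccontr)
  assume "\<not> (f \<longlongrightarrow> M) at_top"
  then obtain e where e: "e > 0" "\<not> (\<forall>\<^sub>F x in at_top. dist (f x) M < e)" unfolding tendsto_iff by blast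
  have "\<exists>R\<ge>max R0 (real n). dist (f R) M \<ge> e" for n
    using e(2) unfolding eventually_at_top_linorder by (meson not_less)
  then obtain r where r: "\<And>n. r n \<ge> max R0 (real n)" "\<And>n. dist (f (r n)) M \<ge> e" by metis
  have lim: "filterlim r at_top sequentially"
    by (rule filterlim_at_top_mono[OF filterlim_real_sequentially]) (use r(1) in \<open>auto intro!: always_eventually\<close>)
  have "bounded (range (\<lambda>n. f (r n)))"
    by (rule bounded_subset[OF bd]) (use r(1) in auto)
  then obtain l s where s: "strict_mono (s :: nat \<Rightarrow> nat)" "((\<lambda>n. f (r n)) \<circ> s) \<longlonglongrightarrow> l"
    using bounded_imp_convergent_subsequence by blast
  have "l = M"
    using uniq[OF filterlim_compose[OF lim filterlim_subseq[OF s(1)]]] s(2) by (simp add: o_def)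
  with s(2) have "\<forall>\<^sub>F n in sequentially. dist (f (r (s n))) M < e"
    using e(1) by (auto simp: o_def tendsto_iff)
  then obtain n where "dist (f (r (s n))) M < e" by (auto simp: eventually_sequentially)
  with r(2)[of "s n"] show False by simp
qed

lemma matrix_norm_le_columns:
  fixes A :: "complex^'m^'m"
  assumes "\<And>c. norm c = 1 \<Longrightarrow> norm (A *v c) \<le> T"
  shows "norm A \<le> real CARD('m) * (real CARD('m) * T)"
proof -
  have e: "norm (A $ i $ j) \<le> T" for i j
  proof -
    have "A $ i $ j = (A *v axis j 1) $ i"
      by (simp add: matrix_vector_mult_def axis_def if_distrib sum.delta' cong: if_cong)
    also have "norm \<dots> \<le> norm (A *v axis j 1)" by (rule Finite_Cartesian_Product.norm_nth_le)
    also have "\<dots> \<le> T" by (rule assms) simp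
    finally show ?thesis .
  qed
  have "norm (A $ i) \<le> real CARD('m) * T" for i
  proof -
    have "norm (A $ i) \<le> (\<Sum>j\<in>UNIV. norm (A $ i $ j))" unfolding norm_vec_def by (rule L2_set_le_sum) simp
    also have "\<dots> \<le> (\<Sum>j\<in>(UNIV :: 'm set). T)" by (intro sum_mono e)
    finally show ?thesis by simp
  qed
  then have "(\<Sum>i\<in>UNIV. norm (A $ i)) \<le> (\<Sum>i\<in>(UNIV :: 'm set). real CARD('m) * T)" by (intro sum_mono)
  moreover have "norm A \<le> (\<Sum>i\<in>UNIV. norm (A $ i))" unfolding norm_vec_def[of A] by (rule L2_set_le_sum) simp
  ultimately show ?thesis by simp
qed

lemma L2p_from:
  fixes u :: "real \<Rightarrow> complex^'m"
  assumes u: "continuous_on UNIV u" and B: "\<And>R. R \<ge> x0 \<Longrightarrow> integral {x0..R} (\<lambda>x. (norm (u x))\<^sup>2) \<le> B"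
  shows "L2p u"
proof -
  let ?f = "\<lambda>x. (norm (u x))\<^sup>2"
  have int: "?f integrable_on {s..t}" for s t
    by (intro integrable_continuous_real continuous_intros continuous_on_subset[OF u]) auto
  have "integral {0..R} ?f \<le> integral {-\<bar>x0\<bar>..x0} ?f + B" for R
  proof -
    let ?R = "max R \<bar>x0\<bar>"
    have "integral {0..R} ?f \<le> integral {-\<bar>x0\<bar>..?R} ?f" by (intro integral_subset_le int) auto
    also have "\<dots> = integral {-\<bar>x0\<bar>..x0} ?f + integral {x0..?R} ?f"
      by (rule Henstock_Kurzweil_Integration.integral_combine[symmetric]) (auto intro: int)
    also have "integral {x0..?R} ?f \<le> B" by (intro B) auto
    finally show ?thesis by simp
  qed
  then show ?thesis unfolding L2p_def by blast
qed

section \<open>Weyl discs, the Weyl solution and the M-function\<close>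

locale weyl_plus =
  fixes Q :: "real \<Rightarrow> complex^'m^'m"
  assumes cont: "continuous_on UNIV Q" and herm: "\<And>x. adj (Q x) = Q x" and lp: "limit_point_plus Q"
begin

text \<open>A kernel vector would give a solution vanishing at both \<open>x0\<close> and
  \<open>R\<close>. For nonreal z the energy identity makes its L2 norm on the interval zero, so it
  vanishes identically.\<close>

lemma dirichlet_invertible:
  assumes \<phi>: "matrix_sol Q z \<phi> \<phi>'" "\<phi> x0 = 0" "\<phi>' x0 = mat 1" and "Im z \<noteq> 0" "R > x0"
  shows "invertible (\<phi> R)"
proof (rule invertibleI_ker)
  fix c assume c: "\<phi> R *v c = 0"
  note u = matrix_sol_column[OF \<phi>(1), of c]
  have "integral {x0..R} (\<lambda>x. (norm (\<phi> x *v c))\<^sup>2) = 0"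
    using energy_identity[OF herm u, of x0 R] c \<phi> assms(4,5) by (simp add: cip_bl.zero_left)
  from vector_sol_interval_zero(2)[OF cont u \<open>R > x0\<close> this, of x0] show "c = 0" by (simp add: \<phi>)
qed

text \<open>The matrix Weyl disc of the interval [x0, R]. The usual inequality is multiplied by (Im
  z)^2, so that one formula covers both signs of Im z.\<close>

definition admissible :: "complex \<Rightarrow> (real \<Rightarrow> complex^'m^'m) \<Rightarrow> (real \<Rightarrow> complex^'m^'m) \<Rightarrow> real \<Rightarrow> real \<Rightarrow> complex^'m^'m \<Rightarrow> bool" where
  "admissible z \<theta> \<phi> x0 R M \<longleftrightarrow>
     (\<forall>c. (Im z)\<^sup>2 * integral {x0..R} (\<lambda>x. (norm (\<theta> x *v c + \<phi> x *v (M *v c)))\<^sup>2) \<le> Im z * Im (cip c (M *v c)))"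

text \<open>The integral of |\<phi> d|^2 over [x0, x0 + 1] is at least a |d|^2 with a > 0: the unit
  sphere is compact and a nonzero solution cannot vanish on an interval. The disc inequality is
  therefore quadratic in |M c| on the left and at most linear on the right.\<close>

lemma bounded_admissible:
  assumes \<theta>: "matrix_sol Q z \<theta> \<theta>'"
    and \<phi>: "matrix_sol Q z \<phi> \<phi>'" "\<phi>' x0 = mat 1" and z: "Im z \<noteq> 0"
  shows "bounded {M. admissible z \<theta> \<phi> x0 (x0 + 1) M}"
proof -
  let ?I = "\<lambda>f. integral {x0..x0+1} (\<lambda>x. (norm (f x))\<^sup>2)"
  let ?S = "sphere (0 :: complex^'m) 1"
  have "(axis undefined 1 :: complex^'m) \<in> ?S" by simp
  then have ne: "?S \<noteq> {}" by blast
  have comp: "compact ?S" by simp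
  have icont: "continuous_on UNIV (\<lambda>d. ?I (\<lambda>x. \<chi>' x *v d))" if "continuous_on UNIV \<chi>'" for \<chi>' :: "real \<Rightarrow> complex^'m^'m"
  proof -
    have "continuous_on UNIV (\<lambda>d. integral (cbox x0 (x0+1)) (\<lambda>x. (norm (\<chi>' x *v d))\<^sup>2))"
    proof (rule integral_continuous_on_param)
      show "continuous_on (UNIV \<times> cbox x0 (x0+1)) (\<lambda>(d, x). (norm (\<chi>' x *v d))\<^sup>2)"
        unfolding case_prod_unfold
        by (intro continuous_intros mv.continuous_on continuous_on_compose2[OF that]) auto
    qed
    then show ?thesis by simp
  qed
  obtain d0 where d0: "d0 \<in> ?S" "\<And>d. d \<in> ?S \<Longrightarrow> ?I (\<lambda>x. \<phi> x *v d0) \<le> ?I (\<lambda>x. \<phi> x *v d)"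
    using continuous_attains_inf[OF comp ne continuous_on_subset[OF icont[OF matrix_solD(3)[OF \<phi>(1)]]]] by blast
  obtain c0 where c0: "c0 \<in> ?S" "\<And>d. d \<in> ?S \<Longrightarrow> ?I (\<lambda>x. \<theta> x *v d) \<le> ?I (\<lambda>x. \<theta> x *v c0)"
    using continuous_attains_sup[OF comp ne continuous_on_subset[OF icont[OF matrix_solD(3)[OF \<theta>]]]] by blast
  define a where "a = ?I (\<lambda>x. \<phi> x *v d0)"
  define b where "b = ?I (\<lambda>x. \<theta> x *v c0)"
  have cts: "continuous_on S (\<lambda>x. \<phi> x *v d)" "continuous_on S (\<lambda>x. \<theta> x *v d)" for S d
    using vector_solD(3)[OF matrix_sol_column[OF \<phi>(1)]] vector_solD(3)[OF matrix_sol_column[OF \<theta>]] by auto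
  have a0: "a > 0"
  proof -
    have "a \<ge> 0" unfolding a_def by (intro integral_nonneg integrable_continuous_real continuous_intros cts) auto
    moreover have "a \<noteq> 0"
    proof
      assume "a = 0"
      then have "\<phi>' x0 *v d0 = 0"
        using vector_sol_interval_zero(2)[OF cont matrix_sol_column[OF \<phi>(1)], of x0 "x0 + 1" d0 x0]
        unfolding a_def by simp
      then show False using d0(1) \<phi> by simp
    qed
    ultimately show ?thesis by simp
  qed
  have b0: "b \<ge> 0" unfolding b_def by (intro integral_nonneg integrable_continuous_real continuous_intros cts) auto
  have alow: "?I (\<lambda>x. \<phi> x *v d) \<ge> a * (norm d)\<^sup>2" for d
  proof (cases "d = 0")
    case False
    let ?e = "(1 / norm d) *\<^sub>R d"
    have "a \<le> ?I (\<lambda>x. \<phi> x *v ?e)" unfolding a_def by (rule d0(2)) (use False in simp)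
    also have "\<dots> = integral {x0..x0+1} (\<lambda>x. (1 / norm d)\<^sup>2 * (norm (\<phi> x *v d))\<^sup>2)"
      by (simp add: mv.scaleR_right power_mult_distrib power_divide)
    also have "\<dots> = (1 / norm d)\<^sup>2 * ?I (\<lambda>x. \<phi> x *v d)" by (rule integral_mult_right)
    finally show ?thesis using False by (simp add: field_simps power2_eq_square)
  qed simp
  define y where "y = \<bar>Im z\<bar>"
  have y0: "y > 0" "(Im z)\<^sup>2 = y * y" using z by (auto simp: y_def power2_eq_square)
  \<comment> \<open>The second entry solves a y t^2 \<le> 2 (t + y b) under t \<ge> 1; the maximum
    with 1 takes care of t \<le> 1.\<close>
  define T where "T = max 1 (2 * (1 + y * b) / (a * y))"
  have "norm M \<le> real CARD('m) * (real CARD('m) * T)" if M: "admissible z \<theta> \<phi> x0 (x0 + 1) M" for M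
  proof (rule matrix_norm_le_columns)
    fix c :: "complex^'m" assume c: "norm c = 1"
    define t where "t = norm (M *v c)"
    have "(1/2) * ?I (\<lambda>x. \<phi> x *v (M *v c)) - ?I (\<lambda>x. \<theta> x *v c)
        = integral {x0..x0+1} (\<lambda>x. (1/2) * (norm (\<phi> x *v (M *v c)))\<^sup>2 - (norm (\<theta> x *v c))\<^sup>2)"
      by (subst Henstock_Kurzweil_Integration.integral_diff)
        (auto intro!: integrable_continuous_real continuous_intros cts)
    also have "\<dots> \<le> ?I (\<lambda>x. \<theta> x *v c + \<phi> x *v (M *v c))"
    proof (rule integral_le)
      fix x
      let ?p = "\<theta> x *v c" and ?q = "\<phi> x *v (M *v c)"
      have "norm ?q \<le> norm (?p + ?q) + norm ?p" using norm_triangle_ineq4[of "?p + ?q" ?p] by simp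
      then have "(norm ?q)\<^sup>2 \<le> (norm (?p + ?q) + norm ?p)\<^sup>2" by (intro power_mono) auto
      also have "\<dots> \<le> 2 * (norm (?p + ?q))\<^sup>2 + 2 * (norm ?p)\<^sup>2"
        using sum_squares_bound[of "norm (?p + ?q)" "norm ?p"] by (simp add: power2_sum)
      finally show "(1/2) * (norm ?q)\<^sup>2 - (norm ?p)\<^sup>2 \<le> (norm (?p + ?q))\<^sup>2" by simp
    qed (auto intro!: integrable_continuous_real continuous_intros cts)
    finally have "(1/2) * ?I (\<lambda>x. \<phi> x *v (M *v c)) - ?I (\<lambda>x. \<theta> x *v c) \<le> ?I (\<lambda>x. \<theta> x *v c + \<phi> x *v (M *v c))" .
    moreover have "a * t\<^sup>2 \<le> ?I (\<lambda>x. \<phi> x *v (M *v c))" using alow unfolding t_def .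
    moreover have "?I (\<lambda>x. \<theta> x *v c) \<le> b" unfolding b_def by (rule c0(2)) (use c in simp)
    ultimately have "(1/2) * (a * t\<^sup>2) - b \<le> ?I (\<lambda>x. \<theta> x *v c + \<phi> x *v (M *v c))" by simp
    then have "y * y * ((1/2) * (a * t\<^sup>2) - b) \<le> y * y * ?I (\<lambda>x. \<theta> x *v c + \<phi> x *v (M *v c))"
      using y0 by (intro mult_left_mono) auto
    also have "\<dots> \<le> Im z * Im (cip c (M *v c))" using M unfolding admissible_def y0(2) by blast
    also have "\<dots> \<le> y * t"
    proof -
      have "\<bar>Im (cip c (M *v c))\<bar> \<le> t"
        using order_trans[OF abs_Im_le_cmod norm_cip_le[of c "M *v c"]] c by (simp add: t_def)
      then have "\<bar>Im z * Im (cip c (M *v c))\<bar> \<le> y * t" unfolding abs_mult y_def by (intro mult_left_mono) auto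
      then show ?thesis by simp
    qed
    finally have "y * ((1/2) * (a * t\<^sup>2) - b) \<le> t" using y0 by (simp add: mult.assoc)
    then have 1: "a * y * t\<^sup>2 \<le> 2 * (t + y * b)" by (simp add: algebra_simps)
    show "t \<le> T"
    proof (cases "t \<le> 1")
      case False
      then have "y * b \<le> t * (y * b)" using y0 b0 mult_right_mono[of 1 t "y * b"] by simp
      then have "a * y * t\<^sup>2 \<le> 2 * (t + t * (y * b))" using 1 by simp
      then have "t * (a * y * t) \<le> t * (2 * (1 + y * b))" by (simp add: power2_eq_square algebra_simps)
      then have "a * y * t \<le> 2 * (1 + y * b)" using False by simp
      then have "t \<le> 2 * (1 + y * b) / (a * y)" using a0 y0 by (simp add: field_simps)
      then show ?thesis by (simp add: T_def)
    qed (simp add: T_def)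
  qed
  then show ?thesis by (auto intro!: boundedI)
qed

lemma weyl_solution_unique:
  assumes z: "Im z \<noteq> 0" and \<psi>: "matrix_sol Q z \<psi> \<psi>'" "\<psi> x0 = mat 1" "\<And>c. L2p (\<lambda>x. \<psi> x *v c)"
    and u: "vector_sol Q z u u'" "L2p u"
  shows "u = (\<lambda>x. \<psi> x *v u x0)" "u' = (\<lambda>x. \<psi>' x *v u x0)"
proof -
  obtain c where c: "u = (\<lambda>x. \<psi> x *v c)" using lp z \<psi> u unfolding limit_point_plus_def by blast
  then have "u x0 = c" by (simp add: \<psi>)
  with c show 1: "u = (\<lambda>x. \<psi> x *v u x0)" by simp
  have "vector_sol Q z u (\<lambda>x. \<psi>' x *v u x0)" using matrix_sol_column[OF \<psi>(1), of "u x0"] 1 by simp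
  then have "u' x = \<psi>' x *v u x0" for x
    using vector_solD(1)[of Q z u, of _ x] u(1) vector_derivative_unique_at by blast
  then show "u' = (\<lambda>x. \<psi>' x *v u x0)" by auto
qed

text \<open>The solution \<theta> + \<phi> \<Phi>(R) is the identity at \<open>x0\<close> and 0 at
  \<open>R\<close>, so the energy identity puts \<Phi>(R) into the Weyl disc of every shorter
  interval. Hence \<Phi> stays bounded, every cluster point has square integrable columns, and the
  limit point case leaves a single cluster point.\<close>

lemma weyl_limit:
  assumes z: "Im z \<noteq> 0"
    and \<theta>: "matrix_sol Q z \<theta> \<theta>'" "\<theta> x0 = mat 1" "\<theta>' x0 = 0"
    and \<phi>: "matrix_sol Q z \<phi> \<phi>'" "\<phi> x0 = 0" "\<phi>' x0 = mat 1"
  defines "\<Phi> \<equiv> \<lambda>R. - (matrix_inv (\<phi> R) ** \<theta> R)"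
  shows "\<exists>M. (\<Phi> \<longlongrightarrow> M) at_top \<and> (\<forall>c. L2p (\<lambda>x. (\<theta> x + \<phi> x ** M) *v c)) \<and>
      (\<forall>R>x0. \<forall>c. Im z * Im (cip c (\<Phi> R *v c)) \<ge> 0) \<and> (\<forall>R>x0. \<theta> R + \<phi> R ** \<Phi> R = 0)"
proof -
  let ?\<psi> = "\<lambda>M x. \<theta> x + \<phi> x ** M"
  have sol: "matrix_sol Q z (?\<psi> M) (\<lambda>x. \<theta>' x + \<phi>' x ** M)" for M
    by (intro matrix_sol_add \<theta>(1) matrix_sol_mult[OF \<phi>(1)])
  have \<psi>c: "?\<psi> M x *v c = \<theta> x *v c + \<phi> x *v (M *v c)" for M x c
    by (simp add: mv.add_left matrix_vector_mul_assoc)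
  have en: "Im (cip (?\<psi> M R *v c) ((\<theta>' R + \<phi>' R ** M) *v c)) - Im (cip c (M *v c))
      = - Im z * integral {x0..R} (\<lambda>x. (norm (?\<psi> M x *v c))\<^sup>2)" if "R \<ge> x0" for M R c
    using energy_identity[OF herm matrix_sol_column[OF sol] that, of M c] by (simp add: \<theta> \<phi>)
  have zero: "?\<psi> (\<Phi> R) R = 0" if "R > x0" for R
    using invertible_matrix_inv(1)[OF dirichlet_invertible[OF \<phi> z that]]
    by (simp add: \<Phi>_def mm.minus_right matrix_mul_assoc)
  have enR: "Im z * integral {x0..R} (\<lambda>x. (norm (?\<psi> (\<Phi> R) x *v c))\<^sup>2) = Im (cip c (\<Phi> R *v c))" if "R > x0" for R c
    using en[of R "\<Phi> R" c] zero[OF that] that by (simp add: cip_bl.zero_left)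
  have int: "(\<lambda>x. (norm (?\<psi> M x *v c))\<^sup>2) integrable_on {s..t}" for M c s t
    by (intro integrable_continuous_real continuous_intros vector_solD(3)[OF matrix_sol_column[OF sol]])
  have adm: "admissible z \<theta> \<phi> x0 R1 (\<Phi> R)" if "R > x0" "R1 \<le> R" for R R1
    unfolding admissible_def \<psi>c[symmetric]
  proof
    fix c
    have "(Im z)\<^sup>2 * integral {x0..R1} (\<lambda>x. (norm (?\<psi> (\<Phi> R) x *v c))\<^sup>2)
        \<le> (Im z)\<^sup>2 * integral {x0..R} (\<lambda>x. (norm (?\<psi> (\<Phi> R) x *v c))\<^sup>2)"
      using that by (intro mult_left_mono integral_subset_le int) auto
    also have "\<dots> = Im z * Im (cip c (\<Phi> R *v c))" using enR[OF that(1), of c] by (simp add: power2_eq_square)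
    finally show "(Im z)\<^sup>2 * integral {x0..R1} (\<lambda>x. (norm (?\<psi> (\<Phi> R) x *v c))\<^sup>2) \<le> Im z * Im (cip c (\<Phi> R *v c))" .
  qed
  have bd: "bounded (\<Phi> ` {x0 + 1..})"
    by (rule bounded_subset[OF bounded_admissible[OF \<theta>(1) \<phi>(1,3) z]]) (use adm in auto)
  \<comment> \<open>On a fixed interval the integral depends continuously on the matrix, so the disc
    inequality passes to the limit; the resulting bound does not depend on
    \<open>R1\<close>.\<close>
  have cluster: "L2p (\<lambda>x. ?\<psi> M x *v c)"
    if r: "filterlim r at_top sequentially" and M: "(\<lambda>n. \<Phi> (r n)) \<longlonglongrightarrow> M" for r M c
  proof -
    let ?B = "Im z * Im (cip c (M *v c)) / (Im z)\<^sup>2"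
    have "integral {x0..R1} (\<lambda>x. (norm (?\<psi> M x *v c))\<^sup>2) \<le> ?B" if R1: "R1 \<ge> x0" for R1
    proof -
      have "continuous_on UNIV (\<lambda>M. integral (cbox x0 R1) (\<lambda>x. (norm (?\<psi> M x *v c))\<^sup>2))"
      proof (rule integral_continuous_on_param)
        show "continuous_on (UNIV \<times> cbox x0 R1) (\<lambda>(M, x). (norm (?\<psi> M x *v c))\<^sup>2)"
          unfolding case_prod_unfold
          by (intro continuous_intros mv.continuous_on mm.continuous_on
              continuous_on_compose2[OF matrix_solD(3)[OF \<theta>(1)]] continuous_on_compose2[OF matrix_solD(3)[OF \<phi>(1)]]) auto
      qed
      then have "isCont (\<lambda>M. integral {x0..R1} (\<lambda>x. (norm (?\<psi> M x *v c))\<^sup>2)) M"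
        by (simp add: continuous_on_eq_continuous_at)
      then have 1: "(\<lambda>n. (Im z)\<^sup>2 * integral {x0..R1} (\<lambda>x. (norm (?\<psi> (\<Phi> (r n)) x *v c))\<^sup>2))
          \<longlonglongrightarrow> (Im z)\<^sup>2 * integral {x0..R1} (\<lambda>x. (norm (?\<psi> M x *v c))\<^sup>2)"
        by (intro tendsto_intros isCont_tendsto_compose[OF _ M])
      have 2: "(\<lambda>n. Im z * Im (cip c (\<Phi> (r n) *v c))) \<longlonglongrightarrow> Im z * Im (cip c (M *v c))"
        by (intro tendsto_intros bounded_linear.tendsto[OF cip_bl.bounded_linear_right]
            bounded_linear.tendsto[OF mv.bounded_linear_left] M)
      have "\<forall>\<^sub>F n in sequentially. r n \<ge> R1 + 1" using r by (simp add: filterlim_at_top)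
      then have "\<forall>\<^sub>F n in sequentially. (Im z)\<^sup>2 * integral {x0..R1} (\<lambda>x. (norm (?\<psi> (\<Phi> (r n)) x *v c))\<^sup>2)
          \<le> Im z * Im (cip c (\<Phi> (r n) *v c))"
        using adm R1 by (auto elim!: eventually_mono simp: admissible_def \<psi>c)
      from tendsto_le[OF _ 2 1 this]
      have "(Im z)\<^sup>2 * integral {x0..R1} (\<lambda>x. (norm (?\<psi> M x *v c))\<^sup>2) \<le> Im z * Im (cip c (M *v c))" by simp
      then show ?thesis using z by (simp add: field_simps)
    qed
    then show ?thesis by (rule L2p_from[OF vector_solD(3)[OF matrix_sol_column[OF sol]]])
  qed
  have uniq: "M = M'" if L: "\<And>c. L2p (\<lambda>x. ?\<psi> M x *v c)" and L': "\<And>c. L2p (\<lambda>x. ?\<psi> M' x *v c)" for M M'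
  proof -
    have "M' *v c = M *v c" for c
    proof -
      have i: "?\<psi> M x0 = mat 1" by (simp add: \<theta> \<phi>)
      from weyl_solution_unique(2)[OF z sol i L matrix_sol_column[OF sol] L', of c]
      have "(\<theta>' x0 + \<phi>' x0 ** M') *v c = (\<theta>' x0 + \<phi>' x0 ** M) *v (?\<psi> M' x0 *v c)" by metis
      then show ?thesis by (simp add: \<theta> \<phi>)
    qed
    then show ?thesis by (metis matrix_eq)
  qed
  have "bounded (range (\<lambda>n. \<Phi> (x0 + 1 + real n)))" by (rule bounded_subset[OF bd]) auto
  then obtain M s where s: "strict_mono (s :: nat \<Rightarrow> nat)" "((\<lambda>n. \<Phi> (x0 + 1 + real n)) \<circ> s) \<longlonglongrightarrow> M"
    using bounded_imp_convergent_subsequence by blast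
  have fs: "filterlim (\<lambda>n. x0 + 1 + real (s n)) at_top sequentially"
    by (intro filterlim_tendsto_add_at_top[OF tendsto_const]
        filterlim_compose[OF filterlim_real_sequentially filterlim_subseq[OF s(1)]])
  have LM: "L2p (\<lambda>x. ?\<psi> M x *v c)" for c
    by (rule cluster[OF fs]) (use s(2) in \<open>simp add: o_def\<close>)
  have "(\<Phi> \<longlongrightarrow> M) at_top"
  proof (rule tendsto_at_top_cluster[OF bd])
    fix r l assume "filterlim r at_top sequentially" "(\<lambda>n. \<Phi> (r n)) \<longlonglongrightarrow> l"
    then show "l = M" by (intro uniq[OF _ LM] cluster)
  qed
  moreover have "Im z * Im (cip c (\<Phi> R *v c)) \<ge> 0" if "R > x0" for R c
  proof -
    have "integral {x0..R} (\<lambda>x. (norm (?\<psi> (\<Phi> R) x *v c))\<^sup>2) \<ge> 0" by (intro integral_nonneg int) auto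
    then show ?thesis unfolding enR[OF that, symmetric] by (simp add: mult.assoc[symmetric] power2_eq_square[symmetric])
  qed
  ultimately show ?thesis using LM zero by blast
qed

text \<open>Any square integrable solution normalized at \<open>x0\<close> computes the M-function
  there. This frees later arguments from the defining limit and permits a change of base
  point.\<close>

lemma M_plus_eqI:
  assumes z: "Im z \<noteq> 0" and \<psi>: "matrix_sol Q z \<psi> \<psi>'" "\<psi> x0 = mat 1" "\<And>c. L2p (\<lambda>x. \<psi> x *v c)"
  shows "M_plus Q z x0 = \<psi>' x0"
    and "((\<lambda>R. - (matrix_inv (phi1 Q z R x0) ** theta1 Q z R x0)) \<longlongrightarrow> \<psi>' x0) at_top"
proof -
  obtain \<theta> \<theta>' \<phi> \<phi>' :: "complex \<Rightarrow> real \<Rightarrow> complex^'m^'m" where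
    t: "\<And>z. matrix_sol Q z (\<theta> z) (\<theta>' z)" "\<And>z. \<theta> z x0 = mat 1" "\<And>z. \<theta>' z x0 = 0"
    and p: "\<And>z. matrix_sol Q z (\<phi> z) (\<phi>' z)" "\<And>z. \<phi> z x0 = 0" "\<And>z. \<phi>' z x0 = mat 1"
    and eq: "\<And>z x. theta1 Q z x x0 = \<theta> z x" "\<And>z x. phi1 Q z x x0 = \<phi> z x"
    by (rule fundamental_system[OF cont, of x0]) blast
  obtain M where M: "((\<lambda>R. - (matrix_inv (\<phi> z R) ** \<theta> z R)) \<longlongrightarrow> M) at_top" "\<And>c. L2p (\<lambda>x. (\<theta> z x + \<phi> z x ** M) *v c)"
    using weyl_limit[OF z t p] by blast
  have sol: "matrix_sol Q z (\<lambda>x. \<theta> z x + \<phi> z x ** M) (\<lambda>x. \<theta>' z x + \<phi>' z x ** M)"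
    by (intro matrix_sol_add t(1) matrix_sol_mult[OF p(1)])
  have "M *v c = \<psi>' x0 *v c" for c
  proof -
    from weyl_solution_unique(2)[OF z \<psi> matrix_sol_column[OF sol] M(2), of c]
    have "(\<theta>' z x0 + \<phi>' z x0 ** M) *v c = \<psi>' x0 *v ((\<theta> z x0 + \<phi> z x0 ** M) *v c)" by metis
    then show ?thesis by (simp add: t p)
  qed
  then have "M = \<psi>' x0" by (simp add: matrix_eq)
  then show 1: "((\<lambda>R. - (matrix_inv (phi1 Q z R x0) ** theta1 Q z R x0)) \<longlongrightarrow> \<psi>' x0) at_top"
    using M(1) by (simp add: eq)
  show "M_plus Q z x0 = \<psi>' x0"
    unfolding M_plus_def by (rule tendsto_Lim[OF _ 1]) simp
qed

lemma weyl_solution_exists: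
  assumes z: "Im z \<noteq> 0"
  obtains \<psi> \<psi>' where "matrix_sol Q z \<psi> \<psi>'" "\<psi> x0 = mat 1" "\<psi>' x0 = M_plus Q z x0" "\<And>c. L2p (\<lambda>x. \<psi> x *v c)"
proof -
  obtain \<theta> \<theta>' \<phi> \<phi>' :: "complex \<Rightarrow> real \<Rightarrow> complex^'m^'m" where
    t: "\<And>z. matrix_sol Q z (\<theta> z) (\<theta>' z)" "\<And>z. \<theta> z x0 = mat 1" "\<And>z. \<theta>' z x0 = 0"
    and p: "\<And>z. matrix_sol Q z (\<phi> z) (\<phi>' z)" "\<And>z. \<phi> z x0 = 0" "\<And>z. \<phi>' z x0 = mat 1"
    by (rule fundamental_system[OF cont, of x0]) blast
  obtain M where M: "\<And>c. L2p (\<lambda>x. (\<theta> z x + \<phi> z x ** M) *v c)"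
    using weyl_limit[OF z t p] by blast
  have sol: "matrix_sol Q z (\<lambda>x. \<theta> z x + \<phi> z x ** M) (\<lambda>x. \<theta>' z x + \<phi>' z x ** M)"
    by (intro matrix_sol_add t(1) matrix_sol_mult[OF p(1)])
  have i: "\<theta> z x0 + \<phi> z x0 ** M = mat 1" by (simp add: t p)
  show ?thesis using M_plus_eqI(1)[OF z sol i M] by (intro that[OF sol i _ M]) simp
qed

text \<open>A square integrable solution is determined by its value at any point, by means of the
  Weyl solution normalized there. One vanishing at x is therefore 0, also at
  \<open>x0\<close>.\<close>

lemma weyl_solution_invertible:
  assumes z: "Im z \<noteq> 0" and \<psi>: "matrix_sol Q z \<psi> \<psi>'" "\<psi> x0 = mat 1" "\<And>c. L2p (\<lambda>x. \<psi> x *v c)"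
  shows "invertible (\<psi> x)"
proof (rule invertibleI_ker)
  fix c assume c: "\<psi> x *v c = 0"
  obtain \<chi>' \<chi>'' where \<chi>: "matrix_sol Q z \<chi>' \<chi>''" "\<chi>' x = mat 1" "\<And>c. L2p (\<lambda>x. \<chi>' x *v c)"
    using weyl_solution_exists[OF z, of x] by metis
  from weyl_solution_unique(1)[OF z \<chi> matrix_sol_column[OF \<psi>(1)] \<psi>(3), of c]
  have "\<psi> x0 *v c = \<chi>' x0 *v (\<psi> x *v c)" by metis
  then show "c = 0" using c \<psi>(2) by simp
qed

lemma M_plus_eq:
  assumes z: "Im z \<noteq> 0" and \<psi>: "matrix_sol Q z \<psi> \<psi>'" "\<psi> x0 = mat 1" "\<And>c. L2p (\<lambda>x. \<psi> x *v c)"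
  shows "M_plus Q z x = \<psi>' x ** matrix_inv (\<psi> x)"
proof (rule M_plus_eqI(1)[OF z matrix_sol_mult[OF \<psi>(1)]])
  show "\<psi> x ** matrix_inv (\<psi> x) = mat 1" by (rule invertible_matrix_inv(1)[OF weyl_solution_invertible[OF z \<psi>]])
  show "L2p (\<lambda>y. (\<psi> y ** matrix_inv (\<psi> x)) *v c)" for c
    using \<psi>(3)[of "matrix_inv (\<psi> x) *v c"] by (simp add: matrix_vector_mul_assoc)
qed

text \<open>The identity holds already for the Dirichlet approximants: the Wronskian of the two
  solutions that vanish at R is 0 at R, hence also at \<open>x0\<close>, where it compares the two
  matrices.\<close>

lemma M_plus_adj:
  assumes z: "Im z \<noteq> 0"
  shows "M_plus Q (cnj z) x0 = adj (M_plus Q z x0)"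
proof -
  obtain \<theta> \<theta>' \<phi> \<phi>' :: "complex \<Rightarrow> real \<Rightarrow> complex^'m^'m" where
    t: "\<And>z. matrix_sol Q z (\<theta> z) (\<theta>' z)" "\<And>z. \<theta> z x0 = mat 1" "\<And>z. \<theta>' z x0 = 0"
    and p: "\<And>z. matrix_sol Q z (\<phi> z) (\<phi>' z)" "\<And>z. \<phi> z x0 = 0" "\<And>z. \<phi>' z x0 = mat 1"
    and eq: "\<And>z x. theta1 Q z x x0 = \<theta> z x" "\<And>z x. phi1 Q z x x0 = \<phi> z x"
    by (rule fundamental_system[OF cont, of x0]) blast
  let ?\<Phi> = "\<lambda>z R. - (matrix_inv (\<phi> z R) ** \<theta> z R)"
  have ex: "\<exists>M. (?\<Phi> w \<longlongrightarrow> M) at_top \<and> (\<forall>R>x0. \<theta> w R + \<phi> w R ** ?\<Phi> w R = 0)" if "Im w \<noteq> 0" for w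
    using weyl_limit[OF that t p] by blast
  have lim: "(?\<Phi> w \<longlongrightarrow> M_plus Q w x0) at_top" if w: "Im w \<noteq> 0" for w
  proof -
    obtain M where M: "(?\<Phi> w \<longlongrightarrow> M) at_top" using ex[OF w] by blast
    then have "M_plus Q w x0 = M" unfolding M_plus_def eq by (intro tendsto_Lim) simp_all
    with M show ?thesis by simp
  qed
  have sol: "matrix_sol Q w (\<lambda>x. \<theta> w x + \<phi> w x ** M) (\<lambda>x. \<theta>' w x + \<phi>' w x ** M)" for w M
    by (intro matrix_sol_add t(1) matrix_sol_mult[OF p(1)])
  have adj_eq: "?\<Phi> (cnj z) R = adj (?\<Phi> z R)" if R: "R > x0" for R
  proof (rule cip_nondegenerate)
    fix d c
    have zw: "\<theta> w R + \<phi> w R ** ?\<Phi> w R = 0" if "Im w \<noteq> 0" for w using ex[OF that] R by blast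
    have 0: "\<theta> z R + \<phi> z R ** ?\<Phi> z R = 0" "\<theta> (cnj z) R + \<phi> (cnj z) R ** ?\<Phi> (cnj z) R = 0"
      using zw z by simp_all
    from wronskian_constant[OF herm matrix_sol_column[OF sol[of z "?\<Phi> z R"], of c]
        matrix_sol_column[OF sol[of "cnj z" "?\<Phi> (cnj z) R"], of d], of R x0]
    have "0 = cip d (?\<Phi> z R *v c) - cip (?\<Phi> (cnj z) R *v d) c"
      by (simp add: 0 cip_bl.zero_left cip_bl.zero_right t p del: matrix_vector_mul_assoc)
    then have "cip (?\<Phi> (cnj z) R *v d) c = cip (adj (?\<Phi> z R) *v d) c" by (simp add: cip_adj)
    then show "cip c (?\<Phi> (cnj z) R *v d) = cip c (adj (?\<Phi> z R) *v d)" by (metis cnj_cip)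
  qed
  have "\<forall>\<^sub>F R in at_top. adj (?\<Phi> z R) = ?\<Phi> (cnj z) R"
    by (rule eventually_mono[OF eventually_gt_at_top[of x0]]) (rule adj_eq[symmetric])
  moreover have "((\<lambda>R. adj (?\<Phi> z R)) \<longlongrightarrow> adj (M_plus Q z x0)) at_top"
    by (intro bounded_linear.tendsto[OF bounded_linear_adj] lim z)
  ultimately have "(?\<Phi> (cnj z) \<longlongrightarrow> adj (M_plus Q z x0)) at_top" by (rule Lim_transform_eventually[rotated])
  moreover have "(?\<Phi> (cnj z) \<longlongrightarrow> M_plus Q (cnj z) x0) at_top" using z by (intro lim) simp
  ultimately show ?thesis using tendsto_unique trivial_limit_at_top_linorder by blast
qed

text \<open>The Dirichlet approximants are holomorphic in z but converge only pointwise. Their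
  quadratic forms g satisfy Im g \<ge> 0 for Im z > 0, so 1 / (g + i) is bounded by 1 and Montel's
  theorem applies. Polarization leads back to the entries.\<close>

lemma M_plus_holomorphic: "(\<lambda>z. M_plus Q z x0 $ i $ j) holomorphic_on {z. Im z > 0}"
proof -
  let ?U = "{z. Im z > 0}"
  obtain \<theta> \<theta>' \<phi> \<phi>' :: "complex \<Rightarrow> real \<Rightarrow> complex^'m^'m" where
    t: "\<And>z. matrix_sol Q z (\<theta> z) (\<theta>' z)" "\<And>z. \<theta> z x0 = mat 1" "\<And>z. \<theta>' z x0 = 0"
    and p: "\<And>z. matrix_sol Q z (\<phi> z) (\<phi>' z)" "\<And>z. \<phi> z x0 = 0" "\<And>z. \<phi>' z x0 = mat 1"
    and eq: "\<And>z x. theta1 Q z x x0 = \<theta> z x" "\<And>z x. phi1 Q z x x0 = \<phi> z x"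
    and hol: "\<And>x i j. (\<lambda>z. \<theta> z x $ i $ j) holomorphic_on UNIV" "\<And>x i j. (\<lambda>z. \<phi> z x $ i $ j) holomorphic_on UNIV"
    by (rule fundamental_system[OF cont, of x0]) blast
  define \<Phi> where "\<Phi> n z = - (matrix_inv (\<phi> z (x0 + 1 + real n)) ** \<theta> z (x0 + 1 + real n))" for n z
  have rlim: "filterlim (\<lambda>n. x0 + 1 + real n) at_top sequentially"
    by (intro filterlim_tendsto_add_at_top[OF tendsto_const] filterlim_real_sequentially)
  have lim: "(\<lambda>n. \<Phi> n z) \<longlonglongrightarrow> M_plus Q z x0" and pos: "\<And>n v. Im (cip v (\<Phi> n z *v v)) \<ge> 0" if "z \<in> ?U" for z
  proof -
    have z: "Im z \<noteq> 0" using that by simp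
    obtain M where M: "((\<lambda>R. - (matrix_inv (\<phi> z R) ** \<theta> z R)) \<longlongrightarrow> M) at_top"
      "\<And>R c. R > x0 \<Longrightarrow> Im z * Im (cip c (- (matrix_inv (\<phi> z R) ** \<theta> z R) *v c)) \<ge> 0"
      using weyl_limit[OF z t p] by blast
    have "M_plus Q z x0 = M" unfolding M_plus_def eq by (rule tendsto_Lim[OF _ M(1)]) simp
    then show "(\<lambda>n. \<Phi> n z) \<longlonglongrightarrow> M_plus Q z x0" unfolding \<Phi>_def using filterlim_compose[OF M(1) rlim] by simp
    show "Im (cip v (\<Phi> n z *v v)) \<ge> 0" for n v
      using M(2)[of "x0 + 1 + real n" v] that by (simp add: \<Phi>_def zero_le_mult_iff)
  qed
  have \<Phi>hol: "(\<lambda>z. \<Phi> n z $ i $ j) holomorphic_on ?U" for n i j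
  proof -
    have "(\<lambda>z. matrix_inv (\<phi> z (x0 + 1 + real n)) $ i $ k) holomorphic_on ?U" for k
      by (rule holomorphic_on_matrix_inv)
        (auto intro!: holomorphic_on_subset[OF hol(2)] dirichlet_invertible[OF p])
    then show ?thesis unfolding \<Phi>_def matrix_matrix_mult_def
      by (simp, intro holomorphic_intros holomorphic_on_subset[OF hol(1)]) auto
  qed
  have form: "(\<lambda>z. cip v (M_plus Q z x0 *v v)) holomorphic_on ?U" for v
  proof -
    define g where "g n z = cip v (\<Phi> n z *v v)" for n z
    define h where "h n z = 1 / (g n z + \<i>)" for n z
    have im: "Im (g n z) \<ge> 0" if "z \<in> ?U" for n z using pos[OF that] by (simp add: g_def)
    have nz: "g n z + \<i> \<noteq> 0" "norm (h n z) \<le> 1" if "z \<in> ?U" for n z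
    proof -
      have "1 \<le> Im (g n z + \<i>)" using im[OF that, of n] by simp
      also have "\<dots> \<le> norm (g n z + \<i>)" using abs_Im_le_cmod[of "g n z + \<i>"] by linarith
      finally have *: "1 \<le> norm (g n z + \<i>)" .
      then show "g n z + \<i> \<noteq> 0" by auto
      show "norm (h n z) \<le> 1" using * by (simp add: h_def norm_divide divide_le_eq)
    qed
    have ghol: "g n holomorphic_on ?U" for n
      unfolding g_def[abs_def] cip_def matrix_vector_mult_def by (simp, intro holomorphic_intros \<Phi>hol)
    have hhol: "h n holomorphic_on ?U" for n
      unfolding h_def[abs_def] using nz by (intro holomorphic_intros ghol) auto
    obtain k r where k: "k holomorphic_on ?U" "strict_mono (r :: nat \<Rightarrow> nat)"
        "\<And>x. x \<in> ?U \<Longrightarrow> (\<lambda>n. h (r n) x) \<longlonglongrightarrow> k x"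
      by (rule Montel[of ?U "range h" h]) (use hhol nz in \<open>auto simp: open_halfspace_Im_gt subset_eq intro!: exI[of _ 1]\<close>)
    define G where "G z = cip v (M_plus Q z x0 *v v)" for z
    have glim: "(\<lambda>n. g n z) \<longlonglongrightarrow> G z" if "z \<in> ?U" for z
      unfolding g_def G_def
      by (intro bounded_linear.tendsto[OF cip_bl.bounded_linear_right] bounded_linear.tendsto[OF mv.bounded_linear_left] lim that)
    have G: "G z + \<i> \<noteq> 0" "k z = 1 / (G z + \<i>)" if z: "z \<in> ?U" for z
    proof -
      have "0 \<le> Im (G z)"
        by (rule LIMSEQ_le_const[OF tendsto_Im[OF glim[OF z]]]) (use im[OF z] in auto)
      then show nz': "G z + \<i> \<noteq> 0" by (auto simp: complex_eq_iff)
      have "(\<lambda>n. h n z) \<longlonglongrightarrow> 1 / (G z + \<i>)" unfolding h_def by (intro tendsto_intros glim z nz')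
      then have "(\<lambda>n. h (r n) z) \<longlonglongrightarrow> 1 / (G z + \<i>)"
        using LIMSEQ_subseq_LIMSEQ[OF _ k(2), of "\<lambda>n. h n z"] by (simp add: o_def)
      from LIMSEQ_unique[OF k(3)[OF z] this] show "k z = 1 / (G z + \<i>)" .
    qed
    have "(\<lambda>z. 1 / k z - \<i>) holomorphic_on ?U"
      using G by (intro holomorphic_intros k(1)) auto
    then show ?thesis
      by (rule holomorphic_transform) (use G in \<open>auto simp: G_def\<close>)
  qed
  have "(\<lambda>z. (cip (axis i 1 + axis j 1) (M_plus Q z x0 *v (axis i 1 + axis j 1))
      - cip (axis i 1 - axis j 1) (M_plus Q z x0 *v (axis i 1 - axis j 1))
      - \<i> * cip (axis i 1 + \<i> *s axis j 1) (M_plus Q z x0 *v (axis i 1 + \<i> *s axis j 1))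
      + \<i> * cip (axis i 1 - \<i> *s axis j 1) (M_plus Q z x0 *v (axis i 1 - \<i> *s axis j 1))) / 4) holomorphic_on ?U"
    by (intro holomorphic_intros form) auto
  then show ?thesis
  proof (rule holomorphic_transform)
    fix z
    have "cip (axis i 1) (M_plus Q z x0 *v axis j 1) = M_plus Q z x0 $ i $ j"
      by (simp add: cip_def matrix_vector_mult_def axis_def if_distrib if_distribR sum.delta sum.delta' cong: if_cong)
    then show "(cip (axis i 1 + axis j 1) (M_plus Q z x0 *v (axis i 1 + axis j 1))
      - cip (axis i 1 - axis j 1) (M_plus Q z x0 *v (axis i 1 - axis j 1))
      - \<i> * cip (axis i 1 + \<i> *s axis j 1) (M_plus Q z x0 *v (axis i 1 + \<i> *s axis j 1))
      + \<i> * cip (axis i 1 - \<i> *s axis j 1) (M_plus Q z x0 *v (axis i 1 - \<i> *s axis j 1))) / 4 = M_plus Q z x0 $ i $ j"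
      unfolding cip_polarization[symmetric] by simp
  qed
qed

end

section \<open>Derivative of the inverse and the Riccati equation\<close>

lemma has_vector_derivative_iff_slope:
  fixes f :: "real \<Rightarrow> 'a::real_normed_vector"
  shows "(f has_vector_derivative f') (at x) \<longleftrightarrow> ((\<lambda>y. (f y - f x) /\<^sub>R (y - x)) \<longlongrightarrow> f') (at x)"
proof -
  have "(f has_vector_derivative f') (at x) \<longleftrightarrow>
      ((\<lambda>y. norm (f y - f x - (y - x) *\<^sub>R f') / norm (y - x)) \<longlongrightarrow> 0) (at x)"
    unfolding has_vector_derivative_def has_derivative_iff_norm by (simp add: bounded_linear_scaleR_left)
  also have "\<dots> \<longleftrightarrow> ((\<lambda>y. norm ((f y - f x) /\<^sub>R (y - x) - f')) \<longlongrightarrow> 0) (at x)"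
  proof (rule tendsto_cong, unfold eventually_at_filter, rule always_eventually, intro allI impI)
    fix y assume "y \<noteq> x"
    then have "(f y - f x) /\<^sub>R (y - x) - f' = (f y - f x - (y - x) *\<^sub>R f') /\<^sub>R (y - x)"
      by (simp add: scaleR_diff_right)
    then show "norm (f y - f x - (y - x) *\<^sub>R f') / norm (y - x) = norm ((f y - f x) /\<^sub>R (y - x) - f')"
      by (simp add: divide_inverse mult.commute)
  qed
  also have "\<dots> \<longleftrightarrow> ((\<lambda>y. (f y - f x) /\<^sub>R (y - x)) \<longlongrightarrow> f') (at x)"
    by (simp add: tendsto_norm_zero_iff LIM_zero_iff)
  finally show ?thesis .
qed

text \<open>Rests on the exact identity for slopes, B(y)^-1 - B(x)^-1 = - B(y)^-1 (B(y) - B(x))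
  B(x)^-1, together with continuity of the inverse.\<close>

lemma has_vector_derivative_matrix_inv:
  fixes B :: "real \<Rightarrow> complex^'m^'m"
  assumes der: "(B has_vector_derivative B') (at x)" and inv: "\<And>y. invertible (B y)" and cont: "continuous_on UNIV B"
  shows "((\<lambda>y. matrix_inv (B y)) has_vector_derivative - (matrix_inv (B x) ** B' ** matrix_inv (B x))) (at x)"
proof -
  let ?I = "\<lambda>y. matrix_inv (B y)"
  have "continuous_on UNIV ?I" by (rule continuous_on_matrix_inv[OF cont inv])
  then have "(?I \<longlongrightarrow> ?I x) (at x)" by (simp add: continuous_on_def)
  moreover have "((\<lambda>y. (B y - B x) /\<^sub>R (y - x)) \<longlongrightarrow> B') (at x)"
    using der by (simp add: has_vector_derivative_iff_slope)
  ultimately have "((\<lambda>y. - (?I y ** ((B y - B x) /\<^sub>R (y - x)) ** ?I x)) \<longlongrightarrow> - (?I x ** B' ** ?I x)) (at x)"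
    by (intro tendsto_intros mm.tendsto)
  moreover have "- (?I y ** ((B y - B x) /\<^sub>R (y - x)) ** ?I x) = (?I y - ?I x) /\<^sub>R (y - x)" for y
  proof -
    have "?I y ** (B y - B x) ** ?I x = ?I x - ?I y"
      using invertible_matrix_inv[OF inv[of x]] invertible_matrix_inv[OF inv[of y]]
      by (simp add: mm.diff_left mm.diff_right matrix_mul_assoc[symmetric])
    then show ?thesis by (simp add: mm.scaleR_left mm.scaleR_right scaleR_minus_right[symmetric] del: scaleR_minus_right)
  qed
  ultimately show ?thesis by (simp add: has_vector_derivative_iff_slope)
qed

lemma (in weyl_plus) M_plus_riccati:
  assumes z: "Im z \<noteq> 0"
  shows "((\<lambda>x. M_plus Q z x) has_vector_derivative (Q x - mat z - M_plus Q z x ** M_plus Q z x)) (at x)"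
proof -
  obtain \<psi> \<psi>' where \<psi>: "matrix_sol Q z \<psi> \<psi>'" "\<psi> 0 = mat 1" "\<And>c. L2p (\<lambda>x. \<psi> x *v c)"
    using weyl_solution_exists[OF z, of 0] by metis
  have M: "M_plus Q z x = \<psi>' x ** matrix_inv (\<psi> x)" for x by (rule M_plus_eq[OF z \<psi>])
  have inv: "invertible (\<psi> x)" for x by (rule weyl_solution_invertible[OF z \<psi>])
  let ?I = "matrix_inv (\<psi> x)"
  have "((\<lambda>x. \<psi>' x ** matrix_inv (\<psi> x)) has_vector_derivative
      \<psi>' x ** (- (?I ** \<psi>' x ** ?I)) + (Q x ** \<psi> x - mat z ** \<psi> x) ** ?I) (at x)"
    by (intro mm.has_vector_derivative matrix_solD[OF \<psi>(1)] has_vector_derivative_matrix_inv inv)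
  moreover have "\<psi>' x ** (- (?I ** \<psi>' x ** ?I)) + (Q x ** \<psi> x - mat z ** \<psi> x) ** ?I
      = Q x - mat z - M_plus Q z x ** M_plus Q z x"
    using invertible_matrix_inv(1)[OF inv[of x]]
    by (simp add: M mm.minus_right mm.diff_left matrix_mul_assoc[symmetric])
  ultimately show ?thesis by (simp add: M)
qed

subsection \<open>Square integrable functions\<close>

definition ip :: "(real \<Rightarrow> complex^'m) \<Rightarrow> (real \<Rightarrow> complex^'m) \<Rightarrow> complex" where
  "ip f g = (LINT x|lebesgue. cip (f x) (g x))"

lemma measurable_cip:
  fixes f g :: "'a \<Rightarrow> complex^'m"
  assumes "f \<in> borel_measurable M" "g \<in> borel_measurable M"
  shows "(\<lambda>x. cip (f x) (g x)) \<in> borel_measurable M"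
proof -
  have nth: "(\<lambda>x. h x $ i) \<in> borel_measurable M" if "h \<in> borel_measurable M" for h :: "'a \<Rightarrow> complex^'m" and i
    by (rule measurable_compose[OF that borel_measurable_continuous_onI]) (intro continuous_intros)
  have cnj: "(\<lambda>x. cnj (h x)) \<in> borel_measurable M" if "h \<in> borel_measurable M" for h
    by (rule measurable_compose[OF that borel_measurable_continuous_onI]) (intro continuous_intros)
  show ?thesis unfolding cip_def by (intro borel_measurable_sum borel_measurable_times cnj nth assms)
qed

lemma in_L2_cip_integrable:
  fixes f g :: "real \<Rightarrow> complex^'m"
  assumes "in_L2 f" "in_L2 g"
  shows "integrable lebesgue (\<lambda>x. cip (f x) (g x))"
proof (rule Bochner_Integration.integrable_bound)
  show "integrable lebesgue (\<lambda>x. (norm (f x))\<^sup>2 + (norm (g x))\<^sup>2)"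
    using assms by (auto simp: in_L2_def)
  show "(\<lambda>x. cip (f x) (g x)) \<in> borel_measurable lebesgue"
    using assms by (intro measurable_cip) (auto simp: in_L2_def)
  have "norm (cip (f x) (g x)) \<le> norm ((norm (f x))\<^sup>2 + (norm (g x))\<^sup>2)" for x
  proof -
    have "2 * (norm (f x) * norm (g x)) \<le> (norm (f x))\<^sup>2 + (norm (g x))\<^sup>2"
      using sum_squares_bound[of "norm (f x)" "norm (g x)"] by (simp add: mult.assoc)
    moreover have "0 \<le> norm (f x) * norm (g x)" by simp
    ultimately have "norm (f x) * norm (g x) \<le> (norm (f x))\<^sup>2 + (norm (g x))\<^sup>2" by linarith
    then show ?thesis using norm_cip_le[of "f x" "g x"] by simp
  qed
  then show "AE x in lebesgue. norm (cip (f x) (g x)) \<le> norm ((norm (f x))\<^sup>2 + (norm (g x))\<^sup>2)" by simp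
qed

lemma in_L2_add:
  fixes f g :: "real \<Rightarrow> complex^'m"
  assumes "in_L2 f" "in_L2 g"
  shows "in_L2 (\<lambda>x. f x + g x)"
  unfolding in_L2_def
proof
  show m: "(\<lambda>x. f x + g x) \<in> borel_measurable lebesgue" using assms by (auto simp: in_L2_def)
  show "integrable lebesgue (\<lambda>x. (norm (f x + g x))\<^sup>2)"
  proof (rule Bochner_Integration.integrable_bound)
    show "integrable lebesgue (\<lambda>x. 2 * (norm (f x))\<^sup>2 + 2 * (norm (g x))\<^sup>2)"
      using assms by (auto simp: in_L2_def)
    show "(\<lambda>x. (norm (f x + g x))\<^sup>2) \<in> borel_measurable lebesgue" using m by measurable
    have "norm ((norm (f x + g x))\<^sup>2) \<le> norm (2 * (norm (f x))\<^sup>2 + 2 * (norm (g x))\<^sup>2)" for x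
    proof -
      have "(norm (f x + g x))\<^sup>2 \<le> (norm (f x) + norm (g x))\<^sup>2" by (intro power_mono norm_triangle_ineq) simp
      also have "\<dots> \<le> 2 * (norm (f x))\<^sup>2 + 2 * (norm (g x))\<^sup>2"
        using sum_squares_bound[of "norm (f x)" "norm (g x)"] by (simp add: power2_sum)
      finally show ?thesis by simp
    qed
    then show "AE x in lebesgue. norm ((norm (f x + g x))\<^sup>2) \<le> norm (2 * (norm (f x))\<^sup>2 + 2 * (norm (g x))\<^sup>2)" by simp
  qed
qed

lemma norm_scale: "norm (c *s v) = norm c * norm (v :: complex^'m)"
  by (simp add: norm_vec_def L2_set_def norm_mult power_mult_distrib real_sqrt_mult flip: sum_distrib_left)

lemma in_L2_scale:
  fixes f :: "real \<Rightarrow> complex^'m"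
  assumes "in_L2 f"
  shows "in_L2 (\<lambda>x. c *s f x)"
proof -
  have "(\<lambda>x. c *s f x) \<in> borel_measurable lebesgue"
    by (rule measurable_compose[of f lebesgue borel, OF _ borel_measurable_continuous_onI])
      (use assms in \<open>auto simp: in_L2_def intro!: bounded_linear.continuous_on[OF cs_bl.bounded_linear_right] continuous_intros\<close>)
  then show ?thesis using assms by (simp add: in_L2_def norm_scale power_mult_distrib)
qed

lemma in_L2_diff:
  fixes f g :: "real \<Rightarrow> complex^'m"
  assumes "in_L2 f" "in_L2 g"
  shows "in_L2 (\<lambda>x. f x - g x)"
  using in_L2_add[OF assms(1) in_L2_scale[OF assms(2), of "-1"]] by simp

lemma ip_diff_right: "in_L2 f \<Longrightarrow> in_L2 g \<Longrightarrow> in_L2 h \<Longrightarrow> ip f (\<lambda>x. g x - h x) = ip f g - ip f h"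
  by (simp add: ip_def cip_bl.diff_right in_L2_cip_integrable)

lemma ip_add_right: "in_L2 f \<Longrightarrow> in_L2 g \<Longrightarrow> in_L2 h \<Longrightarrow> ip f (\<lambda>x. g x + h x) = ip f g + ip f h"
  by (simp add: ip_def cip_bl.add_right in_L2_cip_integrable)

lemma ip_diff_left: "in_L2 f \<Longrightarrow> in_L2 g \<Longrightarrow> in_L2 h \<Longrightarrow> ip (\<lambda>x. g x - h x) f = ip g f - ip h f"
  by (simp add: ip_def cip_bl.diff_left in_L2_cip_integrable)

lemma ip_add_left: "in_L2 f \<Longrightarrow> in_L2 g \<Longrightarrow> in_L2 h \<Longrightarrow> ip (\<lambda>x. g x + h x) f = ip g f + ip h f"
  by (simp add: ip_def cip_bl.add_left in_L2_cip_integrable)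

lemma ip_scale_right: "ip f (\<lambda>x. c *s g x) = c * ip f g"
  by (simp add: ip_def cip_scale_right)

lemma ip_scale_left: "ip (\<lambda>x. c *s f x) g = cnj c * ip f g"
  by (simp add: ip_def cip_scale_left)

lemma cnj_ip: "cnj (ip f g) = ip g f"
  by (simp add: ip_def cnj_cip flip: Bochner_Integration.integral_cnj)

lemma L2_norm_power2: "(L2_norm f)\<^sup>2 = (LINT x|lebesgue. (norm (f x))\<^sup>2)"
  by (simp add: L2_norm_def integral_nonneg_AE)

lemma L2_norm_nonneg: "L2_norm f \<ge> 0"
  by (simp add: L2_norm_def integral_nonneg_AE)

lemma ip_self: "ip f f = of_real ((L2_norm f)\<^sup>2)"
  unfolding L2_norm_power2 ip_def cip_self by (rule integral_complex_of_real)

lemma L2_norm_scale: "L2_norm (\<lambda>x. c *s f x) = norm c * L2_norm f"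
  by (simp add: L2_norm_def norm_scale power_mult_distrib real_sqrt_mult)

text \<open>Integrating 2 |<f(x), g(x)>| \<le> t |f(x)|^2 + |g(x)|^2 / t leaves t free. It is sent
  to infinity or to 0 when a norm vanishes, which for functions, as opposed to classes, does not
  mean that the function is 0; otherwise t is the quotient of the norms.\<close>

lemma ip_Cauchy_Schwarz:
  fixes f g :: "real \<Rightarrow> complex^'m"
  assumes f: "in_L2 f" and g: "in_L2 g"
  shows "norm (ip f g) \<le> L2_norm f * L2_norm g"
proof -
  let ?a = "L2_norm f" and ?b = "L2_norm g" and ?p = "norm (ip f g)"
  have int: "integrable lebesgue (\<lambda>x. (norm (f x))\<^sup>2)" "integrable lebesgue (\<lambda>x. (norm (g x))\<^sup>2)"
    using f g by (auto simp: in_L2_def)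
  have key: "2 * ?p \<le> t * ?a\<^sup>2 + ?b\<^sup>2 / t" if "t > 0" for t
  proof -
    have "2 * ?p \<le> 2 * (LINT x|lebesgue. norm (cip (f x) (g x)))"
      unfolding ip_def by (intro mult_left_mono integral_norm_bound) auto
    also have "\<dots> = (LINT x|lebesgue. 2 * norm (cip (f x) (g x)))" by simp
    also have "\<dots> \<le> (LINT x|lebesgue. t * (norm (f x))\<^sup>2 + (norm (g x))\<^sup>2 / t)"
    proof (rule integral_mono)
      show "integrable lebesgue (\<lambda>x. 2 * norm (cip (f x) (g x)))"
        by (intro integrable_mult_right integrable_norm in_L2_cip_integrable f g)
      show "integrable lebesgue (\<lambda>x. t * (norm (f x))\<^sup>2 + (norm (g x))\<^sup>2 / t)" using int by auto
      fix x
      have "0 \<le> (t * norm (f x) - norm (g x))\<^sup>2 / t" using that by simp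
      also have "\<dots> = t * (norm (f x))\<^sup>2 + (norm (g x))\<^sup>2 / t - 2 * (norm (f x) * norm (g x))"
        using that by (simp add: field_simps power2_eq_square)
      finally show "2 * norm (cip (f x) (g x)) \<le> t * (norm (f x))\<^sup>2 + (norm (g x))\<^sup>2 / t"
        using norm_cip_le[of "f x" "g x"] by simp
    qed
    also have "\<dots> = t * ?a\<^sup>2 + ?b\<^sup>2 / t" using int by (simp add: L2_norm_power2)
    finally show ?thesis .
  qed
  have nn: "?a \<ge> 0" "?b \<ge> 0" by (rule L2_norm_nonneg)+
  consider "?a = 0" | "?b = 0" | "?a > 0" "?b > 0" using nn by linarith
  then show ?thesis
  proof cases
    case 1
    have "((\<lambda>t. ?b\<^sup>2 / t) \<longlongrightarrow> 0) at_top" by (intro tendsto_divide_0[OF tendsto_const] filterlim_at_top_imp_at_infinity filterlim_ident)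
    then have "2 * ?p \<le> 0"
      by (rule tendsto_lowerbound) (use key 1 in \<open>auto intro!: eventually_mono[OF eventually_gt_at_top[of 0]]\<close>)
    then show ?thesis using 1 by simp
  next
    case 2
    have "((\<lambda>t. t * ?a\<^sup>2) \<longlongrightarrow> 0 * ?a\<^sup>2) (at_right 0)" by (intro tendsto_intros)
    then have "2 * ?p \<le> 0 * ?a\<^sup>2"
      by (rule tendsto_lowerbound) (use key 2 in \<open>auto intro!: eventually_mono[OF eventually_at_right_less[of 0]]\<close>)
    then show ?thesis using 2 by simp
  next
    case 3
    then show ?thesis using key[of "?b / ?a"] by (simp add: field_simps power2_eq_square)
  qed
qed

lemma L2_norm_triangle:
  fixes f g :: "real \<Rightarrow> complex^'m"
  assumes f: "in_L2 f" and g: "in_L2 g"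
  shows "L2_norm (\<lambda>x. f x + g x) \<le> L2_norm f + L2_norm g"
proof (rule power2_le_imp_le)
  have "complex_of_real ((L2_norm (\<lambda>x. f x + g x))\<^sup>2) = ip f f + ip f g + ip g f + ip g g"
    unfolding ip_self[symmetric] using f g by (simp add: ip_add_left ip_add_right in_L2_add)
  then have "(L2_norm (\<lambda>x. f x + g x))\<^sup>2 = Re (ip f f + ip f g + ip g f + ip g g)"
    by (metis Re_complex_of_real)
  also have "\<dots> = (L2_norm f)\<^sup>2 + (L2_norm g)\<^sup>2 + 2 * Re (ip f g)"
    using cnj_ip[of f g] by (simp add: ip_self complex_eq_iff del: of_real_power)
  also have "Re (ip f g) \<le> L2_norm f * L2_norm g"
    using ip_Cauchy_Schwarz[OF f g] complex_Re_le_cmod order_trans by blast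
  finally show "(L2_norm (\<lambda>x. f x + g x))\<^sup>2 \<le> (L2_norm f + L2_norm g)\<^sup>2" by (simp add: power2_sum)
qed (simp add: L2_norm_nonneg)

text \<open>Provides compactly supported right-hand sides, for which solutions of (H - z) g = f
  become exact Weyl solutions far out.\<close>

lemma truncation:
  fixes f :: "real \<Rightarrow> complex^'m"
  assumes f: "in_L2 f"
  defines "F \<equiv> \<lambda>n :: nat. \<lambda>x. if x \<in> {- real n..real n} then f x else 0"
  shows "in_L2 (F n)" and "(\<lambda>n. L2_norm (\<lambda>x. f x - F n x)) \<longlonglongrightarrow> 0"
proof -
  have fm: "f \<in> borel_measurable lebesgue" and fi: "integrable lebesgue (\<lambda>x. (norm (f x))\<^sup>2)"
    using f by (auto simp: in_L2_def)
  have F: "F n \<in> borel_measurable lebesgue" for n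
    unfolding F_def by (intro measurable_If_set fm) auto
  show FL: "in_L2 (F n)" for n
    unfolding in_L2_def
  proof (intro conjI F Bochner_Integration.integrable_bound[OF fi])
    show "(\<lambda>x. (norm (F n x))\<^sup>2) \<in> borel_measurable lebesgue" using F by measurable
  qed (auto simp: F_def)
  have "(\<lambda>n. LINT x|lebesgue. (norm (f x - F n x))\<^sup>2) \<longlonglongrightarrow> integral\<^sup>L lebesgue (\<lambda>x::real. 0::real)"
  proof (rule integral_dominated_convergence[where w = "\<lambda>x. (norm (f x))\<^sup>2"])
    show "(\<lambda>x. (norm (f x - F n x))\<^sup>2) \<in> borel_measurable lebesgue" for n using F fm by measurable
    have "(\<lambda>n. (norm (f x - F n x))\<^sup>2) \<longlonglongrightarrow> 0" for x
    proof (rule tendsto_eventually)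
      obtain N where "\<bar>x\<bar> \<le> real N" using real_arch_simple by blast
      then have e: "F n x = f x" if "n \<ge> N" for n using that by (auto simp: F_def abs_le_iff)
      show "\<forall>\<^sub>F n in sequentially. (norm (f x - F n x))\<^sup>2 = 0"
        by (rule eventually_sequentiallyI[of N]) (simp add: e)
    qed
    then show "AE x in lebesgue. (\<lambda>n. (norm (f x - F n x))\<^sup>2) \<longlonglongrightarrow> 0" by simp
    show "AE x in lebesgue. norm ((norm (f x - F n x))\<^sup>2) \<le> (norm (f x))\<^sup>2" for n by (auto simp: F_def)
  qed (use fi in simp_all)
  then have "(\<lambda>n. sqrt (LINT x|lebesgue. (norm (f x - F n x))\<^sup>2)) \<longlonglongrightarrow> sqrt 0"
    by (intro tendsto_real_sqrt) simp
  then show "(\<lambda>n. L2_norm (\<lambda>x. f x - F n x)) \<longlonglongrightarrow> 0" by (simp add: L2_norm_def)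
qed

lemma in_L2_L2p:
  fixes g :: "real \<Rightarrow> complex^'m"
  assumes g: "in_L2 g" "continuous_on UNIV g"
  shows "L2p g" "L2p (\<lambda>x. g (- x))"
proof -
  have i: "set_integrable lebesgue S (\<lambda>x. (norm (g x))\<^sup>2)" if "S \<in> sets lebesgue" for S
    unfolding set_integrable_def using g that by (intro integrable_mult_indicator) (auto simp: in_L2_def)
  show "L2p g" using L2p_iff_top[OF g(2)] i[of "{0..}"] by auto
  show "L2p (\<lambda>x. g (- x))" using L2p_iff_bot[OF g(2)] i[of "{..0}"] by auto
qed

lemma in_L2I_L2p:
  fixes g :: "real \<Rightarrow> complex^'m"
  assumes g: "continuous_on UNIV g" "L2p g" "L2p (\<lambda>x. g (- x))"
  shows "in_L2 g"
  unfolding in_L2_def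
proof
  show "g \<in> borel_measurable lebesgue"
    using borel_measurable_continuous_onI[OF g(1)] by (simp add: measurable_completion)
  let ?f = "\<lambda>x. (norm (g x))\<^sup>2"
  obtain B1 B2 where B: "\<And>R. R \<ge> 0 \<Longrightarrow> integral {0..R} ?f \<le> B1" "\<And>R. R \<ge> 0 \<Longrightarrow> integral {0..R} (\<lambda>x. ?f (- x)) \<le> B2"
    using g(2,3) unfolding L2p_def by auto
  have f: "continuous_on UNIV ?f" by (intro continuous_intros g)
  have "?f absolutely_integrable_on UNIV"
  proof (rule nested_integrable[OF f, of "\<lambda>n. - real n" real _ "B2 + B1"])
    fix n
    have "integral {- real n..real n} ?f = integral {- real n..0} ?f + integral {0..real n} ?f"
      by (rule Henstock_Kurzweil_Integration.integral_combine[symmetric])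
        (auto intro: integrable_continuous_real continuous_on_subset[OF f])
    also have "integral {- real n..0} ?f = integral {0..real n} (\<lambda>x. ?f (- x))"
      using Henstock_Kurzweil_Integration.integral_reflect_real[of 0 "- real n" ?f] by simp
    finally show "integral {- real n..real n} ?f \<le> B2 + B1" using B(1)[of n] B(2)[of n] by simp
    show "\<exists>n. x \<in> {- real n..real n}" for x
    proof -
      obtain k where "\<bar>x\<bar> \<le> real k" using real_arch_simple by blast
      then have "x \<in> {- real k..real k}" by auto
      then show ?thesis by blast
    qed
  qed auto
  then show "integrable lebesgue ?f" by (simp add: set_integrable_def)
qed


subsection \<open>The operator\<close>

lemma schroedinger_graph_diff:
  fixes Q :: "real \<Rightarrow> complex^'m^'m"
  assumes "(g, h) \<in> schroedinger_graph Q" "(g1, h1) \<in> schroedinger_graph Q"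
  shows "(\<lambda>x. g x - g1 x, \<lambda>x. h x - h1 x) \<in> schroedinger_graph Q"
proof -
  obtain g' g'' where g: "AC2 g g' g''" "AE x in lebesgue. h x = - g'' x + Q x *v g x"
    using assms(1) by (auto simp: schroedinger_graph_def)
  obtain k' k'' where k: "AC2 g1 k' k''" "AE x in lebesgue. h1 x = - k'' x + Q x *v g1 x"
    using assms(2) by (auto simp: schroedinger_graph_def)
  have AC2: "AC2 (\<lambda>x. g x - g1 x) (\<lambda>x. g' x - k' x) (\<lambda>x. g'' x - k'' x)"
    unfolding AC2_def
  proof (intro conjI allI)
    show "AC_loc (\<lambda>x. g x - g1 x)" "AC_loc (\<lambda>x. g' x - k' x)"
      using g(1) k(1) by (auto simp: AC2_def AC_loc_def intro: AC_on_diff)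
    show "((\<lambda>x. g x - g1 x) has_vector_derivative g' x - k' x) (at x)" for x
      using g(1) k(1) by (auto simp: AC2_def intro: has_vector_derivative_diff)
    have "AE x in lebesgue. (g' has_vector_derivative g'' x) (at x)" "AE x in lebesgue. (k' has_vector_derivative k'' x) (at x)"
      using g(1) k(1) by (auto simp: AC2_def)
    then show "AE x in lebesgue. ((\<lambda>x. g' x - k' x) has_vector_derivative g'' x - k'' x) (at x)"
      by eventually_elim (rule has_vector_derivative_diff)
  qed
  have AE: "AE x in lebesgue. h x - h1 x = - (g'' x - k'' x) + Q x *v (g x - g1 x)"
    using g(2) k(2) by eventually_elim (simp add: mv.diff_right)
  have "\<exists>d' d''. AC2 (\<lambda>x. g x - g1 x) d' d'' \<and> (AE x in lebesgue. h x - h1 x = - d'' x + Q x *v (g x - g1 x))"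
    by (rule exI[of _ "\<lambda>x. g' x - k' x"], rule exI[of _ "\<lambda>x. g'' x - k'' x"], rule conjI[OF AC2 AE])
  moreover have "in_L2 (\<lambda>x. g x - g1 x)" "in_L2 (\<lambda>x. h x - h1 x)"
    using assms by (auto simp: schroedinger_graph_def intro!: in_L2_diff)
  ultimately show ?thesis unfolding schroedinger_graph_def by simp
qed

lemma schroedinger_graphD:
  assumes "(g, h) \<in> schroedinger_graph Q"
  shows "in_L2 g" "in_L2 h"
  using assms by (auto simp: schroedinger_graph_def)

lemma AC_loc_reflect:
  fixes f :: "real \<Rightarrow> 'a::real_normed_vector"
  assumes "AC_loc f"
  shows "AC_loc (\<lambda>x. f (- x))"
  unfolding AC_loc_def AC_on_def
proof (intro allI impI)
  fix a b \<epsilon> :: real assume "a < b" "\<epsilon> > 0"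
  then have "AC_on (- b) (- a) f" using assms by (simp add: AC_loc_def)
  then obtain \<delta> where "\<delta> > 0" and \<delta>: "\<And>I. finite I \<Longrightarrow> (\<forall>(s, t)\<in>I. - b \<le> s \<and> s < t \<and> t \<le> - a) \<Longrightarrow>
      disjoint_family_on (\<lambda>(s, t). {s<..<t}) I \<Longrightarrow> (\<Sum>(s, t)\<in>I. t - s) < \<delta> \<Longrightarrow>
      (\<Sum>(s, t)\<in>I. norm (f t - f s)) < \<epsilon>"
    using \<open>\<epsilon> > 0\<close> unfolding AC_on_def by blast
  have "(\<Sum>(s, t)\<in>I. norm (f (- t) - f (- s))) < \<epsilon>"
    if I: "finite I" "\<forall>(s, t)\<in>I. a \<le> s \<and> s < t \<and> t \<le> b"
      "disjoint_family_on (\<lambda>(s, t). {s<..<t}) I" "(\<Sum>(s, t)\<in>I. t - s) < \<delta>"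
    for I :: "(real \<times> real) set"
  proof -
    let ?h = "\<lambda>(s :: real, t :: real). (- t, - s)"
    have inj: "inj_on ?h I" by (auto simp: inj_on_def)
    have "(\<Sum>(s, t)\<in>?h ` I. norm (f t - f s)) < \<epsilon>"
    proof (rule \<delta>)
      show "disjoint_family_on (\<lambda>(s, t). {s<..<t}) (?h ` I)"
        unfolding disjoint_family_on_def
      proof (intro ballI impI)
        fix m n assume "m \<in> ?h ` I" "n \<in> ?h ` I" "m \<noteq> n"
        then obtain s t s' t' where A: "(s, t) \<in> I" "(s', t') \<in> I" "(s, t) \<noteq> (s', t')"
          and mn: "m = (- t, - s)" "n = (- t', - s')" by auto
        have "{s<..<t} \<inter> {s'<..<t'} = {}" using I(3) A by (fastforce simp: disjoint_family_on_def)
        have "x \<notin> {- t<..< - s} \<inter> {- t'<..< - s'}" for x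
        proof
          assume "x \<in> {- t<..< - s} \<inter> {- t'<..< - s'}"
          then have "- x \<in> {s<..<t} \<inter> {s'<..<t'}" by auto
          with \<open>{s<..<t} \<inter> {s'<..<t'} = {}\<close> show False by blast
        qed
        then have "{- t<..< - s} \<inter> {- t'<..< - s'} = {}" by blast
        then show "(case m of (s, t) \<Rightarrow> {s<..<t}) \<inter> (case n of (s, t) \<Rightarrow> {s<..<t}) = {}" by (simp only: mn prod.case)
      qed
      have "(\<Sum>(s, t)\<in>?h ` I. t - s) = (\<Sum>(s, t)\<in>I. t - s)"
        by (subst sum.reindex[OF inj]) (simp add: case_prod_unfold)
      then show "(\<Sum>(s, t)\<in>?h ` I. t - s) < \<delta>" using I(4) by simp
    qed (use I(1,2) in auto)
    moreover have "(\<Sum>(s, t)\<in>?h ` I. norm (f t - f s)) = (\<Sum>(s, t)\<in>I. norm (f (- t) - f (- s)))"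
      by (subst sum.reindex[OF inj]) (simp add: case_prod_unfold norm_minus_commute)
    ultimately show ?thesis by simp
  qed
  with \<open>\<delta> > 0\<close> show "\<exists>\<delta>>0. \<forall>I. finite I \<longrightarrow> (\<forall>(s, t)\<in>I. a \<le> s \<and> s < t \<and> t \<le> b) \<longrightarrow>
      disjoint_family_on (\<lambda>(s, t). {s<..<t}) I \<longrightarrow>
      (\<Sum>(s, t)\<in>I. t - s) < \<delta> \<longrightarrow> (\<Sum>(s, t)\<in>I. norm (f (- t) - f (- s))) < \<epsilon>"
    by (intro exI[of _ \<delta>]) simp
qed

lemma AC2_reflect:
  fixes g :: "real \<Rightarrow> 'a::real_normed_vector"
  assumes g: "AC2 g g' g''"
  shows "AC2 (\<lambda>x. g (- x)) (\<lambda>x. - g' (- x)) (\<lambda>x. g'' (- x))"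
  unfolding AC2_def
proof (intro conjI allI)
  show "AC_loc (\<lambda>x. g (- x))" using g by (auto simp: AC2_def intro: AC_loc_reflect)
  have "AC_loc (\<lambda>x. g' (- x))" using g by (auto simp: AC2_def intro: AC_loc_reflect)
  then show "AC_loc (\<lambda>x. - g' (- x))"
    unfolding AC_loc_def AC_on_def by (simp add: norm_minus_commute)
  show "((\<lambda>x. g (- x)) has_vector_derivative - g' (- x)) (at x)" for x
    using g by (intro reflect_has_vector_derivative) (auto simp: AC2_def)
  have "AE x in lebesgue. (g' has_vector_derivative g'' x) (at x)" using g by (simp add: AC2_def)
  from AE_lebesgue_affine[OF this, of "-1" 0]
  have "AE x in lebesgue. (g' has_vector_derivative g'' (- x)) (at (- x))" by simp
  then show "AE x in lebesgue. ((\<lambda>x. - g' (- x)) has_vector_derivative g'' (- x)) (at x)"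
  proof eventually_elim
    fix x assume *: "(g' has_vector_derivative g'' (- x)) (at (- x))"
    have "((\<lambda>x::real. - x) has_vector_derivative -1) (at x)"
      by (auto intro!: derivative_eq_intros simp: has_real_derivative_iff_has_vector_derivative[symmetric])
    from has_vector_derivative_minus[OF vector_diff_chain_at[OF this *]]
    show "((\<lambda>x. - g' (- x)) has_vector_derivative g'' (- x)) (at x)" by (simp add: o_def)
  qed
qed

section \<open>Boundary terms at infinity\<close>

context weyl_plus
begin

lemma vector_sol_exists:
  obtains v v' where "vector_sol Q z v v'" "v x0 = a" "v' x0 = b"
proof -
  obtain \<theta> \<theta>' \<phi> \<phi>' :: "complex \<Rightarrow> real \<Rightarrow> complex^'m^'m" where
    t: "\<And>z. matrix_sol Q z (\<theta> z) (\<theta>' z)" "\<And>z. \<theta> z x0 = mat 1" "\<And>z. \<theta>' z x0 = 0"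
    and p: "\<And>z. matrix_sol Q z (\<phi> z) (\<phi>' z)" "\<And>z. \<phi> z x0 = 0" "\<And>z. \<phi>' z x0 = mat 1"
    by (rule fundamental_system[OF cont, of x0]) blast
  note v = vector_sol_diff[OF matrix_sol_column[OF t(1), of z a] matrix_sol_column[OF p(1), of z "- b"]]
  show ?thesis by (rule that[OF v]) (simp_all add: t p mv.minus_right)
qed

text \<open>An element of the domain that satisfies the homogeneous equation almost everywhere
  beyond n coincides there with the classical solution having the same data at n. The difference,
  continued by 0 to the left, is shown to solve the equation with zero data.\<close>

lemma tail_solution:
  fixes g :: "real \<Rightarrow> complex^'m"
  assumes g: "AC2 g g' g''" and eq: "AE x in lebesgue. x > n \<longrightarrow> - g'' x + Q x *v g x = z *s g x"
  obtains v v' where "vector_sol Q z v v'" "\<And>x. x \<ge> n \<Longrightarrow> g x = v x" "\<And>x. x \<ge> n \<Longrightarrow> g' x = v' x"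
proof -
  obtain v v' where v: "vector_sol Q z v v'" "v n = g n" "v' n = g' n" by (rule vector_sol_exists)
  have gc: "continuous_on UNIV g" using g by (auto simp: AC2_def intro: AC_loc_imp_continuous_on)
  \<comment> \<open>Composition with \<open>max x n\<close> freezes the difference at its value 0 to
    the left of n. It becomes continuous on the whole line, and it agrees with the double primitive
    \<open>D\<close> of its own right-hand side.\<close>
  let ?d = "\<lambda>x. g (max x n) - v (max x n)"
  have dc: "continuous_on UNIV ?d"
    by (intro continuous_intros continuous_on_compose2[OF gc] continuous_on_compose2[OF vector_solD(3)[OF v(1)]]) auto
  define w where "w x = Q x *v ?d x - z *s ?d x" for x
  have wc: "continuous_on UNIV w"
    unfolding w_def by (intro continuous_intros mv.continuous_on cont dc bounded_linear.continuous_on[OF cs_bl.bounded_linear_right])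
  define D' where "D' = prim n w"
  define D where "D = prim n D'"
  have D'd: "(D' has_vector_derivative w x) (at x)" for x unfolding D'_def by (rule prim_derivative[OF wc])
  have D'c: "continuous_on UNIV D'" unfolding D'_def by (rule prim_continuous[OF wc])
  have Dd: "(D has_vector_derivative D' x) (at x)" for x unfolding D_def by (rule prim_derivative[OF D'c])
  have AE: "AE x in lebesgue. x > n \<longrightarrow> (g' has_vector_derivative Q x *v g x - z *s g x) (at x)"
  proof -
    have "AE x in lebesgue. (g' has_vector_derivative g'' x) (at x)" using g by (simp add: AC2_def)
    with eq show ?thesis
    proof eventually_elim
      case (elim x)
      then show ?case by (auto simp: algebra_simps)
    qed
  qed
  obtain N where N: "negligible N" "\<And>x. x \<notin> N \<Longrightarrow> x > n \<longrightarrow> (g' has_vector_derivative Q x *v g x - z *s g x) (at x)"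
    using AE by (rule AE_lebesgueE) blast
  have d': "g' x - v' x = D' x" if "x \<ge> n" for x
  proof -
    have vc: "continuous_on UNIV (\<lambda>x. Q x *v v x - z *s v x)"
      by (intro continuous_intros mv.continuous_on cont vector_solD(3)[OF v(1)]
          bounded_linear.continuous_on[OF cs_bl.bounded_linear_right])
    have AC: "AC_on n x (\<lambda>x. g' x - v' x)" if "x > n"
    proof (rule AC_on_diff)
      show "AC_on n x g'" using g that by (simp add: AC2_def AC_loc_def)
      show "AC_on n x v'" using C1_imp_AC_loc[OF vector_solD(2)[OF v(1)] vc] that by (simp add: AC_loc_def)
    qed
    have "(w has_integral (g' x - v' x) - (g' n - v' n)) {n..x}"
    proof (cases "x = n")
      case False
      then have "x > n" using that by simp
      show ?thesis
      proof (rule AC_fundamental_theorem_of_calculus[OF that AC[OF \<open>x > n\<close>]])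
        show "negligible (insert n N)" using N(1) by simp
        fix y assume y: "y \<in> {n..x} - insert n N"
        then have "(g' has_vector_derivative Q y *v g y - z *s g y) (at y)" using N(2)[of y] by auto
        from has_vector_derivative_diff[OF this vector_solD(2)[OF v(1)]]
        have "((\<lambda>x. g' x - v' x) has_vector_derivative w y) (at y)"
          using y by (simp add: w_def mv.diff_right cs_bl.diff_right max_def algebra_simps)
        then show "((\<lambda>x. g' x - v' x) has_vector_derivative w y) (at y within {n..x})"
          by (rule has_vector_derivative_at_within)
      qed
    qed (auto intro: has_integral_refl)
    moreover have "(w has_integral D' x - D' n) {n..x}"
      by (rule fundamental_theorem_of_calculus[OF that]) (rule has_vector_derivative_at_within[OF D'd])
    ultimately have "(g' x - v' x) - (g' n - v' n) = D' x - D' n" by (rule has_integral_unique)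
    then show ?thesis by (simp add: v D'_def)
  qed
  have d: "g x - v x = D x" if "x \<ge> n" for x
  proof -
    have "(D' has_integral (g x - v x) - (g n - v n)) {n..x}"
    proof (rule fundamental_theorem_of_calculus[OF that])
      fix y assume y: "y \<in> {n..x}"
      have "((\<lambda>x. g x - v x) has_vector_derivative g' y - v' y) (at y)"
        using g by (intro has_vector_derivative_diff vector_solD(1)[OF v(1)]) (simp add: AC2_def)
      then show "((\<lambda>x. g x - v x) has_vector_derivative D' y) (at y within {n..x})"
        using d'[of y] y by (simp add: has_vector_derivative_at_within)
    qed
    moreover have "(D' has_integral D x - D n) {n..x}"
      by (rule fundamental_theorem_of_calculus[OF that]) (rule has_vector_derivative_at_within[OF Dd])
    ultimately have "(g x - v x) - (g n - v n) = D x - D n" by (rule has_integral_unique)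
    then show ?thesis by (simp add: v D_def)
  qed
  have neg: "D x = 0" if "x < n" for x
  proof -
    have w0: "w y = 0" if "y \<le> n" for y using that v by (simp add: w_def mv.zero_right cs_bl.zero_right max_def)
    have D'0: "D' y = 0" if "y \<le> n" for y
    proof -
      have "(w has_integral D' n - D' y) {y..n}"
        by (rule fundamental_theorem_of_calculus[OF that]) (rule has_vector_derivative_at_within[OF D'd])
      moreover have "(w has_integral 0) {y..n}" by (rule has_integral_is_0) (use w0 in auto)
      ultimately have "D' n - D' y = 0" by (rule has_integral_unique)
      then show ?thesis by (simp add: D'_def)
    qed
    have "(D' has_integral D n - D x) {x..n}"
      by (rule fundamental_theorem_of_calculus) (use that in \<open>auto intro: has_vector_derivative_at_within Dd\<close>)
    moreover have "(D' has_integral 0) {x..n}" by (rule has_integral_is_0) (use D'0 in auto)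
    ultimately have "D n - D x = 0" by (rule has_integral_unique)
    then show ?thesis by (simp add: D_def)
  qed
  have "?d x = D x" for x using d[of x] neg[of x] v by (cases "x < n") (auto simp: max_def)
  then have "vector_sol Q z D D'"
    unfolding vector_sol_def using Dd D'd by (simp add: w_def)
  from vector_sol_zero[OF cont this, of n] have "D x = 0" "D' x = 0" for x by (auto simp: D_def D'_def)
  then show ?thesis using d d' by (intro that[OF v(1)]) auto
qed

text \<open>The limit point case gives u' = M(z) u, and v' = M(z)^* v because the M-function at the
  conjugate point is the adjoint. Hence the Wronskian is zero at every point, not merely in the
  limit.\<close>

lemma boundary_zero:
  assumes z: "Im z \<noteq> 0" and u: "vector_sol Q z u u'" "L2p u" and v: "vector_sol Q (cnj z) v v'" "L2p v"
  shows "cip (v x) (u' x) - cip (v' x) (u x) = 0"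
proof -
  have z': "Im (cnj z) \<noteq> 0" using z by simp
  obtain \<psi> \<psi>' where \<psi>: "matrix_sol Q z \<psi> \<psi>'" "\<psi> x = mat 1" "\<psi>' x = M_plus Q z x" "\<And>c. L2p (\<lambda>x. \<psi> x *v c)"
    using weyl_solution_exists[OF z, of x] by metis
  obtain \<chi>' \<chi>'' where \<chi>: "matrix_sol Q (cnj z) \<chi>' \<chi>''" "\<chi>' x = mat 1" "\<chi>'' x = M_plus Q (cnj z) x" "\<And>c. L2p (\<lambda>x. \<chi>' x *v c)"
    using weyl_solution_exists[OF z', of x] by metis
  have "u' x = M_plus Q z x *v u x" using weyl_solution_unique(2)[OF z \<psi>(1,2,4) u] \<psi>(3) by metis
  moreover have "v' x = M_plus Q (cnj z) x *v v x" using weyl_solution_unique(2)[OF z' \<chi>(1,2,4) v] \<chi>(3) by metis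
  ultimately show ?thesis by (simp add: M_plus_adj[OF z] cip_adj)
qed

text \<open>Beyond n both functions agree with classical square integrable solutions, at z and at
  its conjugate, so the boundary term is already 0 at n. Only integration over a compact interval
  remains in the proof of symmetry.\<close>

lemma tail_boundary_zero:
  fixes g h :: "real \<Rightarrow> complex^'m"
  assumes z: "Im z \<noteq> 0"
    and g: "AC2 g g' g''" "AE x in lebesgue. x > n \<longrightarrow> - g'' x + Q x *v g x = z *s g x" "L2p g"
    and h: "AC2 h h' h''" "AE x in lebesgue. x > n \<longrightarrow> - h'' x + Q x *v h x = cnj z *s h x" "L2p h"
  shows "cip (h n) (g' n) - cip (h' n) (g n) = 0"
proof -
  obtain v v' where v: "vector_sol Q z v v'" "\<And>x. x \<ge> n \<Longrightarrow> g x = v x" "\<And>x. x \<ge> n \<Longrightarrow> g' x = v' x"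
    by (rule tail_solution[OF g(1,2)]) blast
  obtain w w' where w: "vector_sol Q (cnj z) w w'" "\<And>x. x \<ge> n \<Longrightarrow> h x = w x" "\<And>x. x \<ge> n \<Longrightarrow> h' x = w' x"
    by (rule tail_solution[OF h(1,2)]) blast
  have tail: "L2p v" if gv: "L2p g" "\<And>x. x \<ge> n \<Longrightarrow> g x = v x" "continuous_on UNIV v" "continuous_on UNIV g"
    for g v :: "real \<Rightarrow> complex^'m"
  proof -
    obtain B where B: "\<And>R. R \<ge> 0 \<Longrightarrow> integral {0..R} (\<lambda>x. (norm (g x))\<^sup>2) \<le> B" using gv(1) unfolding L2p_def by blast
    have int: "(\<lambda>x. (norm (f x))\<^sup>2) integrable_on {s..t}" if "continuous_on UNIV f" for f :: "real \<Rightarrow> complex^'m" and s t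
      by (intro integrable_continuous_real continuous_intros continuous_on_subset[OF that]) auto
    show ?thesis
    proof (rule L2p_from[OF gv(3), of "\<bar>n\<bar>" B])
      fix R assume R: "R \<ge> \<bar>n\<bar>"
      have "integral {\<bar>n\<bar>..R} (\<lambda>x. (norm (v x))\<^sup>2) = integral {\<bar>n\<bar>..R} (\<lambda>x. (norm (g x))\<^sup>2)"
        by (rule Henstock_Kurzweil_Integration.integral_cong) (use gv(2) in auto)
      also have "\<dots> \<le> integral {0..R} (\<lambda>x. (norm (g x))\<^sup>2)" by (intro integral_subset_le int gv(4)) auto
      also have "\<dots> \<le> B" using R by (intro B) auto
      finally show "integral {\<bar>n\<bar>..R} (\<lambda>x. (norm (v x))\<^sup>2) \<le> B" .
    qed
  qed
  have c: "continuous_on UNIV g" "continuous_on UNIV h"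
    using g(1) h(1) by (auto simp: AC2_def intro: AC_loc_imp_continuous_on)
  have "L2p v" by (rule tail[OF g(3) v(2) vector_solD(3)[OF v(1)] c(1)])
  moreover have "L2p w" by (rule tail[OF h(3) w(2) vector_solD(3)[OF w(1)] c(2)])
  ultimately show ?thesis using boundary_zero[OF z v(1) _ w(1), of n] v w by simp
qed

end

subsection \<open>Reflection\<close>

lemma reflected_fundamental:
  fixes Q :: "real \<Rightarrow> complex^'m^'m"
  assumes Q: "continuous_on UNIV Q"
  shows "theta1 Q z (- x) x0 = theta1 (\<lambda>x. Q (- x)) z x (- x0)"
    and "phi1 Q z (- x) x0 = - phi1 (\<lambda>x. Q (- x)) z x (- x0)"
proof -
  have Q': "continuous_on UNIV (\<lambda>x. Q (- x))"
    by (rule continuous_on_compose2[OF Q]) (auto intro!: continuous_intros)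
  obtain \<theta> \<theta>' \<phi> \<phi>' :: "complex \<Rightarrow> real \<Rightarrow> complex^'m^'m" where
    t: "\<And>z. matrix_sol Q z (\<theta> z) (\<theta>' z)" "\<And>z. \<theta> z x0 = mat 1" "\<And>z. \<theta>' z x0 = 0"
    and p: "\<And>z. matrix_sol Q z (\<phi> z) (\<phi>' z)" "\<And>z. \<phi> z x0 = 0" "\<And>z. \<phi>' z x0 = mat 1"
    and eq: "\<And>z x. theta1 Q z x x0 = \<theta> z x" "\<And>z x. phi1 Q z x x0 = \<phi> z x"
    by (rule fundamental_system[OF Q, of x0]) blast
  have "(THE \<psi>. mat_solution (\<lambda>x. Q (- x)) z \<psi> \<and> \<psi> (- x0) = mat 1 \<and> (\<psi> has_vector_derivative 0) (at (- x0)))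
      = (\<lambda>x. \<theta> z (- x))"
    by (rule mat_solution_the[OF Q' reflect_matrix_sol[OF t(1)]]) (simp_all add: t)
  then have "theta1 (\<lambda>x. Q (- x)) z x (- x0) = \<theta> z (- x)" by (simp add: theta1_def)
  then show "theta1 Q z (- x) x0 = theta1 (\<lambda>x. Q (- x)) z x (- x0)" by (simp add: eq)
  have "(THE \<psi>. mat_solution (\<lambda>x. Q (- x)) z \<psi> \<and> \<psi> (- x0) = 0 \<and> (\<psi> has_vector_derivative mat 1) (at (- x0)))
      = (\<lambda>x. \<phi> z (- x) ** (- mat 1))"
    by (rule mat_solution_the[OF Q' matrix_sol_mult[OF reflect_matrix_sol[OF p(1)]]])
      (simp_all add: p mm.minus_left mm.minus_right mm.zero_left)
  then have "phi1 (\<lambda>x. Q (- x)) z x (- x0) = \<phi> z (- x) ** (- mat 1)" by (simp add: phi1_def)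
  then show "phi1 Q z (- x) x0 = - phi1 (\<lambda>x. Q (- x)) z x (- x0)" by (simp add: eq mm.minus_right)
qed

text \<open>Under x \<mapsto> -x the solution \<open>theta1\<close> is preserved and
  \<open>phi1\<close> changes sign, because its initial slope does. The quotient therefore changes
  sign, and the limit at minus infinity becomes one at plus infinity for the reflected
  potential.\<close>

lemma M_minus_eq:
  fixes Q :: "real \<Rightarrow> complex^'m^'m"
  assumes Q: "continuous_on UNIV Q" and "weyl_plus (\<lambda>x. Q (- x))" and z: "Im z \<noteq> 0"
  shows "M_minus Q z x0 = - M_plus (\<lambda>x. Q (- x)) z (- x0)"
proof -
  interpret N: weyl_plus "\<lambda>x. Q (- x)" by fact
  obtain \<theta> \<theta>' \<phi> \<phi>' :: "complex \<Rightarrow> real \<Rightarrow> complex^'m^'m" where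
    t: "\<And>z. matrix_sol (\<lambda>x. Q (- x)) z (\<theta> z) (\<theta>' z)" "\<And>z. \<theta> z (- x0) = mat 1" "\<And>z. \<theta>' z (- x0) = 0"
    and p: "\<And>z. matrix_sol (\<lambda>x. Q (- x)) z (\<phi> z) (\<phi>' z)" "\<And>z. \<phi> z (- x0) = 0" "\<And>z. \<phi>' z (- x0) = mat 1"
    and eq: "\<And>z x. theta1 (\<lambda>x. Q (- x)) z x (- x0) = \<theta> z x" "\<And>z x. phi1 (\<lambda>x. Q (- x)) z x (- x0) = \<phi> z x"
    by (rule fundamental_system[OF N.cont, of "- x0"]) blast
  obtain M where M: "((\<lambda>R. - (matrix_inv (\<phi> z R) ** \<theta> z R)) \<longlongrightarrow> M) at_top"
    using N.weyl_limit[OF z t p] by blast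
  have MP: "M_plus (\<lambda>x. Q (- x)) z (- x0) = M"
    unfolding M_plus_def eq by (rule tendsto_Lim[OF _ M]) simp
  have inv_minus: "matrix_inv (- \<phi> z R) = - matrix_inv (\<phi> z R)" if "R > - x0" for R
    by (rule matrix_inv_unique(2))
      (simp add: mm.minus_left mm.minus_right invertible_matrix_inv[OF N.dirichlet_invertible[OF p z that]])
  have "\<forall>\<^sub>F R in at_top. - (- (matrix_inv (\<phi> z R) ** \<theta> z R))
      = - (matrix_inv (phi1 Q z (- R) x0) ** theta1 Q z (- R) x0)"
    by (rule eventually_mono[OF eventually_gt_at_top[of "- x0"]])
      (simp add: reflected_fundamental[OF Q] eq mm.minus_left inv_minus)
  with tendsto_minus[OF M]
  have "((\<lambda>R. - (matrix_inv (phi1 Q z (- R) x0) ** theta1 Q z (- R) x0)) \<longlongrightarrow> - M) at_top"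
    by (rule Lim_transform_eventually)
  then have "((\<lambda>R. - (matrix_inv (phi1 Q z R x0) ** theta1 Q z R x0)) \<longlongrightarrow> - M) at_bot"
    by (subst filterlim_at_bot_mirror)
  then show ?thesis unfolding M_minus_def MP by (intro tendsto_Lim) simp_all
qed


subsection \<open>Symmetry and lower bound of the operator\<close>

locale schroedinger =
  fixes Q :: "real \<Rightarrow> complex^'m^'m" and E0 :: real
  assumes herm: "\<And>x. adj (Q x) = Q x" and AC: "AC_loc Q"
    and lp_top: "limit_point_at_top Q" and lp_bot: "limit_point_at_bot Q"
    and spec: "spectrum Q = complex_of_real ` {E0..}"
begin

lemma cont: "continuous_on UNIV Q"
  using AC by (rule AC_loc_imp_continuous_on)

lemma weyl_P: "weyl_plus Q"
  by unfold_locales (use cont herm limit_point_at_top_imp[OF cont lp_top] in auto)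

lemma weyl_N: "weyl_plus (\<lambda>x. Q (- x))"
  by unfold_locales
    (use herm limit_point_at_bot_imp[OF cont lp_bot] in \<open>auto intro!: continuous_on_compose2[OF cont] continuous_intros\<close>)

lemma resolventI: "z \<notin> complex_of_real ` {E0..} \<Longrightarrow> z \<in> resolvent_set Q"
  using spec by (auto simp: spectrum_def)

lemma resolvent_solve:
  assumes "z \<notin> complex_of_real ` {E0..}" "in_L2 f"
  obtains g where "(g, \<lambda>x. f x + z *s g x) \<in> schroedinger_graph Q"
  using resolventI[OF assms(1)] assms(2) unfolding resolvent_set_def by blast

lemma resolvent_bound:
  assumes "z \<notin> complex_of_real ` {E0..}"
  obtains C where "C > 0"
    "\<And>g h. (g, h) \<in> schroedinger_graph Q \<Longrightarrow> L2_norm g \<le> C * L2_norm (\<lambda>x. h x - z *s g x)"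
proof -
  obtain C where C: "\<forall>(g, h)\<in>schroedinger_graph Q. L2_norm g \<le> C * L2_norm (\<lambda>x. h x - z *s g x)"
    using resolventI[OF assms] unfolding resolvent_set_def by blast
  show ?thesis
  proof (rule that[of "\<bar>C\<bar> + 1"])
    fix g h assume "(g, h) \<in> schroedinger_graph Q"
    then have "L2_norm g \<le> C * L2_norm (\<lambda>x. h x - z *s g x)" using C by blast
    also have "\<dots> \<le> (\<bar>C\<bar> + 1) * L2_norm (\<lambda>x. h x - z *s g x)"
      by (intro mult_right_mono L2_norm_nonneg) auto
    finally show "L2_norm g \<le> (\<bar>C\<bar> + 1) * L2_norm (\<lambda>x. h x - z *s g x)" .
  qed simp
qed

lemma resolvent_unique:
  assumes "z \<notin> complex_of_real ` {E0..}" "in_L2 f"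
    and "(g, \<lambda>x. f x + z *s g x) \<in> schroedinger_graph Q" "(k, \<lambda>x. f x + z *s k x) \<in> schroedinger_graph Q"
  shows "g = k"
  using resolventI[OF assms(1)] assms(2-4) unfolding resolvent_set_def by blast

text \<open>With right-hand sides supported in [-n, n] the boundary terms at n and at -n vanish.
  Integrating Lagrange's identity over [-n, n] gives the relation between the two
  resolvents.\<close>

lemma symmetric_truncated:
  fixes f k g h :: "real \<Rightarrow> complex^'m"
  assumes z: "Im z \<noteq> 0" and n: "n > 0" and fk: "in_L2 f" "in_L2 k"
    and supp: "\<And>x. x \<notin> {-n..n} \<Longrightarrow> f x = 0" "\<And>x. x \<notin> {-n..n} \<Longrightarrow> k x = 0"
    and g: "(g, \<lambda>x. f x + z *s g x) \<in> schroedinger_graph Q"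
    and h: "(h, \<lambda>x. k x + cnj z *s h x) \<in> schroedinger_graph Q"
  shows "ip h f = ip k g"
proof -
  interpret P: weyl_plus Q by (rule weyl_P)
  interpret N: weyl_plus "\<lambda>x. Q (- x)" by (rule weyl_N)
  obtain g' g'' where g2: "AC2 g g' g''" "AE x in lebesgue. f x + z *s g x = - g'' x + Q x *v g x"
    using g by (auto simp: schroedinger_graph_def)
  obtain h' h'' where h2: "AC2 h h' h''" "AE x in lebesgue. k x + cnj z *s h x = - h'' x + Q x *v h x"
    using h by (auto simp: schroedinger_graph_def)
  have gh: "in_L2 g" "in_L2 h" using schroedinger_graphD g h by blast+
  have c: "continuous_on UNIV g" "continuous_on UNIV h"
    using g2(1) h2(1) by (auto simp: AC2_def intro: AC_loc_imp_continuous_on)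
  have right: "cip (h n) (g' n) - cip (h' n) (g n) = 0"
  proof (rule P.tail_boundary_zero[OF z g2(1) _ in_L2_L2p(1)[OF gh(1) c(1)] h2(1) _ in_L2_L2p(1)[OF gh(2) c(2)]])
    show "AE x in lebesgue. n < x \<longrightarrow> - g'' x + Q x *v g x = z *s g x"
      using g2(2) by eventually_elim (use supp(1) in force)
    show "AE x in lebesgue. n < x \<longrightarrow> - h'' x + Q x *v h x = cnj z *s h x"
      using h2(2) by eventually_elim (use supp(2) in force)
  qed
  have left: "cip (h (- n)) (- g' (- n)) - cip (- h' (- n)) (g (- n)) = 0"
  proof (rule N.tail_boundary_zero[OF z AC2_reflect[OF g2(1)] _ in_L2_L2p(2)[OF gh(1) c(1)]
        AC2_reflect[OF h2(1)] _ in_L2_L2p(2)[OF gh(2) c(2)]])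
    have "AE x in lebesgue. f (- x) + z *s g (- x) = - g'' (- x) + Q (- x) *v g (- x)"
      using AE_lebesgue_affine[OF g2(2), of "-1" 0] by simp
    then show "AE x in lebesgue. n < x \<longrightarrow> - g'' (- x) + Q (- x) *v g (- x) = z *s g (- x)"
      by eventually_elim (use supp(1) n in force)
    have "AE x in lebesgue. k (- x) + cnj z *s h (- x) = - h'' (- x) + Q (- x) *v h (- x)"
      using AE_lebesgue_affine[OF h2(2), of "-1" 0] by simp
    then show "AE x in lebesgue. n < x \<longrightarrow> - h'' (- x) + Q (- x) *v h (- x) = cnj z *s h (- x)"
      by eventually_elim (use supp(2) n in force)
  qed
  let ?W = "\<lambda>x. cip (h x) (g' x) - cip (h' x) (g x)"
  let ?w = "\<lambda>x. cip (k x) (g x) - cip (h x) (f x)"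
  have AE: "AE x in lebesgue. (?W has_vector_derivative ?w x) (at x)"
  proof -
    have "AE x in lebesgue. (g' has_vector_derivative g'' x) (at x)" "AE x in lebesgue. (h' has_vector_derivative h'' x) (at x)"
      using g2(1) h2(1) by (auto simp: AC2_def)
    with g2(2) h2(2) show ?thesis
    proof eventually_elim
      case (elim x)
      have d: "(g has_vector_derivative g' x) (at x)" "(h has_vector_derivative h' x) (at x)"
        using g2(1) h2(1) by (auto simp: AC2_def)
      have "(?W has_vector_derivative (cip (h x) (g'' x) + cip (h' x) (g' x)) - (cip (h' x) (g' x) + cip (h'' x) (g x))) (at x)"
        by (intro has_vector_derivative_diff cip_bl.has_vector_derivative elim d)
      moreover have "g'' x = Q x *v g x - f x - z *s g x"
        using elim(1) by (simp add: algebra_simps)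
      moreover have "h'' x = Q x *v h x - k x - cnj z *s h x"
        using elim(2) by (simp add: algebra_simps)
      moreover have "cip (Q x *v h x) (g x) = cip (h x) (Q x *v g x)" by (simp add: cip_adj' herm)
      ultimately show ?case
        by (simp add: cip_bl.diff_left cip_bl.diff_right cip_scale_left cip_scale_right)
    qed
  qed
  obtain S where S: "negligible S" "\<And>x. x \<notin> S \<Longrightarrow> (?W has_vector_derivative ?w x) (at x)"
    using AE by (rule AE_lebesgueE) blast
  have "(?w has_integral ?W n - ?W (- n)) {-n..n}"
  proof (rule AC_fundamental_theorem_of_calculus[OF _ _ S(1)])
    show "AC_on (- n) n ?W"
      using g2(1) h2(1) n by (intro AC_on_diff AC_on_prod[OF bounded_bilinear_cip]) (auto simp: AC2_def AC_loc_def)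
  qed (use S(2) n in \<open>auto intro: has_vector_derivative_at_within\<close>)
  moreover have "?W (- n) = 0" using left by (simp add: cip_bl.minus_left cip_bl.minus_right)
  ultimately have "(?w has_integral 0) {-n..n}" using right by simp
  then have "(?w has_integral 0) UNIV"
    by (rule has_integral_on_superset) (use supp in \<open>auto simp: cip_bl.zero_left cip_bl.zero_right\<close>)
  moreover have "integrable lebesgue ?w"
    by (intro Bochner_Integration.integrable_diff in_L2_cip_integrable fk gh)
  then have "(?w has_integral (LINT x|lebesgue. ?w x)) UNIV" by (rule has_integral_integral_lebesgue)
  ultimately have "(LINT x|lebesgue. ?w x) = 0" by (rule has_integral_unique[rotated])
  then show ?thesis
    by (simp add: ip_def in_L2_cip_integrable fk gh)
qed

lemma tendsto_ip:
  fixes h f :: "real \<Rightarrow> complex^'m"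
  assumes L: "in_L2 h" "in_L2 f" "\<And>n. in_L2 (H n)" "\<And>n. in_L2 (F n)"
    and H: "(\<lambda>n :: nat. L2_norm (\<lambda>x. h x - H n x)) \<longlonglongrightarrow> 0" and F: "(\<lambda>n. L2_norm (\<lambda>x. f x - F n x)) \<longlonglongrightarrow> 0"
  shows "(\<lambda>n. ip (H n) (F n)) \<longlonglongrightarrow> ip h f"
proof -
  let ?u = "\<lambda>n x. h x - H n x" and ?v = "\<lambda>n x. f x - F n x"
  have uv: "in_L2 (?u n)" "in_L2 (?v n)" for n by (intro in_L2_diff L)+
  have bd: "norm (ip (H n) (F n) - ip h f) \<le> L2_norm h * L2_norm (?v n) + L2_norm (?u n) * L2_norm f + L2_norm (?u n) * L2_norm (?v n)" for n
  proof -
    define a b c where "a = ip (?u n) (?v n)" and "b = ip h (?v n)" and "c = ip (?u n) f"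
    have "ip (H n) (F n) - ip h f = a - b - c"
      unfolding a_def b_def c_def by (simp add: ip_diff_left ip_diff_right L in_L2_diff)
    then have "norm (ip (H n) (F n) - ip h f) \<le> norm a + norm b + norm c"
      using norm_triangle_ineq4[of "a - b" c] norm_triangle_ineq4[of a b] by simp
    also have "norm a \<le> L2_norm (?u n) * L2_norm (?v n)" unfolding a_def by (rule ip_Cauchy_Schwarz[OF uv])
    also have "norm b \<le> L2_norm h * L2_norm (?v n)" unfolding b_def by (rule ip_Cauchy_Schwarz[OF L(1) uv(2)])
    also have "norm c \<le> L2_norm (?u n) * L2_norm f" unfolding c_def by (rule ip_Cauchy_Schwarz[OF uv(1) L(2)])
    finally show ?thesis by simp
  qed
  have "(\<lambda>n. L2_norm h * L2_norm (?v n) + L2_norm (?u n) * L2_norm f + L2_norm (?u n) * L2_norm (?v n))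
      \<longlonglongrightarrow> L2_norm h * 0 + 0 * L2_norm f + 0 * 0"
    by (intro tendsto_intros H F)
  then have "(\<lambda>n. L2_norm h * L2_norm (?v n) + L2_norm (?u n) * L2_norm f + L2_norm (?u n) * L2_norm (?v n)) \<longlonglongrightarrow> 0"
    by simp
  then have "(\<lambda>n. ip (H n) (F n) - ip h f) \<longlonglongrightarrow> 0"
    by (rule Lim_null_comparison[OF always_eventually, rotated]) (rule allI, rule bd)
  then show ?thesis by (simp add: LIM_zero_iff)
qed

text \<open>Boundedness of the resolvent turns approximation of (H - z) g by compactly supported
  functions into approximation of g itself.\<close>

lemma resolvent_truncation:
  assumes z: "z \<notin> complex_of_real ` {E0..}" and g: "(g, k) \<in> schroedinger_graph Q"
  obtains F G where "\<And>n :: nat. in_L2 (F n)" "\<And>n x. x \<notin> {- real n..real n} \<Longrightarrow> F n x = 0"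
    "\<And>n. (G n, \<lambda>x. F n x + z *s G n x) \<in> schroedinger_graph Q"
    "(\<lambda>n. L2_norm (\<lambda>x. (k x - z *s g x) - F n x)) \<longlonglongrightarrow> 0" "(\<lambda>n. L2_norm (\<lambda>x. g x - G n x)) \<longlonglongrightarrow> 0"
proof -
  let ?f = "\<lambda>x. k x - z *s g x"
  have f: "in_L2 ?f" using schroedinger_graphD[OF g] by (intro in_L2_diff in_L2_scale)
  define F where "F = (\<lambda>n :: nat. \<lambda>x. if x \<in> {- real n..real n} then ?f x else 0)"
  have F: "in_L2 (F n)" "(\<lambda>n. L2_norm (\<lambda>x. ?f x - F n x)) \<longlonglongrightarrow> 0" for n
    unfolding F_def by (rule truncation[OF f])+
  have "\<exists>G. (G, \<lambda>x. F n x + z *s G x) \<in> schroedinger_graph Q" for n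
    by (rule resolvent_solve[OF z F(1)]) blast
  then obtain G where G: "\<And>n. (G n, \<lambda>x. F n x + z *s G n x) \<in> schroedinger_graph Q" by metis
  obtain C where C: "C > 0" "\<And>g h. (g, h) \<in> schroedinger_graph Q \<Longrightarrow> L2_norm g \<le> C * L2_norm (\<lambda>x. h x - z *s g x)"
    using resolvent_bound[OF z] by blast
  have bd: "L2_norm (\<lambda>x. g x - G n x) \<le> C * L2_norm (\<lambda>x. ?f x - F n x)" for n
  proof -
    have e: "(\<lambda>x. (k x - (F n x + z *s G n x)) - z *s (g x - G n x)) = (\<lambda>x. ?f x - F n x)"
      by (simp add: cs_bl.diff_right algebra_simps)
    from C(2)[OF schroedinger_graph_diff[OF g G[of n]]] show ?thesis unfolding e .
  qed
  have "(\<lambda>n. C * L2_norm (\<lambda>x. ?f x - F n x)) \<longlonglongrightarrow> C * 0" by (intro tendsto_mult tendsto_const F(2))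
  then have "(\<lambda>n. C * L2_norm (\<lambda>x. ?f x - F n x)) \<longlonglongrightarrow> 0" by simp
  then have "(\<lambda>n. L2_norm (\<lambda>x. g x - G n x)) \<longlonglongrightarrow> 0"
    by (rule Lim_null_comparison[OF always_eventually, rotated]) (use bd in \<open>simp add: L2_norm_nonneg\<close>)
  then show ?thesis using F G by (intro that[of F G]) (auto simp: F_def)
qed

theorem symmetric:
  assumes g: "(g, g1) \<in> schroedinger_graph Q" and h: "(h, h1) \<in> schroedinger_graph Q"
  shows "ip h g1 = ip h1 g"
proof -
  \<comment> \<open>The points i and -i are used for g and h respectively, as the truncated identity
    pairs a point with its conjugate. In the limit the two terms i <h, g> cancel.\<close>
  have nr: "\<i> \<notin> complex_of_real ` {E0..}" "cnj \<i> \<notin> complex_of_real ` {E0..}" by (auto simp: complex_eq_iff)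
  obtain F G where FG: "\<And>n :: nat. in_L2 (F n)" "\<And>n x. x \<notin> {- real n..real n} \<Longrightarrow> F n x = 0"
    "\<And>n. (G n, \<lambda>x. F n x + \<i> *s G n x) \<in> schroedinger_graph Q"
    "(\<lambda>n. L2_norm (\<lambda>x. (g1 x - \<i> *s g x) - F n x)) \<longlonglongrightarrow> 0" "(\<lambda>n. L2_norm (\<lambda>x. g x - G n x)) \<longlonglongrightarrow> 0"
    by (rule resolvent_truncation[OF nr(1) g]) blast
  obtain K H where KH: "\<And>n :: nat. in_L2 (K n)" "\<And>n x. x \<notin> {- real n..real n} \<Longrightarrow> K n x = 0"
    "\<And>n. (H n, \<lambda>x. K n x + cnj \<i> *s H n x) \<in> schroedinger_graph Q"
    "(\<lambda>n. L2_norm (\<lambda>x. (h1 x - cnj \<i> *s h x) - K n x)) \<longlonglongrightarrow> 0" "(\<lambda>n. L2_norm (\<lambda>x. h x - H n x)) \<longlonglongrightarrow> 0"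
    by (rule resolvent_truncation[OF nr(2) h]) blast
  note L = schroedinger_graphD[OF g] schroedinger_graphD[OF h]
  have L': "in_L2 (\<lambda>x. g1 x - \<i> *s g x)" "in_L2 (\<lambda>x. h1 x - cnj \<i> *s h x)"
    by (intro in_L2_diff in_L2_scale L)+
  have 1: "(\<lambda>n. ip (H n) (F n)) \<longlonglongrightarrow> ip h (\<lambda>x. g1 x - \<i> *s g x)"
    by (rule tendsto_ip[OF L(3) L'(1) schroedinger_graphD(1)[OF KH(3)] FG(1) KH(5) FG(4)])
  have 2: "(\<lambda>n. ip (K n) (G n)) \<longlonglongrightarrow> ip (\<lambda>x. h1 x - cnj \<i> *s h x) g"
    by (rule tendsto_ip[OF L'(2) L(1) KH(1) schroedinger_graphD(1)[OF FG(3)] KH(4) FG(5)])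
  have "\<forall>\<^sub>F n in sequentially. ip (H n) (F n) = ip (K n) (G n)"
    using eventually_gt_at_top[of 0]
  proof eventually_elim
    case (elim n)
    show ?case
      by (rule symmetric_truncated[OF _ _ FG(1) KH(1) FG(2) KH(2) FG(3) KH(3), of "real n"]) (use elim in auto)
  qed
  from Lim_transform_eventually[OF 1 this] 2
  have "ip h (\<lambda>x. g1 x - \<i> *s g x) = ip (\<lambda>x. h1 x - cnj \<i> *s h x) g" by (rule LIMSEQ_unique)
  then have "ip h g1 - \<i> * ip h g = ip h1 g - cnj (cnj \<i>) * ip h g"
    by (simp only: ip_diff_right ip_diff_left ip_scale_right ip_scale_left L in_L2_scale)
  then show ?thesis by simp
qed

text \<open>Below the spectrum \<open>\<phi>(\<lambda>) = (f, (H - \<lambda>)\<^sup>-\<^sup>1 f)\<close> satisfies \<open>\<phi>' \<ge> \<phi>\<^sup>2 / \<parallel>f\<parallel>\<^sup>2\<close>; a negative value would make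
  \<open>-1/\<phi>\<close> reach \<open>0\<close> at a finite point to the left.\<close>

theorem lower_bound:
  assumes g: "(g, k) \<in> schroedinger_graph Q"
  shows "E0 * (L2_norm g)\<^sup>2 \<le> Re (ip g k)"
proof (rule ccontr)
  assume "\<not> E0 * (L2_norm g)\<^sup>2 \<le> Re (ip g k)"
  then have neg: "Re (ip g k) < E0 * (L2_norm g)\<^sup>2" by simp
  note Lg = schroedinger_graphD[OF g]
  have ng: "L2_norm g > 0"
  proof (rule ccontr)
    assume "\<not> L2_norm g > 0"
    then have "L2_norm g = 0" using L2_norm_nonneg[of g] by simp
    then have "ip g k = 0" using ip_Cauchy_Schwarz[OF Lg] by simp
    then show False using neg \<open>L2_norm g = 0\<close> by simp
  qed
  define \<mu> where "\<mu> = Re (ip g k) / (L2_norm g)\<^sup>2"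
  \<comment> \<open>A point strictly between the Rayleigh quotient \<mu> of g and E0. For f = (H -
    l0) g one has \<phi>(l0) = (\<mu> - l0) |g|^2 < 0.\<close>
  define l0 where "l0 = (\<mu> + E0) / 2"
  have "\<mu> < E0" using neg ng by (simp add: \<mu>_def field_simps)
  then have l0: "\<mu> < l0" "l0 < E0" by (auto simp: l0_def)
  define f where "f = (\<lambda>x. k x - complex_of_real l0 *s g x)"
  have Lf: "in_L2 f" unfolding f_def by (intro in_L2_diff in_L2_scale Lg)
  have res: "complex_of_real l \<notin> complex_of_real ` {E0..}" if "l < E0" for l using that by auto
  have "\<exists>G. (G, \<lambda>x. f x + complex_of_real l *s G x) \<in> schroedinger_graph Q" if "l < E0" for l
    by (rule resolvent_solve[OF res[OF that] Lf]) blast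
  then obtain G where G: "\<And>l. l < E0 \<Longrightarrow> (G l, \<lambda>x. f x + complex_of_real l *s G l x) \<in> schroedinger_graph Q" by metis
  have LG: "in_L2 (G l)" if "l < E0" for l using schroedinger_graphD[OF G[OF that]] by simp
  have G0: "G l0 = g"
  proof (rule resolvent_unique[OF res[OF l0(2)] Lf G[OF l0(2)]])
    have "(\<lambda>x. f x + complex_of_real l0 *s g x) = k" by (simp add: f_def)
    then show "(g, \<lambda>x. f x + complex_of_real l0 *s g x) \<in> schroedinger_graph Q" using g by simp
  qed
  define \<phi> where "\<phi> l = Re (ip f (G l))" for l
  \<comment> \<open>The first resolvent identity in weak form, obtained from symmetry alone.\<close>
  have diff: "\<phi> l' - \<phi> l = (l' - l) * Re (ip (G l) (G l'))" if "l < E0" "l' < E0" for l l'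
  proof -
    have "ip (G l) (\<lambda>x. f x + complex_of_real l' *s G l' x) = ip (\<lambda>x. f x + complex_of_real l *s G l x) (G l')"
      by (rule symmetric[OF G[OF that(2)] G[OF that(1)]])
    then have "ip (G l) f + l' * ip (G l) (G l') = ip f (G l') + l * ip (G l) (G l')"
      using LG[OF that(1)] LG[OF that(2)] Lf
      by (simp add: ip_add_left ip_add_right in_L2_scale ip_scale_left ip_scale_right)
    then have "Re (ip (G l) f + l' * ip (G l) (G l')) = Re (ip f (G l') + l * ip (G l) (G l'))" by simp
    moreover have "Re (ip (G l) f) = Re (ip f (G l))" using cnj_ip[of "G l" f] by (metis cnj.sel(1))
    ultimately show ?thesis by (simp add: \<phi>_def algebra_simps)
  qed
  have der: "(\<phi> has_real_derivative (L2_norm (G l))\<^sup>2) (at l)" if l: "l < E0" for l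
  proof -
    obtain C where C: "C > 0" "\<And>g h. (g, h) \<in> schroedinger_graph Q \<Longrightarrow> L2_norm g \<le> C * L2_norm (\<lambda>x. h x - complex_of_real l *s g x)"
      using resolvent_bound[OF res[OF l]] by blast
    let ?B = "2 * C * L2_norm (G l) * L2_norm (G l)"
    \<comment> \<open>The resolvent bound at l is applied to the difference of the two solutions.
      The restriction C |l' - l| \<le> 1/2 allows half of its norm to be absorbed on the
      left.\<close>
    have bound: "\<bar>(\<phi> l' - \<phi> l) / (l' - l) - (L2_norm (G l))\<^sup>2\<bar> \<le> ?B * \<bar>l' - l\<bar>"
      if l': "l' < E0" "l' \<noteq> l" "C * \<bar>l' - l\<bar> \<le> 1 / 2" for l'
    proof -
      let ?u = "\<lambda>x. G l' x - G l x"
      have Lu: "in_L2 ?u" by (intro in_L2_diff LG l l'(1))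
      have e: "(\<lambda>x. (f x + complex_of_real l' *s G l' x - (f x + complex_of_real l *s G l x)) - complex_of_real l *s (G l' x - G l x))
          = (\<lambda>x. complex_of_real (l' - l) *s G l' x)"
        by (simp add: cs_bl.diff_right cs_bl.diff_left algebra_simps)
      from C(2)[OF schroedinger_graph_diff[OF G[OF l'(1)] G[OF l]]]
      have "L2_norm ?u \<le> C * L2_norm (\<lambda>x. complex_of_real (l' - l) *s G l' x)" unfolding e .
      also have "\<dots> = C * \<bar>l' - l\<bar> * L2_norm (G l')" by (simp only: L2_norm_scale norm_of_real mult.assoc)
      also have "L2_norm (G l') \<le> L2_norm ?u + L2_norm (G l)"
        using L2_norm_triangle[OF Lu LG[OF l]] by simp
      finally have 1: "L2_norm ?u \<le> C * \<bar>l' - l\<bar> * (L2_norm ?u + L2_norm (G l))"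
        using C(1) by (simp add: mult_left_mono)
      also have "\<dots> \<le> (1/2) * L2_norm ?u + C * \<bar>l' - l\<bar> * L2_norm (G l)"
        using mult_right_mono[OF l'(3) L2_norm_nonneg[of ?u]] by (simp add: algebra_simps)
      finally have u: "L2_norm ?u \<le> 2 * C * \<bar>l' - l\<bar> * L2_norm (G l)" by simp
      have "ip (G l) (G l') = ip (G l) (G l) + ip (G l) ?u"
        using LG[OF l] LG[OF l'(1)] by (simp add: ip_diff_right)
      then have "(\<phi> l' - \<phi> l) / (l' - l) - (L2_norm (G l))\<^sup>2 = Re (ip (G l) ?u)"
        using diff[OF l l'(1)] l'(2) by (simp add: ip_self del: of_real_power)
      also have "\<bar>\<dots>\<bar> \<le> L2_norm (G l) * L2_norm ?u"
        using order_trans[OF abs_Re_le_cmod ip_Cauchy_Schwarz[OF LG[OF l] Lu]] .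
      also have "\<dots> \<le> L2_norm (G l) * (2 * C * \<bar>l' - l\<bar> * L2_norm (G l))"
        by (intro mult_left_mono u L2_norm_nonneg)
      finally show ?thesis by (simp add: mult_ac)
    qed
    have "((\<lambda>l'. (\<phi> l' - \<phi> l) / (l' - l) - (L2_norm (G l))\<^sup>2) \<longlongrightarrow> 0) (at l)"
    proof (rule Lim_null_comparison)
      have "((\<lambda>l'. ?B * \<bar>l' - l\<bar>) \<longlongrightarrow> ?B * \<bar>l - l\<bar>) (at l)" by (intro tendsto_intros)
      then show "((\<lambda>l'. ?B * \<bar>l' - l\<bar>) \<longlongrightarrow> 0) (at l)" by simp
      have "\<forall>\<^sub>F l' in at l. dist l' l < min (E0 - l) (1 / (2 * C))"
        using l C(1) by (auto simp: eventually_at intro!: exI[of _ "min (E0 - l) (1 / (2 * C))"])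
      then show "\<forall>\<^sub>F l' in at l. norm ((\<phi> l' - \<phi> l) / (l' - l) - (L2_norm (G l))\<^sup>2) \<le> ?B * \<bar>l' - l\<bar>"
        using eventually_neq_at_within[of l l UNIV]
      proof eventually_elim
        case (elim l')
        have "C * \<bar>l' - l\<bar> \<le> C * (1 / (2 * C))" using elim(1) C(1) by (intro mult_left_mono) (auto simp: dist_real_def)
        then have "C * \<bar>l' - l\<bar> \<le> 1 / 2" using C(1) by simp
        moreover have "l' < E0" using elim(1) by (auto simp: dist_real_def)
        ultimately show ?case using bound[of l'] elim(2) by simp
      qed
    qed
    then show ?thesis unfolding has_field_derivative_iff by (simp add: LIM_zero_iff)
  qed
  have CS: "(\<phi> l)\<^sup>2 \<le> (L2_norm f)\<^sup>2 * (L2_norm (G l))\<^sup>2" if "l < E0" for l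
  proof -
    have "\<bar>\<phi> l\<bar> \<le> L2_norm f * L2_norm (G l)"
      unfolding \<phi>_def by (rule order_trans[OF abs_Re_le_cmod ip_Cauchy_Schwarz[OF Lf LG[OF that]]])
    then have "\<bar>\<phi> l\<bar>\<^sup>2 \<le> (L2_norm f * L2_norm (G l))\<^sup>2" by (intro power_mono) auto
    then show ?thesis by (simp add: power_mult_distrib)
  qed
  have \<phi>0: "\<phi> l0 < 0"
  proof -
    have "ip f g = ip k g - l0 * ip g g"
      unfolding f_def using Lg by (simp add: ip_diff_left in_L2_scale ip_scale_left)
    then have "\<phi> l0 = Re (ip k g) - l0 * (L2_norm g)\<^sup>2" by (simp add: \<phi>_def G0 ip_self del: of_real_power)
    also have "Re (ip k g) = Re (ip g k)" using cnj_ip[of k g] by (metis cnj.sel(1))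
    also have "\<dots> = \<mu> * (L2_norm g)\<^sup>2" using ng by (simp add: \<mu>_def)
    finally have "\<phi> l0 = (\<mu> - l0) * (L2_norm g)\<^sup>2" by (simp add: algebra_simps)
    then show ?thesis using l0 ng by (simp add: mult_neg_pos)
  qed
  have \<phi>neg: "\<phi> l < 0" if "l \<le> l0" for l
  proof -
    have "\<phi> l \<le> \<phi> l0"
    proof (rule DERIV_nonneg_imp_nondecreasing[OF that])
      fix s assume "s \<le> l0"
      then have "s < E0" using l0 by simp
      from der[OF this] show "\<exists>y. (\<phi> has_real_derivative y) (at s) \<and> 0 \<le> y" by (intro exI conjI) auto
    qed
    then show ?thesis using \<phi>0 by simp
  qed
  have nf: "(L2_norm f)\<^sup>2 > 0"
  proof -
    have "0 < (\<phi> l0)\<^sup>2" using \<phi>0 by simp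
    also have "\<dots> \<le> (L2_norm f)\<^sup>2 * (L2_norm (G l0))\<^sup>2" by (rule CS[OF l0(2)])
    finally show ?thesis by (simp add: zero_less_mult_iff)
  qed
  define \<kappa> where "\<kappa> = 1 / (L2_norm f)\<^sup>2"
  have "\<kappa> > 0" using nf by (simp add: \<kappa>_def)
  \<comment> \<open>The distance to the left of \<open>l0\<close> at which -1/\<phi>, whose slope is
    at least \<kappa>, must have come down to 0.\<close>
  define l where "l = l0 - (- 1 / \<phi> l0) / \<kappa>"
  have "- 1 / \<phi> l0 > 0" using \<phi>0 by (intro divide_neg_neg) simp_all
  then have "(- 1 / \<phi> l0) / \<kappa> > 0" using \<open>\<kappa> > 0\<close> by (rule divide_pos_pos)
  then have l: "l \<le> l0" unfolding l_def by linarith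
  have "- 1 / \<phi> l - \<kappa> * l \<le> - 1 / \<phi> l0 - \<kappa> * l0"
  proof (rule DERIV_nonneg_imp_nondecreasing[OF l])
    fix s assume s: "l \<le> s" "s \<le> l0"
    have n: "\<phi> s < 0" using s \<phi>neg by simp
    have "((\<lambda>l. - 1 / \<phi> l - \<kappa> * l) has_real_derivative (L2_norm (G s))\<^sup>2 / (\<phi> s)\<^sup>2 - \<kappa>) (at s)"
      using der[of s] s l0 n by (auto intro!: derivative_eq_intros simp: power2_eq_square)
    moreover have "\<kappa> \<le> (L2_norm (G s))\<^sup>2 / (\<phi> s)\<^sup>2"
      using CS[of s] s l0 n nf by (simp add: \<kappa>_def field_simps)
    ultimately show "\<exists>y. ((\<lambda>l. - 1 / \<phi> l - \<kappa> * l) has_real_derivative y) (at s) \<and> 0 \<le> y" by force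
  qed
  moreover have "\<kappa> * l = \<kappa> * l0 - (- 1 / \<phi> l0)" using \<open>\<kappa> > 0\<close> \<phi>0 by (simp add: l_def field_simps)
  ultimately have "- 1 / \<phi> l \<le> 0" by simp
  then show False using \<phi>neg[OF l] by (simp add: divide_le_0_iff)
qed

end

subsection \<open>The quadratic form of the Green matrix\<close>

definition loclip :: "(real \<Rightarrow> 'a::real_normed_vector) \<Rightarrow> bool" where
  "loclip f \<longleftrightarrow> (\<forall>T. \<exists>L. \<forall>s t. \<bar>s\<bar> \<le> T \<longrightarrow> \<bar>t\<bar> \<le> T \<longrightarrow> s < t \<longrightarrow> norm (f t - f s) \<le> L * (t - s))"

text \<open>The regularity produced by gluing solutions with matching values and slopes: the second
  derivative may jump at finitely many points. The local Lipschitz condition on u' is stable under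
  gluing and gives the absolute continuity required of the domain.\<close>

definition piecewise_C2 ::
  "(real \<Rightarrow> 'a::real_normed_vector) \<Rightarrow> (real \<Rightarrow> 'a) \<Rightarrow> (real \<Rightarrow> 'a) \<Rightarrow> bool" where
  "piecewise_C2 u u' u'' \<longleftrightarrow> (\<forall>x. (u has_vector_derivative u' x) (at x)) \<and> loclip u' \<and>
     (\<exists>S. finite S \<and> (\<forall>x. x \<notin> S \<longrightarrow> (u' has_vector_derivative u'' x) (at x)))"

lemma C1_loclip:
  fixes f :: "real \<Rightarrow> 'a::real_normed_vector"
  assumes der: "\<And>x. (f has_vector_derivative f' x) (at x)" and cont: "continuous_on UNIV f'"
  shows "loclip f"
  unfolding loclip_def
proof
  fix T :: real
  have "bounded (f' ` {-T..T})"
    by (intro compact_imp_bounded compact_continuous_image continuous_on_subset[OF cont]) auto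
  then obtain L where L: "L > 0" "\<And>y. y \<in> {-T..T} \<Longrightarrow> norm (f' y) \<le> L" by (auto simp: bounded_pos)
  have "norm (f t - f s) \<le> L * (t - s)" if "\<bar>s\<bar> \<le> T" "\<bar>t\<bar> \<le> T" "s < t" for s t
  proof -
    have "norm (f t - f s) \<le> L * t - L * s"
    proof (rule differentiable_bound_general[OF that(3)])
      show "continuous_on {s..t} f"
        by (intro continuous_at_imp_continuous_on ballI has_vector_derivative_continuous[OF der])
      show "((\<lambda>x. L * x) has_vector_derivative L) (at x)" for x
        by (auto intro!: derivative_eq_intros simp: has_real_derivative_iff_has_vector_derivative[symmetric])
      show "norm (f' x) \<le> L" if "s < x" "x < t" for x
        using L(2)[of x] that \<open>\<bar>s\<bar> \<le> T\<close> \<open>\<bar>t\<bar> \<le> T\<close> by (simp add: abs_le_iff)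
    qed (auto intro!: continuous_intros der)
    then show ?thesis by (simp add: algebra_simps)
  qed
  then show "\<exists>L. \<forall>s t. \<bar>s\<bar> \<le> T \<longrightarrow> \<bar>t\<bar> \<le> T \<longrightarrow> s < t \<longrightarrow> norm (f t - f s) \<le> L * (t - s)" by blast
qed

lemma loclip_AC_loc:
  fixes f :: "real \<Rightarrow> 'a::real_normed_vector"
  assumes "loclip f"
  shows "AC_loc f"
  unfolding AC_loc_def
proof (intro allI impI)
  fix a b :: real assume "a < b"
  obtain L where L: "\<And>s t. \<bar>s\<bar> \<le> \<bar>a\<bar> + \<bar>b\<bar> \<Longrightarrow> \<bar>t\<bar> \<le> \<bar>a\<bar> + \<bar>b\<bar> \<Longrightarrow> s < t \<Longrightarrow> norm (f t - f s) \<le> L * (t - s)"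
    using assms unfolding loclip_def by blast
  show "AC_on a b f"
    by (rule lipschitz_imp_AC_on[of a b f L]) (rule L, auto simp: abs_real_def split: if_splits)
qed

lemma loclip_glue:
  fixes f g :: "real \<Rightarrow> 'a::real_normed_vector"
  assumes f: "loclip f" and g: "loclip g" and c: "f c = g c"
  shows "loclip (\<lambda>x. if x < c then f x else g x)"
  unfolding loclip_def
proof
  fix T :: real
  let ?T = "max T \<bar>c\<bar>"
  obtain L1 where L1: "\<And>s t. \<bar>s\<bar> \<le> ?T \<Longrightarrow> \<bar>t\<bar> \<le> ?T \<Longrightarrow> s < t \<Longrightarrow> norm (f t - f s) \<le> L1 * (t - s)"
    using f unfolding loclip_def by blast
  obtain L2 where L2: "\<And>s t. \<bar>s\<bar> \<le> ?T \<Longrightarrow> \<bar>t\<bar> \<le> ?T \<Longrightarrow> s < t \<Longrightarrow> norm (g t - g s) \<le> L2 * (t - s)"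
    using g unfolding loclip_def by blast
  define L where "L = max L1 L2"
  have L1': "norm (f t - f s) \<le> L * (t - s)" if "\<bar>s\<bar> \<le> ?T" "\<bar>t\<bar> \<le> ?T" "s < t" for s t
    by (rule order_trans[OF L1[OF that]]) (use that in \<open>auto simp: L_def intro!: mult_right_mono\<close>)
  have L2': "norm (g t - g s) \<le> L * (t - s)" if "\<bar>s\<bar> \<le> ?T" "\<bar>t\<bar> \<le> ?T" "s \<le> t" for s t
  proof (cases "s = t")
    case False
    then have "s < t" using that by simp
    show ?thesis
      by (rule order_trans[OF L2[OF that(1,2) \<open>s < t\<close>]]) (use that in \<open>auto simp: L_def intro!: mult_right_mono\<close>)
  qed simp
  let ?h = "\<lambda>x. if x < c then f x else g x"
  have "norm (?h t - ?h s) \<le> L * (t - s)" if st: "\<bar>s\<bar> \<le> T" "\<bar>t\<bar> \<le> T" "s < t" for s t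
  proof -
    consider "t < c" | "s < c" "c \<le> t" | "c \<le> s" by linarith
    then show ?thesis
    proof cases
      case 1
      then show ?thesis using L1'[of s t] st by simp
    next
      case 2
      have "norm (g t - f s) \<le> norm (g t - g c) + norm (f c - f s)"
        using norm_triangle_ineq[of "g t - g c" "f c - f s"] c by simp
      also have "\<dots> \<le> L * (t - c) + L * (c - s)" using L1'[of s c] L2'[of c t] 2 st by (intro add_mono) auto
      finally show ?thesis using 2 by (simp add: algebra_simps)
    next
      case 3
      then show ?thesis using L2'[of s t] st by simp
    qed
  qed
  then show "\<exists>L. \<forall>s t. \<bar>s\<bar> \<le> T \<longrightarrow> \<bar>t\<bar> \<le> T \<longrightarrow> s < t \<longrightarrow> norm (?h t - ?h s) \<le> L * (t - s)" by blast
qed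

lemma has_vector_derivative_glue:
  fixes f g :: "real \<Rightarrow> 'a::real_normed_vector"
  assumes f: "(f has_vector_derivative d) (at c)" and g: "(g has_vector_derivative d) (at c)" and c: "f c = g c"
  shows "((\<lambda>x. if x < c then f x else g x) has_vector_derivative d) (at c)"
  unfolding has_vector_derivative_def has_derivative_at_alt
proof (intro conjI allI impI)
  show "bounded_linear (\<lambda>x. x *\<^sub>R d)" by (rule bounded_linear_scaleR_left)
  fix e :: real assume "e > 0"
  obtain d1 where d1: "d1 > 0" "\<And>y. norm (y - c) < d1 \<Longrightarrow> norm (f y - f c - (y - c) *\<^sub>R d) \<le> e * norm (y - c)"
    using f \<open>e > 0\<close> unfolding has_vector_derivative_def has_derivative_at_alt by blast
  obtain d2 where d2: "d2 > 0" "\<And>y. norm (y - c) < d2 \<Longrightarrow> norm (g y - g c - (y - c) *\<^sub>R d) \<le> e * norm (y - c)"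
    using g \<open>e > 0\<close> unfolding has_vector_derivative_def has_derivative_at_alt by blast
  show "\<exists>\<delta>>0. \<forall>y. norm (y - c) < \<delta> \<longrightarrow> norm ((if y < c then f y else g y) - (if c < c then f c else g c) - (y - c) *\<^sub>R d) \<le> e * norm (y - c)"
  proof (intro exI[of _ "min d1 d2"] conjI allI impI)
    fix y assume "norm (y - c) < min d1 d2"
    then show "norm ((if y < c then f y else g y) - (if c < c then f c else g c) - (y - c) *\<^sub>R d) \<le> e * norm (y - c)"
      using d1(2)[of y] d2(2)[of y] c by (cases "y < c") simp_all
  qed (use d1(1) d2(1) in simp)
qed

lemma piecewise_C2_glue:
  fixes f g :: "real \<Rightarrow> 'a::real_normed_vector"
  assumes f: "piecewise_C2 f f' f''" and g: "piecewise_C2 g g' g''" and c: "f c = g c" "f' c = g' c"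
  shows "piecewise_C2 (\<lambda>x. if x < c then f x else g x) (\<lambda>x. if x < c then f' x else g' x) (\<lambda>x. if x < c then f'' x else g'' x)"
proof -
  have away: "((\<lambda>x. if x < c then p x else q x) has_vector_derivative (if x < c then p' else q')) (at x)"
    if "x \<noteq> c" "x < c \<Longrightarrow> (p has_vector_derivative p') (at x)" "x > c \<Longrightarrow> (q has_vector_derivative q') (at x)"
    for p q :: "real \<Rightarrow> 'a" and p' q' x
  proof (cases "x < c")
    case True
    show ?thesis using True that(2)[OF True]
      by (auto intro: has_vector_derivative_transform_within_open[of _ _ _ "{..<c}"])
  next
    case False
    then have "x > c" using that(1) by simp
    then show ?thesis using that(3)
      by (auto intro: has_vector_derivative_transform_within_open[of _ _ _ "{c<..}"])
  qed
  obtain S1 S2 where S: "finite S1" "\<And>x. x \<notin> S1 \<Longrightarrow> (f' has_vector_derivative f'' x) (at x)"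
    "finite S2" "\<And>x. x \<notin> S2 \<Longrightarrow> (g' has_vector_derivative g'' x) (at x)"
    using f g unfolding piecewise_C2_def by blast
  have "((\<lambda>x. if x < c then f x else g x) has_vector_derivative (if x < c then f' x else g' x)) (at x)" for x
  proof (cases "x = c")
    case True
    have "(f has_vector_derivative f' c) (at c)" using f by (simp add: piecewise_C2_def)
    moreover have "(g has_vector_derivative f' c) (at c)" using g c by (simp add: piecewise_C2_def)
    ultimately have "((\<lambda>x. if x < c then f x else g x) has_vector_derivative f' c) (at c)"
      using c(1) by (rule has_vector_derivative_glue)
    then show ?thesis using c(2) by (simp add: True)
  next
    case False
    then show ?thesis using f g by (intro away) (auto simp: piecewise_C2_def)
  qed
  moreover have "loclip (\<lambda>x. if x < c then f' x else g' x)"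
    using f g c by (intro loclip_glue) (auto simp: piecewise_C2_def)
  moreover have "((\<lambda>x. if x < c then f' x else g' x) has_vector_derivative (if x < c then f'' x else g'' x)) (at x)"
    if "x \<notin> S1 \<union> S2 \<union> {c}" for x
    using that S by (intro away) auto
  then have "\<exists>S. finite S \<and> (\<forall>x. x \<notin> S \<longrightarrow> ((\<lambda>x. if x < c then f' x else g' x) has_vector_derivative (if x < c then f'' x else g'' x)) (at x))"
    using S(1,3) by (intro exI[of _ "S1 \<union> S2 \<union> {c}"]) auto
  ultimately show ?thesis unfolding piecewise_C2_def by blast
qed

lemma piecewise_C2_AC2:
  assumes "piecewise_C2 u u' u''"
  shows "AC2 u u' u''"
  unfolding AC2_def
proof (intro conjI allI)
  have u: "\<And>x. (u has_vector_derivative u' x) (at x)" "loclip u'" using assms by (auto simp: piecewise_C2_def)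
  show "(u has_vector_derivative u' x) (at x)" for x by (rule u)
  show AC: "AC_loc u'" by (rule loclip_AC_loc[OF u(2)])
  show "AC_loc u" by (rule C1_imp_AC_loc[OF u(1) AC_loc_imp_continuous_on[OF AC]])
  obtain S where "finite S" "\<And>x. x \<notin> S \<Longrightarrow> (u' has_vector_derivative u'' x) (at x)"
    using assms by (auto simp: piecewise_C2_def)
  then show "AE x in lebesgue. (u' has_vector_derivative u'' x) (at x)"
    by (intro AE_I'[of S]) (auto simp: negligible_iff_null_sets[symmetric] negligible_finite)
qed

lemma vector_sol_piecewise_C2:
  assumes Q: "continuous_on UNIV Q" and u: "vector_sol Q z u u'"
  shows "piecewise_C2 u u' (\<lambda>x. Q x *v u x - z *s u x)"
  unfolding piecewise_C2_def
proof (intro conjI)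
  have "continuous_on UNIV (\<lambda>x. Q x *v u x - z *s u x)"
    by (intro continuous_intros mv.continuous_on Q vector_solD[OF u] bounded_linear.continuous_on[OF cs_bl.bounded_linear_right])
  then show "loclip u'" by (rule C1_loclip[OF vector_solD(2)[OF u]])
qed (use vector_solD[OF u] in auto)

lemma L2p_cong_tail:
  fixes u v :: "real \<Rightarrow> complex^'m"
  assumes "L2p u" and c: "continuous_on UNIV u" "continuous_on UNIV v" and eq: "\<And>x. x \<ge> a \<Longrightarrow> v x = u x"
  shows "L2p v"
proof -
  obtain B where B: "\<And>R. R \<ge> 0 \<Longrightarrow> integral {0..R} (\<lambda>x. (norm (u x))\<^sup>2) \<le> B" using assms(1) by (auto simp: L2p_def)
  have int: "(\<lambda>x. (norm (u x))\<^sup>2) integrable_on {s..t}" for s t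
    by (intro integrable_continuous_real continuous_intros continuous_on_subset[OF c(1)]) auto
  show ?thesis
  proof (rule L2p_from[OF c(2), of "\<bar>a\<bar>" B])
    fix R assume R: "R \<ge> \<bar>a\<bar>"
    have "integral {\<bar>a\<bar>..R} (\<lambda>x. (norm (v x))\<^sup>2) = integral {\<bar>a\<bar>..R} (\<lambda>x. (norm (u x))\<^sup>2)"
      by (rule Henstock_Kurzweil_Integration.integral_cong) (use eq in auto)
    also have "\<dots> \<le> integral {0..R} (\<lambda>x. (norm (u x))\<^sup>2)" by (intro integral_subset_le int) auto
    also have "\<dots> \<le> B" using R by (intro B) auto
    finally show "integral {\<bar>a\<bar>..R} (\<lambda>x. (norm (v x))\<^sup>2) \<le> B" .
  qed
qed

lemma continuous_glue:
  fixes f g :: "real \<Rightarrow> 'a::real_normed_vector"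
  assumes "continuous_on UNIV f" "continuous_on UNIV g" "f c = g c"
  shows "continuous_on UNIV (\<lambda>x. if x < c then f x else g x)"
proof -
  have "(\<lambda>x. if x < c then f x else g x) = (\<lambda>x. f (min x c) + g (max x c) - f c)"
    using assms(3) by (auto simp: fun_eq_iff min_def max_def)
  then show ?thesis
    by (simp only:) (intro continuous_intros continuous_on_compose2[OF assms(1)] continuous_on_compose2[OF assms(2)]; simp)
qed

section \<open>Cutting off the glued Weyl solutions\<close>

context schroedinger
begin

text \<open>\<open>g0\<close> joins the Weyl solutions at \<open>x0\<close> and has the jump
  \<open>J\<close> in its slope. The correction \<open>k\<close>, supported on [x0, x0 + \<delta>],
  makes the slope continuous, so g = g0 + k is in the domain and (H - z) g is supported on that
  short interval. \<open>H \<delta>\<close> is the integrand of <g, (H - z) g> after rescaling the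
  interval to [0, 1]. Symmetry and the lower bound evaluate the same pairing on the right-hand
  side.\<close>

lemma cutoff_quadratic_form:
  fixes u v u' v' :: "real \<Rightarrow> complex^'m" and \<delta> :: real
  assumes u: "vector_sol Q z u u'" "L2p u" and v: "vector_sol Q z v v'" "L2p (\<lambda>x. v (- x))"
    and uv: "u x0 = v x0" and \<delta>: "0 < \<delta>" "\<delta> \<le> 1"
  defines "J \<equiv> v' x0 - u' x0"
  defines "H \<equiv> \<lambda>\<delta> t. cip (u (x0 + \<delta> * t) + (\<delta> * (t * (1 - t)\<^sup>2)) *\<^sub>R J)
      ((4 - 6 * t) *\<^sub>R J + (\<delta>\<^sup>2 * (t * (1 - t)\<^sup>2)) *\<^sub>R (Q (x0 + \<delta> * t) *v J - z *s J))"
    and "g0 \<equiv> \<lambda>x. if x < x0 then v x else u x"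
  shows "\<exists>k. in_L2 (\<lambda>x. g0 x + k x) \<and> in_L2 g0 \<and> k \<in> borel_measurable lebesgue \<and> (\<forall>x. norm (k x) \<le> \<delta> * norm J) \<and> (\<forall>x. x \<notin> {x0..x0+1} \<longrightarrow> k x = 0) \<and>
    (\<exists>s\<ge>0. integral {0..1} (H \<delta>) = of_real s - (z - of_real E0) * of_real ((L2_norm (\<lambda>x. g0 x + k x))\<^sup>2))"
proof -
  \<comment> \<open>The cubic with q(0) = 0, q'(0) = 1 and q(1) = q'(1) = 0: it removes the jump at
    \<open>x0\<close> and ends smoothly to first order. The scaled bump has height at most \<delta>
    |J|, while its second derivative, of size 1/\<delta>, carries the jump.\<close>
  define q q' where "q t = t * (1 - t)\<^sup>2" and "q' t = (1 - t) * (1 - 3 * t)" for t :: real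
  have dq: "(q has_real_derivative q' t) (at t)" "(q' has_real_derivative 6 * t - 4) (at t)" for t
    unfolding q_def[abs_def] q'_def[abs_def]
    by (auto intro!: derivative_eq_intros simp: power2_eq_square algebra_simps)
  define K K' K'' where "K y = (\<delta> * q ((y - x0) / \<delta>)) *\<^sub>R J" and "K' y = q' ((y - x0) / \<delta>) *\<^sub>R J"
    and "K'' y = ((6 * ((y - x0) / \<delta>) - 4) / \<delta>) *\<^sub>R J" for y
  have aff: "((\<lambda>y. (y - x0) / \<delta>) has_real_derivative 1 / \<delta>) (at y)" for y
    using \<delta> by (auto intro!: derivative_eq_intros)
  have dK: "(K has_vector_derivative K' y) (at y)" for y
  proof -
    have "((\<lambda>y. \<delta> * q ((y - x0) / \<delta>)) has_real_derivative \<delta> * (q' ((y - x0) / \<delta>) * (1 / \<delta>))) (at y)"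
      by (intro DERIV_cmult DERIV_chain2[OF dq(1) aff])
    then have "((\<lambda>y. \<delta> * q ((y - x0) / \<delta>)) has_vector_derivative q' ((y - x0) / \<delta>)) (at y)"
      using \<delta> by (simp add: has_real_derivative_iff_has_vector_derivative)
    from bounded_linear.has_vector_derivative[OF bounded_linear_scaleR_left this, of J]
    show ?thesis unfolding K_def[abs_def] K'_def by simp
  qed
  have dK': "(K' has_vector_derivative K'' y) (at y)" for y
  proof -
    have "((\<lambda>y. q' ((y - x0) / \<delta>)) has_real_derivative (6 * ((y - x0) / \<delta>) - 4) * (1 / \<delta>)) (at y)"
      by (intro DERIV_chain2[OF dq(2) aff])
    then have "((\<lambda>y. q' ((y - x0) / \<delta>)) has_vector_derivative (6 * ((y - x0) / \<delta>) - 4) / \<delta>) (at y)"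
      by (simp add: has_real_derivative_iff_has_vector_derivative)
    from bounded_linear.has_vector_derivative[OF bounded_linear_scaleR_left this, of J]
    show ?thesis unfolding K'_def[abs_def] K''_def by simp
  qed
  have Kc: "continuous_on UNIV K" "continuous_on UNIV K'" 
    using dK dK' by (auto intro!: continuous_at_imp_continuous_on intro: has_vector_derivative_continuous)
  have K''c: "continuous_on UNIV K''" unfolding K''_def[abs_def] by (intro continuous_intros) (use \<delta> in auto)
  have uc: "continuous_on UNIV u" and vc: "continuous_on UNIV v" using vector_solD u(1) v(1) by blast+
  have pK: "piecewise_C2 K K' K''" unfolding piecewise_C2_def
    using dK dK' C1_loclip[OF dK' K''c] by auto
  have add: "piecewise_C2 (\<lambda>x. u x + K x) (\<lambda>x. u' x + K' x) (\<lambda>x. (Q x *v u x - z *s u x) + K'' x)"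
  proof -
    have c: "continuous_on UNIV (\<lambda>x. (Q x *v u x - z *s u x) + K'' x)"
      by (intro continuous_intros mv.continuous_on cont uc K''c bounded_linear.continuous_on[OF cs_bl.bounded_linear_right])
    have d: "((\<lambda>x. u' x + K' x) has_vector_derivative (Q x *v u x - z *s u x) + K'' x) (at x)" for x
      by (intro has_vector_derivative_add vector_solD[OF u(1)] dK')
    show ?thesis unfolding piecewise_C2_def
      using C1_loclip[OF d c] d by (auto intro!: has_vector_derivative_add vector_solD[OF u(1)] dK)
  qed
  have end0: "K x0 = 0" "K' x0 = J" "K (x0 + \<delta>) = 0" "K' (x0 + \<delta>) = 0"
    using \<delta> by (simp_all add: K_def K'_def q_def q'_def)
  define k where "k x = (if x \<in> {x0..x0 + \<delta>} then K x else 0)" for x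
  define g where "g x = g0 x + k x" for x
  define g' where "g' x = (if x < x0 then v' x else if x < x0 + \<delta> then u' x + K' x else u' x)" for x
  define g'' where "g'' x = (if x < x0 then Q x *v v x - z *s v x else
      if x < x0 + \<delta> then (Q x *v u x - z *s u x) + K'' x else Q x *v u x - z *s u x)" for x
  have g_eq: "g = (\<lambda>x. if x < x0 then v x else if x < x0 + \<delta> then u x + K x else u x)"
    using end0 by (auto simp: g_def g0_def k_def fun_eq_iff)
  have "piecewise_C2 (\<lambda>x. if x < x0 + \<delta> then u x + K x else u x) (\<lambda>x. if x < x0 + \<delta> then u' x + K' x else u' x)
      (\<lambda>x. if x < x0 + \<delta> then (Q x *v u x - z *s u x) + K'' x else Q x *v u x - z *s u x)"
    by (rule piecewise_C2_glue[OF add vector_sol_piecewise_C2[OF cont u(1)]]) (use end0 in auto)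
  then have pg: "piecewise_C2 g g' g''"
    unfolding g_eq g'_def[abs_def] g''_def[abs_def]
    by (rule piecewise_C2_glue[OF vector_sol_piecewise_C2[OF cont v(1)]]) (use end0 uv \<delta> in \<open>auto simp: J_def\<close>)
  note AC2 = piecewise_C2_AC2[OF pg]
  have gc: "continuous_on UNIV g" using AC2 by (auto simp: AC2_def intro: AC_loc_imp_continuous_on)
  have g0c: "continuous_on UNIV g0" unfolding g0_def by (rule continuous_glue[OF vc uc]) (simp add: uv)
  have L2: "in_L2 f" if "continuous_on UNIV f" "\<And>x. x \<ge> x0 + \<delta> + 1 \<Longrightarrow> f x = u x" "\<And>x. x < x0 \<Longrightarrow> f x = v x" for f
  proof (rule in_L2I_L2p[OF that(1)])
    show "L2p f" by (rule L2p_cong_tail[OF u(2) uc that(1), of "x0 + \<delta> + 1"]) (use that(2) in auto)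
    show "L2p (\<lambda>x. f (- x))"
      by (rule L2p_cong_tail[OF v(2), of _ "- x0 + 1"])
        (use that(3) in \<open>auto intro!: continuous_on_compose2[OF vc] continuous_on_compose2[OF that(1)] continuous_intros\<close>)
  qed
  have Lg: "in_L2 g" by (rule L2[OF gc]) (use \<delta> in \<open>auto simp: g_eq\<close>)
  have Lg0: "in_L2 g0" by (rule L2[OF g0c]) (use \<delta> in \<open>auto simp: g0_def\<close>)
  define E where "E x = - K'' x + (Q x *v K x - z *s K x)" for x
  define F where "F x = (if x \<in> {x0..x0 + \<delta>} then E x else 0)" for x
  have Ec: "continuous_on UNIV E"
    unfolding E_def[abs_def] by (intro continuous_intros mv.continuous_on cont Kc K''c bounded_linear.continuous_on[OF cs_bl.bounded_linear_right])
  have trunc: "(\<lambda>x. if x \<in> {x0..x0 + \<delta>} then f x else 0) \<in> borel_measurable lebesgue"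
    if "continuous_on UNIV f" for f :: "real \<Rightarrow> complex^'m"
    using borel_measurable_continuous_onI[OF that]
    by (intro measurable_If_set) (auto simp: measurable_completion)
  have LF: "in_L2 F"
    unfolding in_L2_def
  proof
    show "F \<in> borel_measurable lebesgue" unfolding F_def[abs_def] by (rule trunc[OF Ec])
    have "set_integrable lebesgue {x0..x0+\<delta>} (\<lambda>x. (norm (E x))\<^sup>2)"
      by (intro absolutely_integrable_continuous_real continuous_intros continuous_on_subset[OF Ec]) auto
    then have "integrable lebesgue (\<lambda>x. indicat_real {x0..x0+\<delta>} x *\<^sub>R (norm (E x))\<^sup>2)" by (simp add: set_integrable_def)
    moreover have "(\<lambda>x. indicat_real {x0..x0+\<delta>} x *\<^sub>R (norm (E x))\<^sup>2) = (\<lambda>x. (norm (F x))\<^sup>2)"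
      by (auto simp: F_def indicator_def fun_eq_iff)
    ultimately show "integrable lebesgue (\<lambda>x. (norm (F x))\<^sup>2)" by simp
  qed
  have graph: "(g, \<lambda>x. F x + z *s g x) \<in> schroedinger_graph Q"
    unfolding schroedinger_graph_def
  proof (clarify, intro conjI exI)
    show "AC2 g g' g''" by (rule AC2)
    have "F x + z *s g x = - g'' x + Q x *v g x" if "x \<noteq> x0 + \<delta>" for x
      using that \<delta> by (auto simp: F_def E_def g_eq g''_def mv.add_right cs_bl.add_right algebra_simps)
    then show "AE x in lebesgue. F x + z *s g x = - g'' x + Q x *v g x"
      by (intro AE_I'[of "{x0 + \<delta>}"]) (auto simp: negligible_iff_null_sets[symmetric])
  qed (intro Lg in_L2_add LF in_L2_scale)+
  \<comment> \<open>The form of H - E0 at g, nonnegative by \<open>lower_bound\<close>. Symmetry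
    makes <g, H g> real, so nothing is lost in taking the real part.\<close>
  define s where "s = Re (ip g (\<lambda>x. F x + z *s g x)) - E0 * (L2_norm g)\<^sup>2"
  have s0: "s \<ge> 0" using lower_bound[OF graph] by (simp add: s_def)
  have "cnj (ip g (\<lambda>x. F x + z *s g x)) = ip g (\<lambda>x. F x + z *s g x)"
    unfolding cnj_ip by (rule symmetric[OF graph graph, symmetric])
  then have "ip g (\<lambda>x. F x + z *s g x) = of_real (Re (ip g (\<lambda>x. F x + z *s g x)))" by (simp add: complex_eq_iff)
  moreover have "ip g (\<lambda>x. F x + z *s g x) = ip g F + z * of_real ((L2_norm g)\<^sup>2)"
    using Lg LF by (simp add: ip_add_right in_L2_scale ip_scale_right ip_self)
  ultimately have ipF: "ip g F = of_real s - (z - of_real E0) * of_real ((L2_norm g)\<^sup>2)"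
    by (simp add: s_def algebra_simps)
  let ?f = "\<lambda>y. cip (u y + K y) (E y)"
  have fc: "continuous_on UNIV ?f" by (intro cip_bl.continuous_on continuous_intros uc Kc Ec)
  have "(?f has_integral prim x0 ?f (x0 + \<delta>) - prim x0 ?f x0) {x0..x0 + \<delta>}"
    by (rule fundamental_theorem_of_calculus) (use \<delta> in \<open>auto intro: has_vector_derivative_at_within prim_derivative[OF fc]\<close>)
  then have "(?f has_integral prim x0 ?f (x0 + \<delta>)) {x0..x0 + \<delta>}" by simp
  then have "((\<lambda>y. if y \<in> {x0..x0 + \<delta>} then ?f y else 0) has_integral prim x0 ?f (x0 + \<delta>)) UNIV"
    by (simp only: has_integral_restrict_UNIV)
  moreover have "(\<lambda>y. if y \<in> {x0..x0 + \<delta>} then ?f y else 0) = (\<lambda>y. cip (g y) (F y))"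
    using end0 by (auto simp: fun_eq_iff F_def g_eq cip_bl.zero_right)
  ultimately have "((\<lambda>y. cip (g y) (F y)) has_integral prim x0 ?f (x0 + \<delta>)) UNIV" by simp
  moreover have "((\<lambda>y. cip (g y) (F y)) has_integral ip g F) UNIV"
    unfolding ip_def by (rule has_integral_integral_lebesgue[OF in_L2_cip_integrable[OF Lg LF]])
  ultimately have ip1: "ip g F = prim x0 ?f (x0 + \<delta>)" by (rule has_integral_unique[rotated])
  \<comment> \<open>Substitution y = x0 + \<delta> t; the factor \<delta> cancels the 1/\<delta> in
    the second derivative of the bump.\<close>
  have "((\<lambda>t. \<delta> *\<^sub>R ?f (x0 + \<delta> * t)) has_integral prim x0 ?f (x0 + \<delta> * 1) - prim x0 ?f (x0 + \<delta> * 0)) {0..1}"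
  proof (rule fundamental_theorem_of_calculus)
    fix t :: real
    have "((\<lambda>t. x0 + \<delta> * t) has_vector_derivative \<delta>) (at t)"
      by (auto intro!: derivative_eq_intros simp: has_real_derivative_iff_has_vector_derivative[symmetric])
    from vector_diff_chain_at[OF this prim_derivative[OF fc]]
    show "((\<lambda>t. prim x0 ?f (x0 + \<delta> * t)) has_vector_derivative \<delta> *\<^sub>R ?f (x0 + \<delta> * t)) (at t within {0..1})"
      by (auto simp: o_def intro: has_vector_derivative_at_within)
  qed simp
  moreover have "\<delta> *\<^sub>R ?f (x0 + \<delta> * t) = H \<delta> t" for t
  proof -
    have Kt: "K (x0 + \<delta> * t) = (\<delta> * q t) *\<^sub>R J" "\<delta> *\<^sub>R K'' (x0 + \<delta> * t) = (6 * t - 4) *\<^sub>R J"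
      using \<delta> by (simp_all add: K_def K''_def)
    have "\<delta> *\<^sub>R E (x0 + \<delta> * t) = - (\<delta> *\<^sub>R K'' (x0 + \<delta> * t)) + \<delta> *\<^sub>R (Q (x0 + \<delta> * t) *v K (x0 + \<delta> * t) - z *s K (x0 + \<delta> * t))"
      by (simp add: E_def scaleR_add_right scaleR_diff_right)
    also have "\<dots> = (4 - 6 * t) *\<^sub>R J + (\<delta>\<^sup>2 * q t) *\<^sub>R (Q (x0 + \<delta> * t) *v J - z *s J)"
      unfolding Kt by (simp add: mv.scaleR_right cs_bl.scaleR_right scaleR_diff_right scaleR_diff_left power2_eq_square algebra_simps)
    finally have "\<delta> *\<^sub>R E (x0 + \<delta> * t) = (4 - 6 * t) *\<^sub>R J + (\<delta>\<^sup>2 * q t) *\<^sub>R (Q (x0 + \<delta> * t) *v J - z *s J)" .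
    then show ?thesis unfolding H_def Kt(1) q_def by (simp add: cip_bl.scaleR_right[symmetric] del: scaleR_conv_of_real)
  qed
  ultimately have "(H \<delta> has_integral ip g F) {0..1}" by (simp add: ip1)
  then have int: "integral {0..1} (H \<delta>) = of_real s - (z - of_real E0) * of_real ((L2_norm g)\<^sup>2)"
    using ipF by (metis integral_unique)
  have kb: "norm (k x) \<le> \<delta> * norm J" for x
  proof (cases "x \<in> {x0..x0 + \<delta>}")
    case True
    let ?t = "(x - x0) / \<delta>"
    have t: "0 \<le> ?t" "?t \<le> 1" using True \<delta> by auto
    have "0 \<le> q t \<and> q t \<le> 1" if "0 \<le> t" "t \<le> 1" for t
      unfolding q_def using that by (auto intro!: mult_nonneg_nonneg mult_le_one power_le_one)
    from this[OF t] have "0 \<le> q ?t" "q ?t \<le> 1" by blast+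
    then have "\<bar>\<delta> * q ?t\<bar> \<le> \<delta>" using \<delta> by (simp add: abs_mult mult_left_le)
    then show ?thesis using True by (simp add: k_def K_def mult_right_mono)
  qed (use \<delta> in \<open>auto simp: k_def\<close>)
  show ?thesis
  proof (intro exI[of _ k] conjI)
    show "in_L2 (\<lambda>x. g0 x + k x)" using Lg by (simp add: g_def[abs_def])
    show "k \<in> borel_measurable lebesgue" unfolding k_def[abs_def] by (rule trunc[OF Kc(1)])
    show "\<exists>s\<ge>0. integral {0..1} (H \<delta>) = of_real s - (z - of_real E0) * of_real ((L2_norm (\<lambda>x. g0 x + k x))\<^sup>2)"
      using int s0 unfolding g_def[abs_def] by blast
  qed (use kb Lg0 \<delta> in \<open>auto simp: k_def\<close>)
qed

lemma M_minus_P: "Im z \<noteq> 0 \<Longrightarrow> M_minus Q z x0 = - M_plus (\<lambda>x. Q (- x)) z (- x0)"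
  by (rule M_minus_eq[OF cont weyl_N])

text \<open>The limit \<delta> \<rightarrow> 0 of the cut-off identity, with \<open>\<nu>\<close>
  the squared L2 norm of the glued Weyl solutions and \<open>t\<close> the limit of the nonnegative
  energies \<open>s n\<close>.\<close>

theorem weyl_quadratic_form:
  assumes z: "Im z > 0"
  obtains t \<nu> :: real where "t \<ge> 0" "w \<noteq> 0 \<Longrightarrow> \<nu> > 0" "\<nu> \<ge> 0"
    "cip w ((M_minus Q z x0 - M_plus Q z x0) *v w) = of_real t - (z - of_real E0) * of_real \<nu>"
proof -
  interpret P: weyl_plus Q by (rule weyl_P)
  interpret N: weyl_plus "\<lambda>x. Q (- x)" by (rule weyl_N)
  have z0: "Im z \<noteq> 0" using z by simp
  obtain \<psi> \<psi>' where \<psi>: "matrix_sol Q z \<psi> \<psi>'" "\<psi> x0 = mat 1" "\<psi>' x0 = M_plus Q z x0" "\<And>c. L2p (\<lambda>x. \<psi> x *v c)"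
    using P.weyl_solution_exists[OF z0, of x0] by metis
  obtain \<chi>' \<chi>'' where \<chi>: "matrix_sol (\<lambda>x. Q (- x)) z \<chi>' \<chi>''" "\<chi>' (- x0) = mat 1"
    "\<chi>'' (- x0) = M_plus (\<lambda>x. Q (- x)) z (- x0)" "\<And>c. L2p (\<lambda>x. \<chi>' x *v c)"
    using N.weyl_solution_exists[OF z0, of "- x0"] by metis
  define u u' where "u x = \<psi> x *v w" and "u' x = \<psi>' x *v w" for x
  define v v' where "v x = \<chi>' (- x) *v w" and "v' x = - (\<chi>'' (- x) *v w)" for x
  have u: "vector_sol Q z u u'" "L2p u"
    unfolding u_def[abs_def] u'_def[abs_def] by (intro matrix_sol_column \<psi>)+
  have v: "vector_sol Q z v v'" "L2p (\<lambda>x. v (- x))"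
    unfolding v_def[abs_def] v'_def[abs_def]
    using reflect_vector_sol[OF matrix_sol_column[OF \<chi>(1), of w]] \<chi>(4) by simp_all
  have uv: "u x0 = v x0" by (simp add: u_def v_def \<psi> \<chi>)
  let ?J = "(M_minus Q z x0 - M_plus Q z x0) *v w"
  have J: "v' x0 - u' x0 = ?J"
    by (simp add: u'_def v'_def \<psi> \<chi> M_minus_P[OF z0] mv.diff_left mv.minus_left)
  have u0: "u x0 = w" by (simp add: u_def \<psi>)
  define g0 where "g0 = (\<lambda>x. if x < x0 then v x else u x)"
  define H where "H = (\<lambda>\<delta> t. cip (u (x0 + \<delta> * t) + (\<delta> * (t * (1 - t)\<^sup>2)) *\<^sub>R ?J)
      ((4 - 6 * t) *\<^sub>R ?J + (\<delta>\<^sup>2 * (t * (1 - t)\<^sup>2)) *\<^sub>R (Q (x0 + \<delta> * t) *v ?J - z *s ?J)))"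
  define d where "d n = 1 / (real n + 1)" for n :: nat
  have d: "0 < d n" "d n \<le> 1" for n by (auto simp: d_def)
  have d0: "d \<longlonglongrightarrow> 0" unfolding d_def by real_asymp
  define A where "A n k \<longleftrightarrow> in_L2 (\<lambda>x. g0 x + k x) \<and> in_L2 g0 \<and> k \<in> borel_measurable lebesgue \<and>
      (\<forall>x. norm (k x) \<le> d n * norm ?J) \<and> (\<forall>x. x \<notin> {x0..x0+1} \<longrightarrow> k x = 0)" for n k
  define B where "B n k s \<longleftrightarrow> s \<ge> 0 \<and>
      integral {0..1} (H (d n)) = of_real s - (z - of_real E0) * of_real ((L2_norm (\<lambda>x. g0 x + k x))\<^sup>2)"
    for n and k :: "real \<Rightarrow> complex^'m" and s :: real
  have "\<exists>k. A n k \<and> (\<exists>s. B n k s)" for n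
    using cutoff_quadratic_form[OF u v uv d] unfolding J H_def g0_def A_def B_def conj_assoc .
  then obtain k s where ks: "\<And>n. A n (k n)" "\<And>n. B n (k n) (s n)" by metis
  have k: "in_L2 (\<lambda>x. g0 x + k n x)" "in_L2 g0" "k n \<in> borel_measurable lebesgue"
      "norm (k n x) \<le> d n * norm ?J" "x \<notin> {x0..x0+1} \<Longrightarrow> k n x = 0" for n x
    using ks(1)[of n] unfolding A_def by blast+
  have s: "s n \<ge> 0"
      "integral {0..1} (H (d n)) = of_real (s n) - (z - of_real E0) * of_real ((L2_norm (\<lambda>x. g0 x + k n x))\<^sup>2)" for n
    using ks(2)[of n] unfolding B_def by blast+
  have "(\<lambda>n. LINT x|lebesgue. (norm (g0 x + k n x))\<^sup>2) \<longlonglongrightarrow> (LINT x|lebesgue. (norm (g0 x))\<^sup>2)"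
  proof (rule integral_dominated_convergence)
    show "(\<lambda>x. (norm (g0 x))\<^sup>2) \<in> borel_measurable lebesgue" "(\<lambda>x. (norm (g0 x + k n x))\<^sup>2) \<in> borel_measurable lebesgue" for n
      using k(1)[of n] k(2) by (auto simp: in_L2_def)
    have "integrable lebesgue (\<lambda>x. 2 * (norm ?J)\<^sup>2 * indicat_real {x0..x0+1} x)"
      by (intro integrable_mult_right integrable_real_indicator) (auto simp: emeasure_lborel_Icc_eq)
    then show "integrable lebesgue (\<lambda>x. 2 * (norm (g0 x))\<^sup>2 + 2 * (norm ?J)\<^sup>2 * indicat_real {x0..x0+1} x)"
      using k(2) by (auto simp: in_L2_def)
    have "(norm (g0 x + k n x))\<^sup>2 \<le> 2 * (norm (g0 x))\<^sup>2 + 2 * (norm ?J)\<^sup>2 * indicat_real {x0..x0+1} x" for n x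
    proof -
      have "(norm (g0 x + k n x))\<^sup>2 \<le> (norm (g0 x) + norm (k n x))\<^sup>2" by (intro power_mono norm_triangle_ineq) simp
      also have "\<dots> \<le> 2 * (norm (g0 x))\<^sup>2 + 2 * (norm (k n x))\<^sup>2"
        using sum_squares_bound[of "norm (g0 x)" "norm (k n x)"] by (simp add: power2_sum)
      also have "(norm (k n x))\<^sup>2 \<le> (norm ?J)\<^sup>2 * indicat_real {x0..x0+1} x"
      proof (cases "x \<in> {x0..x0+1}")
        case True
        have "norm (k n x) \<le> 1 * norm ?J" by (rule order_trans[OF k(4)]) (intro mult_right_mono d norm_ge_zero)
        then show ?thesis using True by (simp add: power_mono)
      next
        case False
        then show ?thesis using k(5)[OF False] by simp
      qed
      finally show ?thesis by simp
    qed
    then show "AE x in lebesgue. norm ((norm (g0 x + k n x))\<^sup>2) \<le> 2 * (norm (g0 x))\<^sup>2 + 2 * (norm ?J)\<^sup>2 * indicat_real {x0..x0+1} x" for n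
      by simp
    have "(\<lambda>n. k n x) \<longlonglongrightarrow> 0" for x
    proof (rule Lim_null_comparison)
      show "(\<lambda>n. d n * norm ?J) \<longlonglongrightarrow> 0" using tendsto_mult[OF d0 tendsto_const[of "norm ?J"]] by simp
    qed (use k(4) in auto)
    then have "(\<lambda>n. (norm (g0 x + k n x))\<^sup>2) \<longlonglongrightarrow> (norm (g0 x + 0))\<^sup>2" for x by (intro tendsto_intros)
    then show "AE x in lebesgue. (\<lambda>n. (norm (g0 x + k n x))\<^sup>2) \<longlonglongrightarrow> (norm (g0 x))\<^sup>2" by simp
  qed
  then have nlim: "(\<lambda>n. (L2_norm (\<lambda>x. g0 x + k n x))\<^sup>2) \<longlonglongrightarrow> (L2_norm g0)\<^sup>2" by (simp add: L2_norm_power2)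
  have Hlim: "(\<lambda>n. integral {0..1} (H (d n))) \<longlonglongrightarrow> cip w ?J"
  proof -
    have uc: "continuous_on UNIV u" by (rule vector_solD[OF u(1)])
    have "continuous_on UNIV (\<lambda>\<delta>. integral (cbox 0 1) (H \<delta>))"
    proof (rule integral_continuous_on_param)
      show "continuous_on (UNIV \<times> cbox 0 1) (\<lambda>(\<delta>, t). H \<delta> t)"
        unfolding H_def case_prod_unfold
        by (intro cip_bl.continuous_on continuous_intros mv.continuous_on continuous_on_compose2[OF uc] continuous_on_compose2[OF cont]) auto
    qed
    then have "isCont (\<lambda>\<delta>. integral {0..1} (H \<delta>)) 0" by (simp add: continuous_on_eq_continuous_at)
    from isCont_tendsto_compose[OF this d0]
    have 1: "(\<lambda>n. integral {0..1} (H (d n))) \<longlonglongrightarrow> integral {0..1} (H 0)" .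
    \<comment> \<open>The factor 4 - 6 t is minus the second derivative of the cubic bump, so its
      integral is q'(0) - q'(1) = 1.\<close>
    have "((\<lambda>t::real. 4 - 6 * t) has_integral (4 * 1 - 3 * 1\<^sup>2) - (4 * 0 - 3 * 0\<^sup>2)) {0..1}"
      by (rule fundamental_theorem_of_calculus)
        (auto intro!: derivative_eq_intros has_vector_derivative_at_within simp: has_real_derivative_iff_has_vector_derivative[symmetric])
    then have "((\<lambda>t::real. 4 - 6 * t) has_integral 1) {0..1}" by simp
    from has_integral_scaleR_left[OF this, of "cip w ?J"]
    have "((\<lambda>t. (4 - 6 * t) *\<^sub>R cip w ?J) has_integral cip w ?J) {0..1}" by simp
    moreover have "H 0 = (\<lambda>t. (4 - 6 * t) *\<^sub>R cip w ?J)"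
      by (simp add: H_def u0 fun_eq_iff cip_bl.scaleR_right del: scaleR_conv_of_real)
    ultimately have "integral {0..1} (H 0) = cip w ?J" by (simp add: integral_unique)
    with 1 show ?thesis by simp
  qed
  define \<nu> where "\<nu> = (L2_norm g0)\<^sup>2"
  have "(\<lambda>n. integral {0..1} (H (d n)) + (z - of_real E0) * of_real ((L2_norm (\<lambda>x. g0 x + k n x))\<^sup>2))
      \<longlonglongrightarrow> cip w ?J + (z - of_real E0) * of_real \<nu>"
    unfolding \<nu>_def by (intro tendsto_intros Hlim tendsto_of_real nlim)
  then have sl: "(\<lambda>n. complex_of_real (s n)) \<longlonglongrightarrow> cip w ?J + (z - of_real E0) * of_real \<nu>" by (simp add: s)
  \<comment> \<open>Convergence of \<open>s n\<close> follows from the other two limits. Being real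
    and nonnegative, these numbers have a real nonnegative limit.\<close>
  define t where "t = Re (cip w ?J + (z - of_real E0) * of_real \<nu>)"
  have "Im (cip w ?J + (z - of_real E0) * of_real \<nu>) = 0"
    using tendsto_Im[OF sl] by (simp add: LIMSEQ_const_iff)
  then have eq: "cip w ?J = of_real t - (z - of_real E0) * of_real \<nu>" unfolding t_def by (simp add: complex_eq_iff)
  have t0: "t \<ge> 0"
    unfolding t_def by (rule LIMSEQ_le_const[OF tendsto_Re[OF sl]]) (use s(1) in auto)
  \<comment> \<open>Norm zero would make the right Weyl solution vanish on an interval, hence
    identically, although its value at \<open>x0\<close> is w.\<close>
  have "\<nu> > 0" if "w \<noteq> 0"
  proof (rule ccontr)
    assume "\<not> \<nu> > 0"
    then have "\<nu> = 0" by (simp add: \<nu>_def)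
    then have "(LINT x|lebesgue. (norm (g0 x))\<^sup>2) = 0" by (simp add: \<nu>_def L2_norm_power2[symmetric])
    then have "AE x in lebesgue. (norm (g0 x))\<^sup>2 = 0"
      using k(2) by (subst (asm) integral_nonneg_eq_0_iff_AE) (auto simp: in_L2_def)
    then obtain S where S: "negligible S" "\<And>x. x \<notin> S \<Longrightarrow> g0 x = 0" by (elim AE_lebesgueE) auto
    have "integral {x0..x0+1} (\<lambda>x. (norm (u x))\<^sup>2) = integral {x0..x0+1} (\<lambda>x. 0)"
      by (rule integral_spike[OF S(1)]) (use S(2) in \<open>force simp: g0_def\<close>)
    then have "u x0 = 0" using vector_sol_interval_zero(1)[OF cont u(1), of x0 "x0 + 1" x0] by simp
    then show False using that u0 by simp
  qed
  then show ?thesis using that[OF t0 _ _ eq] by (simp add: \<nu>_def)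
qed

end

subsection \<open>The logarithm of a matrix with positive imaginary part\<close>

definition pos_im :: "complex^'m^'m \<Rightarrow> bool" where
  "pos_im A \<longleftrightarrow> (\<forall>v. v \<noteq> 0 \<longrightarrow> Im (cip v (A *v v)) > 0)"

abbreviation upper :: "complex set" where "upper \<equiv> {z. Im z > 0}"

lemma open_upper: "open upper" and convex_upper: "convex upper" and connected_upper: "connected upper"
  by (simp_all add: open_halfspace_Im_gt convex_halfspace_Im_gt convex_connected)

lemma mat_spectrum_eigenvector:
  fixes A :: "complex^'m^'m"
  assumes "\<zeta> \<in> mat_spectrum A"
  obtains v where "v \<noteq> 0" "A *v v = \<zeta> *s v"
proof -
  from assms obtain v where "(mat \<zeta> - A) *v v = 0" "v \<noteq> 0"
    unfolding mat_spectrum_def using invertibleI_ker by blast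
  then show ?thesis by (intro that[of v]) (simp_all add: mv.diff_left mat_mult_vec)
qed

lemma mat_spectrum_pos_im:
  fixes A :: "complex^'m^'m"
  assumes "pos_im A"
  shows "mat_spectrum A \<subseteq> upper"
proof clarify
  fix \<zeta> assume "\<zeta> \<in> mat_spectrum A"
  then obtain v where v: "v \<noteq> 0" "A *v v = \<zeta> *s v" by (rule mat_spectrum_eigenvector)
  then have "Im (\<zeta> * of_real ((norm v)\<^sup>2)) > 0"
    using assms unfolding pos_im_def by (metis cip_scale_right cip_self)
  then show "Im \<zeta> > 0" using v by (simp add: zero_less_mult_iff del: of_real_power)
qed

text \<open>The spectrum is the zero set of the characteristic polynomial, which is not the zero
  polynomial because -i is not an eigenvalue. \<open>ispoly\<close> is closed under the sums and
  products in the Leibniz formula.\<close>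

lemma mat_spectrum_finite:
  fixes A :: "complex^'m^'m"
  assumes "pos_im A"
  shows "finite (mat_spectrum A)"
proof -
  define ispoly where "ispoly f \<longleftrightarrow> (\<exists>p. \<forall>\<zeta>. poly p \<zeta> = f \<zeta>)" for f :: "complex \<Rightarrow> complex"
  have c: "ispoly (\<lambda>_. c)" for c unfolding ispoly_def by (intro exI[of _ "[:c:]"]) simp
  have i: "ispoly (\<lambda>\<zeta>. \<zeta> - c)" for c unfolding ispoly_def by (intro exI[of _ "[:- c, 1:]"]) simp
  have a: "ispoly (\<lambda>\<zeta>. f \<zeta> + g \<zeta>)" if "ispoly f" "ispoly g" for f g
    using that unfolding ispoly_def by (metis poly_add)
  have m: "ispoly (\<lambda>\<zeta>. f \<zeta> * g \<zeta>)" if "ispoly f" "ispoly g" for f g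
    using that unfolding ispoly_def by (metis poly_mult)
  have s: "ispoly (\<lambda>\<zeta>. \<Sum>x\<in>X. f x \<zeta>)" if "finite X" "\<And>x. x \<in> X \<Longrightarrow> ispoly (f x)"
    for X :: "('m \<Rightarrow> 'm) set" and f
    using that by (induction X rule: finite_induct) (auto intro: c a)
  have p: "ispoly (\<lambda>\<zeta>. \<Prod>x\<in>X. f x \<zeta>)" if "finite X" "\<And>x. x \<in> X \<Longrightarrow> ispoly (f x)"
    for X :: "'m set" and f
    using that by (induction X rule: finite_induct) (auto intro: c m)
  have e: "ispoly (\<lambda>\<zeta>. (mat \<zeta> - A) $ r $ s)" for r s
    using i[of "A $ r $ r"] c[of "- A $ r $ s"] by (cases "r = s") (auto simp: mat_def)
  have "ispoly (\<lambda>\<zeta>. det (mat \<zeta> - A))"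
    unfolding det_def by (intro s m c p e) (auto simp: finite_permutations)
  then obtain q where q: "\<And>\<zeta>. poly q \<zeta> = det (mat \<zeta> - A)" unfolding ispoly_def by blast
  have "- \<i> \<notin> mat_spectrum A" using mat_spectrum_pos_im[OF assms] by auto
  then have "poly q (- \<i>) \<noteq> 0" by (simp add: q mat_spectrum_def invertible_det_nz)
  then have "q \<noteq> 0" by auto
  then have "finite {\<zeta>. poly q \<zeta> = 0}" by (rule poly_roots_finite)
  moreover have "mat_spectrum A = {\<zeta>. poly q \<zeta> = 0}"
    by (simp add: q mat_spectrum_def invertible_det_nz)
  ultimately show ?thesis by simp
qed

text \<open>A point w lies in the disc of radius \<rho> about i \<rho> exactly when |w|^2 < 2 \<rho>
  Im w. So it suffices that \<rho> exceed every |w|^2 / Im w. A single circle then serves as contour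
  for the whole spectrum.\<close>

lemma finite_upper_in_disc:
  assumes K: "finite K" "K \<subseteq> upper"
  obtains p r where "r > 0" "cball p r \<subseteq> upper" "K \<subseteq> ball p r"
proof -
  define \<rho> where "\<rho> = 1 + (\<Sum>w\<in>K. (norm w)\<^sup>2 / Im w)"
  have \<rho>: "\<rho> > 0" unfolding \<rho>_def using K by (intro add_pos_nonneg sum_nonneg) auto
  have *: "norm (w - \<i> * \<rho>) < \<rho>" if "w \<in> K" for w
  proof -
    have "Im w > 0" using K that by auto
    have "(norm w)\<^sup>2 / Im w \<le> (\<Sum>w\<in>K. (norm w)\<^sup>2 / Im w)"
      using K that by (intro member_le_sum) auto
    then have "(norm w)\<^sup>2 / Im w < \<rho>" by (simp add: \<rho>_def)
    then have "(norm w)\<^sup>2 < \<rho> * Im w" using \<open>Im w > 0\<close> by (simp add: field_simps)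
    moreover have "(norm (w - \<i> * \<rho>))\<^sup>2 = (norm w)\<^sup>2 - 2 * \<rho> * Im w + \<rho>\<^sup>2"
      unfolding cmod_power2 by (simp add: power2_eq_square algebra_simps)
    ultimately have "(norm (w - \<i> * \<rho>))\<^sup>2 < \<rho>\<^sup>2"
      using mult_pos_pos[OF \<rho> \<open>Im w > 0\<close>] by simp
    then show ?thesis using \<rho> power2_less_imp_less by fastforce
  qed
  \<comment> \<open>The largest distance from K to the centre. The radius halfway between
    \<open>d\<close> and \<open>\<rho>\<close> keeps K inside and detaches the closed disc from the
    real axis.\<close>
  define d where "d = Max (insert 0 ((\<lambda>w. norm (w - \<i> * \<rho>)) ` K))"
  have d: "0 \<le> d" "d < \<rho>" "\<And>w. w \<in> K \<Longrightarrow> norm (w - \<i> * \<rho>) \<le> d"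
    unfolding d_def using K * \<rho> by (auto simp: Max_ge_iff)
  show ?thesis
  proof (rule that[of "(d + \<rho>) / 2" "\<i> * \<rho>"])
    show "(d + \<rho>) / 2 > 0" using d \<rho> by simp
    show "cball (\<i> * \<rho>) ((d + \<rho>) / 2) \<subseteq> upper"
    proof clarify
      fix w assume "w \<in> cball (\<i> * \<rho>) ((d + \<rho>) / 2)"
      then have "norm (\<i> * \<rho> - w) < \<rho>" using d by (simp add: dist_norm)
      then have "\<bar>Im (\<i> * \<rho> - w)\<bar> < \<rho>" using abs_Im_le_cmod order_le_less_trans by blast
      then show "Im w > 0" by simp
    qed
    show "K \<subseteq> ball (\<i> * \<rho>) ((d + \<rho>) / 2)"
    proof
      fix w assume "w \<in> K"
      then have "norm (w - \<i> * \<rho>) < (d + \<rho>) / 2" using d(2) d(3)[of w] by simp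
      then show "w \<in> ball (\<i> * \<rho>) ((d + \<rho>) / 2)" by (simp add: dist_norm norm_minus_commute)
    qed
  qed
qed

lemma resolvent_entry_holomorphic:
  fixes A :: "complex^'m^'m"
  shows "(\<lambda>\<zeta>. matrix_inv (mat \<zeta> - A) $ i $ j) holomorphic_on - mat_spectrum A"
proof (rule holomorphic_on_matrix_inv)
  show "(\<lambda>\<zeta>. (mat \<zeta> - A) $ i $ j) holomorphic_on - mat_spectrum A" for i j
    by (cases "i = j") (auto simp: mat_def intro!: holomorphic_intros)
qed (simp add: mat_spectrum_def)

text \<open>Reverse triangle inequality for \<zeta> v - A v. The decay of the resolvent at infinity
  is needed to evaluate the calculus at the constant 1.\<close>

lemma resolvent_entry_bound:
  fixes A :: "complex^'m^'m"
  obtains K where "K > 0"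
    and "\<And>\<zeta>. norm \<zeta> > K \<Longrightarrow> \<zeta> \<notin> mat_spectrum A"
    and "\<And>\<zeta> i j. norm \<zeta> > K \<Longrightarrow> norm (matrix_inv (mat \<zeta> - A) $ i $ j) \<le> 1 / (norm \<zeta> - K)"
proof -
  obtain K where K: "K > 0" "\<And>v. norm (A *v v) \<le> norm v * K"
    using bounded_linear.pos_bounded[OF mv.bounded_linear_right[of A]] by blast
  have ns: "norm (c *s v) = norm c * norm v" for c and v :: "complex^'m"
    by (simp add: norm_vec_def L2_set_def norm_mult power_mult_distrib real_sqrt_mult flip: sum_distrib_left)
  have low: "(norm \<zeta> - K) * norm v \<le> norm ((mat \<zeta> - A) *v v)" for \<zeta> v
  proof -
    have "norm (\<zeta> *s v) - norm (A *v v) \<le> norm (\<zeta> *s v - A *v v)" by (rule norm_triangle_ineq2)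
    then show ?thesis using K(2)[of v] by (simp add: ns mv.diff_left mat_mult_vec algebra_simps)
  qed
  show ?thesis
  proof (rule that[OF K(1)])
    fix \<zeta> :: complex assume z: "norm \<zeta> > K"
    show nsp: "\<zeta> \<notin> mat_spectrum A"
    proof
      assume "\<zeta> \<in> mat_spectrum A"
      then obtain v where "v \<noteq> 0" "A *v v = \<zeta> *s v" by (rule mat_spectrum_eigenvector)
      then have "(norm \<zeta> - K) * norm v \<le> 0" using low[of \<zeta> v] by (simp add: mv.diff_left mat_mult_vec)
      then show False using \<open>v \<noteq> 0\<close> z by (simp add: mult_le_0_iff)
    qed
    fix i j :: 'm
    let ?v = "matrix_inv (mat \<zeta> - A) *v axis j 1"
    have inv: "invertible (mat \<zeta> - A)" using nsp by (simp add: mat_spectrum_def)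
    have "(mat \<zeta> - A) *v ?v = axis j 1"
      by (simp add: matrix_vector_mul_assoc invertible_matrix_inv[OF inv])
    moreover have "norm (axis j 1 :: complex^'m) = 1" by simp
    ultimately have "(norm \<zeta> - K) * norm ?v \<le> 1" using low[of \<zeta> ?v] by simp
    then have "norm ?v \<le> 1 / (norm \<zeta> - K)" using z by (simp add: field_simps)
    moreover have "matrix_inv (mat \<zeta> - A) $ i $ j = ?v $ i"
      by (simp add: matrix_vector_mult_def axis_def if_distrib sum.delta' cong: if_cong)
    ultimately show "norm (matrix_inv (mat \<zeta> - A) $ i $ j) \<le> 1 / (norm \<zeta> - K)"
      using Finite_Cartesian_Product.norm_nth_le[of ?v i] by simp
  qed
qed

lemma mat_minus_one_mult: "mat (-1) ** A = - (A :: complex^'m^'m)"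
  by (simp add: vec_eq_iff mat_mult_entry)

section \<open>Riesz-Dunford calculus on a circle in the upper half-plane\<close>

locale disc_calculus =
  fixes A :: "complex^'m^'m" and p :: complex and r :: real
  assumes pos: "pos_im A" and r: "r > 0" and disc: "cball p r \<subseteq> upper"
    and spec: "mat_spectrum A \<subseteq> ball p r"
begin

abbreviation R where "R \<zeta> \<equiv> matrix_inv (mat \<zeta> - A)"

abbreviation \<gamma> where "\<gamma> \<equiv> circlepath p r"

definition calc :: "(complex \<Rightarrow> complex) \<Rightarrow> complex^'m^'m" where
  "calc f = (\<chi> i j. contour_integral \<gamma> (\<lambda>\<zeta>. f \<zeta> * R \<zeta> $ i $ j) / (2 * of_real pi * \<i>))"

lemma path_image: "path_image \<gamma> = sphere p r" "path_image \<gamma> \<subseteq> upper - mat_spectrum A"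
proof -
  show 1: "path_image \<gamma> = sphere p r" using r by simp
  have "sphere p r \<subseteq> cball p r" "sphere p r \<inter> ball p r = {}" by auto
  then show "path_image \<gamma> \<subseteq> upper - mat_spectrum A" unfolding 1 using disc spec by blast
qed

lemma path_image_Im: "\<zeta> \<in> path_image \<gamma> \<Longrightarrow> Im \<zeta> > 0"
  using path_image(2) by blast

lemma mult_R: "\<zeta> \<in> path_image \<gamma> \<Longrightarrow> (mat \<zeta> - A) ** R \<zeta> = mat 1"
  using path_image by (intro invertible_matrix_inv) (auto simp: mat_spectrum_def)

lemma continuous_R: "continuous_on (path_image \<gamma>) (\<lambda>\<zeta>. R \<zeta> $ i $ j)"
  by (rule continuous_on_subset[OF holomorphic_on_imp_continuous_on[OF resolvent_entry_holomorphic]])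
    (use path_image in auto)

lemma integrable: "continuous_on (path_image \<gamma>) f \<Longrightarrow> (\<lambda>\<zeta>. f \<zeta> * R \<zeta> $ i $ j) contour_integrable_on \<gamma>"
  using continuous_R unfolding circlepath_def
  by (intro contour_integrable_continuous_part_circlepath continuous_on_mult) auto

lemma contf: "f holomorphic_on upper \<Longrightarrow> continuous_on (path_image \<gamma>) f"
  using path_image by (blast intro: holomorphic_on_imp_continuous_on continuous_on_subset)

lemma calc_entry: "calc f $ i $ j = contour_integral \<gamma> (\<lambda>\<zeta>. f \<zeta> * R \<zeta> $ i $ j) / (2 * of_real pi * \<i>)"
  by (simp add: calc_def)

lemma calc_add:
  assumes "f holomorphic_on upper" "g holomorphic_on upper"
  shows "calc (\<lambda>\<zeta>. f \<zeta> + g \<zeta>) = calc f + calc g"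
proof -
  have "contour_integral \<gamma> (\<lambda>\<zeta>. f \<zeta> * R \<zeta> $ i $ j + g \<zeta> * R \<zeta> $ i $ j)
      = contour_integral \<gamma> (\<lambda>\<zeta>. f \<zeta> * R \<zeta> $ i $ j) + contour_integral \<gamma> (\<lambda>\<zeta>. g \<zeta> * R \<zeta> $ i $ j)" for i j
    by (intro contour_integral_add integrable contf assms)
  then show ?thesis by (simp only: vec_eq_iff calc_entry distrib_right add_divide_distrib vector_add_component) simp
qed

lemma calc_cmul:
  assumes "f holomorphic_on upper"
  shows "calc (\<lambda>\<zeta>. c * f \<zeta>) = mat c ** calc f"
proof -
  have "contour_integral \<gamma> (\<lambda>\<zeta>. c * (f \<zeta> * R \<zeta> $ i $ j)) = c * contour_integral \<gamma> (\<lambda>\<zeta>. f \<zeta> * R \<zeta> $ i $ j)" for i j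
    by (intro contour_integral_lmul integrable contf assms)
  then show ?thesis by (simp only: vec_eq_iff calc_entry mat_mult_entry mult.assoc) simp
qed

lemma calc_cong: "(\<And>\<zeta>. \<zeta> \<in> path_image \<gamma> \<Longrightarrow> f \<zeta> = g \<zeta>) \<Longrightarrow> calc f = calc g"
  by (simp add: vec_eq_iff calc_entry) (auto intro!: arg_cong[where f = "\<lambda>x. x / _"] contour_integral_cong)

text \<open>On the contour A R(\<zeta>) = \<zeta> R(\<zeta>) - 1, and the term without resolvent
  contributes the integral of f over a closed curve, which is 0 by Cauchy's theorem.\<close>

lemma calc_id_mult:
  assumes f: "f holomorphic_on upper"
  shows "calc (\<lambda>\<zeta>. \<zeta> * f \<zeta>) = A ** calc f"
proof -
  let ?c = "2 * of_real pi * \<i>"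
  have "(A ** calc f) $ i $ j = calc (\<lambda>\<zeta>. \<zeta> * f \<zeta>) $ i $ j" for i j
  proof -
    have AR: "(\<Sum>k\<in>UNIV. A $ i $ k * R \<zeta> $ k $ j) = \<zeta> * R \<zeta> $ i $ j - mat 1 $ i $ j"
      if "\<zeta> \<in> path_image \<gamma>" for \<zeta>
    proof -
      have "A ** R \<zeta> = mat \<zeta> ** R \<zeta> - mat 1" using mult_R[OF that] by (simp add: mm.diff_left algebra_simps)
      then have "(A ** R \<zeta>) $ i $ j = \<zeta> * R \<zeta> $ i $ j - mat 1 $ i $ j" by (simp add: mat_mult_entry)
      then show ?thesis by (simp add: matrix_matrix_mult_def)
    qed
    have f0: "(f has_contour_integral 0) \<gamma>"
      by (rule Cauchy_theorem_convex_simple[OF f convex_upper]) (use path_image in auto)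
    have "(A ** calc f) $ i $ j = (\<Sum>k\<in>UNIV. A $ i $ k * (contour_integral \<gamma> (\<lambda>\<zeta>. f \<zeta> * R \<zeta> $ k $ j) / ?c))"
      by (simp add: matrix_matrix_mult_def calc_entry)
    also have "\<dots> = (\<Sum>k\<in>UNIV. contour_integral \<gamma> (\<lambda>\<zeta>. A $ i $ k * (f \<zeta> * R \<zeta> $ k $ j))) / ?c"
    proof -
      have "contour_integral \<gamma> (\<lambda>\<zeta>. A $ i $ k * (f \<zeta> * R \<zeta> $ k $ j)) = A $ i $ k * contour_integral \<gamma> (\<lambda>\<zeta>. f \<zeta> * R \<zeta> $ k $ j)" for k
        by (intro contour_integral_lmul integrable contf f)
      then show ?thesis by (simp only: sum_divide_distrib times_divide_eq_right)
    qed
    also have "(\<Sum>k\<in>UNIV. contour_integral \<gamma> (\<lambda>\<zeta>. A $ i $ k * (f \<zeta> * R \<zeta> $ k $ j)))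
        = contour_integral \<gamma> (\<lambda>\<zeta>. \<Sum>k\<in>UNIV. A $ i $ k * (f \<zeta> * R \<zeta> $ k $ j))"
      by (rule contour_integral_sum[symmetric]) (auto intro!: contour_integrable_lmul integrable contf f)
    also have "\<dots> = contour_integral \<gamma> (\<lambda>\<zeta>. \<zeta> * f \<zeta> * R \<zeta> $ i $ j - mat 1 $ i $ j * f \<zeta>)"
    proof (rule contour_integral_cong[OF refl])
      fix \<zeta> assume "\<zeta> \<in> path_image \<gamma>"
      have "(\<Sum>k\<in>UNIV. A $ i $ k * (f \<zeta> * R \<zeta> $ k $ j)) = f \<zeta> * (\<Sum>k\<in>UNIV. A $ i $ k * R \<zeta> $ k $ j)"
        by (simp add: sum_distrib_left mult_ac)
      also have "\<dots> = \<zeta> * f \<zeta> * R \<zeta> $ i $ j - mat 1 $ i $ j * f \<zeta>"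
        unfolding AR[OF \<open>\<zeta> \<in> path_image \<gamma>\<close>] by (simp add: algebra_simps)
      finally show "(\<Sum>k\<in>UNIV. A $ i $ k * (f \<zeta> * R \<zeta> $ k $ j)) = \<zeta> * f \<zeta> * R \<zeta> $ i $ j - mat 1 $ i $ j * f \<zeta>" .
    qed
    also have "\<dots> = contour_integral \<gamma> (\<lambda>\<zeta>. \<zeta> * f \<zeta> * R \<zeta> $ i $ j) - contour_integral \<gamma> (\<lambda>\<zeta>. mat 1 $ i $ j * f \<zeta>)"
      by (intro contour_integral_diff integrable contour_integrable_lmul
          has_contour_integral_integrable[OF f0] continuous_on_mult continuous_on_id contf f)
    also have "contour_integral \<gamma> (\<lambda>\<zeta>. mat 1 $ i $ j * f \<zeta>) = 0"
      using has_contour_integral_lmul[OF f0, of "mat 1 $ i $ j"] by (simp add: contour_integral_unique)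
    finally show ?thesis by (simp add: calc_entry)
  qed
  then show ?thesis by (simp add: vec_eq_iff)
qed

text \<open>The resolvent is holomorphic off the spectrum in the whole plane, and every larger
  concentric circle winds once around each eigenvalue, so the residue sums agree.\<close>

lemma contour_R_indep:
  assumes "\<rho> \<ge> r"
  shows "contour_integral (circlepath p \<rho>) (\<lambda>\<zeta>. R \<zeta> $ i $ j) = contour_integral \<gamma> (\<lambda>\<zeta>. R \<zeta> $ i $ j)"
proof -
  have *: "contour_integral (circlepath p s) (\<lambda>\<zeta>. R \<zeta> $ i $ j)
      = 2 * pi * \<i> * (\<Sum>w\<in>mat_spectrum A. residue (\<lambda>\<zeta>. R \<zeta> $ i $ j) w)" if "s \<ge> r" for s
  proof -
    have wn: "winding_number (circlepath p s) w = 1" if "w \<in> mat_spectrum A" for w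
      using spec that \<open>s \<ge> r\<close> r by (intro winding_number_circlepath) (auto simp: dist_norm norm_minus_commute subset_iff)
    have "contour_integral (circlepath p s) (\<lambda>\<zeta>. R \<zeta> $ i $ j)
      = 2 * pi * \<i> * (\<Sum>w\<in>mat_spectrum A. winding_number (circlepath p s) w * residue (\<lambda>\<zeta>. R \<zeta> $ i $ j) w)"
    proof (rule Residue_theorem[of UNIV])
      show "(\<lambda>\<zeta>. R \<zeta> $ i $ j) holomorphic_on UNIV - mat_spectrum A"
        using resolvent_entry_holomorphic by (simp add: Compl_eq_Diff_UNIV)
      show "path_image (circlepath p s) \<subseteq> UNIV - mat_spectrum A"
        using spec that r by (force simp: dist_norm)
    qed (auto simp: mat_spectrum_finite[OF pos])
    then show ?thesis by (simp add: wn)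
  qed
  show ?thesis using *[OF assms] *[of r] by simp
qed

text \<open>The circle is enlarged to radius \<rho>. There R(\<zeta>) differs from 1/(\<zeta> - p)
  by O(1/\<rho>^2), because (\<zeta> - p) R(\<zeta>) - 1 = (A - p) R(\<zeta>); over a length 2 \<pi>
  \<rho> this tends to 0.\<close>

lemma calc_one: "calc (\<lambda>_. 1) = mat 1"
proof -
  let ?c = "2 * of_real pi * \<i> :: complex"
  have "contour_integral \<gamma> (\<lambda>\<zeta>. R \<zeta> $ i $ j) = ?c * mat 1 $ i $ j" for i j
  proof -
    obtain K where K: "K > 0" "\<And>\<zeta>. norm \<zeta> > K \<Longrightarrow> \<zeta> \<notin> mat_spectrum A"
      "\<And>\<zeta> i j. norm \<zeta> > K \<Longrightarrow> norm (R \<zeta> $ i $ j) \<le> 1 / (norm \<zeta> - K)"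
      by (rule resolvent_entry_bound[of A]) blast
    define C where "C = (\<Sum>k\<in>UNIV. norm ((A - mat p) $ i $ k))"
    have C0: "C \<ge> 0" unfolding C_def by (intro sum_nonneg) auto
    let ?I = "contour_integral \<gamma> (\<lambda>\<zeta>. R \<zeta> $ i $ j)"
    have bd: "norm (?I - ?c * mat 1 $ i $ j) \<le> 2 * pi * C / (\<rho> - norm p - K)"
      if \<rho>: "\<rho> > r + norm p + K" for \<rho>
    proof -
      have rho: "\<rho> > 0" "\<rho> \<ge> r" using \<rho> r K norm_ge_zero[of p] by linarith+
      let ?g = "circlepath p \<rho>"
      have big: "norm \<zeta> \<ge> \<rho> - norm p" "norm \<zeta> > K" if "\<zeta> \<in> sphere p \<rho>" for \<zeta>
      proof -
        show 1: "norm \<zeta> \<ge> \<rho> - norm p" using that norm_triangle_ineq4[of p \<zeta>] by (simp add: dist_norm)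
        show "norm \<zeta> > K" using 1 \<rho> r by linarith
      qed
      have pi: "path_image ?g = sphere p \<rho>" using rho by simp
      have contR: "continuous_on (path_image ?g) (\<lambda>\<zeta>. R \<zeta> $ k $ j)" for k
        unfolding pi using big K(2)
        by (intro continuous_on_subset[OF holomorphic_on_imp_continuous_on[OF resolvent_entry_holomorphic]]) auto
      have intR: "(\<lambda>\<zeta>. R \<zeta> $ i $ j) contour_integrable_on ?g"
        using contR unfolding circlepath_def by (intro contour_integrable_continuous_part_circlepath) auto
      have c1: "((\<lambda>\<zeta>. mat 1 $ i $ j / (\<zeta> - p)) has_contour_integral ?c * mat 1 $ i $ j) ?g"
        using Cauchy_integral_circlepath_simple[of "\<lambda>_. mat 1 $ i $ j" p \<rho> p] rho by auto
      have "((\<lambda>\<zeta>. R \<zeta> $ i $ j - mat 1 $ i $ j / (\<zeta> - p)) has_contour_integral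
          (contour_integral ?g (\<lambda>\<zeta>. R \<zeta> $ i $ j) - ?c * mat 1 $ i $ j)) ?g"
        by (rule has_contour_integral_diff[OF has_contour_integral_integral[OF intR] c1])
      then have "((\<lambda>\<zeta>. R \<zeta> $ i $ j - mat 1 $ i $ j / (\<zeta> - p)) has_contour_integral
          (?I - ?c * mat 1 $ i $ j)) ?g" unfolding contour_R_indep[OF rho(2)] .
      then have "norm (?I - ?c * mat 1 $ i $ j) \<le> C / (\<rho> - norm p - K) / \<rho> * (2 * pi * \<rho>)"
      proof (rule has_contour_integral_bound_circlepath)
        show "0 \<le> C / (\<rho> - norm p - K) / \<rho>" using C0 \<rho> r rho by simp
        fix \<zeta> assume "norm (\<zeta> - p) = \<rho>"
        then have z: "\<zeta> \<in> sphere p \<rho>" by (simp add: dist_norm norm_minus_commute)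
        then have "invertible (mat \<zeta> - A)" using big K(2) by (auto simp: mat_spectrum_def)
        then have "(mat \<zeta> - A) ** R \<zeta> = mat 1" by (rule invertible_matrix_inv)
        then have E: "mat (\<zeta> - p) ** R \<zeta> - mat 1 = (A - mat p) ** R \<zeta>"
          by (simp add: mm.diff_left mat_diff algebra_simps)
        have L: "(mat (\<zeta> - p) ** R \<zeta> - mat 1) $ i $ j = (\<zeta> - p) * R \<zeta> $ i $ j - mat 1 $ i $ j"
          by (simp add: mat_mult_entry)
        have "((A - mat p) ** R \<zeta>) $ i $ j = (\<Sum>k\<in>UNIV. (A - mat p) $ i $ k * R \<zeta> $ k $ j)"
          by (simp add: matrix_matrix_mult_def)
        then have "(\<zeta> - p) * R \<zeta> $ i $ j - mat 1 $ i $ j = (\<Sum>k\<in>UNIV. (A - mat p) $ i $ k * R \<zeta> $ k $ j)"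
          by (simp only: L[symmetric] E)
        also have "norm \<dots> \<le> (\<Sum>k\<in>UNIV. norm ((A - mat p) $ i $ k) * (1 / (norm \<zeta> - K)))"
          by (rule order_trans[OF norm_sum]) (intro sum_mono, simp only: norm_mult,
            intro mult_left_mono K(3) big(2) z norm_ge_zero)
        also have "\<dots> = C * (1 / (norm \<zeta> - K))" unfolding C_def by (rule sum_distrib_right[symmetric])
        also have "\<dots> \<le> C * (1 / (\<rho> - norm p - K))"
          using big[OF z] \<rho> r C0 by (intro mult_left_mono divide_left_mono) auto
        finally have 2: "norm ((\<zeta> - p) * R \<zeta> $ i $ j - mat 1 $ i $ j) \<le> C / (\<rho> - norm p - K)" by simp
        have "\<zeta> - p \<noteq> 0" using \<open>norm (\<zeta> - p) = \<rho>\<close> rho by auto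
        then have "R \<zeta> $ i $ j - mat 1 $ i $ j / (\<zeta> - p) = ((\<zeta> - p) * R \<zeta> $ i $ j - mat 1 $ i $ j) / (\<zeta> - p)"
          by (simp add: field_simps)
        then have "norm (R \<zeta> $ i $ j - mat 1 $ i $ j / (\<zeta> - p)) = norm ((\<zeta> - p) * R \<zeta> $ i $ j - mat 1 $ i $ j) / \<rho>"
          using \<open>norm (\<zeta> - p) = \<rho>\<close> by (simp add: norm_divide)
        also have "\<dots> \<le> C / (\<rho> - norm p - K) / \<rho>"
          by (rule divide_right_mono[OF 2]) (use rho in simp)
        finally show "norm (R \<zeta> $ i $ j - mat 1 $ i $ j / (\<zeta> - p)) \<le> C / (\<rho> - norm p - K) / \<rho>" .
      qed (use rho in auto)
      also have "\<dots> = 2 * pi * C / (\<rho> - norm p - K)" using rho by simp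
      finally show ?thesis .
    qed
    have "((\<lambda>\<rho>. 2 * pi * C / (\<rho> - norm p - K)) \<longlongrightarrow> 0) at_top" by real_asymp
    then have "norm (?I - ?c * mat 1 $ i $ j) \<le> 0"
      by (rule tendsto_lowerbound)
        (use bd in \<open>auto intro!: eventually_mono[OF eventually_gt_at_top[of "r + norm p + K"]]\<close>)
    then show ?thesis by simp
  qed
  then show ?thesis by (simp add: vec_eq_iff calc_entry)
qed

end

lemma pos_im_disc:
  assumes "pos_im A"
  obtains p r where "disc_calculus A p r"
  using finite_upper_in_disc[OF mat_spectrum_finite[OF assms] mat_spectrum_pos_im[OF assms]] assms
  unfolding disc_calculus_def by metis

context disc_calculus
begin

text \<open>\<open>matrix_Ln\<close> integrates over a contour picked by \<open>SOME\<close>. In the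
  slit plane the residue theorem gives every such contour the same value, and the circle is one of
  them.\<close>

lemma matrix_Ln_calc: "matrix_Ln A = calc Ln"
proof -
  let ?S = "- \<real>\<^sub>\<le>\<^sub>0 :: complex set"
  have US: "upper \<subseteq> ?S" by (auto simp: complex_nonpos_Reals_iff)
  have rc: "riesz_contour ?S (mat_spectrum A) \<gamma>"
    unfolding riesz_contour_def
  proof (intro conjI ballI allI impI)
    show "path_image \<gamma> \<subseteq> ?S - mat_spectrum A" using path_image US by blast
    show "winding_number \<gamma> w = 1" if "w \<in> mat_spectrum A" for w
      using spec that by (intro winding_number_circlepath) (auto simp: dist_norm norm_minus_commute subset_iff)
    show "winding_number \<gamma> w = 0" if "w \<notin> ?S" for w
    proof (rule winding_number_zero_outside[of _ "cball p r"])
      show "w \<notin> cball p r" using that disc US by blast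
    qed (use r in auto)
  qed auto
  have "?S = - (complex_of_real ` {..0})"
    by (auto simp: complex_nonpos_Reals_iff image_iff complex_eq_iff)
  then have con: "connected ?S" by (metis starlike_imp_connected starlike_slotted_complex_plane_left)
  have op: "open ?S" by (simp add: open_Compl closed_nonpos_Reals_complex)
  have *: "contour_integral g (\<lambda>\<zeta>. Ln \<zeta> * R \<zeta> $ i $ j)
      = 2 * pi * \<i> * (\<Sum>w\<in>mat_spectrum A. residue (\<lambda>\<zeta>. Ln \<zeta> * R \<zeta> $ i $ j) w)"
    if g: "riesz_contour ?S (mat_spectrum A) g" for g i j
  proof -
    have "contour_integral g (\<lambda>\<zeta>. Ln \<zeta> * R \<zeta> $ i $ j)
      = 2 * pi * \<i> * (\<Sum>w\<in>mat_spectrum A. winding_number g w * residue (\<lambda>\<zeta>. Ln \<zeta> * R \<zeta> $ i $ j) w)"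
    proof (rule Residue_theorem[OF op con mat_spectrum_finite[OF pos]])
      show "(\<lambda>\<zeta>. Ln \<zeta> * R \<zeta> $ i $ j) holomorphic_on ?S - mat_spectrum A"
        by (intro holomorphic_intros holomorphic_on_subset[OF resolvent_entry_holomorphic]) auto
    qed (use g in \<open>auto simp: riesz_contour_def\<close>)
    then show ?thesis using g by (simp add: riesz_contour_def)
  qed
  have "riesz_contour ?S (mat_spectrum A) (SOME \<gamma>. riesz_contour ?S (mat_spectrum A) \<gamma>)"
    by (rule someI[of "riesz_contour ?S (mat_spectrum A)", OF rc])
  from *[OF this] *[OF rc] show ?thesis
    by (simp add: matrix_Ln_def holo_calculus_def calc_def Let_def)
qed

text \<open>The segment from the identity to cA, along which the logarithm is integrated.\<close>

definition segm :: "complex \<Rightarrow> real \<Rightarrow> complex^'m^'m" where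
  "segm c t = mat (1 - of_real t) + mat (of_real t * c) ** A"

text \<open>Ln w is the integral over t in [0, 1] of (w - 1) / (1 + t (w - 1)). Exchanging it with
  the contour integral replaces the logarithm by inverses of matrices on the segment from 1 to cA.
  The additional factor \<open>f\<close> provides the multiplicativity needed for powers of the
  logarithm.\<close>

lemma Ln_mult_calc:
  assumes f: "f holomorphic_on upper" and c: "\<And>\<zeta>. Im \<zeta> > 0 \<Longrightarrow> c * \<zeta> \<notin> \<real>\<^sub>\<le>\<^sub>0"
  shows "\<And>t. t \<in> {0..1} \<Longrightarrow> invertible (segm c t)"
    and "calc (\<lambda>\<zeta>. f \<zeta> * Ln (c * \<zeta>))
      = integral {0..1} (\<lambda>t. (mat c ** A - mat 1) ** matrix_inv (segm c t)) ** calc f"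
    and "continuous_on {0..1} (\<lambda>t. (mat c ** A - mat 1) ** matrix_inv (segm c t))"
proof -
  let ?d = "\<lambda>t \<zeta>. 1 + of_real t * (c * \<zeta> - 1) :: complex"
  \<comment> \<open>The slit plane is star-shaped about 1, so the segment from 1 to w avoids the
    cut.\<close>
  have nz: "1 + s * (w - 1) \<notin> \<real>\<^sub>\<le>\<^sub>0" if "w \<notin> \<real>\<^sub>\<le>\<^sub>0" "s = of_real t" "t \<in> {0..1}" for w s :: complex and t
  proof
    assume A: "1 + s * (w - 1) \<in> \<real>\<^sub>\<le>\<^sub>0"
    show False
    proof (cases "t = 0")
      case True
      then show False using A that by (simp add: complex_nonpos_Reals_iff)
    next
      case False
      then have "t > 0" using that by simp
      from A have "t * Im w = 0" "1 + t * (Re w - 1) \<le> 0"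
        using that by (simp_all add: complex_nonpos_Reals_iff)
      then have "Im w = 0" "t * Re w \<le> t - 1" using \<open>t > 0\<close> by (auto simp: algebra_simps)
      then have "Re w \<le> 0" using that \<open>t > 0\<close>
        by (metis atLeastAtMost_iff diff_le_0_iff_le mult_le_0_iff not_less order_trans)
      then show False using \<open>Im w = 0\<close> that(1) by (simp add: complex_nonpos_Reals_iff)
    qed
  qed
  have nz0: "?d t \<zeta> \<noteq> 0" if "Im \<zeta> > 0" "t \<in> {0..1}" for \<zeta> t
    using nz[OF c[OF that(1)] refl that(2)] by (metis nonpos_Reals_zero_I)
  \<comment> \<open>Multiplication by the segment matrix cancels the denominator, by linearity and
    \<open>calc_id_mult\<close>. With h = 1 this also exhibits the inverse of the segment
    matrix.\<close>
  have div: "segm c t ** calc (\<lambda>\<zeta>. h \<zeta> / ?d t \<zeta>) = calc h"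
    if h: "h holomorphic_on upper" and t: "t \<in> {0..1}" for h t
  proof -
    have hd: "(\<lambda>\<zeta>. h \<zeta> / ?d t \<zeta>) holomorphic_on upper"
      using nz0 t by (intro holomorphic_intros h) auto
    have "segm c t ** calc (\<lambda>\<zeta>. h \<zeta> / ?d t \<zeta>)
        = calc (\<lambda>\<zeta>. (1 - of_real t) * (h \<zeta> / ?d t \<zeta>) + (of_real t * c) * (\<zeta> * (h \<zeta> / ?d t \<zeta>)))"
      by (subst calc_add calc_cmul calc_id_mult, (intro holomorphic_intros hd)+)+
        (simp add: segm_def mm.add_left matrix_mul_assoc)
    also have "\<dots> = calc h"
    proof (rule calc_cong)
      fix \<zeta> assume "\<zeta> \<in> path_image \<gamma>"
      then have "?d t \<zeta> \<noteq> 0" using path_image t by (intro nz0) auto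
      have "(1 - of_real t) * (h \<zeta> / ?d t \<zeta>) + (of_real t * c) * (\<zeta> * (h \<zeta> / ?d t \<zeta>)) = h \<zeta> / ?d t \<zeta> * ?d t \<zeta>"
        by (simp add: algebra_simps add_divide_distrib diff_divide_distrib)
      then show "(1 - of_real t) * (h \<zeta> / ?d t \<zeta>) + (of_real t * c) * (\<zeta> * (h \<zeta> / ?d t \<zeta>)) = h \<zeta>"
        using \<open>?d t \<zeta> \<noteq> 0\<close> by simp
    qed
    finally show ?thesis .
  qed
  show inv: "invertible (segm c t)" if "t \<in> {0..1}" for t
    by (rule matrix_inv_unique(1)[of _ "calc (\<lambda>\<zeta>. 1 / ?d t \<zeta>)"], subst div)
      (use that in \<open>auto simp: calc_one\<close>)
  have div': "calc (\<lambda>\<zeta>. h \<zeta> / ?d t \<zeta>) = matrix_inv (segm c t) ** calc h"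
    if h: "h holomorphic_on upper" and t: "t \<in> {0..1}" for h t
  proof -
    have "matrix_inv (segm c t) ** calc h = matrix_inv (segm c t) ** segm c t ** calc (\<lambda>\<zeta>. h \<zeta> / ?d t \<zeta>)"
      by (simp add: div[OF h t, symmetric] matrix_mul_assoc)
    then show ?thesis by (simp add: invertible_matrix_inv[OF inv[OF t]])
  qed
  show cont: "continuous_on {0..1} (\<lambda>t. (mat c ** A - mat 1) ** matrix_inv (segm c t))"
    unfolding segm_def
    by (intro mm.continuous_on continuous_on_matrix_inv continuous_intros
        bounded_linear.continuous_on[OF bounded_linear_mat])
      (use inv in \<open>auto simp: segm_def\<close>)
  have "calc (\<lambda>\<zeta>. f \<zeta> * Ln (c * \<zeta>)) $ i $ j
      = (integral {0..1} (\<lambda>t. (mat c ** A - mat 1) ** matrix_inv (segm c t)) ** calc f) $ i $ j" for i j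
  proof -
    let ?l = "linepath 0 1 :: real \<Rightarrow> complex"
    let ?g = "\<lambda>\<zeta> t. f \<zeta> * ((c * \<zeta> - 1) / (1 + t * (c * \<zeta> - 1))) * R \<zeta> $ i $ j"
    have l01: "path_image ?l = of_real ` {0..1}"
      by (auto simp: path_image_def linepath_def image_iff scaleR_conv_of_real)
    have LnI: "Ln w = contour_integral ?l (\<lambda>t. (w - 1) / (1 + t * (w - 1)))" if w: "w \<notin> \<real>\<^sub>\<le>\<^sub>0" for w
    proof -
      have "((\<lambda>t. (w - 1) / (1 + t * (w - 1))) has_contour_integral
          (Ln (1 + pathfinish ?l * (w - 1)) - Ln (1 + pathstart ?l * (w - 1)))) ?l"
      proof (rule contour_integral_primitive[where S = "path_image ?l"])
        fix x assume "x \<in> path_image ?l"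
        then have "1 + x * (w - 1) \<notin> \<real>\<^sub>\<le>\<^sub>0" unfolding l01 using nz[OF w] by blast
        then show "((\<lambda>x. Ln (1 + x * (w - 1))) has_field_derivative (w - 1) / (1 + x * (w - 1))) (at x within path_image ?l)"
          by (auto intro!: derivative_eq_intros simp: divide_inverse)
      qed (rule valid_path_linepath, rule subset_refl)
      then show ?thesis by (simp add: contour_integral_unique)
    qed
    have gc: "continuous_on (path_image \<gamma> \<times> path_image ?l) (\<lambda>(\<zeta>, t). ?g \<zeta> t)"
    proof -
      have 1: "continuous_on (path_image \<gamma> \<times> path_image ?l) (\<lambda>x. f (fst x))"
        by (rule continuous_on_compose2[OF contf[OF f]]) (auto intro!: continuous_intros)
      have 2: "continuous_on (path_image \<gamma> \<times> path_image ?l) (\<lambda>x. R (fst x) $ i $ j)"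
        by (rule continuous_on_compose2[OF continuous_R]) (auto intro!: continuous_intros)
      have 3: "1 + snd x * (c * fst x - 1) \<noteq> 0" if "x \<in> path_image \<gamma> \<times> path_image ?l" for x
        using that nz0 path_image(2) unfolding l01 by auto
      show ?thesis unfolding case_prod_unfold
        by (intro continuous_intros 1 2) (use 3 in auto)
    qed
    have "contour_integral \<gamma> (\<lambda>\<zeta>. f \<zeta> * Ln (c * \<zeta>) * R \<zeta> $ i $ j) = contour_integral \<gamma> (\<lambda>\<zeta>. contour_integral ?l (?g \<zeta>))"
    proof (rule contour_integral_cong[OF refl])
      fix \<zeta> assume "\<zeta> \<in> path_image \<gamma>"
      then have "Im \<zeta> > 0" using path_image by auto
      let ?h = "\<lambda>t. (c * \<zeta> - 1) / (1 + t * (c * \<zeta> - 1))"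
      have "?h contour_integrable_on ?l"
      proof (rule contour_integrable_continuous_linepath, intro continuous_intros)
        show "\<forall>x\<in>closed_segment 0 1. 1 + x * (c * \<zeta> - 1) \<noteq> 0"
          using nz0[OF \<open>Im \<zeta> > 0\<close>] l01 by auto
      qed
      then have "contour_integral ?l (\<lambda>t. (f \<zeta> * R \<zeta> $ i $ j) * ?h t) = (f \<zeta> * R \<zeta> $ i $ j) * contour_integral ?l ?h"
        by (rule contour_integral_lmul)
      also have "contour_integral ?l ?h = Ln (c * \<zeta>)" by (rule LnI[OF c[OF \<open>Im \<zeta> > 0\<close>], symmetric])
      finally have "contour_integral ?l (\<lambda>t. (f \<zeta> * R \<zeta> $ i $ j) * ?h t) = f \<zeta> * R \<zeta> $ i $ j * Ln (c * \<zeta>)" .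
      then show "f \<zeta> * Ln (c * \<zeta>) * R \<zeta> $ i $ j = contour_integral ?l (?g \<zeta>)" by (simp add: mult_ac)
    qed
    \<comment> \<open>After the exchange the inner integral has a rational function of \<zeta> as
      factor, and \<open>div'\<close> evaluates it.\<close>
    also have "\<dots> = contour_integral ?l (\<lambda>t. contour_integral \<gamma> (\<lambda>\<zeta>. ?g \<zeta> t))"
      by (rule contour_integral_swap[OF gc]) (auto simp: vector_derivative_circlepath intro!: continuous_intros)
    also have "\<dots> = integral {0..1} (\<lambda>t. contour_integral \<gamma> (\<lambda>\<zeta>. ?g \<zeta> (of_real t)))"
      using contour_integral_linepath_Reals_eq[of 0 1 "\<lambda>t. contour_integral \<gamma> (\<lambda>\<zeta>. ?g \<zeta> t)"] by simp
    also have "\<dots> = integral {0..1} (\<lambda>t. (2 * of_real pi * \<i>) * ((mat c ** A - mat 1) ** matrix_inv (segm c t) ** calc f) $ i $ j)"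
    proof (rule integral_cong)
      fix t :: real assume t: "t \<in> {0..1}"
      have hd: "(\<lambda>\<zeta>. f \<zeta> / ?d t \<zeta>) holomorphic_on upper"
        using nz0 t by (intro holomorphic_intros f) auto
      have "(mat c ** A - mat 1) ** matrix_inv (segm c t) ** calc f
          = mat c ** (A ** calc (\<lambda>\<zeta>. f \<zeta> / ?d t \<zeta>)) + mat (-1) ** calc (\<lambda>\<zeta>. f \<zeta> / ?d t \<zeta>)"
        by (simp add: div'[OF f t] mm.diff_left matrix_mul_assoc mat_minus_one_mult mm.minus_left)
      also have "\<dots> = calc (\<lambda>\<zeta>. c * (\<zeta> * (f \<zeta> / ?d t \<zeta>)) + (-1) * (f \<zeta> / ?d t \<zeta>))"
        by (subst calc_add calc_cmul calc_id_mult, (intro holomorphic_intros hd)+)+ simp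
      finally have c1: "(mat c ** A - mat 1) ** matrix_inv (segm c t) ** calc f
          = calc (\<lambda>\<zeta>. c * (\<zeta> * (f \<zeta> / ?d t \<zeta>)) + (-1) * (f \<zeta> / ?d t \<zeta>))" .
      have c2: "calc (\<lambda>\<zeta>. c * (\<zeta> * (f \<zeta> / ?d t \<zeta>)) + (-1) * (f \<zeta> / ?d t \<zeta>)) $ i $ j = contour_integral \<gamma> (\<lambda>\<zeta>. ?g \<zeta> (of_real t)) / (2 * of_real pi * \<i>)"
      proof -
        have "contour_integral \<gamma> (\<lambda>\<zeta>. (c * (\<zeta> * (f \<zeta> / ?d t \<zeta>)) + (-1) * (f \<zeta> / ?d t \<zeta>)) * R \<zeta> $ i $ j)
            = contour_integral \<gamma> (\<lambda>\<zeta>. ?g \<zeta> (of_real t))"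
        proof (rule contour_integral_cong[OF refl])
          fix \<zeta>
          have alg: "(c * (\<zeta> * (y / D)) + (-1) * (y / D)) * r = y * ((c * \<zeta> - 1) / D) * r" for y D r :: complex
            by (simp add: divide_inverse algebra_simps)
          show "(c * (\<zeta> * (f \<zeta> / ?d t \<zeta>)) + (-1) * (f \<zeta> / ?d t \<zeta>)) * R \<zeta> $ i $ j = ?g \<zeta> (of_real t)"
            by (rule alg)
        qed
        then show ?thesis unfolding calc_entry by simp
      qed
      have e: "((mat c ** A - mat 1) ** matrix_inv (segm c t) ** calc f) $ i $ j
          = contour_integral \<gamma> (\<lambda>\<zeta>. ?g \<zeta> (of_real t)) / (2 * of_real pi * \<i>)"
        by (rule trans[OF arg_cong[where f = "\<lambda>X. X $ i $ j", OF c1] c2])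
      have "a = 2 * of_real pi * \<i> * (a / (2 * of_real pi * \<i>))" for a :: complex by simp
      then show "contour_integral \<gamma> (\<lambda>\<zeta>. ?g \<zeta> (of_real t))
          = (2 * of_real pi * \<i>) * ((mat c ** A - mat 1) ** matrix_inv (segm c t) ** calc f) $ i $ j" unfolding e .
    qed
    also have "\<dots> = (2 * of_real pi * \<i>) * integral {0..1} (\<lambda>t. ((mat c ** A - mat 1) ** matrix_inv (segm c t) ** calc f) $ i $ j)"
      by (rule integral_mult_right)
    also have "integral {0..1} (\<lambda>t. ((mat c ** A - mat 1) ** matrix_inv (segm c t) ** calc f) $ i $ j)
        = (integral {0..1} (\<lambda>t. (mat c ** A - mat 1) ** matrix_inv (segm c t)) ** calc f) $ i $ j"
    proof -
      have bl: "bounded_linear (\<lambda>X. (X ** calc f) $ i $ j)"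
        by (intro bounded_linear_compose[OF bounded_linear_vec_nth] mm.bounded_linear_left)
      show ?thesis
        using integral_linear[OF integrable_continuous_real[OF cont] bl] by (simp add: o_def)
    qed
    finally show ?thesis by (simp add: calc_entry)
  qed
  then show "calc (\<lambda>\<zeta>. f \<zeta> * Ln (c * \<zeta>))
      = integral {0..1} (\<lambda>t. (mat c ** A - mat 1) ** matrix_inv (segm c t)) ** calc f"
    by (simp add: vec_eq_iff)
qed

lemma calc_Ln_eq_integral:
  assumes c: "\<And>\<zeta>. Im \<zeta> > 0 \<Longrightarrow> c * \<zeta> \<notin> \<real>\<^sub>\<le>\<^sub>0"
  shows "calc (\<lambda>\<zeta>. Ln (c * \<zeta>)) = integral {0..1} (\<lambda>t. (mat c ** A - mat 1) ** matrix_inv (segm c t))"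
  using Ln_mult_calc(2)[of "\<lambda>_. 1" c] c by (simp add: calc_one)

text \<open>Solve v = y + t w with w = (cA - 1) y. The integrand at v is <v, w> = <y, w> + t |w|^2,
  with imaginary part Im (c <y, A y>). So the sign of the numerical range is inherited at every t.
  The factor \<open>s\<close> allows bounds from either side.\<close>

lemma Im_calc_Ln_le_0:
  assumes c: "\<And>\<zeta>. Im \<zeta> > 0 \<Longrightarrow> c * \<zeta> \<notin> \<real>\<^sub>\<le>\<^sub>0" and s: "\<And>v. s * Im (c * cip v (A *v v)) \<le> 0"
  shows "s * Im (cip v (calc (\<lambda>\<zeta>. Ln (c * \<zeta>)) *v v)) \<le> 0"
proof -
  let ?F = "\<lambda>t. (mat c ** A - mat 1) ** matrix_inv (segm c t)"
  have inv: "invertible (segm c t)" if "t \<in> {0..1}" for t by (rule Ln_mult_calc(1)[of "\<lambda>_. 1", OF _ c that]) auto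
  have cont: "continuous_on {0..1} ?F" by (rule Ln_mult_calc(3)[of "\<lambda>_. 1", OF _ c]) auto
  have bl: "bounded_linear (\<lambda>X. s * Im (cip v (X *v v)))"
    by (intro bounded_linear_compose[OF bounded_linear_mult_right] bounded_linear_compose[OF bounded_linear_Im]
        bounded_linear_compose[OF cip_bl.bounded_linear_right] mv.bounded_linear_left)
  have "s * Im (cip v (calc (\<lambda>\<zeta>. Ln (c * \<zeta>)) *v v)) = integral {0..1} (\<lambda>t. s * Im (cip v (?F t *v v)))"
  proof -
    have e: "calc (\<lambda>\<zeta>. Ln (c * \<zeta>)) = integral {0..1} ?F" by (rule calc_Ln_eq_integral) (rule c)
    show ?thesis unfolding e
      by (rule integral_linear[OF integrable_continuous_real[OF cont] bl, unfolded o_def, symmetric])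
  qed
  also have "\<dots> \<le> integral {0..1} (\<lambda>t::real. 0)"
  proof (rule integral_le)
    show "(\<lambda>t. s * Im (cip v (?F t *v v))) integrable_on {0..1}"
      by (intro integrable_continuous_real bounded_linear.continuous_on[OF bl cont])
    fix t :: real assume t: "t \<in> {0..1}"
    define y where "y = matrix_inv (segm c t) *v v"
    have v: "v = segm c t *v y"
      by (simp add: y_def matrix_vector_mul_assoc invertible_matrix_inv[OF inv[OF t]])
    let ?w = "(mat c ** A - mat 1) *v y"
    have w: "?w = c *s (A *v y) - y"
      by (simp add: mv.diff_left mat_mult_vec matrix_vector_mul_assoc[symmetric])
    have Fv: "?F t *v v = ?w" by (simp add: y_def matrix_vector_mul_assoc)
    have seg: "segm c t *v y = y + of_real t *s ?w"
      by (simp add: w segm_def mv.add_left mat_mult_vec matrix_vector_mul_assoc[symmetric] vec_eq_iff algebra_simps)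
    have "cip v (?F t *v v) = cip (segm c t *v y) ?w" by (simp only: Fv v[symmetric])
    also have "\<dots> = cip (y + of_real t *s ?w) ?w" unfolding seg ..
    also have "\<dots> = cip y ?w + of_real t * of_real ((norm ?w)\<^sup>2)"
      by (simp add: cip_bl.add_left cip_scale_left cip_self)
    finally have "Im (cip v (?F t *v v)) = Im (cip y ?w)" by (simp del: of_real_power)
    also have "\<dots> = Im (c * cip y (A *v y))"
      by (simp add: w cip_bl.diff_right cip_scale_right cip_self del: of_real_power)
    finally show "s * Im (cip v (?F t *v v)) \<le> 0" using s[of y] by simp
  qed auto
  finally show ?thesis by simp
qed

end

text \<open>For 0 \<le> \<alpha> \<le> \<pi> the argument of the rotated point stays strictly
  between -\<pi> and \<pi>, so the principal branch is not left.\<close>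

lemma Ln_rotate:
  assumes "Im \<zeta> > 0" "0 \<le> \<alpha>" "\<alpha> \<le> pi"
  shows "exp (- \<i> * \<alpha>) * \<zeta> \<notin> \<real>\<^sub>\<le>\<^sub>0" "Ln (exp (- \<i> * \<alpha>) * \<zeta>) = Ln \<zeta> - \<i> * \<alpha>"
proof -
  have z: "\<zeta> \<noteq> 0" using assms by auto
  have I: "0 < Im (Ln \<zeta>)" "Im (Ln \<zeta>) < pi" using Im_Ln_pos_lt[OF z] assms by auto
  have e: "exp (Ln \<zeta> - \<i> * \<alpha>) = exp (- \<i> * \<alpha>) * \<zeta>" using z by (simp add: exp_diff exp_minus field_simps)
  show L: "Ln (exp (- \<i> * \<alpha>) * \<zeta>) = Ln \<zeta> - \<i> * \<alpha>"
    by (rule Ln_unique) (use I assms e in auto)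
  show "exp (- \<i> * \<alpha>) * \<zeta> \<notin> \<real>\<^sub>\<le>\<^sub>0"
  proof
    assume A: "exp (- \<i> * \<alpha>) * \<zeta> \<in> \<real>\<^sub>\<le>\<^sub>0"
    have nz: "exp (- \<i> * \<alpha>) * \<zeta> \<noteq> 0" using z by simp
    have "Im (Ln (exp (- \<i> * \<alpha>) * \<zeta>)) = pi"
      using A nz Im_Ln_eq_pi[OF nz] by (auto simp: complex_nonpos_Reals_iff complex_eq_iff less_le)
    then show False using L I assms by simp
  qed
qed

text \<open>Rotation by -\<alpha> moves the ray of angle \<alpha> to the positive axis, where the
  sign lemma applies. With s = 1 a numerical range below the ray gives an upper bound for the
  imaginary part of the logarithm, with s = -1 one above the ray gives a lower bound.\<close>

lemma Im_matrix_Ln_sector: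
  fixes A :: "complex^'m^'m"
  assumes A: "pos_im A" and \<alpha>: "0 \<le> \<alpha>" "\<alpha> \<le> pi"
    and s: "\<And>v. s * Im (exp (- \<i> * \<alpha>) * cip v (A *v v)) \<le> 0"
  shows "s * (Im (cip v (matrix_Ln A *v v)) - \<alpha> * (norm v)\<^sup>2) \<le> 0"
proof -
  obtain p r where "disc_calculus A p r" using pos_im_disc[OF A] .
  then interpret disc_calculus A p r .
  have "calc (\<lambda>\<zeta>. Ln (exp (- \<i> * \<alpha>) * \<zeta>)) = calc (\<lambda>\<zeta>. Ln \<zeta> + (- \<i> * \<alpha>) * 1)"
  proof (rule calc_cong)
    fix \<zeta> assume "\<zeta> \<in> path_image \<gamma>"
    from Ln_rotate(2)[OF path_image_Im[OF this] \<alpha>]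
    show "Ln (exp (- \<i> * \<alpha>) * \<zeta>) = Ln \<zeta> + (- \<i> * \<alpha>) * 1" by simp
  qed
  also have "\<dots> = matrix_Ln A + mat (- \<i> * \<alpha>)"
    by (subst calc_add calc_cmul, (intro holomorphic_intros; auto simp: complex_nonpos_Reals_iff)+)+
      (simp add: calc_one matrix_Ln_calc)
  finally have "s * Im (cip v ((matrix_Ln A + mat (- \<i> * \<alpha>)) *v v)) \<le> 0"
    using Im_calc_Ln_le_0[of "exp (- \<i> * \<alpha>)" s v] Ln_rotate \<alpha> s by simp
  then show ?thesis
    by (simp add: mv.add_left cip_bl.add_right cip_bl.diff_right cip_bl.minus_right cs_bl.minus_left
        mat_mult_vec cip_scale_right cip_self del: of_real_power)
qed

text \<open>A formula without contours: the integrand is rational in A, so continuity and holomorphy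
  in a parameter can be checked entrywise although the contour varies with the matrix.\<close>

lemma matrix_Ln_integral:
  fixes A :: "complex^'m^'m"
  assumes A: "pos_im A"
  shows "matrix_Ln A = integral {0..1} (\<lambda>t. (A - mat 1) ** matrix_inv (mat (1 - of_real t) + mat (of_real t) ** A))"
    and "\<And>t. t \<in> {0..1} \<Longrightarrow> invertible (mat (1 - of_real t) + mat (of_real t) ** A)"
proof -
  obtain p r where "disc_calculus A p r" using pos_im_disc[OF A] .
  then interpret disc_calculus A p r .
  have c: "1 * \<zeta> \<notin> \<real>\<^sub>\<le>\<^sub>0" if "Im \<zeta> > 0" for \<zeta> using that by (simp add: complex_nonpos_Reals_iff)
  show "matrix_Ln A = integral {0..1} (\<lambda>t. (A - mat 1) ** matrix_inv (mat (1 - of_real t) + mat (of_real t) ** A))"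
    using calc_Ln_eq_integral[OF c] by (simp add: matrix_Ln_calc segm_def)
  show "invertible (mat (1 - of_real t) + mat (of_real t) ** A)" if "t \<in> {0..1}" for t
    using Ln_mult_calc(1)[OF _ c that, of "\<lambda>_. 1"] by (simp add: segm_def)
qed

section \<open>Injectivity of the matrix logarithm and dependence on a parameter\<close>

fun mpow :: "complex^'m^'m \<Rightarrow> nat \<Rightarrow> complex^'m^'m" where
  "mpow X 0 = mat 1"
| "mpow X (Suc n) = X ** mpow X n"

text \<open>Evaluating the exponential series inside the contour integral replaces a theory of the matrix
  exponential.\<close>

lemma exp_matrix_Ln:
  fixes A :: "complex^'m^'m"
  assumes A: "pos_im A"
  shows "(\<lambda>n. \<Sum>k<n. mat (1 / fact k) ** mpow (matrix_Ln A + mat a) k) \<longlonglongrightarrow> mat (exp a) ** A"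
proof -
  obtain p r where "disc_calculus A p r" using pos_im_disc[OF A] .
  then interpret disc_calculus A p r .
  let ?L = "\<lambda>\<zeta>. Ln \<zeta> + a"
  have Ln_hol: "Ln holomorphic_on upper"
    by (intro holomorphic_intros) (auto simp: complex_nonpos_Reals_iff)
  have hol: "(\<lambda>\<zeta>. ?L \<zeta> ^ n) holomorphic_on upper" for n by (intro holomorphic_intros Ln_hol; simp add: complex_nonpos_Reals_iff)
  \<comment> \<open>Powers of the logarithm only require multiplicativity against this one function,
    which the integral representation of Ln supplies.\<close>
  have mult: "calc (\<lambda>\<zeta>. f \<zeta> * ?L \<zeta>) = (matrix_Ln A + mat a) ** calc f" if f: "f holomorphic_on upper" for f
  proof -
    have c: "1 * \<zeta> \<notin> \<real>\<^sub>\<le>\<^sub>0" if "Im \<zeta> > 0" for \<zeta> using that by (simp add: complex_nonpos_Reals_iff)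
    let ?I = "integral {0..1} (\<lambda>t. (mat 1 ** A - mat 1) ** matrix_inv (segm 1 t))"
    have fL: "calc (\<lambda>\<zeta>. f \<zeta> * Ln (1 * \<zeta>)) = ?I ** calc f" by (rule Ln_mult_calc(2)[OF f]) (rule c)
    have L: "calc (\<lambda>\<zeta>. Ln (1 * \<zeta>)) = ?I" by (rule calc_Ln_eq_integral) (rule c)
    have 1: "calc (\<lambda>\<zeta>. f \<zeta> * Ln (1 * \<zeta>)) = matrix_Ln A ** calc f"
      unfolding fL L[symmetric] by (simp add: matrix_Ln_calc)
    have "calc (\<lambda>\<zeta>. f \<zeta> * Ln \<zeta> + a * f \<zeta>) = matrix_Ln A ** calc f + mat a ** calc f"
      using 1 by (subst calc_add) (auto intro!: holomorphic_on_mult f Ln_hol holomorphic_on_const simp: calc_cmul f)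
    moreover have "(\<lambda>\<zeta>. f \<zeta> * ?L \<zeta>) = (\<lambda>\<zeta>. f \<zeta> * Ln \<zeta> + a * f \<zeta>)" by (simp add: fun_eq_iff algebra_simps)
    ultimately show ?thesis by (simp add: mm.add_left)
  qed
  have pow: "calc (\<lambda>\<zeta>. ?L \<zeta> ^ n) = mpow (matrix_Ln A + mat a) n" for n
    by (induction n) (use mult[OF hol] in \<open>auto simp: calc_one mult.commute\<close>)
  have part: "calc (\<lambda>\<zeta>. \<Sum>k<n. (1 / fact k) * ?L \<zeta> ^ k) = (\<Sum>k<n. mat (1 / fact k) ** mpow (matrix_Ln A + mat a) k)" for n
  proof (induction n)
    case 0
    show ?case by (simp add: vec_eq_iff calc_entry)
  next
    case (Suc n)
    have "calc (\<lambda>\<zeta>. (\<Sum>k<n. (1 / fact k) * ?L \<zeta> ^ k) + (1 / fact n) * ?L \<zeta> ^ n)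
        = calc (\<lambda>\<zeta>. \<Sum>k<n. (1 / fact k) * ?L \<zeta> ^ k) + calc (\<lambda>\<zeta>. (1 / fact n) * ?L \<zeta> ^ n)"
      by (rule calc_add) (intro holomorphic_on_sum holomorphic_on_mult holomorphic_on_const hol)+
    then show ?case using Suc by (simp only: sum.lessThan_Suc calc_cmul[OF hol] pow)
  qed
  have compact: "compact (path_image \<gamma>)" unfolding path_image(1) by simp
  have "bounded (?L ` path_image \<gamma>)"
    using contf[OF hol[of 1]] by (intro compact_imp_bounded compact_continuous_image compact) simp
  then obtain M where M: "M > 0" "\<And>\<zeta>. \<zeta> \<in> path_image \<gamma> \<Longrightarrow> norm (?L \<zeta>) \<le> M" by (auto simp: bounded_pos)
  have lim: "(\<lambda>n. calc (\<lambda>\<zeta>. \<Sum>k<n. (1 / fact k) * ?L \<zeta> ^ k) $ i $ j) \<longlonglongrightarrow> calc (\<lambda>\<zeta>. exp (?L \<zeta>)) $ i $ j" for i j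
  proof -
    have "bounded ((\<lambda>\<zeta>. R \<zeta> $ i $ j) ` path_image \<gamma>)"
      by (intro compact_imp_bounded compact_continuous_image compact continuous_R)
    then obtain N where N: "N > 0" "\<And>\<zeta>. \<zeta> \<in> path_image \<gamma> \<Longrightarrow> norm (R \<zeta> $ i $ j) \<le> N" by (auto simp: bounded_pos)
    let ?f = "\<lambda>k \<zeta>. (1 / fact k) * ?L \<zeta> ^ k * R \<zeta> $ i $ j"
    have "uniform_limit (path_image \<gamma>) (\<lambda>n \<zeta>. \<Sum>k<n. ?f k \<zeta>) (\<lambda>\<zeta>. \<Sum>k. ?f k \<zeta>) sequentially"
    proof (rule Weierstrass_m_test)
      show "norm (?f k \<zeta>) \<le> M ^ k / fact k * N" if "\<zeta> \<in> path_image \<gamma>" for k \<zeta>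
      proof -
        have "norm (?f k \<zeta>) = norm (?L \<zeta>) ^ k / fact k * norm (R \<zeta> $ i $ j)"
          by (simp add: norm_mult norm_divide norm_power)
        also have "\<dots> \<le> M ^ k / fact k * N"
          using M(2)[OF that] N(2)[OF that] M(1) by (intro mult_mono divide_right_mono power_mono) auto
        finally show ?thesis .
      qed
      show "summable (\<lambda>k. M ^ k / fact k * N)"
        using summable_exp[of M] by (intro summable_mult2) (simp add: divide_inverse mult.commute)
    qed
    moreover have "(\<Sum>k. ?f k \<zeta>) = exp (?L \<zeta>) * R \<zeta> $ i $ j" for \<zeta>
    proof -
      have "(\<lambda>k. ?L \<zeta> ^ k /\<^sub>R fact k) sums exp (?L \<zeta>)" by (rule exp_converges)
      then have "(\<lambda>k. ?L \<zeta> ^ k /\<^sub>R fact k * R \<zeta> $ i $ j) sums (exp (?L \<zeta>) * R \<zeta> $ i $ j)" by (rule sums_mult2)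
      then show ?thesis by (simp add: sums_iff scaleR_conv_of_real divide_inverse)
    qed
    ultimately have ul: "uniform_limit (path_image \<gamma>) (\<lambda>n \<zeta>. (\<Sum>k<n. (1 / fact k) * ?L \<zeta> ^ k) * R \<zeta> $ i $ j)
        (\<lambda>\<zeta>. exp (?L \<zeta>) * R \<zeta> $ i $ j) sequentially" by (simp only: sum_distrib_right)
    have "(\<lambda>n. contour_integral \<gamma> (\<lambda>\<zeta>. (\<Sum>k<n. (1 / fact k) * ?L \<zeta> ^ k) * R \<zeta> $ i $ j))
        \<longlonglongrightarrow> contour_integral \<gamma> (\<lambda>\<zeta>. exp (?L \<zeta>) * R \<zeta> $ i $ j)"
    proof (rule contour_integral_uniform_limit_circlepath(2)[OF _ ul[unfolded path_image(1)]])
      show "\<forall>\<^sub>F n in sequentially. (\<lambda>\<zeta>. (\<Sum>k<n. (1 / fact k) * ?L \<zeta> ^ k) * R \<zeta> $ i $ j) contour_integrable_on \<gamma>"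
        by (intro always_eventually allI integrable contf holomorphic_on_sum holomorphic_on_mult holomorphic_on_const hol)
    qed (use r in auto)
    then show ?thesis unfolding calc_entry by (intro tendsto_divide) auto
  qed
  have "calc (\<lambda>\<zeta>. exp (?L \<zeta>)) = calc (\<lambda>\<zeta>. exp a * (\<zeta> * 1))"
  proof (rule calc_cong)
    fix \<zeta> assume "\<zeta> \<in> path_image \<gamma>"
    then have "\<zeta> \<noteq> 0" using path_image_Im[of \<zeta>] by auto
    then show "exp (?L \<zeta>) = exp a * (\<zeta> * 1)" by (simp add: exp_add mult.commute)
  qed
  also have "\<dots> = mat (exp a) ** A"
    by (subst calc_cmul calc_id_mult, (intro holomorphic_intros))+ (simp add: calc_one)
  finally have "calc (\<lambda>\<zeta>. exp (?L \<zeta>)) = mat (exp a) ** A" .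
  with lim show ?thesis unfolding part by (intro vec_tendstoI) simp
qed

text \<open>The scalar summands are what carries the factor (E0 - z)^(1/2) in the application, where
  the two logarithms differ by a multiple of the identity.\<close>

theorem matrix_Ln_inj:
  assumes "pos_im A" "pos_im B" "matrix_Ln A + mat a = matrix_Ln B + mat b"
  shows "mat (exp a) ** A = mat (exp b) ** B"
  using exp_matrix_Ln[OF assms(1), of a] exp_matrix_Ln[OF assms(2), of b] unfolding assms(3)
  by (rule LIMSEQ_unique)

text \<open>Cauchy's formula for each t, integrated over t and exchanged with the circle integral,
  is a Cauchy formula for the integrated function; such a representation is differentiable.\<close>

lemma holomorphic_on_param_integral:
  fixes f :: "complex \<Rightarrow> real \<Rightarrow> complex"
  assumes "open U" and cont: "continuous_on (U \<times> {0..1}) (\<lambda>(z, t). f z t)"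
    and hol: "\<And>t. t \<in> {0..1} \<Longrightarrow> (\<lambda>z. f z t) holomorphic_on U"
  shows "(\<lambda>z. integral {0..1} (f z)) holomorphic_on U"
proof -
  let ?F = "\<lambda>z. integral {0..1} (f z)"
  have Fc: "continuous_on U ?F" using integral_continuous_on_param[of U 0 1 f] cont by simp
  have "\<exists>D. (?F has_field_derivative D) (at z0)" if z0: "z0 \<in> U" for z0
  proof -
    obtain r where r: "r > 0" "cball z0 r \<subseteq> U" using open_contains_cball_eq[OF \<open>open U\<close>] z0 by blast
    let ?g = "circlepath z0 r" and ?l = "linepath 0 1 :: real \<Rightarrow> complex"
    have pg: "path_image ?g = sphere z0 r" "path_image ?g \<subseteq> U" using r by auto
    have l01: "path_image ?l = of_real ` {0..1}"
      by (auto simp: path_image_def linepath_def image_iff scaleR_conv_of_real)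
    have "((\<lambda>u. ?F u / (u - w) ^ 1) has_contour_integral 2 * of_real pi * \<i> * ?F w) ?g" if w: "w \<in> ball z0 r" for w
    proof -
      have wU: "w \<in> U" using w r by auto
      \<comment> \<open>The integral over [0, 1] is written along a complex path so that two contour
        integrals can be exchanged; \<open>Re t\<close> recovers the parameter.\<close>
      let ?h = "\<lambda>u t. f u (Re t) / (u - w)"
      have cont': "continuous_on (path_image ?g \<times> path_image ?l) (\<lambda>(u, t). ?h u t)"
      proof -
        have "continuous_on (path_image ?g \<times> path_image ?l) (\<lambda>x. (\<lambda>(z, t). f z t) (fst x, Re (snd x)))"
        proof (rule continuous_on_compose2[OF cont])
          show "(\<lambda>x. (fst x, Re (snd x))) ` (path_image ?g \<times> path_image ?l) \<subseteq> U \<times> {0..1}"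
            unfolding l01 using pg(2) by auto
        qed (intro continuous_intros)
        moreover have "fst x - w \<noteq> 0" if "x \<in> path_image ?g \<times> path_image ?l" for x
          using that w by (auto simp: pg)
        ultimately show ?thesis unfolding case_prod_unfold by (intro continuous_intros) auto
      qed
      have "contour_integral ?g (\<lambda>u. ?F u / (u - w)) = contour_integral ?g (\<lambda>u. contour_integral ?l (?h u))"
      proof (rule contour_integral_cong[OF refl])
        fix u
        have "contour_integral ?l (?h u) = integral {0..1} (\<lambda>t. f u t / (u - w))"
          using contour_integral_linepath_Reals_eq[of 0 1 "?h u"] by simp
        then show "?F u / (u - w) = contour_integral ?l (?h u)" by simp
      qed
      also have "\<dots> = contour_integral ?l (\<lambda>t. contour_integral ?g (\<lambda>u. ?h u t))"
        by (rule contour_integral_swap[OF cont']) (auto simp: vector_derivative_circlepath intro!: continuous_intros)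
      also have "\<dots> = integral {0..1} (\<lambda>t. contour_integral ?g (\<lambda>u. f u t / (u - w)))"
        using contour_integral_linepath_Reals_eq[of 0 1 "\<lambda>t. contour_integral ?g (\<lambda>u. ?h u t)"] by simp
      also have "\<dots> = integral {0..1} (\<lambda>t. 2 * of_real pi * \<i> * f w t)"
      proof (rule integral_cong)
        fix t :: real assume "t \<in> {0..1}"
        then have "((\<lambda>u. f u t / (u - w)) has_contour_integral 2 * of_real pi * \<i> * f w t) ?g"
          using w r by (intro Cauchy_integral_circlepath_simple holomorphic_on_subset[OF hol]) (auto simp: dist_norm norm_minus_commute)
        then show "contour_integral ?g (\<lambda>u. f u t / (u - w)) = 2 * of_real pi * \<i> * f w t" by (rule contour_integral_unique)
      qed
      also have "\<dots> = 2 * of_real pi * \<i> * ?F w" by (rule integral_mult_right)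
      finally have ci: "contour_integral ?g (\<lambda>u. ?F u / (u - w)) = 2 * of_real pi * \<i> * ?F w" .
      have "(\<lambda>u. ?F u / (u - w)) contour_integrable_on ?g"
        unfolding circlepath_def
        by (rule contour_integrable_continuous_part_circlepath, fold circlepath_def)
          (use w pg in \<open>auto intro!: continuous_intros continuous_on_subset[OF Fc]\<close>)
      from has_contour_integral_integral[OF this] show ?thesis unfolding ci power_one_right .
    qed
    from Cauchy_next_derivative_circlepath(2)[OF continuous_on_subset[OF Fc pg(2)] this, of z0]
    obtain D where "((\<lambda>w. 2 * of_real pi * \<i> * ?F w) has_field_derivative D) (at z0)" using r by auto
    from DERIV_cmult[OF this, of "1 / (2 * of_real pi * \<i>)"]
    show ?thesis by (auto simp: mult.assoc[symmetric])
  qed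
  then show ?thesis using \<open>open U\<close> by (auto simp: holomorphic_on_open)
qed

theorem matrix_Ln_holomorphic:
  fixes G :: "complex \<Rightarrow> complex^'m^'m"
  assumes G: "\<And>i j. (\<lambda>z. G z $ i $ j) holomorphic_on U" and U: "open U" and pos: "\<And>z. z \<in> U \<Longrightarrow> pos_im (G z)"
  shows "(\<lambda>z. matrix_Ln (G z) $ i $ j) holomorphic_on U"
proof -
  let ?B = "\<lambda>z t. mat (1 - of_real t) + mat (of_real t) ** G z"
  let ?f = "\<lambda>z t. ((G z - mat 1) ** matrix_inv (?B z t))"
  have Gc: "continuous_on U G"
    by (rule continuous_on_vecI2) (intro holomorphic_on_imp_continuous_on G)
  have cont: "continuous_on (U \<times> {0..1}) (\<lambda>(z, t). ?f z t)"
  proof -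
    have 1: "continuous_on (U \<times> {0..1}) (\<lambda>x. G (fst x))"
      by (rule continuous_on_compose2[OF Gc]) (auto intro!: continuous_intros)
    show ?thesis unfolding case_prod_unfold
      by (intro mm.continuous_on continuous_on_matrix_inv continuous_intros 1
          bounded_linear.continuous_on[OF bounded_linear_mat])
        (use matrix_Ln_integral(2)[OF pos] in auto)
  qed
  have "(\<lambda>z. integral {0..1} (\<lambda>t. ?f z t $ i $ j)) holomorphic_on U"
  proof (rule holomorphic_on_param_integral[OF U])
    show "continuous_on (U \<times> {0..1}) (\<lambda>(z, t). ?f z t $ i $ j)"
      using continuous_on_vec_nth2[OF cont] by (simp add: case_prod_unfold)
    fix t :: real assume t: "t \<in> {0..1}"
    have "(\<lambda>z. matrix_inv (?B z t) $ k $ j) holomorphic_on U" for k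
    proof (rule holomorphic_on_matrix_inv)
      show "(\<lambda>z. ?B z t $ r $ s) holomorphic_on U" for r s
        by (simp add: mat_mult_entry) (intro holomorphic_intros G)
    qed (use matrix_Ln_integral(2)[OF pos] t in auto)
    then show "(\<lambda>z. ?f z t $ i $ j) holomorphic_on U"
      unfolding matrix_matrix_mult_def by (simp, intro holomorphic_intros G)
  qed
  then show ?thesis
  proof (rule holomorphic_transform)
    fix z assume z: "z \<in> U"
    have "continuous_on {0..1} (\<lambda>t. (\<lambda>(z, t). ?f z t) (z, t))"
      by (rule continuous_on_compose2[OF cont]) (use z in \<open>auto intro!: continuous_intros\<close>)
    then have "?f z integrable_on {0..1}" by (intro integrable_continuous_real) simp
    from integral_linear[OF this, of "\<lambda>X. X $ i $ j"]
    show "integral {0..1} (\<lambda>t. ?f z t $ i $ j) = matrix_Ln (G z) $ i $ j"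
      by (simp add: o_def matrix_Ln_integral(1)[OF pos[OF z]] bounded_linear_compose[OF bounded_linear_vec_nth bounded_linear_vec_nth])
  qed
qed

subsection \<open>Rigidity of the reflectionless case\<close>

lemma mult_axis_entry:
  fixes A :: "complex^'m^'m"
  shows "(A *v axis j 1) $ i = A $ i $ j"
  by (simp add: matrix_vector_mult_def axis_def if_distrib sum.delta' cong: if_cong)

lemma trace_congruence:
  fixes A T :: "complex^'m^'m"
  shows "trace (adj A ** T ** A) = (\<Sum>j\<in>UNIV. cip (A *v axis j 1) (T *v (A *v axis j 1)))"
  unfolding trace_def
proof (rule sum.cong[OF refl])
  fix j :: 'm
  have "cip (A *v axis j 1) (T *v (A *v axis j 1)) = cip (axis j 1) ((adj A ** T ** A) *v axis j 1)"
    by (simp add: cip_adj' matrix_vector_mul_assoc matrix_mul_assoc)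
  also have "\<dots> = ((adj A ** T ** A) *v axis j 1) $ j"
    by (simp add: cip_def axis_def if_distrib if_distribR sum.delta sum.delta' cong: if_cong)
  also have "\<dots> = (adj A ** T ** A) $ j $ j"
    by (rule mult_axis_entry)
  finally show "(adj A ** T ** A) $ j $ j = cip (A *v axis j 1) (T *v (A *v axis j 1))" by simp
qed

text \<open>Multiply by adj X and take the trace. By cyclicity it is the sum of the traces of A^* T
  A for A = X and A = adj X, both with nonnegative real part. So the real part for A = X is 0, and
  positivity annihilates every column of X.\<close>

lemma sylvester_zero:
  fixes X T :: "complex^'m^'m"
  assumes XT: "X ** T + T ** X = 0" and T: "\<And>v. v \<noteq> 0 \<Longrightarrow> Re (cip v (T *v v)) > 0"
  shows "X = 0"
proof -
  have T0: "Re (cip v (T *v v)) \<ge> 0" for v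
    using T[of v] by (cases "v = 0") (auto simp: cip_bl.zero_left)
  have nonneg: "Re (trace (adj A ** T ** A)) \<ge> 0" for A :: "complex^'m^'m"
    unfolding trace_congruence by (simp add: sum_nonneg T0)
  have "adj X ** X ** T + adj X ** T ** X = adj X ** (X ** T + T ** X)"
    by (simp add: mm.add_right matrix_mul_assoc)
  then have "trace (adj X ** X ** T + adj X ** T ** X) = 0" by (simp add: XT trace_def)
  moreover have "trace (adj X ** X ** T) = trace (adj (adj X) ** T ** adj X)"
    using trace_mul_sym[of "adj X" "X ** T"] by (simp add: matrix_mul_assoc)
  ultimately have "Re (trace (adj (adj X) ** T ** adj X)) + Re (trace (adj X ** T ** X)) = 0"
    by (simp add: trace_add flip: plus_complex.sel)
  then have "Re (trace (adj X ** T ** X)) = 0"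
    using nonneg[of X] nonneg[of "adj X"] by simp
  then have "(\<Sum>j\<in>UNIV. Re (cip (X *v axis j 1) (T *v (X *v axis j 1)))) = 0"
    by (simp add: trace_congruence)
  then have "Re (cip (X *v axis j 1) (T *v (X *v axis j 1))) = 0" for j
    by (simp add: sum_nonneg_eq_0_iff T0)
  then have "X *v axis j 1 = 0" for j using T by (metis less_irrefl)
  then have "X $ i $ j = 0" for i j using mult_axis_entry[of X j i] by simp
  then show ?thesis by (simp add: vec_eq_iff)
qed

lemma Im_Ln_lower:
  assumes "Im w < 0"
  shows "- pi < Im (Ln w)" "Im (Ln w) < 0"
proof -
  have w: "w \<noteq> 0" using assms by auto
  show "- pi < Im (Ln w)" by (rule mpi_less_Im_Ln[OF w])
  show "Im (Ln w) < 0" using Im_Ln_pos_le[OF w] Im_Ln_le_pi[OF w] assms by linarith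
qed

text \<open>Boundary argument of the square root of E - z: it is 0 to the left of E and -\<pi>/2 to
  the right, because E - z approaches the cut from below. The second case is reflected through 0 to
  reach a point of continuity of Ln.\<close>

lemma tendsto_Ln_vertical:
  fixes l E :: real
  shows "l < E \<Longrightarrow> ((\<lambda>\<epsilon>. Im (Ln (of_real E - Complex l \<epsilon>) / 2)) \<longlongrightarrow> 0) (at_right 0)"
    and "l > E \<Longrightarrow> ((\<lambda>\<epsilon>. Im (Ln (of_real E - Complex l \<epsilon>) / 2)) \<longlongrightarrow> - pi / 2) (at_right 0)"
proof -
  have lim: "((\<lambda>\<epsilon>. Ln (of_real a + s * \<i> * of_real \<epsilon>)) \<longlongrightarrow> Ln (of_real a)) (at_right 0)"
    if "a > 0" for a :: real and s :: complex
  proof -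
    have "((\<lambda>\<epsilon>. Ln (of_real a + s * \<i> * of_real \<epsilon>)) \<longlongrightarrow> Ln (of_real a + s * \<i> * of_real 0)) (at_right 0)"
      using that by (intro tendsto_Ln tendsto_intros) auto
    then show ?thesis by simp
  qed
  have Im0: "Im (Ln (of_real a) / 2) = 0" if "a > 0" for a :: real using that by (simp add: Ln_of_real)
  show "((\<lambda>\<epsilon>. Im (Ln (of_real E - Complex l \<epsilon>) / 2)) \<longlongrightarrow> 0) (at_right 0)" if "l < E"
  proof -
    have eq: "of_real (E - l) + (-1) * \<i> * of_real \<epsilon> = of_real E - Complex l \<epsilon>" for \<epsilon>
      by (simp add: complex_eq_iff)
    have "((\<lambda>\<epsilon>. Im (Ln (of_real (E - l) + (-1) * \<i> * of_real \<epsilon>) / 2)) \<longlongrightarrow> Im (Ln (of_real (E - l)) / 2)) (at_right 0)"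
      using that by (intro tendsto_Im tendsto_divide lim tendsto_const) auto
    then show ?thesis unfolding eq using Im0[of "E - l"] that by (simp only: diff_gt_0_iff_gt)
  qed
  show "((\<lambda>\<epsilon>. Im (Ln (of_real E - Complex l \<epsilon>) / 2)) \<longlongrightarrow> - pi / 2) (at_right 0)" if "l > E"
  proof -
    have eq: "Im (Ln (of_real E - Complex l \<epsilon>) / 2) = Im (Ln (of_real (l - E) + 1 * \<i> * of_real \<epsilon>) / 2) - pi / 2"
      if "\<epsilon> > 0" for \<epsilon>
    proof -
      let ?w = "of_real (l - E) + 1 * \<i> * of_real \<epsilon> :: complex"
      have m: "of_real E - Complex l \<epsilon> = - ?w" by (simp add: complex_eq_iff)
      have "?w \<noteq> 0" "Im ?w > 0" using that by (auto simp: complex_eq_iff)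
      then have "Ln (of_real E - Complex l \<epsilon>) = Ln ?w - \<i> * pi" unfolding m by (subst Ln_minus) auto
      then show ?thesis by (simp only:) simp
    qed
    have "((\<lambda>\<epsilon>. Im (Ln (of_real (l - E) + 1 * \<i> * of_real \<epsilon>) / 2) - pi / 2) \<longlongrightarrow> Im (Ln (of_real (l - E)) / 2) - pi / 2) (at_right 0)"
      using that by (intro tendsto_diff tendsto_Im tendsto_divide lim tendsto_const) auto
    then have "((\<lambda>\<epsilon>. Im (Ln (of_real (l - E) + 1 * \<i> * of_real \<epsilon>) / 2) - pi / 2) \<longlongrightarrow> - pi / 2) (at_right 0)"
      using Im0[of "l - E"] that by (simp only: diff_gt_0_iff_gt diff_0 minus_divide_left)
    then show ?thesis
      by (rule Lim_transform_eventually) (use eq in \<open>auto simp: eventually_at_filter\<close>)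
  qed
qed

section \<open>The Green's matrix and its boundary values\<close>

context schroedinger
begin

definition weyl_diff :: "complex \<Rightarrow> real \<Rightarrow> complex^'m^'m" where
  "weyl_diff z x = M_minus Q z x - M_plus Q z x"

lemma green_diag_eq: "green_diag Q z x = matrix_inv (weyl_diff z x)"
  by (simp add: green_diag_def weyl_diff_def)

lemma weyl_diff_form:
  assumes z: "Im z > 0" and w: "w \<noteq> 0"
  obtains t \<nu> :: real where "t \<ge> 0" "\<nu> > 0"
    "cip w (weyl_diff z x *v w) = of_real t - (z - of_real E0) * of_real \<nu>"
  using weyl_quadratic_form[OF z, of w x] w unfolding weyl_diff_def by metis

lemma invertible_weyl_diff:
  assumes z: "Im z > 0"
  shows "invertible (weyl_diff z x)"
proof (rule invertibleI_ker, rule ccontr)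
  fix v assume v: "weyl_diff z x *v v = 0" "v \<noteq> 0"
  from weyl_diff_form[OF z v(2)] obtain t \<nu> :: real where n: "\<nu> > 0"
    and "cip v (weyl_diff z x *v v) = of_real t - (z - of_real E0) * of_real \<nu>" by metis
  then have "of_real t - (z - of_real E0) * of_real \<nu> = 0" by (simp only: v(1) cip_bl.zero_right)
  then have "Im (of_real t - (z - of_real E0) * of_real \<nu>) = 0" by (simp only: zero_complex.sel)
  then show False using n z by simp
qed

text \<open>With w = G v the form of G at v is the conjugate of the form of the inverse of G at w;
  this is the origin of the conjugated z.\<close>

lemma green_diag_form:
  assumes z: "Im z > 0" and v: "v \<noteq> 0"
  obtains t \<nu> :: real where "t \<ge> 0" "\<nu> > 0"
    "cip v (green_diag Q z x *v v) = of_real t - cnj (z - of_real E0) * of_real \<nu>"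
proof -
  let ?w = "green_diag Q z x *v v"
  have vw: "v = weyl_diff z x *v ?w"
    by (simp add: green_diag_eq matrix_vector_mul_assoc invertible_matrix_inv[OF invertible_weyl_diff[OF z]])
  then have "?w \<noteq> 0" using v by auto
  from weyl_diff_form[OF z this] obtain t \<nu> :: real where tn: "t \<ge> 0" "\<nu> > 0"
    and e: "cip ?w (weyl_diff z x *v ?w) = of_real t - (z - of_real E0) * of_real \<nu>" by metis
  have "cip v ?w = cnj (cip ?w (weyl_diff z x *v ?w))" using vw by (simp add: cnj_cip)
  then show thesis unfolding e using tn by (intro that[of t \<nu>]) auto
qed

lemma pos_im_green_diag:
  assumes z: "Im z > 0"
  shows "pos_im (green_diag Q z x)"
  unfolding pos_im_def
proof (intro allI impI)
  fix v :: "complex^'m" assume "v \<noteq> 0"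
  from green_diag_form[OF z this] obtain t \<nu> :: real where "\<nu> > 0"
    and e: "cip v (green_diag Q z x *v v) = of_real t - cnj (z - of_real E0) * of_real \<nu>" by metis
  then show "Im (cip v (green_diag Q z x *v v)) > 0" unfolding e using z by simp
qed

lemma green_diag_holomorphic: "(\<lambda>z. green_diag Q z x $ i $ j) holomorphic_on upper"
proof -
  have "(\<lambda>z. weyl_diff z x $ i $ j) holomorphic_on upper" for i j
  proof -
    have "(\<lambda>z. - M_plus (\<lambda>x. Q (- x)) z (- x) $ i $ j - M_plus Q z x $ i $ j) holomorphic_on upper"
      by (intro holomorphic_intros weyl_plus.M_plus_holomorphic weyl_P weyl_N)
    then show ?thesis
      by (rule holomorphic_transform) (simp add: weyl_diff_def M_minus_P)
  qed
  then show ?thesis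
    unfolding green_diag_eq
    by (intro holomorphic_on_matrix_inv) (auto intro: invertible_weyl_diff)
qed

text \<open>No point above E0 is isolated in the spectrum, so none is discrete. This makes the
  reflectionless condition applicable on the whole open half-line.\<close>

lemma ess_spectrumI:
  assumes l: "l > E0"
  shows "of_real l \<in> ess_spectrum Q"
proof -
  have "of_real l \<in> spectrum Q" using l by (simp add: spec)
  moreover have "\<not> complex_of_real l isolated_in spectrum Q"
  proof
    assume "complex_of_real l isolated_in spectrum Q"
    then obtain T where T: "open T" "T \<inter> spectrum Q = {complex_of_real l}" unfolding isolated_in_def by blast
    then have "complex_of_real l \<in> T" by auto
    with T(1) obtain e where e: "e > 0" "ball (complex_of_real l) e \<subseteq> T" by (auto simp: open_contains_ball)
    have "complex_of_real (l + e / 2) \<in> ball (complex_of_real l) e"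
      using e(1) by (simp add: dist_norm flip: of_real_diff of_real_add)
    then have "complex_of_real (l + e / 2) \<in> T" using e(2) by blast
    moreover have "complex_of_real (l + e / 2) \<in> spectrum Q"
      unfolding spec using l e(1) by (intro imageI) simp
    ultimately have "complex_of_real (l + e / 2) = complex_of_real l" using T(2) by blast
    then show False using e(1) by simp
  qed
  ultimately show ?thesis by (simp add: ess_spectrum_def discrete_spectrum_def)
qed

lemma Im_form_boundary_above:
  assumes l: "l > E0" and Xi: "has_Xi Q l x (mat (1/2))"
  shows "((\<lambda>\<epsilon>. Im (cip v (matrix_Ln (green_diag Q (Complex l \<epsilon>) x) *v v))) \<longlongrightarrow> pi / 2 * (norm v)\<^sup>2) (at_right 0)"
proof -
  let ?A = "\<lambda>\<epsilon>. matrix_Ln (green_diag Q (Complex l \<epsilon>) x)"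
  have bl: "bounded_linear (\<lambda>X. pi * Re (cip v (X *v v)))"
    by (intro bounded_linear_compose[OF bounded_linear_mult_right] bounded_linear_compose[OF bounded_linear_Re]
        bounded_linear_compose[OF cip_bl.bounded_linear_right] mv.bounded_linear_left)
  have 1: "pi * Re (cip v (((1 / pi) *\<^sub>R matrix_Im A) *v v)) = Im (cip v (A *v v))" for A
    by (simp add: mv.scaleR_left cip_bl.scaleR_right matrix_Im_form)
  have 2: "pi * Re (cip v (mat (1/2) *v v)) = pi / 2 * (norm v)\<^sup>2"
    by (simp add: mat_mult_vec cip_scale_right cip_self del: of_real_power)
  show ?thesis
    using bounded_linear.tendsto[OF bl Xi[unfolded has_Xi_def]] unfolding 1 2 .
qed

lemma Im_form_nonneg:
  assumes z: "Im z > 0"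
  shows "0 \<le> Im (cip v (matrix_Ln (green_diag Q z x) *v v))"
proof -
  have "-1 * Im (exp (- \<i> * of_real 0) * cip u (green_diag Q z x *v u)) \<le> 0" for u
    using pos_im_green_diag[OF z, of x] by (cases "u = 0") (auto simp: pos_im_def cip_bl.zero_left intro: less_imp_le)
  from Im_matrix_Ln_sector[OF pos_im_green_diag[OF z] _ _ this, of v] show ?thesis by simp
qed

text \<open>The sector lemma for \<alpha> = \<pi>, where the rotation is multiplication by
  -1.\<close>

lemma Im_form_le_pi: "Im z > 0 \<Longrightarrow> Im (cip v (matrix_Ln (green_diag Q z x) *v v)) \<le> pi * (norm v)\<^sup>2"
proof -
  assume z: "Im z > 0"
  have "Im (exp (- \<i> * pi) * cip u (green_diag Q z x *v u)) \<le> 0" for u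
  proof (cases "u = 0")
    case False
    then have "Im (cip u (green_diag Q z x *v u)) > 0" using pos_im_green_diag[OF z] by (simp add: pos_im_def)
    then show ?thesis by (simp add: exp_minus)
  qed (simp add: cip_bl.zero_left)
  then show ?thesis using Im_matrix_Ln_sector[OF pos_im_green_diag[OF z], of pi 1 x v] by simp
qed

text \<open>Near the half-line below the spectrum the numerical range of the Green's matrix lies in a
  sector around the positive axis whose angle tends to zero.\<close>

lemma Im_form_boundary_below:
  assumes l: "l < E0"
  shows "((\<lambda>\<epsilon>. Im (cip v (matrix_Ln (green_diag Q (Complex l \<epsilon>) x) *v v))) \<longlongrightarrow> 0) (at_right 0)"
proof (rule tendsto_sandwich)
  let ?A = "\<lambda>\<epsilon>. matrix_Ln (green_diag Q (Complex l \<epsilon>) x)"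
  show "\<forall>\<^sub>F \<epsilon> in at_right 0. 0 \<le> Im (cip v (?A \<epsilon> *v v))"
    by (auto simp: eventually_at_filter Im_form_nonneg)
  have "Im (cip v (?A \<epsilon> *v v)) \<le> arctan (\<epsilon> / (E0 - l)) * (norm v)\<^sup>2" if \<epsilon>: "\<epsilon> > 0" for \<epsilon>
  proof -
    \<comment> \<open>The angle of (E0 - l) + i \<epsilon>, the number that multiplies \<nu> in the
      form of the Green's matrix. Adding t \<ge> 0 can only decrease it.\<close>
    let ?\<alpha> = "arctan (\<epsilon> / (E0 - l))"
    have "?\<alpha> \<ge> 0" using \<epsilon> l by simp
    have a: "- (pi / 2) < ?\<alpha>" "?\<alpha> < pi / 2" by (rule arctan_lbound, rule arctan_ubound)
    have "cos ?\<alpha> > 0" by (rule cos_gt_zero_pi[OF a])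
    have sc: "sin ?\<alpha> = cos ?\<alpha> * (\<epsilon> / (E0 - l))"
      using \<open>cos ?\<alpha> > 0\<close> tan_arctan[of "\<epsilon> / (E0 - l)"] by (simp add: tan_def field_simps)
    have "Im (exp (- \<i> * ?\<alpha>) * cip u (green_diag Q (Complex l \<epsilon>) x *v u)) \<le> 0" for u
    proof (cases "u = 0")
      case False
      have "Im (Complex l \<epsilon>) > 0" using \<epsilon> by simp
      from green_diag_form[OF this False] obtain t \<nu> :: real where tn: "t \<ge> 0" "\<nu> > 0"
        and e: "cip u (green_diag Q (Complex l \<epsilon>) x *v u) = of_real t - cnj (Complex l \<epsilon> - of_real E0) * of_real \<nu>"
        by metis
      have "exp (- \<i> * of_real ?\<alpha>) = Complex (cos ?\<alpha>) (- sin ?\<alpha>)"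
        by (simp add: complex_eq_iff Re_exp Im_exp)
      then have "Im (exp (- \<i> * ?\<alpha>) * cip u (green_diag Q (Complex l \<epsilon>) x *v u))
          = cos ?\<alpha> * (\<epsilon> * \<nu>) - sin ?\<alpha> * (t + (E0 - l) * \<nu>)"
        unfolding e by (simp add: algebra_simps)
      also have "\<dots> = - (cos ?\<alpha> * (\<epsilon> / (E0 - l)) * t)"
        using l by (simp add: sc field_simps)
      also have "\<dots> \<le> 0" using tn l \<epsilon> \<open>cos ?\<alpha> > 0\<close> by simp
      finally show ?thesis .
    qed (simp add: cip_bl.zero_left)
    then show ?thesis
      using Im_matrix_Ln_sector[OF pos_im_green_diag, of "Complex l \<epsilon>" ?\<alpha> 1 x v] a \<epsilon> \<open>?\<alpha> \<ge> 0\<close> pi_gt_zero by simp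
  qed
  then show "\<forall>\<^sub>F \<epsilon> in at_right 0. Im (cip v (?A \<epsilon> *v v)) \<le> arctan (\<epsilon> / (E0 - l)) * (norm v)\<^sup>2"
    by (auto simp: eventually_at_filter)
  have "((\<lambda>\<epsilon>. arctan (\<epsilon> / (E0 - l)) * (norm v)\<^sup>2) \<longlongrightarrow> arctan (0 / (E0 - l)) * (norm v)\<^sup>2) (at_right 0)"
    using l by (intro tendsto_intros) auto
  then show "((\<lambda>\<epsilon>. arctan (\<epsilon> / (E0 - l)) * (norm v)\<^sup>2) \<longlongrightarrow> 0) (at_right 0)" by simp
qed simp

text \<open>The principal square root of E0 - z. For Im z > 0 that number is in the open lower
  half-plane, away from the cut.\<close>

definition wave :: "complex \<Rightarrow> complex" where
  "wave z = exp (Ln (of_real E0 - z) / 2)"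

lemma wave_squared: "Im z > 0 \<Longrightarrow> wave z * wave z = of_real E0 - z"
  by (simp add: wave_def flip: exp_add) (subst exp_Ln, auto simp: complex_eq_iff)

lemma wave_nonzero: "wave z \<noteq> 0"
  by (simp add: wave_def)

theorem weyl_diff_factor:
  assumes refl: "reflectionless Q" and z: "Im z > 0" and w: "Im w > 0"
  shows "mat (wave z) ** weyl_diff w x = mat (wave w) ** weyl_diff z x"
proof -
  define L where "L z = Ln (of_real E0 - z) / 2" for z :: complex
  let ?G = "\<lambda>z. green_diag Q z x"
  let ?F = "\<lambda>z. matrix_Ln (?G z) + mat (L z)"
  have L: "- pi / 2 < Im (L z)" "Im (L z) < 0" if "Im z > 0" for z
    using Im_Ln_lower[of "of_real E0 - z"] that by (auto simp: L_def)
  have form: "cip v (?F z *v v) = cip v (matrix_Ln (?G z) *v v) + L z * of_real ((norm v)\<^sup>2)" for v z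
    by (simp add: mv.add_left cip_bl.add_right mat_mult_vec cip_scale_right cip_self del: of_real_power)
  have "cip v (?F z *v v) = cip v (?F w *v v)" for v
  proof (rule upper_half_plane_constant[OF _ _ _ z w])
    show "(\<lambda>z. cip v (?F z *v v)) holomorphic_on {z. Im z > 0}"
      unfolding form unfolding L_def
      by (auto simp: cip_def matrix_vector_mult_def complex_nonpos_Reals_iff
          intro!: holomorphic_intros matrix_Ln_holomorphic green_diag_holomorphic open_upper pos_im_green_diag)
    \<comment> \<open>The logarithm contributes between 0 and \<pi> |v|^2 and the scalar term
      between -\<pi>/2 |v|^2 and 0, so the sum stays within \<pi> |v|^2.\<close>
    show "\<bar>Im (cip v (?F z *v v))\<bar> \<le> pi * (norm v)\<^sup>2" if "Im z > 0" for z
    proof -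
      have "Im (L z) * (norm v)\<^sup>2 \<le> 0" using L[OF that] by (intro mult_nonpos_nonneg) auto
      moreover have "- pi * (norm v)\<^sup>2 \<le> Im (L z) * (norm v)\<^sup>2"
      proof (rule mult_right_mono)
        show "- pi \<le> Im (L z)" using L(1)[OF that] pi_gt_zero by linarith
      qed simp
      ultimately show ?thesis
        using Im_form_nonneg[OF that, of v x] Im_form_le_pi[OF that, of v x]
        unfolding form by (simp del: of_real_power)
    qed
    have "AE l in lebesgue. of_real l \<in> ess_spectrum Q \<longrightarrow> has_Xi Q l x (mat (1/2))"
      using refl by (simp add: reflectionless_def)
    moreover have "AE l in lebesgue. l \<noteq> E0"
      by (rule AE_completion) (rule AE_lborel_singleton)
    ultimately show "AE l in lebesgue. ((\<lambda>\<epsilon>. Im (cip v (?F (Complex l \<epsilon>) *v v))) \<longlongrightarrow> 0) (at_right 0)"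
    proof eventually_elim
      fix l assume Xi: "of_real l \<in> ess_spectrum Q \<longrightarrow> has_Xi Q l x (mat (1/2))" and "l \<noteq> E0"
      have eq: "Im (cip v (?F z *v v)) = Im (cip v (matrix_Ln (?G z) *v v)) + Im (L z) * (norm v)\<^sup>2" for z
        unfolding form by (simp del: of_real_power)
      show "((\<lambda>\<epsilon>. Im (cip v (?F (Complex l \<epsilon>) *v v))) \<longlongrightarrow> 0) (at_right 0)"
      proof (cases "l < E0")
        case True
        have "((\<lambda>\<epsilon>. Im (cip v (?F (Complex l \<epsilon>) *v v))) \<longlongrightarrow> 0 + 0 * (norm v)\<^sup>2) (at_right 0)"
          unfolding eq unfolding L_def
          by (intro tendsto_add tendsto_mult tendsto_const Im_form_boundary_below tendsto_Ln_vertical True)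
        then show ?thesis by simp
      next
        case False
        then have l: "l > E0" using \<open>l \<noteq> E0\<close> by simp
        have "((\<lambda>\<epsilon>. Im (cip v (?F (Complex l \<epsilon>) *v v))) \<longlongrightarrow> pi / 2 * (norm v)\<^sup>2 + (- pi / 2) * (norm v)\<^sup>2) (at_right 0)"
          unfolding eq unfolding L_def
          by (intro tendsto_add tendsto_mult tendsto_const Im_form_boundary_above tendsto_Ln_vertical l
              mp[OF Xi] ess_spectrumI)
        then show ?thesis by simp
      qed
    qed
  qed
  then have "?F z = ?F w" by (rule quadratic_form_eqI)
  from matrix_Ln_inj[OF pos_im_green_diag[OF z] pos_im_green_diag[OF w] this]
  have "mat (wave z) ** ?G z = mat (wave w) ** ?G w" by (simp add: wave_def L_def)
  \<comment> \<open>Multiplying by the inverses on both sides turns the identity between Green's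
    matrices into one between their inverses; the scalar factors change places.\<close>
  then have "weyl_diff z x ** (mat (wave z) ** ?G z) ** weyl_diff w x
      = weyl_diff z x ** (mat (wave w) ** ?G w) ** weyl_diff w x" by simp
  moreover have "weyl_diff z x ** (mat (wave z) ** ?G z) = mat (wave z) ** (weyl_diff z x ** ?G z)"
    by (simp add: matrix_mul_assoc mat_mult_comm[of _ "weyl_diff z x"])
  then have "weyl_diff z x ** (mat (wave z) ** ?G z) = mat (wave z)"
    by (simp add: green_diag_eq invertible_matrix_inv[OF invertible_weyl_diff[OF z]])
  moreover have "weyl_diff z x ** (mat (wave w) ** ?G w) ** weyl_diff w x = weyl_diff z x ** mat (wave w)"
    by (simp add: matrix_mul_assoc[symmetric] green_diag_eq invertible_matrix_inv[OF invertible_weyl_diff[OF w]])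
  ultimately show ?thesis by (simp add: mat_mult_comm[of _ "weyl_diff z x"])
qed

text \<open>The matrix T(x) of the factorization, normalized at z = i; for reflectionless Q the
  factorization makes it independent of this choice.\<close>

definition profile :: "real \<Rightarrow> complex^'m^'m" where
  "profile x = mat (inverse (wave \<i>)) ** weyl_diff \<i> x"

lemma weyl_diff_eq_profile:
  assumes refl: "reflectionless Q" and z: "Im z > 0"
  shows "weyl_diff z x = mat (wave z) ** profile x"
proof -
  have "mat (wave z) ** profile x = mat (inverse (wave \<i>)) ** (mat (wave z) ** weyl_diff \<i> x)"
    by (simp add: profile_def matrix_mul_assoc mat_mult_mat mult.commute)
  also have "\<dots> = mat (inverse (wave \<i>) * wave \<i>) ** weyl_diff z x"
    by (simp add: weyl_diff_factor[OF refl z] matrix_mul_assoc mat_mult_mat)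
  finally show ?thesis by (simp add: wave_nonzero)
qed

text \<open>At z = E0 - 1 + i \<epsilon> the form of the Weyl difference satisfies |Im| \<le>
  \<epsilon> Re, and \<open>wave\<close> tends to 1 there. In the limit the form of the profile is
  real and nonnegative; it is not 0 because its product with \<open>wave\<close> has positive real
  part.\<close>

lemma Re_profile_form:
  assumes refl: "reflectionless Q" and v: "v \<noteq> 0"
  shows "Re (cip v (profile x *v v)) > 0"
proof -
  let ?z = "\<lambda>\<epsilon>. Complex (E0 - 1) \<epsilon>" and ?\<tau> = "cip v (profile x *v v)"
  have form: "cip v (weyl_diff (?z \<epsilon>) x *v v) = wave (?z \<epsilon>) * ?\<tau>" if "\<epsilon> > 0" for \<epsilon>
    using that
    by (simp add: weyl_diff_eq_profile[OF refl] mat_mult_vec cip_scale_right matrix_vector_mul_assoc[symmetric])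
  have bd: "Re (wave (?z \<epsilon>) * ?\<tau>) > 0" "\<bar>Im (wave (?z \<epsilon>) * ?\<tau>)\<bar> \<le> \<epsilon> * Re (wave (?z \<epsilon>) * ?\<tau>)" if \<epsilon>: "\<epsilon> > 0" for \<epsilon>
  proof -
    have "Im (?z \<epsilon>) > 0" using \<epsilon> by simp
    from weyl_diff_form[OF this v] obtain t \<nu> :: real where tn: "t \<ge> 0" "\<nu> > 0"
      and e: "cip v (weyl_diff (?z \<epsilon>) x *v v) = of_real t - (?z \<epsilon> - of_real E0) * of_real \<nu>" by metis
    show "Re (wave (?z \<epsilon>) * ?\<tau>) > 0" "\<bar>Im (wave (?z \<epsilon>) * ?\<tau>)\<bar> \<le> \<epsilon> * Re (wave (?z \<epsilon>) * ?\<tau>)"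
      unfolding form[OF \<epsilon>, symmetric] e using tn \<epsilon> by (simp_all add: abs_mult algebra_simps)
  qed
  have wz: "wave (?z \<epsilon>) = exp (Ln (1 - \<i> * of_real \<epsilon>) / 2)" for \<epsilon>
  proof -
    have "of_real E0 - ?z \<epsilon> = 1 - \<i> * of_real \<epsilon>" by (simp add: complex_eq_iff)
    then show ?thesis by (simp add: wave_def)
  qed
  have "((\<lambda>\<epsilon>. exp (Ln (1 - \<i> * of_real \<epsilon>) / 2)) \<longlongrightarrow> exp (Ln (1 - \<i> * of_real 0) / 2)) (at_right 0)"
    by (intro tendsto_intros tendsto_Ln) auto
  then have "((\<lambda>\<epsilon>. wave (?z \<epsilon>)) \<longlongrightarrow> 1) (at_right 0)" by (simp add: wz)
  from tendsto_mult[OF this tendsto_const, of ?\<tau>]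
  have lim: "((\<lambda>\<epsilon>. wave (?z \<epsilon>) * ?\<tau>) \<longlongrightarrow> ?\<tau>) (at_right 0)" by simp
  have "Re ?\<tau> \<ge> 0"
  proof (rule tendsto_lowerbound[OF tendsto_Re[OF lim]])
    show "\<forall>\<^sub>F \<epsilon> in at_right 0. 0 \<le> Re (wave (?z \<epsilon>) * ?\<tau>)"
      using eventually_at_right_less[of 0] by eventually_elim (rule less_imp_le, rule bd(1))
  qed simp
  moreover have "\<bar>Im ?\<tau>\<bar> \<le> 0 * Re ?\<tau>"
  proof (rule tendsto_le)
    show "((\<lambda>\<epsilon>. \<epsilon> * Re (wave (?z \<epsilon>) * ?\<tau>)) \<longlongrightarrow> 0 * Re ?\<tau>) (at_right 0)"
      by (intro tendsto_mult tendsto_Re lim tendsto_ident_at)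
    show "((\<lambda>\<epsilon>. \<bar>Im (wave (?z \<epsilon>) * ?\<tau>)\<bar>) \<longlongrightarrow> \<bar>Im ?\<tau>\<bar>) (at_right 0)"
      by (intro tendsto_rabs tendsto_Im lim)
    show "\<forall>\<^sub>F \<epsilon> in at_right 0. \<bar>Im (wave (?z \<epsilon>) * ?\<tau>)\<bar> \<le> \<epsilon> * Re (wave (?z \<epsilon>) * ?\<tau>)"
      using eventually_at_right_less[of 0] by eventually_elim (rule bd(2))
  qed simp
  moreover have "?\<tau> \<noteq> 0" using bd(1)[of 1] by auto
  ultimately show ?thesis by (auto simp: complex_eq_iff less_le)
qed

text \<open>Reflection and the minus sign in \<open>M_minus_P\<close> each contribute a sign to the
  derivative, so the Riccati equation is the same as for \<open>M_plus\<close>.\<close>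

lemma M_minus_riccati:
  assumes z: "Im z \<noteq> 0"
  shows "((\<lambda>x. M_minus Q z x) has_vector_derivative (Q x - mat z - M_minus Q z x ** M_minus Q z x)) (at x)"
proof -
  have "((\<lambda>x. - M_plus (\<lambda>x. Q (- x)) z (- x)) has_vector_derivative
      - (- (Q (- (- x)) - mat z - M_plus (\<lambda>x. Q (- x)) z (- x) ** M_plus (\<lambda>x. Q (- x)) z (- x)))) (at x)"
    by (intro has_vector_derivative_minus)
      (rule reflect_has_vector_derivative[OF weyl_plus.M_plus_riccati[OF weyl_N z]])
  then show ?thesis by (simp add: M_minus_P[OF z] mm.minus_left mm.minus_right)
qed

theorem constant_potential:
  assumes refl: "reflectionless Q"
  shows "Q x = mat (of_real E0)"
proof -
  define S where "S z x = M_minus Q z x + M_plus Q z x" for z x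
  define T where "T = profile"
  note T = Re_profile_form[OF refl, folded T_def]
  have D: "weyl_diff z x = mat (wave z) ** T x" if "Im z > 0" for z x
    unfolding T_def by (rule weyl_diff_eq_profile[OF refl that])
  have mat_entry: "(mat c :: complex^'m^'m) $ i $ j = c * mat 1 $ i $ j" for c i j by (simp add: mat_def)
  have two: "mat 2 ** A = A + A" for A :: "complex^'m^'m"
    by (simp add: vec_eq_iff mat_mult_entry)
  have S': "((\<lambda>x. S z x) has_vector_derivative
      mat 2 ** (Q x - mat z) - mat (1/2) ** (S z x ** S z x + weyl_diff z x ** weyl_diff z x)) (at x)"
    if "Im z > 0" for z x
  proof -
    have "Im z \<noteq> 0" using that by simp
    have "mat (1/2) ** (S z x ** S z x + weyl_diff z x ** weyl_diff z x)
        = M_minus Q z x ** M_minus Q z x + M_plus Q z x ** M_plus Q z x"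
    proof -
      have "S z x ** S z x + weyl_diff z x ** weyl_diff z x
          = mat 2 ** (M_minus Q z x ** M_minus Q z x + M_plus Q z x ** M_plus Q z x)"
        by (simp add: S_def weyl_diff_def two mm.add_left mm.add_right mm.diff_left mm.diff_right algebra_simps)
      then show ?thesis by (simp add: matrix_mul_assoc mat_mult_mat)
    qed
    moreover have "((\<lambda>x. S z x) has_vector_derivative
        (Q x - mat z - M_minus Q z x ** M_minus Q z x) + (Q x - mat z - M_plus Q z x ** M_plus Q z x)) (at x)"
      unfolding S_def
      by (intro has_vector_derivative_add M_minus_riccati weyl_plus.M_plus_riccati weyl_P \<open>Im z \<noteq> 0\<close>)
    ultimately show ?thesis by (simp add: two algebra_simps)
  qed
  have T': "(T has_vector_derivative mat (-1/2) ** (S z x ** T x + T x ** S z x)) (at x)"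
    if "Im z > 0" for z x
  proof -
    have "Im z \<noteq> 0" using that by simp
    have Teq: "T = (\<lambda>x. mat (inverse (wave z)) ** weyl_diff z x)"
      by (simp add: fun_eq_iff D[OF that] matrix_mul_assoc mat_mult_mat wave_nonzero)
    have "((\<lambda>x. weyl_diff z x) has_vector_derivative
        (Q x - mat z - M_minus Q z x ** M_minus Q z x) - (Q x - mat z - M_plus Q z x ** M_plus Q z x)) (at x)"
      unfolding weyl_diff_def
      by (intro has_vector_derivative_diff M_minus_riccati weyl_plus.M_plus_riccati weyl_P \<open>Im z \<noteq> 0\<close>)
    moreover have "(Q x - mat z - M_minus Q z x ** M_minus Q z x) - (Q x - mat z - M_plus Q z x ** M_plus Q z x)
        = mat (-1/2) ** (S z x ** weyl_diff z x + weyl_diff z x ** S z x)"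
    proof -
      have "S z x ** weyl_diff z x + weyl_diff z x ** S z x
          = mat 2 ** (M_minus Q z x ** M_minus Q z x - M_plus Q z x ** M_plus Q z x)"
        by (simp add: S_def weyl_diff_def two mm.add_left mm.add_right mm.diff_left mm.diff_right algebra_simps)
      then show ?thesis by (simp add: matrix_mul_assoc mat_mult_mat mat_minus_one_mult)
    qed
    ultimately have "((\<lambda>x. mat (inverse (wave z)) ** weyl_diff z x) has_vector_derivative
        mat (inverse (wave z)) ** (mat (-1/2) ** (S z x ** weyl_diff z x + weyl_diff z x ** S z x))) (at x)"
      by (metis bounded_linear.has_vector_derivative[OF mm.bounded_linear_right])
    moreover have "mat (inverse (wave z)) ** (mat (-1/2) ** (S z x ** weyl_diff z x + weyl_diff z x ** S z x))
        = mat (-1/2) ** (S z x ** T x + T x ** S z x)"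
    proof -
      have "S z x ** weyl_diff z x = mat (wave z) ** (S z x ** T x)"
        unfolding D[OF that] by (simp add: matrix_mul_assoc mat_mult_comm[of _ "S z x"])
      moreover have "weyl_diff z x ** S z x = mat (wave z) ** (T x ** S z x)"
        unfolding D[OF that] by (simp add: matrix_mul_assoc)
      ultimately have "S z x ** weyl_diff z x + weyl_diff z x ** S z x = mat (wave z) ** (S z x ** T x + T x ** S z x)"
        by (simp add: mm.add_right)
      then show ?thesis by (simp add: matrix_mul_assoc mat_mult_mat wave_nonzero)
    qed
    ultimately show ?thesis by (simp add: Teq[symmetric])
  qed
  have half: "A = B" if "mat c ** A = mat c ** B" "c \<noteq> 0" for A B :: "complex^'m^'m" and c
  proof -
    have "mat (inverse c) ** (mat c ** A) = mat (inverse c) ** (mat c ** B)" using that by simp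
    then show ?thesis using that(2) by (simp add: matrix_mul_assoc mat_mult_mat)
  qed
  \<comment> \<open>Any two distinct points of the upper half-plane would serve.\<close>
  define z w where "z = \<i>" and "w = 2 * \<i>"
  have zw: "Im z > 0" "Im w > 0" "z \<noteq> w" by (auto simp: z_def w_def)
  \<comment> \<open>T does not involve z. Equating its derivative computed at z and at w leaves a
    homogeneous Sylvester equation for the difference of the sums.\<close>
  have SS: "S z x = S w x" for x
  proof -
    have "mat (-1/2) ** (S z x ** T x + T x ** S z x) = mat (-1/2) ** (S w x ** T x + T x ** S w x)"
      by (rule vector_derivative_unique_at[OF T'[OF zw(1)] T'[OF zw(2)]])
    then have "S z x ** T x + T x ** S z x = S w x ** T x + T x ** S w x"
      by (rule half) simp
    then have "(S z x - S w x) ** T x + T x ** (S z x - S w x) = 0"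
      by (simp add: mm.diff_left mm.diff_right algebra_simps)
    from sylvester_zero[OF this T] show ?thesis by simp
  qed
  have D2: "weyl_diff z x ** weyl_diff z x = mat (of_real E0 - z) ** (T x ** T x)" if "Im z > 0" for z x
  proof -
    have "weyl_diff z x ** weyl_diff z x = mat (wave z) ** (T x ** mat (wave z)) ** T x"
      unfolding D[OF that] by (simp add: matrix_mul_assoc)
    also have "\<dots> = mat (wave z * wave z) ** (T x ** T x)"
      by (simp add: mat_mult_comm[of _ "T x", symmetric] matrix_mul_assoc mat_mult_mat)
    finally show ?thesis by (simp add: wave_squared[OF that])
  qed
  have T4: "T x ** T x = mat 4" for x
  proof -
    have "((\<lambda>x. S z x) has_vector_derivative
        mat 2 ** (Q x - mat w) - mat (1/2) ** (S z x ** S z x + weyl_diff w x ** weyl_diff w x)) (at x)"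
      using S'[OF zw(2), of x] by (simp add: SS[symmetric])
    from vector_derivative_unique_at[OF S'[OF zw(1)] this]
    have "mat 2 ** mat z + mat (1/2) ** (mat (of_real E0 - z) ** (T x ** T x))
        = mat 2 ** mat w + mat (1/2) ** (mat (of_real E0 - w) ** (T x ** T x))"
      unfolding D2[OF zw(1)] D2[OF zw(2)] by (simp add: mm.diff_right mm.add_right algebra_simps)
    then have e: "2 * (z * mat 1 $ i $ j) + (of_real E0 - z) * (T x ** T x) $ i $ j / 2
        = 2 * (w * mat 1 $ i $ j) + (of_real E0 - w) * (T x ** T x) $ i $ j / 2" for i j
      by (simp add: vec_eq_iff mat_mult_entry mat_entry[of z] mat_entry[of w])
    \<comment> \<open>Here \<open>a\<close> stands for an entry of T^2 and \<open>d\<close> for the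
      same entry of the identity; the common terms drop out and the difference w - z factors
      off.\<close>
    have alg: "(w - z) * (a - 4 * d) = 0"
      if "2 * (z * d) + (of_real E0 - z) * a / 2 = 2 * (w * d) + (of_real E0 - w) * a / 2" for a d
    proof -
      have "(w - z) * (a - 4 * d)
          = 2 * ((2 * (z * d) + (of_real E0 - z) * a / 2) - (2 * (w * d) + (of_real E0 - w) * a / 2))"
        by (simp add: field_simps)
      then show ?thesis by (simp only: that diff_self mult_zero_right)
    qed
    have "(T x ** T x) $ i $ j = mat 4 $ i $ j" for i j
      using alg[OF e, of i j] zw(3) by (simp add: mat_entry[of 4])
    then show ?thesis by (simp add: vec_eq_iff)
  qed
  have T2: "T x = mat 2" for x
  proof -
    have "T x *v v = 2 *s v" for v
    proof (rule ccontr)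
      assume "T x *v v \<noteq> 2 *s v"
      \<comment> \<open>Since T^2 = 4, the vector y = (T - 2) v satisfies T y = -2 y, which
        contradicts the positive real part of T.\<close>
      define y where "y = T x *v v - 2 *s v"
      have y: "y \<noteq> 0" using \<open>T x *v v \<noteq> 2 *s v\<close> by (simp add: y_def)
      have "T x *v (T x *v v) = 4 *s v" by (simp add: matrix_vector_mul_assoc T4 mat_mult_vec)
      moreover have "T x *v (2 *s v) = 2 *s (T x *v v)" by (simp add: vector_scalar_commute)
      ultimately have Ty: "T x *v y = - (2 *s y)"
        by (simp add: y_def mv.diff_right cs_bl.diff_right vec_eq_iff)
      have "Re (cip y (T x *v y)) = - 2 * (norm y)\<^sup>2"
        unfolding Ty by (simp add: cip_bl.minus_right cip_scale_right cip_self del: of_real_power)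
      with T[OF y, of x] show False by (smt (verit) zero_le_power2)
    qed
    then have "T x *v v = mat 2 *v v" for v by (simp add: mat_mult_vec)
    then show ?thesis by (simp add: matrix_eq)
  qed
  \<comment> \<open>With T constant its derivative is 0, which is again a homogeneous Sylvester
    equation, now for the sum itself.\<close>
  have S0: "S z x = 0" for x
  proof -
    have "T = (\<lambda>x. mat 2)" using T2 by auto
    then have "(T has_vector_derivative 0) (at x)" by simp
    from vector_derivative_unique_at[OF T'[OF zw(1)] this]
    have "mat (-1/2) ** (S z x ** T x + T x ** S z x) = mat (-1/2) ** 0" by simp
    then have "S z x ** T x + T x ** S z x = 0" by (rule half) simp
    from sylvester_zero[OF this T] show ?thesis .
  qed
  have "(\<lambda>x. S z x) = (\<lambda>x. 0)" using S0 by auto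
  then have "((\<lambda>x. S z x) has_vector_derivative 0) (at x)" by simp
  from vector_derivative_unique_at[OF S'[OF zw(1)] this]
  have e: "mat 2 ** (Q x - mat z) = mat (1/2) ** (mat (of_real E0 - z) ** mat 4)"
    by (simp add: S0 D2[OF zw(1)] T4)
  have "mat 2 ** (Q x - mat z) = mat 2 ** mat (of_real E0 - z)"
    unfolding e by (simp only: mat_mult_mat) (rule arg_cong[where f = mat], simp add: field_simps)
  then have "Q x - mat z = mat (of_real E0 - z)" by (rule half) simp
  then show ?thesis by (simp add: mat_diff)
qed

end

theorem theorem4p4:
  fixes Q :: "real \<Rightarrow> complex^'m^'m" and E0 :: real
  assumes "\<And>x. conj_transpose (Q x) = Q x"
    and "AC_loc Q"
    and "limit_point_at_top Q" and "limit_point_at_bot Q"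
    and "reflectionless Q"
    and "spectrum Q = complex_of_real ` {E0..}"
  shows "\<forall>x. Q x = mat (complex_of_real E0)"
proof -
  interpret schroedinger Q E0
    using assms by unfold_locales auto
  show ?thesis using constant_potential[OF assms(5)] by blast
qed

end
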